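(* Let $L$ be an alternating virtual link represented by a proper alternating virtual link diagram $D$. Then $$\operatorname{span}(L)=4\bigl(c(D)-g(D)+m-1\bigr),$$ where $c(D)$ is the number of real crossings of $D$, $g(D)$ is the supporting genus of $D$, and $m$ is the number of connected components of $D$. In particular, if $L$ is represented by a proper alternating connected virtual link diagram $D$, then $$\operatorname{span}(L)=4\bigl(c(D)-g(D)\bigr).$$
   Context: Virtual links. An (oriented) virtual link diagram is a (nonempty) closed oriented 1-manifold generically immersed in $\mathbf{R}^2$, each double point being labeled either a real crossing (with over/under information, as in classical knot theory) or a virtual crossing (no over/under information). Two diagrams are equivalent if related by a finite sequence of generalized Reidemeister moves: planar isotopy, the classical Reidemeister moves I, II, III on real crossings, the analogous moves I, II, III with all crossings virtual, and the mixed move III in which an arc with two virtual crossings is moved across a real crossing. A virtual link is an equivalence class of diagrams. A diagram is alternating if, travelling along each component, over- and under-passes at real crossings alternate (virtual crossings ignored). A virtual link is alternating if it is represented by an alternating diagram. Bracket and span. At a real crossing, the two regions swept by the over-arc when rotated counterclockwise towards the under-arc are joined by the A-splice; the other smoothing is the B-splice. A state $S$ of $D$ is obtained by an A- or B-splice at each real crossing (virtual crossings are kept); $\natural(S)$ is the number of A-splices minus the number of B-splices, $\sharp(S)$ is the number of loops of $S$. Set $\langle D\rangle=\sum_S A^{\natural(S)}(-A^2-A^{-2})^{\sharp(S)-1}$ and $f_D(A)=(-A^3)^{-\omega(D)}\langle D\rangle\in\mathbf{Z}[A,A^{-1}]$, where $\omega(D)$ is the number of positive minus the number of negative real crossings.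 $f_D$ is an invariant of the virtual link $L$ represented by $D$, and $\operatorname{span}(L)=\operatorname{span}(D)$ is the maximal degree minus the minimal degree of $f_D(A)$. Associated surface. An abstract link diagram (ALD) is a pair $(\Sigma,\mathcal D)$ of a compact oriented surface $\Sigma$ and a link diagram $\mathcal D$ in $\Sigma$ such that the underlying graph $|\mathcal D|$ (crossings replaced by 4-valent vertices; circle components allowed) is a deformation retract of $\Sigma$. The ALD $\phi(D)=(\Sigma,\mathcal D)$ associated with $D$ is obtained by thickening $D$ to a planar regular neighborhood at real crossings and along arcs, while at each virtual crossing the two bands pass one over the other without meeting; equivalently it is a regular neighborhood of a realization of $D$ as a link diagram in a closed oriented surface. The supporting genus $g(D)$ is the minimal genus of a closed oriented surface in which $D$ can be realized as a link diagram (equivalently, in which $\Sigma$ embeds); the genus of a disconnected surface is the sum of the genera of its components. A real crossing $p$ of $D$ is proper if the four boundary arcs of $\Sigma$ in the neighborhood of the corresponding crossing of $\mathcal D$ belong to four distinct connected components of $\partial\Sigma$; $D$ is proper if every real crossing is proper. Connected components. Let $C_1,\dots,C_\mu$ be the immersed circles of $D$. Take the equivalence relation generated by $C_i\sim C_j$ when $C_i\cap C_j$ contains at least one real crossing; the restriction of $D$ to the union of the circles in an equivalence class is a connected component of $D$. $D$ is connected if it has exactly one connected component. *)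

theory Defs
  imports
    "HOL-Analysis.Analysis"
    "HOL-Library.Poly_Mapping"
    "HOL-Combinatorics.Orbits"
begin

section \<open>Virtual link diagrams\<close>

text \<open>
  The plane is \<^typ>\<open>complex\<close>. The closed oriented 1-manifold is a disjoint union of \<open>ncomp\<close> copies of
  the circle \<open>\<real>/\<int>\<close>; the \<open>i\<close>-th circle is mapped by the 1-periodic curve \<open>crv i\<close>, and its points
  are addressed by pairs \<open>(i, t)\<close> with \<open>0 \<le> t < 1\<close>. The function \<open>lvl\<close> carries the crossing
  information. It only matters at preimages of double points: there it tells whether the strand
  is the over-strand or the under-strand of a real crossing, or a strand of a virtual crossing.
\<close>

datatype level = Over | Under | Virt

type_synonym param = "nat \<times> real"

datatype vdiagram =
  VDiagram (ncomp: nat) (crv: "nat \<Rightarrow> real \<Rightarrow> complex") (lvl: "param \<Rightarrow> level")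

definition cross :: "complex \<Rightarrow> complex \<Rightarrow> real" where
  "cross z w = Re z * Im w - Im z * Re w"

definition params :: "vdiagram \<Rightarrow> param set" where
  "params D = {..<ncomp D} \<times> {0..<1}"

definition pt :: "vdiagram \<Rightarrow> param \<Rightarrow> complex" where
  "pt D x = crv D (fst x) (snd x)"

definition tangent :: "vdiagram \<Rightarrow> param \<Rightarrow> complex" where
  "tangent D x = vector_derivative (crv D (fst x)) (at (snd x))"

definition closed_immersion :: "(real \<Rightarrow> complex) \<Rightarrow> bool" where
  "closed_immersion \<gamma> \<longleftrightarrow>
     (\<forall>t. \<gamma> (t + 1) = \<gamma> t) \<and>
     (\<exists>\<gamma>'. continuous_on UNIV \<gamma>' \<and> (\<forall>t. (\<gamma> has_vector_derivative \<gamma>' t) (at t) \<and> \<gamma>' t \<noteq> 0))"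

definition double_params :: "vdiagram \<Rightarrow> param set" where
  "double_params D = {x \<in> params D. \<exists>y \<in> params D. y \<noteq> x \<and> pt D y = pt D x}"

definition is_vdiagram :: "vdiagram \<Rightarrow> bool" where
  "is_vdiagram D \<longleftrightarrow>
     ncomp D > 0 \<and>
     (\<forall>i < ncomp D. closed_immersion (crv D i)) \<and>
     finite (double_params D) \<and>
     (\<forall>x \<in> params D. \<forall>y \<in> params D. \<forall>z \<in> params D.
        pt D x = pt D y \<and> pt D y = pt D z \<longrightarrow> x = y \<or> y = z \<or> x = z) \<and>
     (\<forall>x \<in> params D. \<forall>y \<in> params D. x \<noteq> y \<and> pt D x = pt D y \<longrightarrow>
        cross (tangent D x) (tangent D y) \<noteq> 0 \<and>
        (lvl D x, lvl D y) \<in> {(Over, Under), (Under, Over), (Virt, Virt)})"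

text \<open>Preimages of real crossings, and the real crossings themselves (as points of the plane).\<close>

definition real_params :: "vdiagram \<Rightarrow> param set" where
  "real_params D = {x \<in> double_params D. lvl D x \<noteq> Virt}"

definition real_crossings :: "vdiagram \<Rightarrow> complex set" where
  "real_crossings D = pt D ` real_params D"

definition crossing_number :: "vdiagram \<Rightarrow> nat" where
  "crossing_number D = card (real_crossings D)"

definition partner :: "vdiagram \<Rightarrow> param \<Rightarrow> param" where
  "partner D x = (THE y. y \<in> params D \<and> y \<noteq> x \<and> pt D y = pt D x)"

text \<open>
  A real crossing is positive iff the direction of its over-strand is turned into that of its
  under-strand by a counterclockwise rotation through less than \<open>\<pi>\<close>.
\<close>

definition writhe :: "vdiagram \<Rightarrow> int" where
  "writhe D =
     int (card {x \<in> real_params D. lvl D x = Over \<and> 0 < cross (tangent D x) (tangent D (partner D x))})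
   - int (card {x \<in> real_params D. lvl D x = Over \<and> cross (tangent D x) (tangent D (partner D x)) < 0})"


section \<open>Generalized Reidemeister moves\<close>

definition plane_diffeo :: "(complex \<Rightarrow> complex) \<Rightarrow> (complex \<Rightarrow> complex \<Rightarrow>\<^sub>L complex) \<Rightarrow> bool" where
  "plane_diffeo h h' \<longleftrightarrow>
     bij h \<and> continuous_on UNIV h' \<and>
     (\<forall>z. (h has_derivative blinfun_apply (h' z)) (at z) \<and>
          cross (blinfun_apply (h' z) 1) (blinfun_apply (h' z) \<i>) \<noteq> 0)"

definition orient_diffeo :: "(complex \<Rightarrow> complex) \<Rightarrow> bool" where
  "orient_diffeo h \<longleftrightarrow>
     (\<exists>h'. plane_diffeo h h' \<and>
           (\<forall>z. cross (blinfun_apply (h' z) 1) (blinfun_apply (h' z) \<i>) > 0))"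

definition planar_isotopy :: "(real \<Rightarrow> complex \<Rightarrow> complex) \<Rightarrow> bool" where
  "planar_isotopy H \<longleftrightarrow>
     H 0 = id \<and>
     (\<exists>H'. (\<forall>t \<in> {0..1}. plane_diffeo (H t) (H' t)) \<and>
           continuous_on ({0..1} \<times> UNIV) (\<lambda>(t, z). H t z) \<and>
           continuous_on ({0..1} \<times> UNIV) (\<lambda>(t, z). H' t z))"

definition isotopy_move :: "vdiagram \<Rightarrow> vdiagram \<Rightarrow> bool" where
  "isotopy_move D D' \<longleftrightarrow>
     (\<exists>H. planar_isotopy H \<and> D' = VDiagram (ncomp D) (\<lambda>i t. H 1 (crv D i t)) (lvl D))"

text \<open>
  Two parametrizations of the same labeled immersed oriented 1-manifold: they differ by an
  orientation-preserving diffeomorphism of the source.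
\<close>

definition same_diagram :: "vdiagram \<Rightarrow> vdiagram \<Rightarrow> bool" where
  "same_diagram D D' \<longleftrightarrow>
     (\<exists>\<pi> \<theta> \<theta>'. bij_betw \<pi> {..<ncomp D'} {..<ncomp D} \<and>
        (\<forall>i < ncomp D'. continuous_on UNIV (\<theta>' i) \<and>
           (\<forall>t. (\<theta> i has_real_derivative \<theta>' i t) (at t) \<and> \<theta>' i t > 0 \<and>
                \<theta> i (t + 1) = \<theta> i t + 1 \<and>
                crv D' i t = crv D (\<pi> i) (\<theta> i t))) \<and>
        (\<forall>(i, t) \<in> double_params D'. lvl D' (i, t) = lvl D (\<pi> i, frac (\<theta> i t))))"

text \<open>
  A Reidemeister move takes place in the image \<open>h ` square\<close> of a square under an
  orientation-preserving diffeomorphism \<open>h\<close> of the plane. A strand \<open>(i, a, b, d)\<close> is the part of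
  the \<open>i\<close>-th curve with parameters in \<open>[a, b]\<close>. In the coordinates given by \<open>h\<close> it runs along a
  model curve \<open>\<sigma>\<close> defined on \<open>[-1, 1]\<close>, forwards if \<open>d = 1\<close> and backwards if \<open>d = -1\<close>. Affine
  parametrizations of the strands and base points outside of them are no restriction in view of
  \<^const>\<open>same_diagram\<close>.
\<close>

type_synonym strand = "nat \<times> real \<times> real \<times> real"

definition square :: "complex set" where
  "square = {z. \<bar>Re z\<bar> \<le> 1 \<and> \<bar>Im z\<bar> \<le> 1}"

fun strand_set :: "strand \<Rightarrow> param set" where
  "strand_set (i, a, b, d) = {i} \<times> {a..b}"

fun strand_ok :: "vdiagram \<Rightarrow> strand \<Rightarrow> bool" where
  "strand_ok D (i, a, b, d) \<longleftrightarrow> i < ncomp D \<and> 0 < a \<and> a < b \<and> b < 1 \<and> (d = 1 \<or> d = -1)"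

fun strand_mid :: "strand \<Rightarrow> param" where
  "strand_mid (i, a, b, d) = (i, (a + b) / 2)"

fun runs_along :: "vdiagram \<Rightarrow> (complex \<Rightarrow> complex) \<Rightarrow> strand \<Rightarrow> (real \<Rightarrow> complex) \<Rightarrow> bool" where
  "runs_along D h (i, a, b, d) \<sigma> \<longleftrightarrow>
     (\<forall>t \<in> {a..b}. crv D i t = h (\<sigma> (d * (2 * (t - a) / (b - a) - 1))))"

text \<open>
  \<open>D\<close> meets \<open>h ` square\<close> exactly in the given strands, which run along the given model curves.
\<close>

definition tangle ::
  "vdiagram \<Rightarrow> (complex \<Rightarrow> complex) \<Rightarrow> (strand \<times> (real \<Rightarrow> complex)) list \<Rightarrow> bool" where
  "tangle D h ss \<longleftrightarrow>
     (\<forall>(s, \<sigma>) \<in> set ss. strand_ok D s \<and> runs_along D h s \<sigma>) \<and>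
     (\<forall>k < length ss. \<forall>l < length ss. k \<noteq> l \<longrightarrow>
        strand_set (fst (ss ! k)) \<inter> strand_set (fst (ss ! l)) = {}) \<and>
     {x \<in> params D. pt D x \<in> h ` square} = (\<Union>(s, \<sigma>) \<in> set ss. strand_set s)"

definition agree_off :: "strand list \<Rightarrow> vdiagram \<Rightarrow> vdiagram \<Rightarrow> bool" where
  "agree_off ss D D' \<longleftrightarrow>
     ncomp D' = ncomp D \<and>
     (\<forall>x \<in> params D - (\<Union>s \<in> set ss. strand_set s). pt D' x = pt D x \<and> lvl D' x = lvl D x)"

text \<open>
  Move I. The model curve \<open>kink \<epsilon>\<close> agrees with the straight segment to first order at its
  endpoints and has a single double point, at \<open>u\<^sup>2 = 1/2\<close>. All four oriented kinks arise from the
  sign \<open>\<epsilon>\<close> and the label of the new crossing, which is arbitrary (in particular possibly virtual).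
\<close>

definition kink :: "real \<Rightarrow> real \<Rightarrow> complex" where
  "kink \<epsilon> u = Complex (u * (1 - 4 * (1 - u\<^sup>2)\<^sup>2)) (\<epsilon> * (1 - u\<^sup>2)\<^sup>2 / 2)"

definition move_I :: "vdiagram \<Rightarrow> vdiagram \<Rightarrow> bool" where
  "move_I D D' \<longleftrightarrow>
     (\<exists>h s \<epsilon>. orient_diffeo h \<and> (\<epsilon> = 1 \<or> \<epsilon> = -1) \<and>
        agree_off [s] D D' \<and>
        tangle D h [(s, \<lambda>u. Complex u 0)] \<and>
        tangle D' h [(s, kink \<epsilon>)])"

text \<open>
  Move II. The second strand is pushed across the first one, and it is the over-strand at both new
  crossings, or the under-strand at both, or both new crossings are virtual.
\<close>

definition move_II :: "vdiagram \<Rightarrow> vdiagram \<Rightarrow> bool" where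
  "move_II D D' \<longleftrightarrow>
     (\<exists>h s1 s2 l. orient_diffeo h \<and>
        agree_off [s1, s2] D D' \<and>
        tangle D h [(s1, \<lambda>u. Complex u 0), (s2, \<lambda>u. Complex u (1/2))] \<and>
        tangle D' h [(s1, \<lambda>u. Complex u 0), (s2, \<lambda>u. Complex u (1/2 - (1 - u\<^sup>2)\<^sup>2))] \<and>
        (\<forall>x \<in> double_params D' \<inter> strand_set s2. lvl D' x = l))"

text \<open>
  Move III. The third strand is moved across the crossing of the first two, which is at the
  midpoint of both of them. The third strand has the same level \<open>l\<close> at its two crossings. If it is
  virtual, the crossing of the first two strands may be virtual (virtual move) or real (mixed
  move). Otherwise the third strand passes over, or under, a real crossing; moving a real strand
  across a virtual crossing is not allowed.
\<close>

definition move_III :: "vdiagram \<Rightarrow> vdiagram \<Rightarrow> bool" where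
  "move_III D D' \<longleftrightarrow>
     (\<exists>h s1 s2 s3 l. orient_diffeo h \<and>
        agree_off [s1, s2, s3] D D' \<and>
        tangle D h [(s1, \<lambda>u. Complex u u), (s2, \<lambda>u. Complex u (- u)),
                    (s3, \<lambda>u. Complex u ((1 - u\<^sup>2)\<^sup>2 / 2))] \<and>
        tangle D' h [(s1, \<lambda>u. Complex u u), (s2, \<lambda>u. Complex u (- u)),
                     (s3, \<lambda>u. Complex u (- ((1 - u\<^sup>2)\<^sup>2 / 2)))] \<and>
        (\<forall>x \<in> double_params D \<inter> strand_set s3. lvl D x = l) \<and>
        (\<forall>x \<in> double_params D' \<inter> strand_set s3. lvl D' x = l) \<and>
        lvl D' (strand_mid s1) = lvl D (strand_mid s1) \<and>
        (l = Virt \<or> lvl D (strand_mid s1) \<noteq> Virt))"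

definition moves :: "(vdiagram \<times> vdiagram) set" where
  "moves = {(D, D'). is_vdiagram D \<and> is_vdiagram D' \<and>
     (same_diagram D D' \<or> isotopy_move D D' \<or> move_I D D' \<or> move_II D D' \<or> move_III D D')}"

definition virtual_links :: "vdiagram set set" where
  "virtual_links = {D. is_vdiagram D} // ((moves \<union> moves\<inverse>)\<^sup>*)"


section \<open>The 4-valent graph of a diagram\<close>

text \<open>
  The vertices of the graph are the real crossings and, in order to avoid circle edges, one
  bivalent vertex at the base point of each circle component without real crossings. \<open>marks\<close> are
  the preimages of the vertices. A mark \<open>x\<close> has the two half-edges \<open>(x, True)\<close>, leaving the vertex
  in the direction of the orientation, and \<open>(x, False)\<close>, leaving against the orientation.
\<close>

type_synonym half_edge = "param \<times> bool"

definition free_circles :: "vdiagram \<Rightarrow> nat set" where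
  "free_circles D = {i. i < ncomp D \<and> (\<forall>t. (i, t) \<notin> real_params D)}"

definition marks :: "vdiagram \<Rightarrow> param set" where
  "marks D = real_params D \<union> (\<lambda>i. (i, 0)) ` free_circles D"

definition half_edges :: "vdiagram \<Rightarrow> half_edge set" where
  "half_edges D = marks D \<times> UNIV"

text \<open>The next mark on the (cyclically ordered) circle; virtual crossings are ignored.\<close>

definition next_mark :: "vdiagram \<Rightarrow> param \<Rightarrow> param" where
  "next_mark D x =
     (fst x,
      if \<exists>u. snd x < u \<and> (fst x, u) \<in> marks D
      then Min {u. snd x < u \<and> (fst x, u) \<in> marks D}
      else Min {u. (fst x, u) \<in> marks D})"

text \<open>The other half of the edge containing a given half-edge.\<close>

fun other_end :: "vdiagram \<Rightarrow> half_edge \<Rightarrow> half_edge" where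
  "other_end D (x, True) = (next_mark D x, False)"
| "other_end D (x, False) = (inv_into (marks D) (next_mark D) x, True)"

text \<open>The next half-edge at the same vertex in counterclockwise order.\<close>

definition direction :: "vdiagram \<Rightarrow> half_edge \<Rightarrow> complex" where
  "direction D e = (if snd e then tangent D (fst e) else - tangent D (fst e))"

definition rot :: "vdiagram \<Rightarrow> half_edge \<Rightarrow> half_edge" where
  "rot D e =
     (if fst e \<in> real_params D
      then (partner D (fst e), 0 < cross (direction D e) (tangent D (partner D (fst e))))
      else (fst e, \<not> snd e))"


section \<open>States, bracket, span\<close>

text \<open>
  A state is given by the set \<open>S\<close> of the real crossings at which the A-splice is applied. The regions
  swept by the over-arc when rotated counterclockwise are those between an over-half-edge \<open>e\<close> and
  the under-half-edge \<open>rot e\<close>. The A-splice joins them, hence connects every under-half-edge \<open>e\<close>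
  with the over-half-edge \<open>rot e\<close>; the B-splice connects every over-half-edge \<open>e\<close> with \<open>rot e\<close>. At a
  bivalent vertex the two half-edges are connected. The loops of the state are the classes of
  half-edges under the equivalence relation generated by these connections and by the edges.
\<close>

definition state_links :: "vdiagram \<Rightarrow> complex set \<Rightarrow> (half_edge \<times> half_edge) set" where
  "state_links D S =
     {(e, other_end D e) | e. e \<in> half_edges D} \<union>
     {(e, rot D e) | e. e \<in> half_edges D \<and>
        (fst e \<in> real_params D \<longrightarrow> lvl D (fst e) = (if pt D (fst e) \<in> S then Under else Over))}"

definition loops :: "vdiagram \<Rightarrow> complex set \<Rightarrow> nat" where
  "loops D S = card (half_edges D // ((state_links D S \<union> (state_links D S)\<inverse>)\<^sup>*))"

text \<open>
  \<open>\<int>[A, A\<^sup>-\<^sup>1]\<close> as the ring of finitely supported functions from exponents to coefficients.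
\<close>

type_synonym laurent = "int \<Rightarrow>\<^sub>0 int"

definition Apow :: "int \<Rightarrow> laurent" where
  "Apow k = Poly_Mapping.single k 1"

definition bracket :: "vdiagram \<Rightarrow> laurent" where
  "bracket D =
     (\<Sum>S \<in> Pow (real_crossings D).
        Apow (int (card S) - int (card (real_crossings D - S))) *
        (- Apow 2 - Apow (-2)) ^ (loops D S - 1))"

text \<open>The first factor is \<open>(- A\<^sup>3)\<close> to the power \<open>- writhe D\<close>.\<close>

definition f_poly :: "vdiagram \<Rightarrow> laurent" where
  "f_poly D = (- 1) ^ nat \<bar>writhe D\<bar> * Apow (- 3 * writhe D) * bracket D"

definition span_diagram :: "vdiagram \<Rightarrow> int" where
  "span_diagram D = Max (Poly_Mapping.keys (f_poly D)) - Min (Poly_Mapping.keys (f_poly D))"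

text \<open>The common value of \<^const>\<open>span_diagram\<close> on all diagrams representing the link.\<close>

definition span_link :: "vdiagram set \<Rightarrow> int" where
  "span_link L = the_elem (span_diagram ` L)"


section \<open>Alternating and connected diagrams\<close>

definition alternating :: "vdiagram \<Rightarrow> bool" where
  "alternating D \<longleftrightarrow> (\<forall>x \<in> real_params D. lvl D (next_mark D x) \<noteq> lvl D x)"

definition alternating_link :: "vdiagram set \<Rightarrow> bool" where
  "alternating_link L \<longleftrightarrow> (\<exists>D \<in> L. alternating D)"

definition meets :: "vdiagram \<Rightarrow> (nat \<times> nat) set" where
  "meets D = {(i, j). \<exists>t u. (i, t) \<in> real_params D \<and> (j, u) \<in> real_params D \<and>
                            pt D (i, t) = pt D (j, u)}"

definition connected_components :: "vdiagram \<Rightarrow> nat set set" where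
  "connected_components D = {..<ncomp D} // ((meets D)\<^sup>*)"

definition connected_diagram :: "vdiagram \<Rightarrow> bool" where
  "connected_diagram D \<longleftrightarrow> card (connected_components D) = 1"


section \<open>The associated surface\<close>

text \<open>
  Compact oriented surfaces are given by combinatorial maps: a finite set of darts (half-edges), the
  counterclockwise rotation of the darts around their vertices, and the involution
  exchanging the two halves of each edge. Gluing bands along the edges to discs at the vertices gives
  a compact oriented surface having the graph as a deformation retract. Its corners are the
  boundary arcs of the vertex discs between consecutive darts. If the corner from \<open>e\<close> to
  \<open>rotation e\<close> is named \<open>e\<close>, then the boundary, after running along corner \<open>e\<close>, follows the
  edge of \<open>rotation e\<close> and reaches the corner \<open>opposite (rotation e)\<close>. Thus boundary components are
  the orbits of \<^term>\<open>\<lambda>e. opposite (rotation e)\<close>. Gluing a disc to each boundary component gives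
  the closed oriented surface, cellulated with these orbits as faces.
\<close>

datatype 'a cmap =
  CMap (darts: "'a set") (rotation: "'a \<Rightarrow> 'a") (opposite: "'a \<Rightarrow> 'a")

definition boundary_component :: "'a cmap \<Rightarrow> 'a \<Rightarrow> 'a set" where
  "boundary_component M e = orbit (\<lambda>e. opposite M (rotation M e)) e"

definition cellulated_surface :: "'a cmap \<Rightarrow> bool" where
  "cellulated_surface M \<longleftrightarrow>
     finite (darts M) \<and> rotation M permutes darts M \<and> opposite M permutes darts M \<and>
     (\<forall>e \<in> darts M. opposite M e \<noteq> e \<and> opposite M (opposite M e) = e)"

definition euler_char :: "'a cmap \<Rightarrow> int" where
  "euler_char M =
     int (card (orbit (rotation M) ` darts M))
   - int (card (orbit (opposite M) ` darts M))
   + int (card (boundary_component M ` darts M))"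

definition surface_links :: "'a cmap \<Rightarrow> ('a \<times> 'a) set" where
  "surface_links M =
     {(e, rotation M e) | e. e \<in> darts M} \<union> {(e, opposite M e) | e. e \<in> darts M}"

definition surface_components :: "'a cmap \<Rightarrow> 'a set set" where
  "surface_components M = darts M // ((surface_links M \<union> (surface_links M)\<inverse>)\<^sup>*)"

text \<open>The restriction of a map to one of its connected components.\<close>

definition submap :: "'a cmap \<Rightarrow> 'a set \<Rightarrow> 'a cmap" where
  "submap M C = CMap C (rotation M) (opposite M)"

text \<open>
  A connected closed oriented surface of genus \<open>g\<close> has Euler characteristic \<open>2 - 2 * g\<close>.
\<close>

definition genus :: "'a cmap \<Rightarrow> nat" where
  "genus M = (\<Sum>C \<in> surface_components M. nat ((2 - euler_char (submap M C)) div 2))"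

text \<open>
  The ALD of \<open>D\<close>: discs at the real crossings (and at the auxiliary bivalent vertices, so that a
  circle component without real crossings gives an annulus), and bands along the edges, which do
  not meet at virtual crossings.
\<close>

definition ald :: "vdiagram \<Rightarrow> half_edge cmap" where
  "ald D = CMap (half_edges D) (rot D) (other_end D)"

definition proper_crossing :: "vdiagram \<Rightarrow> complex \<Rightarrow> bool" where
  "proper_crossing D p \<longleftrightarrow>
     inj_on (boundary_component (ald D)) {e \<in> half_edges D. pt D (fst e) = p \<and> fst e \<in> real_params D}"

definition proper :: "vdiagram \<Rightarrow> bool" where
  "proper D \<longleftrightarrow> (\<forall>p \<in> real_crossings D. proper_crossing D p)"

text \<open>
  A realization of \<open>D\<close> in a closed oriented surface: the surface is cellulated so that the graph of
  the realized diagram is a subgraph of the 1-skeleton (its edges being single edges), and the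
  counterclockwise order of the half-edges at each vertex is that of \<open>D\<close>. The remaining edges of
  the 1-skeleton may be attached at any corner, so \<open>rot\<close> corresponds to the first return of the
  rotation of the surface to the half-edges of the realized diagram.
\<close>

definition first_return :: "('a \<Rightarrow> 'a) \<Rightarrow> 'a set \<Rightarrow> 'a \<Rightarrow> 'a" where
  "first_return f X x = (f ^^ (LEAST k. 0 < k \<and> (f ^^ k) x \<in> X)) x"

definition realized_in :: "vdiagram \<Rightarrow> 'a cmap \<Rightarrow> bool" where
  "realized_in D M \<longleftrightarrow>
     (\<exists>\<iota>. inj_on \<iota> (half_edges D) \<and> \<iota> ` half_edges D \<subseteq> darts M \<and>
        (\<forall>e \<in> half_edges D.
           opposite M (\<iota> e) = \<iota> (other_end D e) \<and>
           first_return (rotation M) (\<iota> ` half_edges D) (\<iota> e) = \<iota> (rot D e)))"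

definition supporting_genus :: "vdiagram \<Rightarrow> nat" where
  "supporting_genus D =
     (LEAST g. \<exists>M :: nat cmap. cellulated_surface M \<and> realized_in D M \<and> genus M = g)"

end

theory Submission
  imports Defs
begin

text \<open>
  The polynomial \<open>f_poly\<close> is a state sum over the signed Gauss diagram, the loops of a state being the
  classes of an equivalence relation on half-edges. Virtual moves do not change the Gauss diagram, and a
  classical Reidemeister move replaces the relation only inside the tangle, where the skein expansion of
  its at most three crossings gives invariance.

  For an alternating diagram the all-A state joins the corners at the under-strands and the all-B state
  those at the over-strands, so the loops of these two states together are the \<open>F\<close> boundary components of
  the surface. If the diagram is proper, a parity argument shows that changing one splice in either
  state merges two loops. Hence each of the two states alone contributes its extreme degree, and the span is
  \<open>2 c + 2 F - 4\<close>. By Euler's formula \<open>F = c + 2 m - 2 g\<close>, where \<open>g\<close> is the genus of the capped surface. No closed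
  surface containing the diagram has smaller genus, because the genus of a pair of permutations does not
  increase when darts are deleted.
\<close>

section \<open>Counting classes of a generated equivalence relation\<close>

text \<open>The half-edges behind \<open>bracket\<close> depend on the diagram: a move creates or
  destroys crossings, and a base point is a mark only on a circle without real crossings. So the two
  sides of a move need not share their half-edges. Bivalent marks can be added without changing any
  loop count; this brings both sides to the same outer marks \<open>M0\<close>, and only then are
  their skein expansions comparable.

  For a virtual diagram in general, switching a splice may leave the number of loops unchanged. The
  degree estimate uses only that a switch changes it by at most 1: the exponent of A moves by 2 at
  each switch, a loop is worth 2 in degree, and the loop lost in the first switch away from an
  extreme state makes the gap strict.

  The genus is minimised over all cellulated surfaces, whose graphs may have further edges. Deleting
  darts one by one leads through pairs of permutations in which the second is no fixed-point-free
  involution, so that \<open>genus\<close> makes no sense for them; hence \<open>dfc\<close>,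
  defined for all pairs.\<close>

definition eqv :: "('a \<times> 'a) set \<Rightarrow> ('a \<times> 'a) set" where
  "eqv R = (R \<union> R\<inverse>)\<^sup>*"

text \<open>Counts the classes that meet \<open>H\<close>. The generated equivalence is kept in the
  literal form used by \<open>loops\<close> and \<open>surface_components\<close>, so loops of
  states, cycles of permutations and connected components all become values of one function.\<close>

definition kc :: "'a set \<Rightarrow> ('a \<times> 'a) set \<Rightarrow> nat" where
  "kc H R = card (H // eqv R)"

lemma eqv_refl [simp, intro]: "(x, x) \<in> eqv R"
  by (simp add: eqv_def)

lemma eqv_sym: "(x, y) \<in> eqv R \<Longrightarrow> (y, x) \<in> eqv R"
  unfolding eqv_def by (rule symD[OF sym_rtrancl[OF sym_Un_converse]])

lemma eqv_trans: "(x, y) \<in> eqv R \<Longrightarrow> (y, z) \<in> eqv R \<Longrightarrow> (x, z) \<in> eqv R"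
  unfolding eqv_def by (rule rtrancl_trans)

lemma eqv_base: "(x, y) \<in> R \<Longrightarrow> (x, y) \<in> eqv R"
  unfolding eqv_def by blast

lemma eqv_base': "(y, x) \<in> R \<Longrightarrow> (x, y) \<in> eqv R"
  unfolding eqv_def by blast

lemma eqv_mono: "R \<subseteq> S \<Longrightarrow> eqv R \<subseteq> eqv S"
  unfolding eqv_def by (rule rtrancl_mono) blast

lemma eqv_rel_mono: "(x, y) \<in> eqv R \<Longrightarrow> R \<subseteq> S \<Longrightarrow> (x, y) \<in> eqv S"
  by (rule subsetD[OF eqv_mono])

lemma eqv_map:
  assumes "(x, y) \<in> eqv R" and "\<And>a b. (a, b) \<in> R \<Longrightarrow> (f a, f b) \<in> eqv S"
  shows "(f x, f y) \<in> eqv S"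
  using assms(1) unfolding eqv_def[of R]
proof (induction rule: rtrancl_induct)
  case (step y z)
  then have "(f y, f z) \<in> eqv S" using assms(2)[of y z] eqv_sym[OF assms(2)[of z y]] by auto
  then show ?case by (rule eqv_trans[OF step.IH])
qed simp

lemma eqv_least:
  assumes "(x, y) \<in> eqv R" and "\<And>a b. (a, b) \<in> R \<Longrightarrow> (a, b) \<in> eqv S"
  shows "(x, y) \<in> eqv S"
  using eqv_map[where f = "\<lambda>x. x", OF assms] by simp

lemma eqv_eqI:
  assumes "R \<subseteq> eqv S" "S \<subseteq> eqv R"
  shows "eqv R = eqv S"
proof (rule subset_antisym; rule subrelI)
  show "(x, y) \<in> eqv S" if "(x, y) \<in> eqv R" for x y
    using that by (rule eqv_least) (use assms(1) in blast)
  show "(x, y) \<in> eqv R" if "(x, y) \<in> eqv S" for x y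
    using that by (rule eqv_least) (use assms(2) in blast)
qed

lemma eqv_inv:
  assumes "(x, y) \<in> eqv R" "P x" and "\<And>a b. (a, b) \<in> R \<Longrightarrow> P a \<longleftrightarrow> P b"
  shows "P y"
  using assms(1) unfolding eqv_def
  by (induction rule: rtrancl_induct) (use assms in auto)

lemma eqv_class_eq: "eqv R `` {x} = eqv R `` {y} \<longleftrightarrow> (x, y) \<in> eqv R"
proof
  assume "eqv R `` {x} = eqv R `` {y}"
  then have "y \<in> eqv R `` {x}" by auto
  then show "(x, y) \<in> eqv R" by simp
next
  assume "(x, y) \<in> eqv R"
  then show "eqv R `` {x} = eqv R `` {y}"
    using eqv_trans[of x y R] eqv_trans[of y x R] eqv_sym[of x y R] by blast
qed

lemma kc_card_image: "kc H R = card ((\<lambda>x. eqv R `` {x}) ` H)"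
  unfolding kc_def quotient_def by (rule arg_cong[where f = card]) blast

lemma kc_cong: "eqv R = eqv S \<Longrightarrow> kc H R = kc H S"
  by (simp add: kc_def)

lemma card_image_eq_if_same_kernel:
  assumes "\<And>x y. x \<in> A \<Longrightarrow> y \<in> A \<Longrightarrow> g x = g y \<longleftrightarrow> h x = h y"
  shows "card (g ` A) = card (h ` A)"
proof (rule bij_betw_same_card)
  define F where "F z = h (SOME x. x \<in> A \<and> g x = z)" for z
  have F: "F (g x) = h x" if "x \<in> A" for x
  proof -
    have "(SOME y. y \<in> A \<and> g y = g x) \<in> A \<and> g (SOME y. y \<in> A \<and> g y = g x) = g x"
      by (rule someI[where P = "\<lambda>y. y \<in> A \<and> g y = g x"]) (use that in simp)
    then show ?thesis unfolding F_def using assms that by blast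
  qed
  show "bij_betw F (g ` A) (h ` A)"
    by (rule bij_betw_imageI) (use F assms in \<open>auto simp: inj_on_def image_image\<close>)
qed

text \<open>\<open>f\<close> induces a bijection of classes. It is well defined by
  \<open>fwd\<close>. Injectivity is path lifting: by \<open>bwd\<close> a step of \<open>R\<close>
  lifts to a path of \<open>R'\<close> that starts in the right fibre, and \<open>fib\<close> joins
  the points of one fibre.\<close>

lemma kc_map:
  assumes "f ` H' = H" and "R' \<subseteq> H' \<times> H'"
    and fwd: "\<And>a b. (a, b) \<in> R' \<Longrightarrow> (f a, f b) \<in> eqv R"
    and bwd: "\<And>a b. (a, b) \<in> R \<Longrightarrow>
      \<exists>a' b'. a' \<in> H' \<and> b' \<in> H' \<and> (a', b') \<in> eqv R' \<and> f a' = a \<and> f b' = b"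
    and fib: "\<And>x y. x \<in> H' \<Longrightarrow> y \<in> H' \<Longrightarrow> f x = f y \<Longrightarrow> (x, y) \<in> eqv R'"
  shows "kc H' R' = kc H R"
proof -
  have lift: "(x, y) \<in> eqv R'" if "x \<in> H'" "y \<in> H'" "(f x, f y) \<in> eqv R" for x y
  proof -
    have "(f x, w) \<in> eqv R \<Longrightarrow> \<exists>z \<in> H'. f z = w \<and> (x, z) \<in> eqv R'" for w
      unfolding eqv_def[of R]
    proof (induction rule: rtrancl_induct)
      case base
      then show ?case using that(1) by auto
    next
      case (step v w)
      then obtain z where z: "z \<in> H'" "f z = v" "(x, z) \<in> eqv R'" by blast
      obtain a' b' where ab: "a' \<in> H'" "b' \<in> H'" "(a', b') \<in> eqv R'" "f a' = v" "f b' = w"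
      proof -
        consider "(v, w) \<in> R" | "(w, v) \<in> R" using step.hyps(2) by blast
        then show thesis
        proof cases
          case 1
          then show ?thesis using bwd[OF 1] that by auto
        next
          case 2
          then show ?thesis using bwd[OF 2] that eqv_sym[of _ _ R'] by metis
        qed
      qed
      have "(z, a') \<in> eqv R'" using fib z ab by simp
      then have "(x, b') \<in> eqv R'"
        using eqv_trans[OF eqv_trans[OF z(3)] ab(3)] by simp
      then show ?case using ab by blast
    qed
    from this[OF that(3)] obtain z where "z \<in> H'" "f z = f y" "(x, z) \<in> eqv R'" by blast
    then show ?thesis using fib[of z y] that(2) eqv_trans[of x z R' y] by simp
  qed
  have "eqv R' `` {x} = eqv R' `` {y} \<longleftrightarrow> eqv R `` {f x} = eqv R `` {f y}"
    if "x \<in> H'" "y \<in> H'" for x y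
    unfolding eqv_class_eq using lift[OF that] eqv_map[of x y R' f R, OF _ fwd] by auto
  then have "card ((\<lambda>x. eqv R' `` {x}) ` H') = card ((\<lambda>x. eqv R `` {f x}) ` H')"
    by (rule card_image_eq_if_same_kernel)
  also have "(\<lambda>x. eqv R `` {f x}) ` H' = (\<lambda>x. eqv R `` {x}) ` H"
    using assms(1) by (auto simp: image_image)
  finally show ?thesis by (simp add: kc_card_image)
qed

lemma kc_inj_image:
  assumes "inj_on f H" "R \<subseteq> H \<times> H"
  shows "kc (f ` H) (map_prod f f ` R) = kc H R"
proof (rule sym, rule kc_map)
  show "(x, y) \<in> eqv R" if "x \<in> H" "y \<in> H" "f x = f y" for x y
    using that assms(1) by (simp add: inj_on_eq_iff)
  show "(f a, f b) \<in> eqv (map_prod f f ` R)" if "(a, b) \<in> R" for a b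
    using that by (intro eqv_base) force
  show "\<exists>a' b'. a' \<in> H \<and> b' \<in> H \<and> (a', b') \<in> eqv R \<and> f a' = a \<and> f b' = b"
    if "(a, b) \<in> map_prod f f ` R" for a b
    using that assms(2) eqv_base by fastforce
qed (use assms in auto)

text \<open>Every point is moved to an equivalent one. This is how half-edges inside a tangle are
  removed without changing the number of loops.\<close>

lemma kc_contract:
  assumes "R' \<subseteq> H' \<times> H'" "f ` H' = H" "H \<subseteq> H'" "R = map_prod f f ` R'"
    and c: "\<And>x. x \<in> H' \<Longrightarrow> (x, f x) \<in> eqv R'"
  shows "kc H' R' = kc H R"
proof (rule kc_map[where f = f])
  show "(x, y) \<in> eqv R'" if "x \<in> H'" "y \<in> H'" "f x = f y" for x y
    using eqv_trans[OF c[OF that(1)]] eqv_sym[OF c[OF that(2)]] that(3) by simp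
  show "(f a, f b) \<in> eqv R" if "(a, b) \<in> R'" for a b
    using that assms(4) by (intro eqv_base) force
  show "\<exists>a' b'. a' \<in> H' \<and> b' \<in> H' \<and> (a', b') \<in> eqv R' \<and> f a' = a \<and> f b' = b"
    if ab: "(a, b) \<in> R" for a b
  proof -
    obtain x y where "(x, y) \<in> R'" "f x = a" "f y = b" using ab assms(4) by auto
    then show ?thesis using assms(1) eqv_base by (metis mem_Sigma_iff subsetD)
  qed
qed (use assms in auto)

lemma kc_isolated:
  assumes "finite H" "v \<notin> H" "v \<notin> Field R"
  shows "kc (insert v H) R = Suc (kc H R)"
proof -
  have v: "(v, x) \<in> eqv R \<Longrightarrow> x = v" for x
    by (rule eqv_inv[of v x R "\<lambda>y. y = v"]) (use assms in \<open>auto simp: Field_def\<close>)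
  have "eqv R `` {v} \<notin> (\<lambda>x. eqv R `` {x}) ` H"
  proof
    assume "eqv R `` {v} \<in> (\<lambda>x. eqv R `` {x}) ` H"
    then obtain x where "x \<in> H" "(v, x) \<in> eqv R" by (auto simp: eqv_class_eq)
    then show False using v assms by blast
  qed
  then show ?thesis using assms(1) by (simp add: kc_card_image)
qed

lemma kc_add_redundant: "(a, b) \<in> eqv R \<Longrightarrow> kc H (insert (a, b) R) = kc H R"
  by (rule kc_cong, rule eqv_eqI) (auto intro: eqv_base)

lemma kc_add_pair:
  assumes "finite H" "a \<in> H" "b \<in> H" "(a, b) \<notin> eqv R"
  shows "kc H R = Suc (kc H (insert (a, b) R))"
proof -
  let ?S = "insert (a, b) R"
  let ?g = "\<lambda>x. eqv R `` {x}"
  \<comment> \<open>\<open>?q\<close> renames the class of \<open>b\<close> to that of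
    \<open>a\<close>; its fibres on the classes of \<open>R\<close> correspond to the classes after
    the new pair is added.\<close>
  let ?q = "\<lambda>C. if C = ?g b then ?g a else C"
  have ab: "?g a \<noteq> ?g b" using assms(4) by (simp add: eqv_class_eq)
  have step: "?q (?g u) = ?q (?g v)" if "(u, v) \<in> ?S" for u v
  proof (cases "(u, v) \<in> R")
    case True
    then have "?g u = ?g v" unfolding eqv_class_eq by (rule eqv_base)
    then show ?thesis by simp
  qed (use that ab in auto)
  have fwd: "?q (?g x) = ?q (?g y)" if "(x, y) \<in> eqv ?S" for x y
    by (rule eqv_inv[OF that, of "\<lambda>z. ?q (?g x) = ?q (?g z)"]) (simp_all only: step)
  have "(x, y) \<in> eqv ?S" if q: "?q (?g x) = ?q (?g y)" for x y
  proof -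
    have m: "(u, v) \<in> eqv R \<Longrightarrow> (u, v) \<in> eqv ?S" for u v using eqv_mono[of R ?S] by blast
    have s: "(a, b) \<in> eqv ?S" by (rule eqv_base) simp
    have "?g x = ?g y \<or> ?g x = ?g b \<and> ?g a = ?g y \<or> ?g y = ?g b \<and> ?g x = ?g a"
      using q by (simp split: if_splits)
    then consider "(x, y) \<in> eqv R" | "(x, b) \<in> eqv R" "(a, y) \<in> eqv R" | "(y, b) \<in> eqv R" "(x, a) \<in> eqv R"
      unfolding eqv_class_eq by argo
    then show ?thesis
    proof cases
      case 2
      then show ?thesis using m[OF 2(1)] m[OF 2(2)] eqv_sym[OF s] eqv_trans by metis
    next
      case 3
      then show ?thesis using eqv_sym[OF m[OF 3(1)]] m[OF 3(2)] s eqv_trans by metis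
    qed (rule m)
  qed
  with fwd have "eqv ?S `` {x} = eqv ?S `` {y} \<longleftrightarrow> ?q (?g x) = ?q (?g y)" for x y
    unfolding eqv_class_eq by blast
  then have "kc H ?S = card ((\<lambda>x. ?q (?g x)) ` H)"
    unfolding kc_card_image by (rule card_image_eq_if_same_kernel)
  also have "(\<lambda>x. ?q (?g x)) ` H = ?g ` H - {?g b}"
    using assms ab by auto
  finally have "kc H ?S = card (?g ` H) - 1" using assms(3) by simp
  moreover have "card (?g ` H) > 0" using assms(1,3) by (auto simp: card_gt_0_iff)
  ultimately show ?thesis unfolding kc_card_image by linarith
qed

lemma kc_add_pair_le:
  assumes "finite H" "a \<in> H" "b \<in> H"
  shows "kc H R \<le> Suc (kc H (insert (a, b) R))" "kc H (insert (a, b) R) \<le> kc H R"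
proof -
  have "kc H (insert (a, b) R) = kc H R \<or> kc H R = Suc (kc H (insert (a, b) R))"
    using kc_add_pair[OF assms] kc_add_redundant by metis
  then show "kc H R \<le> Suc (kc H (insert (a, b) R))" "kc H (insert (a, b) R) \<le> kc H R"
    by linarith+
qed

lemma kc_pos: "finite H \<Longrightarrow> H \<noteq> {} \<Longrightarrow> 0 < kc H R"
  by (simp add: kc_card_image card_gt_0_iff)

section \<open>State sums\<close>

abbreviation (input) delta :: laurent where "delta \<equiv> - Apow 2 - Apow (-2)"

text \<open>A bracket with an open environment: \<open>R\<close> holds the edges and the splices
  already decided, \<open>C\<close> the crossings still to be smoothed. With \<open>R\<close> as an
  argument, a skein expansion stays inside the family of such sums.\<close>

definition ssum :: "'a set \<Rightarrow> ('a \<times> 'a) set \<Rightarrow> 'c set \<Rightarrow> ('c \<Rightarrow> ('a \<times> 'a) set) \<Rightarrow>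
    ('c \<Rightarrow> ('a \<times> 'a) set) \<Rightarrow> laurent" where
  "ssum H R C A B = (\<Sum>T \<in> Pow C. Apow (int (card T) - int (card (C - T))) *
     delta ^ (kc H (R \<union> (\<Union>c\<in>C. if c \<in> T then A c else B c)) - 1))"

lemma Apow_mult: "Apow k * Apow l = Apow (k + l)"
  by (simp add: Apow_def mult_single)

lemma Apow_0: "Apow 0 = 1"
  by (simp add: Apow_def)

text \<open>The skein relation of the bracket: subsets of \<open>insert c C\<close> are sorted by
  whether they contain \<open>c\<close>.\<close>

lemma ssum_insert:
  assumes "finite C" "c \<notin> C"
  shows "ssum H R (insert c C) A B =
    Apow 1 * ssum H (R \<union> A c) C A B + Apow (- 1) * ssum H (R \<union> B c) C A B"
proof -
  let ?t = "\<lambda>T. Apow (int (card T) - int (card (insert c C - T))) *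
     delta ^ (kc H (R \<union> (\<Union>d\<in>insert c C. if d \<in> T then A d else B d)) - 1)"
  have "ssum H R (insert c C) A B = sum ?t (Pow C) + sum ?t (insert c ` Pow C)"
    unfolding ssum_def Pow_insert by (rule sum.union_disjoint) (use assms in auto)
  also have "sum ?t (insert c ` Pow C) = (\<Sum>T\<in>Pow C. ?t (insert c T))"
  proof -
    have "inj_on (insert c) (Pow C)" using assms by (auto simp: inj_on_def)
    then show ?thesis by (simp only: sum.reindex comp_def)
  qed
  also have "\<dots> = Apow 1 * ssum H (R \<union> A c) C A B"
    unfolding ssum_def sum_distrib_left
  proof (rule sum.cong[OF refl])
    fix T assume T: "T \<in> Pow C"
    then have "finite T" "c \<notin> T" using assms finite_subset by auto
    moreover have "insert c C - insert c T = C - T" using T assms by auto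
    moreover have "R \<union> (\<Union>d\<in>insert c C. if d \<in> insert c T then A d else B d) =
       R \<union> A c \<union> (\<Union>d\<in>C. if d \<in> T then A d else B d)"
      using T assms by (auto split: if_splits)
    ultimately show "?t (insert c T) = Apow 1 * (Apow (int (card T) - int (card (C - T))) *
     delta ^ (kc H (R \<union> A c \<union> (\<Union>d\<in>C. if d \<in> T then A d else B d)) - 1))"
      by (simp only: mult.assoc[symmetric] Apow_mult) (simp add: algebra_simps)
  qed
  also have "sum ?t (Pow C) = Apow (-1) * ssum H (R \<union> B c) C A B"
    unfolding ssum_def sum_distrib_left
  proof (rule sum.cong[OF refl])
    fix T assume T: "T \<in> Pow C"
    then have "c \<notin> T" using assms by auto
    moreover have "card (insert c C - T) = Suc (card (C - T))"
      using \<open>c \<notin> T\<close> assms by (simp add: insert_Diff_if)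
    moreover have "R \<union> (\<Union>d\<in>insert c C. if d \<in> T then A d else B d) =
       R \<union> B c \<union> (\<Union>d\<in>C. if d \<in> T then A d else B d)"
      using T assms \<open>c \<notin> T\<close> by (auto split: if_splits)
    ultimately show "?t T = Apow (-1) * (Apow (int (card T) - int (card (C - T))) *
     delta ^ (kc H (R \<union> B c \<union> (\<Union>d\<in>C. if d \<in> T then A d else B d)) - 1))"
      by (simp only: mult.assoc[symmetric] Apow_mult) (simp add: algebra_simps)
  qed
  finally show ?thesis by (simp add: add.commute)
qed

text \<open>The hypothesis compares \<open>R1\<close> with \<open>R2\<close> under every relation
  \<open>Q\<close> that the remaining crossings can contribute. If the loop counts always differ by
  \<open>n\<close>, a factor \<open>delta ^ n\<close> comes out of each term.\<close>

lemma ssum_local: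
  assumes "\<And>Q. Q \<subseteq> O1 \<times> O1 \<Longrightarrow> kc H1 (R1 \<union> Q) = kc H2 (R2 \<union> Q) + n"
    and "\<And>c. c \<in> C \<Longrightarrow> A c \<subseteq> O1 \<times> O1" "\<And>c. c \<in> C \<Longrightarrow> B c \<subseteq> O1 \<times> O1"
    and "finite H2" "H2 \<noteq> {}"
  shows "ssum H1 R1 C A B = delta ^ n * ssum H2 R2 C A B"
  unfolding ssum_def sum_distrib_left
proof (rule sum.cong[OF refl])
  fix T assume "T \<in> Pow C"
  let ?Q = "\<Union>c\<in>C. if c \<in> T then A c else B c"
  have "?Q \<subseteq> O1 \<times> O1" using assms(2,3) by (intro UN_least) (simp split: if_split)
  \<comment> \<open>The exponent of \<open>delta\<close> is a truncated difference; positivity of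
    the loop count keeps it exact.\<close>
  from assms(1)[OF this] have "kc H1 (R1 \<union> (\<Union>c\<in>C. if c \<in> T then A c else B c)) - 1 =
     n + (kc H2 (R2 \<union> (\<Union>c\<in>C. if c \<in> T then A c else B c)) - 1)"
    using kc_pos[OF assms(4,5), of "R2 \<union> (\<Union>c\<in>C. if c \<in> T then A c else B c)"]
    by linarith
  then show "Apow (int (card T) - int (card (C - T))) *
      delta ^ (kc H1 (R1 \<union> (\<Union>c\<in>C. if c \<in> T then A c else B c)) - 1) =
    delta ^ n * (Apow (int (card T) - int (card (C - T))) *
      delta ^ (kc H2 (R2 \<union> (\<Union>c\<in>C. if c \<in> T then A c else B c)) - 1))"
    by (simp add: power_add mult_ac)
qed

lemma ssum_iso:
  assumes "inj_on \<phi> C" "\<And>T. T \<subseteq> C \<Longrightarrow>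
     kc H (R \<union> (\<Union>c\<in>C. if c \<in> T then A c else B c)) =
     kc H' (R' \<union> (\<Union>c\<in>C. if c \<in> T then A' (\<phi> c) else B' (\<phi> c)))"
  shows "ssum H R C A B = ssum H' R' (\<phi> ` C) A' B'"
proof -
  have inj: "inj_on (image \<phi>) (Pow C)" by (rule inj_on_image_Pow[OF assms(1)])
  have Pow: "Pow (\<phi> ` C) = image \<phi> ` Pow C" by (rule image_Pow_surj[symmetric]) simp
  show ?thesis unfolding ssum_def Pow sum.reindex[OF inj] comp_def
  proof (rule sum.cong[OF refl])
    fix T assume T: "T \<in> Pow C"
    have c1: "card (\<phi> ` T) = card T"
      using T assms(1) by (auto intro: card_image inj_on_subset)
    have c2: "card (\<phi> ` C - \<phi> ` T) = card (C - T)"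
      using T assms(1) by (subst inj_on_image_set_diff[symmetric, of \<phi> C]) (auto intro!: card_image intro: inj_on_subset)
    have m: "\<phi> c \<in> \<phi> ` T \<longleftrightarrow> c \<in> T" if "c \<in> C" for c
      using T that assms(1) by (auto dest: inj_onD)
    have "(\<Union>c\<in>\<phi> ` C. if c \<in> \<phi> ` T then A' c else B' c) =
       (\<Union>c\<in>C. if c \<in> T then A' (\<phi> c) else B' (\<phi> c))"
      unfolding UN_simps(10) by (rule SUP_cong) (simp_all add: m)
    then show "Apow (int (card T) - int (card (C - T))) *
        delta ^ (kc H (R \<union> (\<Union>c\<in>C. if c \<in> T then A c else B c)) - 1) =
      Apow (int (card (\<phi> ` T)) - int (card (\<phi> ` C - \<phi> ` T))) *
        delta ^ (kc H' (R' \<union> (\<Union>c\<in>\<phi> ` C. if c \<in> \<phi> ` T then A' c else B' c)) - 1)"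
      using assms(2) T c1 c2 by simp
  qed
qed

section \<open>Lists of arcs and the elimination of single half-edges\<close>

definition lk :: "'a \<Rightarrow> 'a \<Rightarrow> ('a \<times> 'a) set" where
  "lk x y = {(x, y), (y, x)}"

definition relim :: "('a \<Rightarrow> 'b) \<Rightarrow> ('a \<times> 'a) set \<Rightarrow> ('b \<times> 'b) set" where
  "relim f R = map_prod f f ` R"

lemma relim_lk: "relim f (lk x y) = lk (f x) (f y)"
  by (simp add: relim_def lk_def)

lemma relim_Un: "relim f (R \<union> S) = relim f R \<union> relim f S"
  by (simp add: relim_def image_Un)

lemma relim_id:
  assumes "R \<subseteq> H \<times> H" "\<And>x. x \<in> H \<Longrightarrow> f x = x"
  shows "relim f R = R"
proof -
  have "map_prod f f z = z" if "z \<in> R" for z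
    using that assms by (cases z) auto
  then show ?thesis by (simp add: relim_def)
qed

lemma relim_UN_if:
  "relim f (\<Union>c\<in>C. if c \<in> T then A c else B c) = (\<Union>c\<in>C. if c \<in> T then relim f (A c) else relim f (B c))"
  unfolding relim_def image_UN by (rule SUP_cong) auto

lemma eqv_lk: "lk x y \<subseteq> R \<Longrightarrow> (x, y) \<in> eqv R"
  by (rule eqv_base) (auto simp: lk_def)

text \<open>Local states are written as explicit lists of arcs. Equality up to the order of the
  list, the direction of the arcs and trivial arcs then becomes a \<open>list_all\<close> and
  \<open>list_ex\<close> condition that simplification decides.\<close>

definition lks :: "('a \<times> 'a) list \<Rightarrow> ('a \<times> 'a) set" where
  "lks xs = (\<Union>(a, b) \<in> set xs. lk a b)"

lemma lks_Un: "lks xs \<union> lks ys = lks (xs @ ys)"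
  by (simp add: lks_def)

lemma relim_lks: "relim f (lks xs) = lks (map (map_prod f f) xs)"
  by (induction xs) (auto simp: lks_def relim_lk relim_Un relim_def[of f "{}"])

lemma lks_subset:
  assumes "list_all (\<lambda>(a, b). a \<in> H \<and> b \<in> H) xs"
  shows "lks xs \<subseteq> H \<times> H"
  using assms by (auto simp: lks_def lk_def list_all_iff)

lemma lks_cover:
  assumes "list_all (\<lambda>(a, b). a = b \<or> list_ex (\<lambda>(c, d). a = c \<and> b = d \<or> a = d \<and> b = c) ys) xs"
  shows "lks xs \<subseteq> lks ys \<union> Id"
  using assms by (fastforce simp: lks_def lk_def list_all_iff list_ex_iff)

lemma lks_eq:
  assumes "list_all (\<lambda>(a, b). a = b \<or> list_ex (\<lambda>(c, d). a = c \<and> b = d \<or> a = d \<and> b = c) ys) xs"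
    and "list_all (\<lambda>(a, b). a = b \<or> list_ex (\<lambda>(c, d). a = c \<and> b = d \<or> a = d \<and> b = c) xs) ys"
  shows "lks xs \<union> Id = lks ys \<union> Id"
  using lks_cover[OF assms(1)] lks_cover[OF assms(2)] by blast

lemma ssum_contract:
  assumes "R \<subseteq> H' \<times> H'" "f ` H' = H" "H \<subseteq> H'"
    and "\<And>c. c \<in> C \<Longrightarrow> A c \<subseteq> H' \<times> H'" "\<And>c. c \<in> C \<Longrightarrow> B c \<subseteq> H' \<times> H'"
    and "\<And>x. x \<in> H' \<Longrightarrow> (x, f x) \<in> eqv R"
  shows "ssum H' R C A B = ssum H (relim f R) C (\<lambda>c. relim f (A c)) (\<lambda>c. relim f (B c))"
proof -
  have "ssum H' R C A B = ssum H (relim f R) ((\<lambda>x. x) ` C) (\<lambda>c. relim f (A c)) (\<lambda>c. relim f (B c))"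
  proof (rule ssum_iso)
    fix T assume "T \<subseteq> C"
    show "kc H' (R \<union> (\<Union>c\<in>C. if c \<in> T then A c else B c)) =
      kc H (relim f R \<union> (\<Union>c\<in>C. if c \<in> T then relim f (A c) else relim f (B c)))"
    proof (rule kc_contract)
      have "(\<Union>c\<in>C. if c \<in> T then A c else B c) \<subseteq> H' \<times> H'"
        using assms(4,5) by (intro UN_least) (simp split: if_split)
      then show "R \<union> (\<Union>c\<in>C. if c \<in> T then A c else B c) \<subseteq> H' \<times> H'" using assms(1) by simp
      show "relim f R \<union> (\<Union>c\<in>C. if c \<in> T then relim f (A c) else relim f (B c)) =
        map_prod f f ` (R \<union> (\<Union>c\<in>C. if c \<in> T then A c else B c))"
        by (simp only: relim_def[symmetric] relim_Un relim_UN_if)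
      show "(x, f x) \<in> eqv (R \<union> (\<Union>c\<in>C. if c \<in> T then A c else B c))" if "x \<in> H'" for x
        by (rule eqv_rel_mono[OF assms(6)[OF that]]) simp
    qed (use assms in auto)
  qed simp
  then show ?thesis by simp
qed

lemma eqv_Un_cong:
  assumes "eqv R = eqv R'"
  shows "eqv (R \<union> Q) = eqv (R' \<union> Q)"
proof (rule eqv_eqI)
  have "R \<subseteq> eqv R'" "R' \<subseteq> eqv R" using assms eqv_base by (metis subrelI)+
  moreover have "eqv R \<subseteq> eqv (R \<union> Q)" "eqv R' \<subseteq> eqv (R' \<union> Q)" by (simp_all add: eqv_mono)
  moreover have "Q \<subseteq> eqv (R \<union> Q)" "Q \<subseteq> eqv (R' \<union> Q)" by (auto intro: eqv_base)
  ultimately show "R \<union> Q \<subseteq> eqv (R' \<union> Q)" "R' \<union> Q \<subseteq> eqv (R \<union> Q)" by simp_all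
qed

lemma eqv_cong_Id:
  assumes "R \<union> Id = R' \<union> Id"
  shows "eqv R = eqv R'"
proof -
  have "S \<subseteq> eqv S'" if "S \<subseteq> S' \<union> Id" for S S' :: "('a \<times> 'a) set"
    using that by (auto intro: eqv_base)
  then show ?thesis using assms by (intro eqv_eqI) blast+
qed

lemma ssum_cong:
  assumes "C = C'" "eqv R = eqv R'" "\<And>c. c \<in> C \<Longrightarrow> A c = A' c" "\<And>c. c \<in> C \<Longrightarrow> B c = B' c"
  shows "ssum H R C A B = ssum H R' C' A' B'"
proof -
  have "kc H (R \<union> Q) = kc H (R' \<union> Q)" for Q
    by (rule kc_cong, rule eqv_Un_cong, rule assms(2))
  moreover have "(\<Union>c\<in>C. if c \<in> T then A c else B c) = (\<Union>c\<in>C. if c \<in> T then A' c else B' c)" for T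
    by (rule SUP_cong) (simp_all add: assms)
  ultimately show ?thesis unfolding ssum_def assms(1)[symmetric] by simp
qed

text \<open>The half-edge \<open>m\<close> occurs in no outer arc and in no splice of
  \<open>C\<close>, so contracting it onto its neighbour \<open>w\<close> changes only the local
  arcs \<open>L\<close>.\<close>

lemma ssum_elim:
  assumes "m \<notin> Ob" "w \<in> Ob" "R \<subseteq> Ob \<times> Ob" "L \<subseteq> insert m Ob \<times> insert m Ob" "(m, w) \<in> L"
    and "\<And>c. c \<in> C \<Longrightarrow> A c \<subseteq> Ob \<times> Ob" "\<And>c. c \<in> C \<Longrightarrow> B c \<subseteq> Ob \<times> Ob"
  shows "ssum (insert m Ob) (R \<union> L) C A B = ssum Ob (R \<union> relim (id(m := w)) L) C A B"
proof -
  let ?f = "id(m := w)"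
  have id: "relim ?f X = X" if "X \<subseteq> Ob \<times> Ob" for X
    using that by (rule relim_id) (use assms(1) in auto)
  have "ssum (insert m Ob) (R \<union> L) C A B =
      ssum Ob (relim ?f (R \<union> L)) C (\<lambda>c. relim ?f (A c)) (\<lambda>c. relim ?f (B c))"
  proof (rule ssum_contract)
    show "?f ` insert m Ob = Ob" using assms(1,2) by auto
    show "(x, ?f x) \<in> eqv (R \<union> L)" if "x \<in> insert m Ob" for x
      using that assms(5) by (auto intro: eqv_base)
    show "A c \<subseteq> insert m Ob \<times> insert m Ob" "B c \<subseteq> insert m Ob \<times> insert m Ob" if "c \<in> C" for c
      using assms(6)[OF that] assms(7)[OF that] by auto
  qed (use assms(3,4) in auto)
  also have "\<dots> = ssum Ob (R \<union> relim ?f L) C A B"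
    by (rule ssum_cong) (simp_all add: relim_Un id assms)
  finally show ?thesis .
qed

text \<open>A half-edge that meets no arc is a class by itself, that is, one closed loop.\<close>

lemma ssum_loop:
  assumes "m \<notin> Ob" "finite Ob" "Ob \<noteq> {}" "R \<subseteq> Ob \<times> Ob"
    and "\<And>c. c \<in> C \<Longrightarrow> A c \<subseteq> Ob \<times> Ob" "\<And>c. c \<in> C \<Longrightarrow> B c \<subseteq> Ob \<times> Ob"
  shows "ssum (insert m Ob) R C A B = delta * ssum Ob R C A B"
proof -
  have "ssum (insert m Ob) R C A B = delta ^ 1 * ssum Ob R C A B"
  proof (rule ssum_local)
    fix Q assume "Q \<subseteq> Ob \<times> Ob"
    then have "m \<notin> Field (R \<union> Q)" using assms(1,4) by (auto simp: Field_def)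
    then show "kc (insert m Ob) (R \<union> Q) = kc Ob (R \<union> Q) + 1" using kc_isolated assms by fastforce
  qed (use assms in auto)
  then show ?thesis by simp
qed

text \<open>The sign \<open>e\<close> tells which of \<open>X\<close> and \<open>Y\<close> is the
  A-splice, so that a crossing and its mirror image are covered by one formula.\<close>

lemma ssum_insert_eps:
  assumes "finite C" "c \<notin> C" "e = 1 \<and> A c = X \<and> B c = Y \<or> e = - 1 \<and> A c = Y \<and> B c = X"
  shows "ssum H R (insert c C) A B =
    Apow e * ssum H (R \<union> X) C A B + Apow (- e) * ssum H (R \<union> Y) C A B"
  using assms(3)
proof
  assume "e = 1 \<and> A c = X \<and> B c = Y"
  then show ?thesis using ssum_insert[OF assms(1,2), of H R A B] by simp
next
  assume "e = - 1 \<and> A c = Y \<and> B c = X"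
  then show ?thesis using ssum_insert[OF assms(1,2), of H R A B] by (simp add: add.commute)
qed

section \<open>Reidemeister moves of states\<close>

text \<open>The part of a diagram outside a tangle: half-edges, arcs and crossings that a move
  leaves alone. \<open>Z H P\<close> is the state sum once the inside has been replaced by the arcs
  \<open>P\<close>.\<close>

locale outer =
  fixes Ob :: "'a set" and R :: "('a \<times> 'a) set" and C :: "'c set"
    and A B :: "'c \<Rightarrow> ('a \<times> 'a) set"
  assumes fin: "finite Ob" "Ob \<noteq> {}" "finite C" and R: "R \<subseteq> Ob \<times> Ob"
    and A: "c \<in> C \<Longrightarrow> A c \<subseteq> Ob \<times> Ob" and B: "c \<in> C \<Longrightarrow> B c \<subseteq> Ob \<times> Ob"
begin

abbreviation Z where "Z H P \<equiv> ssum H (R \<union> P) C A B"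

lemma ne: "m \<notin> Ob \<Longrightarrow> x \<in> Ob \<Longrightarrow> (x = m) = False" "m \<notin> Ob \<Longrightarrow> x \<in> Ob \<Longrightarrow> (m = x) = False"
  by auto

lemma Z_cong: "P \<union> Id = P' \<union> Id \<Longrightarrow> Z H P = Z H P'"
  by (rule ssum_cong) (simp_all add: Un_assoc eqv_cong_Id)

lemma Z_elim0:
  assumes "Ob \<subseteq> H" "m \<notin> H" "w \<in> H" "L \<subseteq> insert m H \<times> insert m H" "(m, w) \<in> L"
    and "relim (id(m := w)) L \<union> Id = L' \<union> Id"
  shows "Z (insert m H) L = Z H L'"
proof -
  have "Z (insert m H) L = Z H (relim (id(m := w)) L)"
  proof (rule ssum_elim)
    have "Ob \<times> Ob \<subseteq> H \<times> H" using assms(1) by (rule Sigma_mono) (rule assms(1))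
    then show "R \<subseteq> H \<times> H" "c \<in> C \<Longrightarrow> A c \<subseteq> H \<times> H" "c \<in> C \<Longrightarrow> B c \<subseteq> H \<times> H" for c
      using R A B subset_trans by metis+
  qed (rule assms)+
  also have "\<dots> = Z H L'" by (rule Z_cong) (rule assms(6))
  finally show ?thesis .
qed

lemma Z_elim:
  assumes "Ob \<subseteq> H" "m \<notin> H" "w \<in> H"
    and "list_all (\<lambda>(a, b). a \<in> insert m H \<and> b \<in> insert m H) xs"
    and "list_ex (\<lambda>(a, b). a = m \<and> b = w \<or> a = w \<and> b = m) xs"
    and "list_all (\<lambda>(a, b). a = b \<or> list_ex (\<lambda>(c, d). a = c \<and> b = d \<or> a = d \<and> b = c) ys)
      (map (map_prod (id(m := w)) (id(m := w))) xs)"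
    and "list_all (\<lambda>(a, b). a = b \<or> list_ex (\<lambda>(c, d). a = c \<and> b = d \<or> a = d \<and> b = c)
      (map (map_prod (id(m := w)) (id(m := w))) xs)) ys"
  shows "Z (insert m H) (lks xs) = Z H (lks ys)"
proof (rule Z_elim0[OF assms(1-3)])
  show "lks xs \<subseteq> insert m H \<times> insert m H" by (rule lks_subset) (rule assms(4))
  show "(m, w) \<in> lks xs" using assms(5) by (fastforce simp: list_ex_iff lks_def lk_def)
  show "relim (id(m := w)) (lks xs) \<union> Id = lks ys \<union> Id"
    unfolding relim_lks by (rule lks_eq) (rule assms)+
qed

lemma Z_loop:
  assumes "m \<notin> Ob"
    and "list_all (\<lambda>(a, b). a \<in> Ob \<and> b \<in> Ob) ys"
    and "list_all (\<lambda>(a, b). a = b \<or> list_ex (\<lambda>(c, d). a = c \<and> b = d \<or> a = d \<and> b = c) ys) xs"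
    and "list_all (\<lambda>(a, b). a = b \<or> list_ex (\<lambda>(c, d). a = c \<and> b = d \<or> a = d \<and> b = c) xs) ys"
  shows "Z (insert m Ob) (lks xs) = delta * Z Ob (lks ys)"
proof -
  have "Z (insert m Ob) (lks xs) = Z (insert m Ob) (lks ys)"
    by (rule Z_cong, rule lks_eq) (rule assms)+
  also have "\<dots> = delta * Z Ob (lks ys)"
  proof (rule ssum_loop)
    show "R \<union> lks ys \<subseteq> Ob \<times> Ob" using R lks_subset[OF assms(2)] by simp
  qed (use assms(1) fin A B in auto)
  finally show ?thesis .
qed

end

text \<open>This cancellation explains the value of \<open>delta\<close>; it removes the unwanted
  states in moves II and III.\<close>

lemma delta_cancel:
  assumes "v = 1 \<or> v = (-1 :: int)"
  shows "Apow v * Apow v + delta + Apow (- v) * Apow (- v) = 0"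
  using assms by (auto simp: Apow_mult)

text \<open>\<open>m\<close> stands for the small loop of the kink. One splice keeps it as part of
  the strand, the other closes it off, and A^e + A^(-e) \<open>delta\<close> is -A^(-3e).\<close>

lemma (in outer) state_move_I:
  assumes "c \<notin> C" "m \<notin> Ob" "p \<in> Ob" "q \<in> Ob"
    and "e = 1 \<and> A c = lks [(p, m), (m, q)] \<and> B c = lks [(m, m), (p, q)] \<or>
      e = - 1 \<and> A c = lks [(m, m), (p, q)] \<and> B c = lks [(p, m), (m, q)]"
  shows "ssum (insert m Ob) R (insert c C) A B = - Apow (- 3 * e) * Z Ob (lks [(p, q)])"
proof -
  note d = assms(1-4)
  have 1: "Z (insert m Ob) (lks [(p, m), (m, q)]) = Z Ob (lks [(p, q)])"
    by (rule Z_elim[where w = p]) (use d in \<open>simp_all add: ne subset_insertI subset_insertI2\<close>)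
  have 2: "Z (insert m Ob) (lks [(m, m), (p, q)]) = delta * Z Ob (lks [(p, q)])"
    by (rule Z_loop) (use d in \<open>simp_all add: ne subset_insertI subset_insertI2\<close>)
  have "e = 1 \<or> e = - 1" using assms(5) by blast
  then have 3: "Apow e + Apow (- e) * delta = - Apow (- 3 * e)"
    by (auto simp: algebra_simps Apow_mult)
  have "ssum (insert m Ob) R (insert c C) A B = (Apow e + Apow (- e) * delta) * Z Ob (lks [(p, q)])"
    by (subst ssum_insert_eps[where A = A and B = B, OF fin(3) assms(1,5)]) (simp only: 1 2 distrib_right mult.assoc)
  then show ?thesis using 3 by simp
qed

text \<open>\<open>m1\<close> and \<open>m2\<close> are the arcs of the two strands between the
  crossings. Three of the four states join p1 to p2 and q1 to q2, one of them with an extra loop,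
  and their coefficients add up to zero. The fourth is the pair of separated strands, with
  coefficient 1.\<close>

lemma (in outer) state_move_II:
  assumes "c1 \<notin> C" "c2 \<notin> C" "c1 \<noteq> c2" "m1 \<notin> Ob" "m2 \<notin> Ob" "m1 \<noteq> m2"
    and O: "p1 \<in> Ob" "q1 \<in> Ob" "p2 \<in> Ob" "q2 \<in> Ob"
    and c1: "e = (1 :: int) \<and> A c1 = lks [(p1, m2), (m1, p2)] \<and> B c1 = lks [(p1, p2), (m1, m2)] \<or>
      e = - 1 \<and> A c1 = lks [(p1, p2), (m1, m2)] \<and> B c1 = lks [(p1, m2), (m1, p2)]"
    and c2: "e = 1 \<and> A c2 = lks [(m1, m2), (q1, q2)] \<and> B c2 = lks [(m1, q2), (q1, m2)] \<or>
      e = - 1 \<and> A c2 = lks [(m1, q2), (q1, m2)] \<and> B c2 = lks [(m1, m2), (q1, q2)]"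
  shows "ssum (insert m1 (insert m2 Ob)) R (insert c1 (insert c2 C)) A B =
    Z Ob (lks [(p1, q1), (p2, q2)])"
proof -
  note d = assms(1-6) O
  let ?H = "insert m1 (insert m2 Ob)" and ?P = "lks [(p1, p2), (q1, q2)]"
  have aa: "Z ?H (lks [(p1, m2), (m1, p2), (m1, m2), (q1, q2)]) = Z Ob ?P"
  proof (rule trans)
    show "Z ?H (lks [(p1, m2), (m1, p2), (m1, m2), (q1, q2)]) =
      Z (insert m2 Ob) (lks [(p1, m2), (p2, m2), (q1, q2)])"
      by (rule Z_elim[where w = p2]) (use d in \<open>simp_all add: ne subset_insertI subset_insertI2\<close>)
    show "\<dots> = Z Ob ?P"
      by (rule Z_elim[where w = p1]) (use d in \<open>simp_all add: ne subset_insertI subset_insertI2\<close>)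
  qed
  have ab: "Z ?H (lks [(p1, m2), (m1, p2), (m1, q2), (q1, m2)]) = Z Ob (lks [(p1, q1), (p2, q2)])"
  proof (rule trans)
    show "Z ?H (lks [(p1, m2), (m1, p2), (m1, q2), (q1, m2)]) =
      Z (insert m2 Ob) (lks [(p1, m2), (p2, q2), (q1, m2)])"
      by (rule Z_elim[where w = p2]) (use d in \<open>simp_all add: ne subset_insertI subset_insertI2\<close>)
    show "\<dots> = Z Ob (lks [(p1, q1), (p2, q2)])"
      by (rule Z_elim[where w = p1]) (use d in \<open>simp_all add: ne subset_insertI subset_insertI2\<close>)
  qed
  have ba: "Z ?H (lks [(p1, p2), (m1, m2), (m1, m2), (q1, q2)]) = delta * Z Ob ?P"
  proof (rule trans)
    show "Z ?H (lks [(p1, p2), (m1, m2), (m1, m2), (q1, q2)]) = Z (insert m2 Ob) ?P"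
      by (rule Z_elim[where w = m2]) (use d in \<open>simp_all add: ne subset_insertI subset_insertI2\<close>)
    show "\<dots> = delta * Z Ob ?P"
      by (rule Z_loop) (use d in \<open>simp_all add: ne subset_insertI subset_insertI2\<close>)
  qed
  have bb: "Z ?H (lks [(p1, p2), (m1, m2), (m1, q2), (q1, m2)]) = Z Ob ?P"
  proof (rule trans)
    show "Z ?H (lks [(p1, p2), (m1, m2), (m1, q2), (q1, m2)]) =
      Z (insert m2 Ob) (lks [(p1, p2), (m2, q2), (q1, m2)])"
      by (rule Z_elim[where w = m2]) (use d in \<open>simp_all add: ne subset_insertI subset_insertI2\<close>)
    show "\<dots> = Z Ob ?P"
      by (rule Z_elim[where w = q1]) (use d in \<open>simp_all add: ne subset_insertI subset_insertI2\<close>)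
  qed
  have e: "e = 1 \<or> e = - 1" using c1 by blast
  have inv: "Apow e * Apow (- e) = 1" by (simp add: Apow_mult Apow_0)
  have c1': "c1 \<notin> insert c2 C" and fin': "finite (insert c2 C)" using assms(1,3) fin by auto
  \<comment> \<open>The terms are grouped so that the sum of \<open>delta_cancel\<close> and the
    product v1 v2, which is 1, appear as coefficients.\<close>
  have alg: "v1 * (v1 * K + v2 * K2) + v2 * (v1 * (d * K) + v2 * K) =
    (v1 * v1 + d + v2 * v2) * K + (v1 * v2) * K2 + (v1 * v2 - 1) * d * K"
    for v1 v2 d K K2 :: laurent
    by (simp add: algebra_simps)
  have "ssum ?H R (insert c1 (insert c2 C)) A B =
     (Apow e * Apow e + delta + Apow (- e) * Apow (- e)) * Z Ob ?P
     + (Apow e * Apow (- e)) * Z Ob (lks [(p1, q1), (p2, q2)])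
     + (Apow e * Apow (- e) - 1) * delta * Z Ob ?P"
    unfolding ssum_insert_eps[where A = A and B = B and H = ?H and R = R, OF fin' c1' c1] ssum_insert_eps[where A = A and B = B, OF fin(3) assms(2) c2]
    unfolding Un_assoc lks_Un append.simps aa ab ba bb
    by (rule alg)
  then show ?thesis by (simp only: delta_cancel[OF e] inv) simp
qed

text \<open>The right-hand side mentions only the ends of the strands. For the splice of weight A^w
  at \<open>c12\<close>, the third strand slides off the other two as in move II. For the other
  splice all four states remain, two of them with weight 1.\<close>

lemma (in outer) state_move_III:
  fixes v w :: int
  assumes "c12 \<notin> C" "c13 \<notin> C" "c23 \<notin> C" "c12 \<noteq> c13" "c12 \<noteq> c23" "c13 \<noteq> c23"
    and m: "m1 \<notin> Ob" "m2 \<notin> Ob" "m3 \<notin> Ob" "m1 \<noteq> m2" "m1 \<noteq> m3" "m2 \<noteq> m3"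
    and O: "p1 \<in> Ob" "q1 \<in> Ob" "p2 \<in> Ob" "q2 \<in> Ob" "p3 \<in> Ob" "q3 \<in> Ob"
    and c12: "w = 1 \<and> A c12 = lks [(p1, q2), (m1, m2)] \<and> B c12 = lks [(p1, m2), (m1, q2)] \<or>
      w = - 1 \<and> A c12 = lks [(p1, m2), (m1, q2)] \<and> B c12 = lks [(p1, q2), (m1, m2)]"
    and c23: "v = 1 \<and> A c23 = lks [(p3, m2), (m3, p2)] \<and> B c23 = lks [(p3, p2), (m3, m2)] \<or>
      v = - 1 \<and> A c23 = lks [(p3, p2), (m3, m2)] \<and> B c23 = lks [(p3, m2), (m3, p2)]"
    and c13: "v = 1 \<and> A c13 = lks [(m3, m1), (q3, q1)] \<and> B c13 = lks [(m3, q1), (q3, m1)] \<or>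
      v = - 1 \<and> A c13 = lks [(m3, q1), (q3, m1)] \<and> B c13 = lks [(m3, m1), (q3, q1)]"
  shows "ssum (insert m1 (insert m2 (insert m3 Ob))) R (insert c12 (insert c13 (insert c23 C))) A B =
    Apow w * Z Ob (lks [(p1, q2), (p3, q3), (p2, q1)]) +
    Apow (- w) * (Apow v * Apow v * Z Ob (lks [(p1, p3), (p2, q2), (q3, q1)]) +
       Z Ob (lks [(p1, p3), (p2, q1), (q3, q2)]) + Z Ob (lks [(p3, p2), (p1, q2), (q3, q1)]) +
       Apow (- v) * Apow (- v) * Z Ob (lks [(p3, p2), (p1, q1), (q3, q2)]))"
proof -
  let ?H3 = "insert m3 Ob"
  let ?H2 = "insert m2 ?H3"
  let ?H = "insert m1 ?H2"
  note d = assms(1-6) m O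
  have 1: "Z ?H (lks [(p1, q2), (m1, m2), (m3, m1), (q3, q1), (p3, m2), (m3, p2)]) =
     Z Ob (lks [(p1, q2), (p3, p2), (q3, q1)])" (is "_ = ?K")
  proof -
    have "Z ?H (lks [(p1, q2), (m1, m2), (m3, m1), (q3, q1), (p3, m2), (m3, p2)]) =
      Z ?H2 (lks [(p1, q2), (m3, m2), (q3, q1), (p3, m2), (m3, p2)])"
      by (rule Z_elim[where w = m2]) (use d in \<open>simp_all add: ne subset_insertI subset_insertI2\<close>)
    also have "\<dots> = Z ?H3 (lks [(p1, q2), (m3, p3), (q3, q1), (m3, p2)])"
      by (rule Z_elim[where w = p3]) (use d in \<open>simp_all add: ne subset_insertI subset_insertI2\<close>)
    also have "\<dots> = ?K"
      by (rule Z_elim[where w = p2]) (use d in \<open>simp_all add: ne subset_insertI subset_insertI2\<close>)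
    finally show ?thesis .
  qed
  have 2: "Z ?H (lks [(p1, q2), (m1, m2), (m3, q1), (q3, m1), (p3, m2), (m3, p2)]) =
     Z Ob (lks [(p1, q2), (p3, q3), (p2, q1)])" (is "_ = ?K2")
  proof -
    have "Z ?H (lks [(p1, q2), (m1, m2), (m3, q1), (q3, m1), (p3, m2), (m3, p2)]) =
      Z ?H2 (lks [(p1, q2), (q3, m2), (m3, q1), (p3, m2), (m3, p2)])"
      by (rule Z_elim[where w = m2]) (use d in \<open>simp_all add: ne subset_insertI subset_insertI2\<close>)
    also have "\<dots> = Z ?H3 (lks [(p1, q2), (q3, p3), (m3, q1), (m3, p2)])"
      by (rule Z_elim[where w = p3]) (use d in \<open>simp_all add: ne subset_insertI subset_insertI2\<close>)
    also have "\<dots> = ?K2"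
      by (rule Z_elim[where w = p2]) (use d in \<open>simp_all add: ne subset_insertI subset_insertI2\<close>)
    finally show ?thesis .
  qed
  have 3: "Z ?H (lks [(p1, q2), (m1, m2), (m3, m1), (q3, q1), (p3, p2), (m3, m2)]) = delta * ?K"
  proof -
    have "Z ?H (lks [(p1, q2), (m1, m2), (m3, m1), (q3, q1), (p3, p2), (m3, m2)]) =
      Z ?H2 (lks [(p1, q2), (m3, m2), (q3, q1), (p3, p2)])"
      by (rule Z_elim[where w = m2]) (use d in \<open>simp_all add: ne subset_insertI subset_insertI2\<close>)
    also have "\<dots> = Z ?H3 (lks [(p1, q2), (q3, q1), (p3, p2)])"
      by (rule Z_elim[where w = m3]) (use d in \<open>simp_all add: ne subset_insertI subset_insertI2\<close>)
    also have "\<dots> = delta * ?K"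
      by (rule Z_loop) (use d in \<open>simp_all add: ne subset_insertI subset_insertI2\<close>)
    finally show ?thesis .
  qed
  have 4: "Z ?H (lks [(p1, q2), (m1, m2), (m3, q1), (q3, m1), (p3, p2), (m3, m2)]) = ?K"
  proof -
    have "Z ?H (lks [(p1, q2), (m1, m2), (m3, q1), (q3, m1), (p3, p2), (m3, m2)]) =
      Z ?H2 (lks [(p1, q2), (q3, m2), (m3, q1), (p3, p2), (m3, m2)])"
      by (rule Z_elim[where w = m2]) (use d in \<open>simp_all add: ne subset_insertI subset_insertI2\<close>)
    also have "\<dots> = Z ?H3 (lks [(p1, q2), (q3, m3), (m3, q1), (p3, p2)])"
      by (rule Z_elim[where w = m3]) (use d in \<open>simp_all add: ne subset_insertI subset_insertI2\<close>)
    also have "\<dots> = ?K"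
      by (rule Z_elim[where w = q1]) (use d in \<open>simp_all add: ne subset_insertI subset_insertI2\<close>)
    finally show ?thesis .
  qed
  have 5: "Z ?H (lks [(p1, m2), (m1, q2), (m3, m1), (q3, q1), (p3, m2), (m3, p2)]) =
     Z Ob (lks [(p1, p3), (p2, q2), (q3, q1)])" (is "_ = ?K5")
  proof -
    have "Z ?H (lks [(p1, m2), (m1, q2), (m3, m1), (q3, q1), (p3, m2), (m3, p2)]) =
      Z ?H2 (lks [(p1, m2), (m3, q2), (q3, q1), (p3, m2), (m3, p2)])"
      by (rule Z_elim[where w = q2]) (use d in \<open>simp_all add: ne subset_insertI subset_insertI2\<close>)
    also have "\<dots> = Z ?H3 (lks [(p1, p3), (m3, q2), (q3, q1), (m3, p2)])"
      by (rule Z_elim[where w = p3]) (use d in \<open>simp_all add: ne subset_insertI subset_insertI2\<close>)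
    also have "\<dots> = ?K5"
      by (rule Z_elim[where w = p2]) (use d in \<open>simp_all add: ne subset_insertI subset_insertI2\<close>)
    finally show ?thesis .
  qed
  have 6: "Z ?H (lks [(p1, m2), (m1, q2), (m3, q1), (q3, m1), (p3, m2), (m3, p2)]) =
     Z Ob (lks [(p1, p3), (p2, q1), (q3, q2)])" (is "_ = ?K6")
  proof -
    have "Z ?H (lks [(p1, m2), (m1, q2), (m3, q1), (q3, m1), (p3, m2), (m3, p2)]) =
      Z ?H2 (lks [(p1, m2), (q3, q2), (m3, q1), (p3, m2), (m3, p2)])"
      by (rule Z_elim[where w = q2]) (use d in \<open>simp_all add: ne subset_insertI subset_insertI2\<close>)
    also have "\<dots> = Z ?H3 (lks [(p1, p3), (q3, q2), (m3, q1), (m3, p2)])"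
      by (rule Z_elim[where w = p3]) (use d in \<open>simp_all add: ne subset_insertI subset_insertI2\<close>)
    also have "\<dots> = ?K6"
      by (rule Z_elim[where w = p2]) (use d in \<open>simp_all add: ne subset_insertI subset_insertI2\<close>)
    finally show ?thesis .
  qed
  have 7: "Z ?H (lks [(p1, m2), (m1, q2), (m3, m1), (q3, q1), (p3, p2), (m3, m2)]) =
     Z Ob (lks [(p3, p2), (p1, q2), (q3, q1)])" (is "_ = ?K7")
  proof -
    have "Z ?H (lks [(p1, m2), (m1, q2), (m3, m1), (q3, q1), (p3, p2), (m3, m2)]) =
      Z ?H2 (lks [(p1, m2), (m3, q2), (q3, q1), (p3, p2), (m3, m2)])"
      by (rule Z_elim[where w = q2]) (use d in \<open>simp_all add: ne subset_insertI subset_insertI2\<close>)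
    also have "\<dots> = Z ?H3 (lks [(p1, m3), (m3, q2), (q3, q1), (p3, p2)])"
      by (rule Z_elim[where w = m3]) (use d in \<open>simp_all add: ne subset_insertI subset_insertI2\<close>)
    also have "\<dots> = ?K7"
      by (rule Z_elim[where w = p1]) (use d in \<open>simp_all add: ne subset_insertI subset_insertI2\<close>)
    finally show ?thesis .
  qed
  have 8: "Z ?H (lks [(p1, m2), (m1, q2), (m3, q1), (q3, m1), (p3, p2), (m3, m2)]) =
     Z Ob (lks [(p3, p2), (p1, q1), (q3, q2)])" (is "_ = ?K8")
  proof -
    have "Z ?H (lks [(p1, m2), (m1, q2), (m3, q1), (q3, m1), (p3, p2), (m3, m2)]) =
      Z ?H2 (lks [(p1, m2), (q3, q2), (m3, q1), (p3, p2), (m3, m2)])"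
      by (rule Z_elim[where w = q2]) (use d in \<open>simp_all add: ne subset_insertI subset_insertI2\<close>)
    also have "\<dots> = Z ?H3 (lks [(p1, m3), (q3, q2), (m3, q1), (p3, p2)])"
      by (rule Z_elim[where w = m3]) (use d in \<open>simp_all add: ne subset_insertI subset_insertI2\<close>)
    also have "\<dots> = ?K8"
      by (rule Z_elim[where w = p1]) (use d in \<open>simp_all add: ne subset_insertI subset_insertI2\<close>)
    finally show ?thesis .
  qed
  have v: "v = 1 \<or> v = - 1" using c23 by blast
  have inv: "Apow v * Apow (- v) = 1" by (simp add: Apow_mult Apow_0)
  have n: "c12 \<notin> insert c13 (insert c23 C)" "c13 \<notin> insert c23 C"
    and f: "finite (insert c13 (insert c23 C))" "finite (insert c23 C)" using assms(1-6) fin by auto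
  have alg: "w1 * (v1 * (v1 * K + v2 * (d * K)) + v2 * (v1 * K2 + v2 * K)) +
      w2 * (v1 * (v1 * K5 + v2 * K7) + v2 * (v1 * K6 + v2 * K8)) =
    w1 * ((v1 * v1 + d + v2 * v2) * K + (v1 * v2 - 1) * d * K + (v1 * v2) * K2) +
    w2 * (v1 * v1 * K5 + (v1 * v2) * K6 + (v1 * v2) * K7 + v2 * v2 * K8)"
    for w1 w2 v1 v2 d K K2 K5 K6 K7 K8 :: laurent
    by (simp add: algebra_simps)
  have "ssum ?H R (insert c12 (insert c13 (insert c23 C))) A B =
     Apow w * ((Apow v * Apow v + delta + Apow (- v) * Apow (- v)) * ?K
        + (Apow v * Apow (- v) - 1) * delta * ?K + (Apow v * Apow (- v)) * ?K2) +
    Apow (- w) * (Apow v * Apow v * ?K5 + (Apow v * Apow (- v)) * ?K6 +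
       (Apow v * Apow (- v)) * ?K7 + Apow (- v) * Apow (- v) * ?K8)"
    unfolding ssum_insert_eps[where A = A and B = B and H = ?H and R = R, OF f(1) n(1) c12]
      ssum_insert_eps[where A = A and B = B and H = ?H, OF f(2) n(2) c13]
      ssum_insert_eps[where A = A and B = B and H = ?H, OF fin(3) assms(3) c23]
    unfolding Un_assoc lks_Un append.simps 1 2 3 4 5 6 7 8
    by (rule alg)
  then show ?thesis by (simp only: delta_cancel[OF v] inv) simp
qed

text \<open>The position after the move is the position before it seen after a half-turn, which
  exchanges each p_i with q_i. The right-hand side is invariant under this exchange; its two middle
  terms change places.\<close>

lemma (in outer) state_move_III':
  fixes v w :: int
  assumes "c12 \<notin> C" "c13 \<notin> C" "c23 \<notin> C" "c12 \<noteq> c13" "c12 \<noteq> c23" "c13 \<noteq> c23"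
    and m: "m1 \<notin> Ob" "m2 \<notin> Ob" "m3 \<notin> Ob" "m1 \<noteq> m2" "m1 \<noteq> m3" "m2 \<noteq> m3"
    and O: "p1 \<in> Ob" "q1 \<in> Ob" "p2 \<in> Ob" "q2 \<in> Ob" "p3 \<in> Ob" "q3 \<in> Ob"
    and c12: "w = 1 \<and> A c12 = lks [(m1, m2), (q1, p2)] \<and> B c12 = lks [(m1, p2), (q1, m2)] \<or>
      w = - 1 \<and> A c12 = lks [(m1, p2), (q1, m2)] \<and> B c12 = lks [(m1, m2), (q1, p2)]"
    and c13: "v = 1 \<and> A c13 = lks [(p3, p1), (m3, m1)] \<and> B c13 = lks [(p3, m1), (m3, p1)] \<or>
      v = - 1 \<and> A c13 = lks [(p3, m1), (m3, p1)] \<and> B c13 = lks [(p3, p1), (m3, m1)]"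
    and c23: "v = 1 \<and> A c23 = lks [(m3, q2), (q3, m2)] \<and> B c23 = lks [(m3, m2), (q3, q2)] \<or>
      v = - 1 \<and> A c23 = lks [(m3, m2), (q3, q2)] \<and> B c23 = lks [(m3, q2), (q3, m2)]"
  shows "ssum (insert m1 (insert m2 (insert m3 Ob))) R (insert c12 (insert c13 (insert c23 C))) A B =
    Apow w * Z Ob (lks [(p1, q2), (p3, q3), (p2, q1)]) +
    Apow (- w) * (Apow v * Apow v * Z Ob (lks [(p1, p3), (p2, q2), (q3, q1)]) +
       Z Ob (lks [(p1, p3), (p2, q1), (q3, q2)]) + Z Ob (lks [(p3, p2), (p1, q2), (q3, q1)]) +
       Apow (- v) * Apow (- v) * Z Ob (lks [(p3, p2), (p1, q1), (q3, q2)]))"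
proof -
  have sw: "lks [x, y] = lks [y, x]" for x y :: "'a \<times> 'a" by (auto simp: lks_def)
  note III = state_move_III[OF assms(1-6) m O(2,1,4,3,6,5),
      OF c12[unfolded sw[of "(m1, m2)"] sw[of "(m1, p2)"]]
      c23[unfolded sw[of "(m3, q2)"] sw[of "(m3, m2)"]]
      c13[unfolded sw[of "(p3, p1)"] sw[of "(p3, m1)"]]]
  have "Z Ob (lks [(q1, p2), (q3, p3), (q2, p1)]) = Z Ob (lks [(p1, q2), (p3, q3), (p2, q1)])"
    "Z Ob (lks [(q1, q3), (q2, p2), (p3, p1)]) = Z Ob (lks [(p1, p3), (p2, q2), (q3, q1)])"
    "Z Ob (lks [(q1, q3), (q2, p1), (p3, p2)]) = Z Ob (lks [(p3, p2), (p1, q2), (q3, q1)])"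
    "Z Ob (lks [(q3, q2), (q1, p2), (p3, p1)]) = Z Ob (lks [(p1, p3), (p2, q1), (q3, q2)])"
    "Z Ob (lks [(q3, q2), (q1, p1), (p3, p2)]) = Z Ob (lks [(p3, p2), (p1, q1), (q3, q2)])"
    by (rule Z_cong, rule lks_eq; simp)+
  then show ?thesis using III by (simp add: add_ac)
qed

section \<open>Cyclic order of marks on circles\<close>

definition marking :: "param set \<Rightarrow> bool" where
  "marking M \<longleftrightarrow> finite M \<and> M \<subseteq> UNIV \<times> {0..<1}"

definition nxt :: "param set \<Rightarrow> param \<Rightarrow> param" where
  "nxt M x =
     (fst x,
      if \<exists>u. snd x < u \<and> (fst x, u) \<in> M
      then Min {u. snd x < u \<and> (fst x, u) \<in> M}
      else Min {u. (fst x, u) \<in> M})"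

text \<open>\<open>r\<close> is the lift to the universal cover \<open>\<real>\<close> of the mark following \<open>x\<close>.\<close>

definition succ_lift :: "param set \<Rightarrow> param \<Rightarrow> real \<Rightarrow> bool" where
  "succ_lift M x r \<longleftrightarrow> snd x < r \<and> (fst x, frac r) \<in> M \<and>
     (\<forall>s. snd x < s \<and> s < r \<longrightarrow> (fst x, frac s) \<notin> M)"

lemma frac_id: "0 \<le> r \<Longrightarrow> r < 1 \<Longrightarrow> frac r = r"
  by (simp add: frac_eq)

lemma frac_shift: "frac (r + of_int n) = frac r" "frac (r - of_int n) = frac r" "frac (r + 1) = frac r" "frac (r - 1) = frac r"
  by (simp_all add: frac_def)

lemma frac_eq_imp: "frac r = frac s \<Longrightarrow> \<exists>n :: int. r = s + of_int n"
  unfolding frac_def by (rule exI[of _ "\<lfloor>r\<rfloor> - \<lfloor>s\<rfloor>"]) simp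

lemma succ_lift_unique: "succ_lift M x r \<Longrightarrow> succ_lift M x s \<Longrightarrow> r = s"
  unfolding succ_lift_def by (metis linorder_neqE)

text \<open>The bound by one full turn includes the case of a single mark, which is its own
  successor; later it excludes that an edge wraps around twice.\<close>

lemma nxt_ex:
  assumes M: "marking M" and x: "x \<in> M"
  shows "\<exists>r. succ_lift M x r \<and> r \<le> snd x + 1 \<and> nxt M x = (fst x, frac r)"
proof -
  obtain i t where [simp]: "x = (i, t)" by (cases x)
  have t: "0 \<le> t" "t < 1" using assms by (auto simp: marking_def)
  have sub: "\<And>u. (i, u) \<in> M \<Longrightarrow> 0 \<le> u \<and> u < 1" using M by (auto simp: marking_def)
  have "finite (snd ` M)" using M by (simp add: marking_def)
  moreover have "{u. (i, u) \<in> M} \<subseteq> snd ` M" by force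
  ultimately have fin: "finite {u. (i, u) \<in> M}" by (rule finite_subset[rotated])
  show ?thesis
  proof (cases "\<exists>u. t < u \<and> (i, u) \<in> M")
    case True
    define r where "r = Min {u. t < u \<and> (i, u) \<in> M}"
    have fin': "finite {u. t < u \<and> (i, u) \<in> M}" by (rule finite_subset[OF _ fin]) auto
    have "r \<in> {u. t < u \<and> (i, u) \<in> M}" unfolding r_def
      by (rule Min_in[OF fin']) (use True in auto)
    then have r: "t < r" "(i, r) \<in> M" by auto
    have min: "r \<le> u" if "t < u" "(i, u) \<in> M" for u
      unfolding r_def using fin' that by (intro Min_le) auto
    have "(i, frac s) \<notin> M" if "t < s" "s < r" for s
      using min[of s] that frac_id[of s] t sub[OF r(2)] by auto
    moreover have "frac r = r" using sub[OF r(2)] by (simp add: frac_id)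
    moreover have "nxt M x = (i, r)" by (simp only: nxt_def r_def \<open>x = (i, t)\<close> fst_conv snd_conv True if_True)
    moreover have "r \<le> t + 1" using sub[OF r(2)] t by simp
    ultimately show ?thesis using r by (intro exI[of _ r]) (simp add: succ_lift_def)
  next
    case False
    define q where "q = Min {u. (i, u) \<in> M}"
    have "q \<in> {u. (i, u) \<in> M}" unfolding q_def
      by (rule Min_in[OF fin]) (use x in auto)
    then have q: "(i, q) \<in> M" by auto
    have min: "q \<le> u" if "(i, u) \<in> M" for u
      unfolding q_def using fin that by (intro Min_le) auto
    \<comment> \<open>The successor lies past the base point, so its lift is one turn further on the
      line.\<close>
    have fq: "frac (q + 1) = q" using sub[OF q] by (simp add: frac_shift frac_id)
    have "(i, frac s) \<notin> M" if "t < s" "s < q + 1" for s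
    proof
      assume s: "(i, frac s) \<in> M"
      show False
      proof (cases "s < 1")
        case True
        then show False using False s that t frac_id[of s] by auto
      next
        case False
        then have "frac s = s - 1" using that sub[OF q] frac_shift(4)[of s] frac_id[of "s - 1"] by simp
        then show False using min[OF s] that by simp
      qed
    qed
    moreover have "nxt M x = (i, q)" by (simp only: nxt_def q_def \<open>x = (i, t)\<close> fst_conv snd_conv False if_False)
    moreover have "q + 1 \<le> t + 1" using min[of t] x by simp
    ultimately show ?thesis using q fq t sub[OF q] by (intro exI[of _ "q + 1"]) (simp add: succ_lift_def)
  qed
qed

lemma nxt_eqI:
  assumes "marking M" "x \<in> M" "succ_lift M x r"
  shows "nxt M x = (fst x, frac r)"
  using nxt_ex[OF assms(1,2)] succ_lift_unique[OF assms(3)] by metis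

lemma nxt_in: "marking M \<Longrightarrow> x \<in> M \<Longrightarrow> nxt M x \<in> M"
  using nxt_ex[of M x] by (auto simp: succ_lift_def)

lemma fst_nxt [simp]: "fst (nxt M x) = fst x"
  by (simp add: nxt_def)

text \<open>If two different marks had a common successor, then after an integer shift the later of
  them would lie strictly between the earlier one and its successor.\<close>

lemma nxt_inj:
  assumes M: "marking M"
  shows "inj_on (nxt M) M"
proof (rule inj_onI)
  fix x y assume xy: "x \<in> M" "y \<in> M" "nxt M x = nxt M y"
  obtain r where r: "succ_lift M x r" "nxt M x = (fst x, frac r)" using nxt_ex[OF M xy(1)] by blast
  obtain s where s: "succ_lift M y s" "nxt M y = (fst y, frac s)" using nxt_ex[OF M xy(2)] by blast
  obtain i t u where [simp]: "x = (i, t)" "y = (i, u)"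
    using xy(3) r(2) s(2) by (cases x, cases y) auto
  obtain n :: int where n: "r = s + of_int n" using frac_eq_imp r s xy(3) by auto
  have b: "0 \<le> t" "t < 1" "0 \<le> u" "u < 1" using xy(1,2) M by (auto simp: marking_def)
  have m: "(i, frac t) \<in> M" "(i, frac u) \<in> M" using xy(1,2) b by (simp_all add: frac_id)
  have rt: "t < r" "\<And>v. t < v \<Longrightarrow> v < r \<Longrightarrow> (i, frac v) \<notin> M"
    and su: "u < s" "\<And>v. u < v \<Longrightarrow> v < s \<Longrightarrow> (i, frac v) \<notin> M"
    using r(1) s(1) by (auto simp: succ_lift_def)
  have "\<not> t < u + of_int n"
    using rt(2)[of "u + of_int n"] m su(1) n by (auto simp: frac_shift)
  moreover have "\<not> u < t - of_int n"
    using su(2)[of "t - of_int n"] m rt(1) n by (auto simp: frac_shift)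
  ultimately have "t = u + of_int n" by simp
  then have "frac t = frac u" by (simp add: frac_shift)
  then show "x = y" using b by (simp add: frac_id)
qed

lemma nxt_bij:
  assumes "marking M"
  shows "bij_betw (nxt M) M M"
proof -
  have "finite M" using assms by (simp add: marking_def)
  moreover have "nxt M ` M \<subseteq> M" using nxt_in[OF assms] by auto
  ultimately show ?thesis using endo_inj_surj nxt_inj[OF assms] unfolding bij_betw_def by metis
qed

text \<open>On the line the new mark lies between \<open>x\<close> and the old successor of
  \<open>x\<close>, so only the edge leaving \<open>x\<close> is subdivided.\<close>

lemma nxt_insert:
  assumes M: "marking M" and m: "m \<notin> M" "marking (insert m M)" and x: "x \<in> M"
    and r: "succ_lift (insert m M) x r" "m = (fst x, frac r)"
  shows "nxt (insert m M) x = m" "nxt (insert m M) m = nxt M x"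
    "\<And>y. y \<in> M \<Longrightarrow> y \<noteq> x \<Longrightarrow> nxt (insert m M) y = nxt M y"
proof -
  obtain i t where [simp]: "x = (i, t)" by (cases x)
  have mi: "m = (i, frac r)" using r by simp
  show n1: "nxt (insert m M) x = m" using nxt_eqI[OF m(2) _ r(1)] r(2) x by simp
  obtain r' where r': "succ_lift M x r'" "nxt M x = (i, frac r')" using nxt_ex[OF M x] by auto
  have lt: "r < r'"
  proof (rule ccontr)
    assume "\<not> r < r'"
    then consider "r' < r" | "r' = r" by linarith
    then show False
      by cases (use r r' m(1) in \<open>auto simp: succ_lift_def\<close>)
  qed
  have tr: "t < r" using r(1) by (simp add: succ_lift_def)
  have "succ_lift (insert m M) m (r' - of_int \<lfloor>r\<rfloor>)"
    unfolding succ_lift_def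
  proof (intro conjI allI impI)
    show "snd m < r' - of_int \<lfloor>r\<rfloor>" using lt by (simp add: mi frac_def)
    show "(fst m, frac (r' - of_int \<lfloor>r\<rfloor>)) \<in> insert m M"
      using r'(1) by (simp add: frac_shift mi succ_lift_def)
    fix s assume s: "snd m < s \<and> s < r' - of_int \<lfloor>r\<rfloor>"
    then have s': "r < s + of_int \<lfloor>r\<rfloor>" "s + of_int \<lfloor>r\<rfloor> < r'" by (auto simp: mi frac_def)
    then have 1: "(i, frac s) \<notin> M" using r'(1) tr lt by (auto simp: succ_lift_def frac_shift dest!: spec[of _ "s + of_int \<lfloor>r\<rfloor>"])
    \<comment> \<open>A second lift of \<open>m\<close> would come a full turn after
      \<open>r\<close>, but the old successor of \<open>x\<close> is at most one turn after
      \<open>x\<close>.\<close>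
    have "frac s \<noteq> frac r"
    proof
      assume "frac s = frac r"
      then obtain n :: int where n: "s = r + of_int n" using frac_eq_imp by blast
      let ?k = "n + \<lfloor>r\<rfloor>"
      have "?k > 0" using s'(1) n by linarith
      then have "real_of_int ?k \<ge> 1" by linarith
      moreover have "r' \<le> t + 1" using nxt_ex[OF M x] succ_lift_unique[OF r'(1)] by auto
      ultimately show False using s'(2) n tr by simp
    qed
    then show "(fst m, frac s) \<notin> insert m M" using 1 by (simp add: mi)
  qed
  from nxt_eqI[OF m(2) _ this] show "nxt (insert m M) m = nxt M x"
    using r'(2) by (simp add: mi frac_shift)
  fix y assume y: "y \<in> M" "y \<noteq> x"
  obtain q where q: "succ_lift (insert m M) y q" "nxt (insert m M) y = (fst y, frac q)"
    using nxt_ex[OF m(2)] y by blast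
  have "nxt (insert m M) y \<noteq> m"
    using inj_onD[OF nxt_inj[OF m(2)], of y x] y x n1 by auto
  then have "(fst y, frac q) \<in> M" using q by (auto simp: succ_lift_def)
  then have "succ_lift M y q" using q(1) by (auto simp: succ_lift_def)
  then show "nxt (insert m M) y = nxt M y" using nxt_eqI[OF M y(1)] q(2) by simp
qed

text \<open>A predecessor exists because the successor map is a bijection. It is not
  \<open>m\<close> itself, since the turn from \<open>m\<close> back to \<open>m\<close> passes the
  mark \<open>u\<close> of the same circle.\<close>

lemma nxt_pred_ex:
  assumes M: "marking (insert m M)" and m: "m \<notin> M" "(fst m, u) \<in> M"
  shows "\<exists>x r. x \<in> M \<and> succ_lift (insert m M) x r \<and> m = (fst x, frac r)"
proof -
  have "m \<in> nxt (insert m M) ` insert m M"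
    using nxt_bij[OF M] by (auto simp: bij_betw_def)
  then obtain x where x: "x \<in> insert m M" "m = nxt (insert m M) x" by blast
  obtain r where r: "succ_lift (insert m M) x r" "r \<le> snd x + 1" "nxt (insert m M) x = (fst x, frac r)"
    using nxt_ex[OF M x(1)] by blast
  have "x \<noteq> m"
  proof
    assume xm: "x = m"
    obtain i t where [simp]: "m = (i, t)" by (cases m)
    have b: "0 \<le> t" "t < 1" "0 \<le> u" "u < 1" using M m by (auto simp: marking_def)
    have nn: "(i, frac s) \<notin> M" if "t < s" "s < r" for s using r(1) xm that by (auto simp: succ_lift_def)
    have "frac r = frac t" using r(3) x(2) xm b by (simp add: frac_id)
    moreover have "t < r" using r(1) xm by (simp add: succ_lift_def)
    moreover obtain n :: int where "r = t + of_int n" using frac_eq_imp[OF calculation(1)] by blast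
    ultimately have n: "r = t + of_int n" "n > 0" by simp_all
    then have "real_of_int n \<ge> 1" by linarith
    then have "r = t + 1" using n r(2) xm by simp
    then show False
      using nn[of u] nn[of "u + 1"] b m by (cases "t < u"; cases "u < t") (auto simp: frac_id frac_shift)
  qed
  then have "x \<in> M" using x by simp
  moreover have "m = (fst x, frac r)" using x r by simp
  ultimately show ?thesis using r(1) by blast
qed

section \<open>States on an arbitrary set of marks\<close>

definition eds :: "param set \<Rightarrow> (half_edge \<times> half_edge) set" where
  "eds M = (\<lambda>x. ((x, True), (nxt M x, False))) ` M"

definition biv :: "param set \<Rightarrow> (half_edge \<times> half_edge) set" where
  "biv M = (\<lambda>x. ((x, True), (x, False))) ` M"

lemma eds_insert:
  assumes M: "marking M" and m: "m \<notin> M" "marking (insert m M)" and x: "x \<in> M"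
    and r: "succ_lift (insert m M) x r" "m = (fst x, frac r)"
  shows "eds (insert m M) = (\<lambda>x. ((x, True), (nxt M x, False))) ` (M - {x}) \<union>
    {((x, True), (m, False)), ((m, True), (nxt M x, False))}"
proof -
  have M_eq: "insert m M = insert m (insert x (M - {x}))" using x by auto
  define g where "g y = ((y, True), (nxt (insert m M) y, False))" for y
  have "g ` (M - {x}) = (\<lambda>x. ((x, True), (nxt M x, False))) ` (M - {x})"
    by (rule image_cong) (use nxt_insert(3)[OF assms] in \<open>auto simp: g_def\<close>)
  moreover have "g x = ((x, True), (m, False))" "g m = ((m, True), (nxt M x, False))"
    using nxt_insert(1,2)[OF assms] by (simp_all add: g_def)
  moreover have "eds (insert m M) = g ` insert m (insert x (M - {x}))"
    unfolding eds_def M_eq[symmetric] by (simp add: g_def)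
  ultimately show ?thesis by (simp only: image_insert) blast
qed

text \<open>The edge that leaves \<open>x\<close> is subdivided by a bivalent vertex. Contracting
  both half-edges of \<open>m\<close> onto \<open>(x, True)\<close> restores the old edge and leaves
  only a trivial pair.\<close>

lemma kc_insert_mark:
  assumes M: "marking M" and m: "m \<notin> M" "marking (insert m M)" "(fst m, u) \<in> M"
    and X: "X \<subseteq> M" "Q \<subseteq> (M \<times> UNIV) \<times> (M \<times> UNIV)"
  shows "kc (insert m M \<times> UNIV) (eds (insert m M) \<union> biv (insert m M - X) \<union> Q) =
    kc (M \<times> UNIV) (eds M \<union> biv (M - X) \<union> Q)"
proof -
  obtain x r where x: "x \<in> M" "succ_lift (insert m M) x r" "m = (fst x, frac r)"
    using nxt_pred_ex[OF m(2,1,3)] by blast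
  let ?E = "(\<lambda>y. ((y, True), (nxt M y, False))) ` (M - {x})"
  have E1: "eds (insert m M) = ?E \<union> {((x, True), (m, False)), ((m, True), (nxt M x, False))}"
    by (rule eds_insert) (use M m x in auto)
  have E2: "eds M = insert ((x, True), (nxt M x, False)) ?E"
    unfolding eds_def using x(1) by auto
  have B: "biv (insert m M - X) = insert ((m, True), (m, False)) (biv (M - X))"
    using m(1) X(1) by (auto simp: biv_def)
  let ?f = "id((m, True) := (x, True), (m, False) := (x, True))"
  let ?R' = "eds (insert m M) \<union> biv (insert m M - X) \<union> Q"
  have keep: "relim ?f Y = Y" if "Y \<subseteq> (M \<times> UNIV) \<times> (M \<times> UNIV)" for Y
    by (rule relim_id[OF that]) (use m(1) in auto)
  have nM: "nxt M y \<in> M" if "y \<in> M" for y using nxt_in[OF M that] .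
  have Es: "?E \<subseteq> (M \<times> UNIV) \<times> (M \<times> UNIV)" "biv (M - X) \<subseteq> (M \<times> UNIV) \<times> (M \<times> UNIV)"
    using nM by (auto simp: biv_def)
  have "kc (insert m M \<times> UNIV) ?R' = kc (M \<times> UNIV) (relim ?f ?R')"
  proof (rule kc_contract[where f = ?f])
    show "?R' \<subseteq> (insert m M \<times> UNIV) \<times> (insert m M \<times> UNIV)"
      unfolding E1 B using Es X(2) x(1) nM by (auto; blast)
    show "?f ` (insert m M \<times> UNIV) = M \<times> UNIV"
    proof -
      have "?f ` (M \<times> UNIV) = M \<times> UNIV" using m(1) by (force simp: image_iff)
      moreover have "insert m M \<times> UNIV = {(m, True), (m, False)} \<union> M \<times> UNIV"
        using UNIV_bool by auto
      ultimately show ?thesis using x(1) by (simp only: image_Un) auto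
    qed
    have 1: "((x, True), (m, False)) \<in> ?R'" "((m, True), (m, False)) \<in> ?R'" by (auto simp: E1 B)
    have "((m, False), (x, True)) \<in> eqv ?R'" "((m, True), (x, True)) \<in> eqv ?R'"
      using eqv_base'[OF 1(1)] eqv_trans[OF eqv_base[OF 1(2)] eqv_base'[OF 1(1)]] by auto
    then show "(z, ?f z) \<in> eqv ?R'" for z by simp
  qed (use m in \<open>auto simp: relim_def\<close>)
  also have "relim ?f ?R' = insert ((x, True), (x, True)) (eds M \<union> biv (M - X) \<union> Q)"
  proof -
    have "x \<noteq> m" "nxt M x \<noteq> m" using x(1) nM[OF x(1)] m(1) by blast+
    then have "relim ?f {((x, True), (m, False)), ((m, True), (nxt M x, False))} =
      {((x, True), (x, True)), ((x, True), (nxt M x, False))}"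
      "relim ?f {((m, True), (m, False))} = {((x, True), (x, True))}"
      by (auto simp: relim_def)
    moreover have "relim ?f ?E = ?E" "relim ?f (biv (M - X)) = biv (M - X)" "relim ?f Q = Q"
      using keep Es X(2) by blast+
    moreover have "relim ?f (insert ((m, True), (m, False)) (biv (M - X))) =
      relim ?f {((m, True), (m, False))} \<union> relim ?f (biv (M - X))"
      by (simp only: relim_Un[symmetric] insert_is_Un[symmetric])
    ultimately show ?thesis
      unfolding E1 B by (simp only: relim_Un E2) blast
  qed
  also have "kc (M \<times> UNIV) \<dots> = kc (M \<times> UNIV) (eds M \<union> biv (M - X) \<union> Q)"
    by (rule kc_add_redundant) simp
  finally show ?thesis .
qed

text \<open>Bivalent marks may be added freely on circles that already carry a mark. A mark on a new
  circle would add a loop, which the last hypothesis excludes.\<close>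

lemma kc_marks_mono:
  assumes "marking M'" "M \<subseteq> M'" "X \<subseteq> M" "Q \<subseteq> (M \<times> UNIV) \<times> (M \<times> UNIV)"
    and "fst ` M' \<subseteq> fst ` M"
  shows "kc (M' \<times> UNIV) (eds M' \<union> biv (M' - X) \<union> Q) = kc (M \<times> UNIV) (eds M \<union> biv (M - X) \<union> Q)"
proof -
  have "finite (M' - M)" using assms(1) by (simp add: marking_def)
  have "kc ((M \<union> N) \<times> UNIV) (eds (M \<union> N) \<union> biv (M \<union> N - X) \<union> Q) =
      kc (M \<times> UNIV) (eds M \<union> biv (M - X) \<union> Q)"
    if "finite N" "N \<subseteq> M' - M" for N
    using that
  proof (induction N rule: finite_induct)
    case (insert m N)
    have mk: "marking Y" if "Y \<subseteq> M'" for Y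
      using that assms(1) finite_subset by (auto simp: marking_def)
    obtain y where y: "y \<in> M" "fst m = fst y" using insert.prems assms(5) by auto
    have "kc ((insert m (M \<union> N)) \<times> UNIV) (eds (insert m (M \<union> N)) \<union> biv (insert m (M \<union> N) - X) \<union> Q)
      = kc ((M \<union> N) \<times> UNIV) (eds (M \<union> N) \<union> biv (M \<union> N - X) \<union> Q)"
    proof (rule kc_insert_mark)
      show "(fst m, snd y) \<in> M \<union> N" using y by simp
      show "marking (M \<union> N)" "marking (insert m (M \<union> N))"
        using insert.prems assms(2) by (auto intro!: mk)
    qed (use insert assms(3,4) in auto)
    then show ?case using insert by simp
  qed simp
  from this[of "M' - M"] show ?thesis using \<open>finite (M' - M)\<close> assms(2) by (simp add: Un_absorb1)
qed

section \<open>Bracket of a diagram\<close>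

text \<open>At an over-strand, truth means a positive crossing; at the under-strand of the same
  crossing the value is the opposite one.\<close>

definition sg :: "vdiagram \<Rightarrow> param \<Rightarrow> bool" where
  "sg D x \<longleftrightarrow> 0 < cross (tangent D x) (tangent D (partner D x))"

text \<open>Each real crossing is represented by the parameter of its over-strand.\<close>

definition Ov :: "vdiagram \<Rightarrow> param set" where
  "Ov D = {x \<in> real_params D. lvl D x = Over}"

text \<open>The A-splice applies \<open>rot\<close> to the half-edges of the under-strand
  \<open>partner D x\<close>, where the sign is opposite to \<open>sg D x\<close>;
  \<open>Bsp\<close> applies \<open>rot\<close> at the over-strand.\<close>

definition Asp :: "vdiagram \<Rightarrow> param \<Rightarrow> (half_edge \<times> half_edge) set" where
  "Asp D x = lks [((partner D x, True), (x, \<not> sg D x)), ((partner D x, False), (x, sg D x))]"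

definition Bsp :: "vdiagram \<Rightarrow> param \<Rightarrow> (half_edge \<times> half_edge) set" where
  "Bsp D x = lks [((x, True), (partner D x, sg D x)), ((x, False), (partner D x, \<not> sg D x))]"

text \<open>Base points of all circles, not only of the free ones as in \<open>marks\<close>: this
  set depends on nothing but the number of circles.\<close>

definition bases :: "vdiagram \<Rightarrow> param set" where
  "bases D = {..<ncomp D} \<times> {0}"

lemma cross_swap: "cross z w = - cross w z"
  by (simp add: cross_def)

lemma cross_minus: "cross (- z) w = - cross z w"
  by (simp add: cross_def)

locale vdiag =
  fixes D :: vdiagram
  assumes D: "is_vdiagram D"
begin

lemma ncomp_pos: "0 < ncomp D"
  and immersion: "i < ncomp D \<Longrightarrow> closed_immersion (crv D i)"
  and fin_double: "finite (double_params D)"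
  using D unfolding is_vdiagram_def by (elim conjE, simp)+

lemma triple:
  assumes "x \<in> params D" "y \<in> params D" "z \<in> params D" "pt D x = pt D y" "pt D y = pt D z"
  shows "x = y \<or> y = z \<or> x = z"
proof -
  have "\<forall>x \<in> params D. \<forall>y \<in> params D. \<forall>z \<in> params D.
      pt D x = pt D y \<and> pt D y = pt D z \<longrightarrow> x = y \<or> y = z \<or> x = z"
    using D unfolding is_vdiagram_def by (elim conjE)
  then show ?thesis using assms by blast
qed

lemma double:
  assumes "x \<in> params D" "y \<in> params D" "x \<noteq> y" "pt D x = pt D y"
  shows "cross (tangent D x) (tangent D y) \<noteq> 0 \<and>
        (lvl D x, lvl D y) \<in> {(Over, level.Under), (level.Under, Over), (Virt, Virt)}"
proof -
  have "\<forall>x \<in> params D. \<forall>y \<in> params D. x \<noteq> y \<and> pt D x = pt D y \<longrightarrow>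
        cross (tangent D x) (tangent D y) \<noteq> 0 \<and>
        (lvl D x, lvl D y) \<in> {(Over, level.Under), (level.Under, Over), (Virt, Virt)}"
    using D unfolding is_vdiagram_def by (elim conjE)
  then show ?thesis using assms by blast
qed

lemma partner_eq:
  assumes "x \<in> params D" "y \<in> params D" "y \<noteq> x" "pt D y = pt D x"
  shows "partner D x = y"
  unfolding partner_def
proof (rule the_equality)
  fix z assume "z \<in> params D \<and> z \<noteq> x \<and> pt D z = pt D x"
  then show "z = y" using triple[of x y z] assms by auto
qed (use assms in auto)

lemma partner_props:
  assumes "x \<in> double_params D"
  shows "x \<in> params D" "partner D x \<in> params D" "partner D x \<noteq> x" "pt D (partner D x) = pt D x"
    "partner D x \<in> double_params D" "partner D (partner D x) = x"
    "cross (tangent D x) (tangent D (partner D x)) \<noteq> 0"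
    "(lvl D x, lvl D (partner D x)) \<in> {(Over, level.Under), (level.Under, Over), (Virt, Virt)}"
    "sg D (partner D x) \<longleftrightarrow> \<not> sg D x"
proof -
  obtain y where y: "x \<in> params D" "y \<in> params D" "y \<noteq> x" "pt D y = pt D x"
    using assms unfolding double_params_def by blast
  have p: "partner D x = y" by (rule partner_eq) (use y in auto)
  show 1: "x \<in> params D" "partner D x \<in> params D" "partner D x \<noteq> x" "pt D (partner D x) = pt D x"
    using y p by auto
  show "partner D x \<in> double_params D" using 1 unfolding double_params_def by (auto intro!: bexI[of _ x])
  show 2: "partner D (partner D x) = x" by (rule partner_eq) (use 1 in auto)
  show 3: "cross (tangent D x) (tangent D (partner D x)) \<noteq> 0"
    "(lvl D x, lvl D (partner D x)) \<in> {(Over, level.Under), (level.Under, Over), (Virt, Virt)}"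
    using double[of x "partner D x"] 1 by auto
  show "sg D (partner D x) \<longleftrightarrow> \<not> sg D x"
    using 3(1) cross_swap[of "tangent D x" "tangent D (partner D x)"] by (auto simp: sg_def 2)
qed

lemma real_double: "x \<in> real_params D \<Longrightarrow> x \<in> double_params D"
  by (simp add: real_params_def)

lemma real_partner:
  assumes "x \<in> real_params D"
  shows "partner D x \<in> real_params D"
    "lvl D x = Over \<and> lvl D (partner D x) = level.Under \<or> lvl D x = level.Under \<and> lvl D (partner D x) = Over"
  using partner_props[OF real_double[OF assms]] assms by (auto simp: real_params_def)

lemma fin_real: "finite (real_params D)"
  using fin_double by (rule rev_finite_subset) (auto simp: real_params_def)

lemma fin_Ov: "finite (Ov D)"
  using fin_real by (simp add: Ov_def)

lemma Ov_real: "x \<in> Ov D \<Longrightarrow> x \<in> real_params D"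
  by (simp add: Ov_def)

lemma real_cases:
  assumes "x \<in> real_params D"
  obtains "x \<in> Ov D" "lvl D x = Over" | "partner D x \<in> Ov D" "lvl D x = level.Under" "partner D (partner D x) = x" "x \<notin> Ov D"
  using real_partner[OF assms] partner_props(6)[OF real_double[OF assms]] assms by (auto simp: Ov_def)

lemma real_params_subset: "real_params D \<subseteq> params D"
  by (auto simp: real_params_def double_params_def)

lemma marking_params: "finite M \<Longrightarrow> M \<subseteq> params D \<Longrightarrow> marking M"
  by (auto simp: marking_def params_def)

lemma inj_pt_Ov: "inj_on (pt D) (Ov D)"
proof (rule inj_onI, rule ccontr)
  fix x y assume *: "x \<in> Ov D" "y \<in> Ov D" "pt D x = pt D y" "x \<noteq> y"
  then have "partner D x = y"
    using partner_props(1)[OF real_double[OF Ov_real]] by (intro partner_eq) auto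
  then show False using * real_partner(2)[of x] by (auto simp: Ov_def)
qed

lemma pt_Ov: "pt D ` Ov D = real_crossings D"
proof
  show "real_crossings D \<subseteq> pt D ` Ov D"
  proof
    fix p assume "p \<in> real_crossings D"
    then obtain x where "x \<in> real_params D" "p = pt D x" by (auto simp: real_crossings_def)
    show "p \<in> pt D ` Ov D"
    proof (cases rule: real_cases[OF \<open>x \<in> real_params D\<close>])
      case 2
      have "p = pt D (partner D x)"
        using partner_props(4)[OF real_double] \<open>x \<in> real_params D\<close> \<open>p = pt D x\<close> by simp
      then show ?thesis using 2(1) by (rule image_eqI)
    qed (simp add: \<open>p = pt D x\<close>)
  qed
qed (auto simp: Ov_def real_crossings_def)

lemma crossing_number: "crossing_number D = card (Ov D)"
  unfolding crossing_number_def pt_Ov[symmetric] by (rule card_image[OF inj_pt_Ov])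

lemma pt_mem_image:
  assumes "T \<subseteq> Ov D" "x \<in> Ov D"
  shows "pt D x \<in> pt D ` T \<longleftrightarrow> x \<in> T"
  using assms inj_on_image_mem_iff[OF inj_pt_Ov] by blast

lemma marks_facts: "finite (marks D)" "real_params D \<subseteq> marks D" "marks D \<subseteq> params D"
  "marks D - real_params D = (\<lambda>i. (i, 0)) ` free_circles D" "fst ` marks D = {..<ncomp D}"
proof -
  have f: "free_circles D \<subseteq> {..<ncomp D}" by (auto simp: free_circles_def)
  then show "finite (marks D)" using fin_real finite_subset unfolding marks_def by blast
  show "real_params D \<subseteq> marks D" by (simp add: marks_def)
  show "marks D - real_params D = (\<lambda>i. (i, 0)) ` free_circles D"
    by (auto simp: marks_def free_circles_def)
  show s: "marks D \<subseteq> params D" using f real_params_subset by (auto simp: marks_def params_def)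
  show "fst ` marks D = {..<ncomp D}"
  proof
    show "fst ` marks D \<subseteq> {..<ncomp D}" using s by (auto simp: params_def)
    show "{..<ncomp D} \<subseteq> fst ` marks D"
    proof
      fix i assume i: "i \<in> {..<ncomp D}"
      show "i \<in> fst ` marks D"
      proof (cases "i \<in> free_circles D")
        case False
        then obtain t where "(i, t) \<in> real_params D" using i by (auto simp: free_circles_def)
        then show ?thesis by (force simp: marks_def)
      qed (force simp: marks_def)
    qed
  qed
qed

lemma marking_marks: "marking (marks D)"
  using marks_facts marking_params by blast

lemma next_mark_nxt: "next_mark D = nxt (marks D)"
  by (simp add: fun_eq_iff next_mark_def nxt_def)

text \<open>Reversing a half-edge changes the sign of its cross product with the other
  strand.\<close>

lemma rot_real: "x \<in> real_params D \<Longrightarrow> rot D (x, b) = (partner D x, b = sg D x)"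
  using partner_props(7)[OF real_double, of x] by (auto simp: rot_def direction_def sg_def cross_minus)

lemma rot_free: "x \<notin> real_params D \<Longrightarrow> rot D (x, b) = (x, \<not> b)"
  by (simp add: rot_def)

lemma other_end_True: "other_end D (x, True) = (nxt (marks D) x, False)"
  by (simp add: next_mark_nxt)

lemma other_end_False:
  assumes "x \<in> marks D"
  shows "other_end D (nxt (marks D) x, False) = (x, True)"
  using inv_into_f_f[OF nxt_inj[OF marking_marks] assms] by (simp add: next_mark_nxt)

lemma other_end_False_ex:
  assumes "y \<in> marks D"
  obtains x where "x \<in> marks D" "y = nxt (marks D) x" "other_end D (y, False) = (x, True)"
proof -
  have "y \<in> nxt (marks D) ` marks D"
    using nxt_bij[OF marking_marks] assms by (auto simp: bij_betw_def)
  then show ?thesis using that other_end_False by blast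
qed

abbreviation gl :: "param set \<Rightarrow> (half_edge \<times> half_edge) set" where
  "gl M \<equiv> eds M \<union> biv (M - real_params D)"

lemma state_links_edge: "e \<in> half_edges D \<Longrightarrow> (e, other_end D e) \<in> state_links D S"
  unfolding state_links_def by blast

lemma state_links_rot:
  "e \<in> half_edges D \<Longrightarrow> fst e \<in> real_params D \<longrightarrow> lvl D (fst e) = (if pt D (fst e) \<in> S then level.Under else Over)
    \<Longrightarrow> (e, rot D e) \<in> state_links D S"
  unfolding state_links_def by blast

text \<open>The pointwise description by \<open>rot\<close> is replaced by a union over crossings,
  the shape that \<open>ssum\<close> needs. An A-splice is read off at the under-strand and a
  B-splice at the over-strand.\<close>

lemma eqv_state_links:
  assumes S: "S \<subseteq> real_crossings D"
  shows "eqv (state_links D S) =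
    eqv (gl (marks D) \<union> (\<Union>c\<in>Ov D. if pt D c \<in> S then Asp D c else Bsp D c))" (is "_ = eqv ?R")
proof (rule eqv_eqI; rule subrelI)
  fix e f assume "(e, f) \<in> state_links D S"
  then consider "e \<in> half_edges D" "f = other_end D e" |
    "e \<in> half_edges D" "f = rot D e" "fst e \<notin> real_params D" |
    "fst e \<in> real_params D" "f = rot D e" "lvl D (fst e) = (if pt D (fst e) \<in> S then level.Under else Over)"
    unfolding state_links_def by blast
  then show "(e, f) \<in> eqv ?R"
  proof cases
    case 1
    obtain x b where e: "e = (x, b)" "x \<in> marks D" using 1 by (cases e) (auto simp: half_edges_def)
    show ?thesis
    proof (cases b)
      case True
      then have "(e, f) \<in> eds (marks D)" using 1 e other_end_True by (auto simp: eds_def)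
      then show ?thesis by (intro eqv_base) simp
    next
      case False
      obtain y where "y \<in> marks D" "x = nxt (marks D) y" "other_end D (x, False) = (y, True)"
        using e other_end_False_ex by metis
      then have "(f, e) \<in> eds (marks D)" using 1 e False by (auto simp: eds_def)
      then show ?thesis by (intro eqv_base') simp
    qed
  next
    case 2
    obtain x b where e: "e = (x, b)" "x \<in> marks D" using 2 by (cases e) (auto simp: half_edges_def)
    have m: "((x, True), (x, False)) \<in> ?R" using 2 e by (auto simp: biv_def)
    show ?thesis using eqv_base[OF m] eqv_base'[OF m] 2 e by (cases b) (auto simp: rot_free)
  next
    case 3
    obtain x b where e: "e = (x, b)" "x \<in> real_params D" using 3 by (cases e) auto
    have f: "f = (partner D x, b = sg D x)" using 3 e rot_real by simp
    have "\<exists>c\<in>Ov D. (e, f) \<in> (if pt D c \<in> S then Asp D c else Bsp D c)"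
      using e(2)
    proof (cases rule: real_cases)
      case 1
      then have "pt D x \<notin> S" using 3 e by (auto split: if_splits)
      then show ?thesis using 1 e f by (intro bexI[of _ x]) (cases b; auto simp: Bsp_def lks_def lk_def)+
    next
      case 2
      have "pt D (partner D x) \<in> S"
        using 3 e 2 partner_props(4)[OF real_double[OF e(2)]] by (auto split: if_splits)
      then show ?thesis using 2 e f partner_props(9)[OF real_double[OF e(2)]]
        by (intro bexI[of _ "partner D x"]) (cases b; auto simp: Asp_def lks_def lk_def)+
    qed
    then show ?thesis by (intro eqv_base) blast
  qed
next
  fix e f assume "(e, f) \<in> ?R"
  then consider x where "x \<in> marks D" "e = (x, True)" "f = (nxt (marks D) x, False)" |
    x where "x \<in> marks D" "x \<notin> real_params D" "e = (x, True)" "f = (x, False)" |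
    c where "c \<in> Ov D" "pt D c \<in> S" "(e, f) \<in> Asp D c" |
    c where "c \<in> Ov D" "pt D c \<notin> S" "(e, f) \<in> Bsp D c"
    unfolding eds_def biv_def by (fastforce split: if_splits)
  then show "(e, f) \<in> eqv (state_links D S)"
  proof cases
    case 1
    then have "(e, f) \<in> state_links D S"
      using state_links_edge[of e S] by (simp add: half_edges_def next_mark_nxt)
    then show ?thesis by (rule eqv_base)
  next
    case 2
    then have "(e, f) \<in> state_links D S"
      using state_links_rot[of e S] by (simp add: half_edges_def rot_free)
    then show ?thesis by (rule eqv_base)
  next
    case 3
    have c: "c \<in> real_params D" "lvl D (partner D c) = level.Under" "partner D (partner D c) = c"
      "sg D (partner D c) \<longleftrightarrow> \<not> sg D c" "pt D (partner D c) = pt D c"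
      using 3(1) real_partner(2)[of c] partner_props[OF real_double, of c] by (auto simp: Ov_def)
    have pr: "partner D c \<in> real_params D" using real_partner(1)[OF c(1)] .
    have l: "((partner D c, b), rot D (partner D c, b)) \<in> state_links D S" for b
      by (rule state_links_rot) (use pr c 3(2) marks_facts(2) in \<open>auto simp: half_edges_def\<close>)
    have "((partner D c, b), (c, b \<noteq> sg D c)) \<in> eqv (state_links D S)" for b
      using eqv_base[OF l[of b]] by (simp add: rot_real[OF pr] c)
    from this[of True] this[of False] show ?thesis
      using 3(3) eqv_sym by (auto simp: Asp_def lks_def lk_def)
  next
    case 4
    have c: "c \<in> real_params D" "lvl D c = Over" using 4(1) by (auto simp: Ov_def)
    have l: "((c, b), rot D (c, b)) \<in> state_links D S" for b
      by (rule state_links_rot) (use c 4(2) marks_facts(2) in \<open>auto simp: half_edges_def\<close>)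
    have "((c, b), (partner D c, b = sg D c)) \<in> eqv (state_links D S)" for b
      using eqv_base[OF l[of b]] by (simp add: rot_real[OF c(1)])
    from this[of True] this[of False] show ?thesis
      using 4(3) eqv_sym by (auto simp: Bsp_def lks_def lk_def)
  qed
qed

lemma loops_kc:
  assumes "S \<subseteq> real_crossings D"
  shows "loops D S = kc (marks D \<times> UNIV) (gl (marks D) \<union>
    (\<Union>c\<in>Ov D. if pt D c \<in> S then Asp D c else Bsp D c))"
  unfolding loops_def half_edges_def eqv_def[symmetric] kc_def
  by (simp only: eqv_state_links[OF assms])

lemma Asp_subset: "Asp D c \<subseteq> (M \<times> UNIV) \<times> (M \<times> UNIV)"
  and Bsp_subset: "Bsp D c \<subseteq> (M \<times> UNIV) \<times> (M \<times> UNIV)"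
  if "c \<in> Ov D" "real_params D \<subseteq> M"
proof -
  have "c \<in> M" "partner D c \<in> M" using real_partner(1) Ov_real that by blast+
  then show "Asp D c \<subseteq> (M \<times> UNIV) \<times> (M \<times> UNIV)" "Bsp D c \<subseteq> (M \<times> UNIV) \<times> (M \<times> UNIV)"
    unfolding Asp_def Bsp_def by (intro lks_subset; simp)+
qed

lemma splices_subset:
  assumes "real_params D \<subseteq> M"
  shows "(\<Union>c\<in>Ov D. if P c then Asp D c else Bsp D c) \<subseteq> (M \<times> UNIV) \<times> (M \<times> UNIV)"
  using Asp_subset[OF _ assms] Bsp_subset[OF _ assms] by (intro UN_least) (simp split: if_split)

text \<open>Sets of crossing points are reindexed by sets of over-strand parameters, on which
  \<open>pt D\<close> is injective.\<close>

lemma bracket_marks: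
  "bracket D = ssum (marks D \<times> UNIV) (gl (marks D)) (Ov D) (Asp D) (Bsp D)"
proof -
  have inj: "inj_on (image (pt D)) (Pow (Ov D))" by (rule inj_on_image_Pow[OF inj_pt_Ov])
  have Pow: "Pow (real_crossings D) = image (pt D) ` Pow (Ov D)"
    unfolding pt_Ov[symmetric] by (rule image_Pow_surj[symmetric]) simp
  show ?thesis unfolding bracket_def ssum_def Pow sum.reindex[OF inj] comp_def
  proof (rule sum.cong[OF refl])
    fix T assume "T \<in> Pow (Ov D)"
    then have T: "T \<subseteq> Ov D" by simp
    have c1: "card (pt D ` T) = card T"
      using T inj_pt_Ov by (intro card_image) (rule inj_on_subset)
    have "real_crossings D - pt D ` T = pt D ` (Ov D - T)"
      unfolding pt_Ov[symmetric] using inj_on_image_set_diff[OF inj_pt_Ov, of "Ov D" T] T by simp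
    moreover have "inj_on (pt D) (Ov D - T)" using inj_pt_Ov by (rule inj_on_subset) simp
    ultimately have c2: "card (real_crossings D - pt D ` T) = card (Ov D - T)"
      by (simp add: card_image)
    have l: "loops D (pt D ` T) = kc (marks D \<times> UNIV) (gl (marks D) \<union>
       (\<Union>c\<in>Ov D. if c \<in> T then Asp D c else Bsp D c))"
    proof -
      have "(\<Union>c\<in>Ov D. if pt D c \<in> pt D ` T then Asp D c else Bsp D c) =
         (\<Union>c\<in>Ov D. if c \<in> T then Asp D c else Bsp D c)"
        by (rule SUP_cong) (simp_all add: pt_mem_image[OF T])
      moreover have "pt D ` T \<subseteq> real_crossings D" using T pt_Ov by blast
      ultimately show ?thesis by (simp only: loops_kc)
    qed
    show "Apow (int (card (pt D ` T)) - int (card (real_crossings D - pt D ` T))) *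
         delta ^ (loops D (pt D ` T) - 1) =
      Apow (int (card T) - int (card (Ov D - T))) *
         delta ^ (kc (marks D \<times> UNIV) (gl (marks D) \<union>
           (\<Union>c\<in>Ov D. if c \<in> T then Asp D c else Bsp D c)) - 1)"
      by (simp only: c1 c2 l)
  qed
qed

text \<open>Any finite set of marks will do if it contains the real ones and meets every circle.
  \<open>M\<close> and \<open>marks D\<close> are both compared with their union, since neither need
  contain the other.\<close>

lemma ssum_marks:
  assumes "finite M" "M \<subseteq> params D" "real_params D \<subseteq> M" "{..<ncomp D} \<subseteq> fst ` M"
  shows "bracket D = ssum (M \<times> UNIV) (gl M) (Ov D) (Asp D) (Bsp D)"
proof -
  let ?N = "M \<union> marks D"
  have N: "marking ?N" using assms marks_facts by (intro marking_params) auto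
  have circ: "fst ` ?N \<subseteq> {..<ncomp D}" using assms(2) marks_facts(3) by (auto simp: params_def)
  have "kc (M \<times> UNIV) (gl M \<union> (\<Union>c\<in>Ov D. if c \<in> T then Asp D c else Bsp D c)) =
     kc (marks D \<times> UNIV) (gl (marks D) \<union> (\<Union>c\<in>Ov D. if c \<in> T then Asp D c else Bsp D c))" for T
  proof -
    let ?Q = "\<Union>c\<in>Ov D. if c \<in> T then Asp D c else Bsp D c"
    have "kc (?N \<times> UNIV) (gl ?N \<union> ?Q) = kc (M \<times> UNIV) (gl M \<union> ?Q)"
      by (rule kc_marks_mono[OF N _ assms(3) splices_subset[OF assms(3)]]) (use assms circ in auto)
    moreover have "kc (?N \<times> UNIV) (gl ?N \<union> ?Q) = kc (marks D \<times> UNIV) (gl (marks D) \<union> ?Q)"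
      by (rule kc_marks_mono[OF N _ marks_facts(2) splices_subset[OF marks_facts(2)]])
         (use circ marks_facts(5) in auto)
    ultimately show ?thesis by simp
  qed
  then show ?thesis unfolding bracket_marks ssum_def by simp
qed

lemma writhe_sg: "writhe D = (\<Sum>x\<in>Ov D. if sg D x then 1 else - 1)"
proof -
  have "{x \<in> real_params D. lvl D x = Over \<and> 0 < cross (tangent D x) (tangent D (partner D x))} = {x \<in> Ov D. sg D x}"
    by (auto simp: Ov_def sg_def)
  moreover have "{x \<in> real_params D. lvl D x = Over \<and> cross (tangent D x) (tangent D (partner D x)) < 0} =
    {x \<in> Ov D. \<not> sg D x}"
  proof -
    have "cross (tangent D x) (tangent D (partner D x)) < 0 \<longleftrightarrow> \<not> sg D x" if "x \<in> real_params D" for x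
      using partner_props(7)[OF real_double[OF that]] unfolding sg_def by linarith
    then show ?thesis unfolding Ov_def by blast
  qed
  moreover have "(\<Sum>x\<in>Ov D. if sg D x then 1 else - 1 :: int) =
    int (card {x \<in> Ov D. sg D x}) - int (card {x \<in> Ov D. \<not> sg D x})"
  proof -
    have "{x \<in> Ov D. sg D x} = Ov D \<inter> {x. sg D x}" "{x \<in> Ov D. \<not> sg D x} = Ov D \<inter> - {x. sg D x}"
      by blast+
    then show ?thesis using fin_Ov by (simp add: sum.If_cases)
  qed
  ultimately show ?thesis by (simp add: writhe_def)
qed

end

section \<open>The writhe factor, and invariance under change of everything but the Gauss
  diagram\<close>

definition unit_w :: "int \<Rightarrow> laurent" where
  "unit_w n = (- 1) ^ nat \<bar>n\<bar> * Apow (- 3 * n)"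

lemma f_poly_unit: "f_poly D = unit_w (writhe D) * bracket D"
  by (simp add: f_poly_def unit_w_def)

text \<open>A kink changes the writhe by one; the resulting factor is to cancel the factor of the
  bracket in \<open>state_move_I\<close>.\<close>

lemma unit_w_Suc: "unit_w (n + e) = - Apow (- 3 * e) * unit_w n" if "e = 1 \<or> e = - 1"
proof -
  have sgn: "(- 1 :: laurent) ^ nat \<bar>k\<bar> = (if even k then 1 else - 1)" for k :: int
    by (simp add: minus_one_power_iff even_nat_iff)
  have "even (n + e) \<longleftrightarrow> odd n" using that by auto
  moreover have "Apow (- 3 * (n + e)) = Apow (- 3 * e) * Apow (- 3 * n)"
    by (simp add: Apow_mult algebra_simps)
  ultimately show ?thesis
    unfolding unit_w_def sgn by (cases "even n") simp_all
qed

text \<open>Only partners, levels and signs of the real crossings enter, that is, the signed Gauss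
  diagram. This settles isotopies and, through \<open>f_poly_same_inner\<close>, the virtual and
  mixed moves.\<close>

lemma f_poly_gauss_cong:
  assumes "is_vdiagram D" "is_vdiagram D'" "ncomp D' = ncomp D" "real_params D' = real_params D"
    and "\<And>x. x \<in> real_params D \<Longrightarrow> partner D' x = partner D x \<and> lvl D' x = lvl D x \<and> sg D' x = sg D x"
  shows "f_poly D' = f_poly D"
proof -
  interpret A: vdiag D by unfold_locales (rule assms)
  interpret B: vdiag D' by unfold_locales (rule assms)
  have Ov: "Ov D' = Ov D" using assms(4,5) by (auto simp: Ov_def)
  have m: "real_params D \<union> bases D \<subseteq> params D" "finite (real_params D \<union> bases D)"
    "{..<ncomp D} \<subseteq> fst ` (real_params D \<union> bases D)"
    using A.real_params_subset A.fin_real by (auto simp: bases_def params_def image_Un)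
  have p: "params D' = params D" by (simp add: params_def assms(3))
  have r: "x \<in> Ov D \<Longrightarrow> partner D' x = partner D x \<and> sg D' x = sg D x" for x
    using assms(5) A.Ov_real by blast
  have "bracket D' = bracket D"
  proof -
    have "bracket D = ssum ((real_params D \<union> bases D) \<times> UNIV) (A.gl (real_params D \<union> bases D)) (Ov D) (Asp D) (Bsp D)"
      by (rule A.ssum_marks) (use m in auto)
    also have "\<dots> = ssum ((real_params D \<union> bases D) \<times> UNIV) (A.gl (real_params D \<union> bases D)) (Ov D) (Asp D') (Bsp D')"
      by (rule ssum_cong) (simp_all add: Asp_def Bsp_def r)
    also have "\<dots> = ssum ((real_params D \<union> bases D) \<times> UNIV) (B.gl (real_params D \<union> bases D)) (Ov D') (Asp D') (Bsp D')"
      by (simp only: assms(4) Ov)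
    also have "\<dots> = bracket D'"
      by (rule B.ssum_marks[symmetric]) (use m p assms(3,4) in auto)
    finally show ?thesis ..
  qed
  moreover have "writhe D' = writhe D"
    unfolding A.writhe_sg B.writhe_sg Ov by (rule sum.cong) (simp_all add: r)
  ultimately show ?thesis by (simp add: f_poly_unit)
qed

section \<open>Reparametrization and isotopy\<close>

lemma closed_immersion_shift:
  assumes "closed_immersion \<gamma>"
  shows "\<gamma> (t + of_int n) = \<gamma> t" "\<gamma> (frac t) = \<gamma> t"
proof -
  have 1: "\<gamma> (s + 1) = \<gamma> s" for s using assms by (simp add: closed_immersion_def)
  have 2: "\<gamma> (s + real k) = \<gamma> s" for s k
    by (induction k) (use 1 in \<open>simp_all add: add.assoc[symmetric] add.commute[of 1]\<close>)
  show *: "\<gamma> (t + of_int n) = \<gamma> t" for t n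
  proof (cases "n \<ge> 0")
    case True
    then show ?thesis using 2[of t "nat n"] by simp
  next
    case False
    then show ?thesis using 2[of "t + of_int n" "nat (- n)"] by simp
  qed
  show "\<gamma> (frac t) = \<gamma> t" using *[of "frac t" "\<lfloor>t\<rfloor>"] by (simp add: frac_def)
qed

lemma closed_immersion_deriv:
  assumes "closed_immersion \<gamma>"
  shows "(\<gamma> has_vector_derivative vector_derivative \<gamma> (at t)) (at t)"
    "vector_derivative \<gamma> (at (frac t)) = vector_derivative \<gamma> (at t)"
proof -
  obtain \<gamma>' where g: "\<And>t. (\<gamma> has_vector_derivative \<gamma>' t) (at t)"
    using assms by (auto simp: closed_immersion_def)
  show "(\<gamma> has_vector_derivative vector_derivative \<gamma> (at t)) (at t)"
    using g vector_derivative_works differentiableI_vector by blast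
  have "((\<lambda>s. \<gamma> (s + - of_int \<lfloor>t\<rfloor>)) has_vector_derivative \<gamma>' (frac t)) (at t)"
  proof -
    have "(\<gamma> has_vector_derivative \<gamma>' (frac t)) (at (t + - of_int \<lfloor>t\<rfloor>))"
      using g[of "frac t"] by (simp add: frac_def)
    moreover have "((\<lambda>s. s + - of_int \<lfloor>t\<rfloor>) has_vector_derivative 1) (at t)"
      by (auto intro!: derivative_eq_intros)
    ultimately show ?thesis using vector_diff_chain_at[of "\<lambda>s. s + - of_int \<lfloor>t\<rfloor>" 1 t \<gamma> "\<gamma>' (frac t)"]
      by (simp add: o_def)
  qed
  moreover have "(\<lambda>s. \<gamma> (s + - of_int \<lfloor>t\<rfloor>)) = \<gamma>"
    using closed_immersion_shift(1)[OF assms, of _ "- \<lfloor>t\<rfloor>"] by (simp add: fun_eq_iff)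
  ultimately have "(\<gamma> has_vector_derivative \<gamma>' (frac t)) (at t)" by simp
  then show "vector_derivative \<gamma> (at (frac t)) = vector_derivative \<gamma> (at t)"
    using g[of "frac t"] by (simp add: vector_derivative_at)
qed

text \<open>The factor \<open>cross (A 1) (A \<i>)\<close> is the determinant of
  \<open>A\<close>.\<close>

lemma cross_linear:
  fixes A :: "complex \<Rightarrow>\<^sub>L complex"
  shows "cross (A v) (A w) = cross (A 1) (A \<i>) * cross v w"
proof -
  have lin: "A z = Re z *\<^sub>R A 1 + Im z *\<^sub>R A \<i>" for z
  proof -
    have "z = Re z *\<^sub>R 1 + Im z *\<^sub>R \<i>" by (simp add: complex_eq_iff)
    then have "A z = A (Re z *\<^sub>R 1 + Im z *\<^sub>R \<i>)" by simp
    then show ?thesis by (simp add: blinfun.add_right blinfun.scaleR_right)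
  qed
  show ?thesis unfolding lin[of v] lin[of w] by (simp add: cross_def algebra_simps)
qed

lemma cross_scaleR: "cross (a *\<^sub>R v) (b *\<^sub>R w) = a * b * cross v w"
  by (simp add: cross_def algebra_simps)

lemma (in vdiag) tangent_deriv:
  assumes "x \<in> params D"
  shows "(crv D (fst x) has_vector_derivative tangent D x) (at (snd x))"
  unfolding tangent_def
  by (rule closed_immersion_deriv(1), rule immersion) (use assms in \<open>auto simp: params_def\<close>)

lemma (in vdiag) pt_frac:
  assumes "i < ncomp D"
  shows "pt D (i, frac t) = crv D i t"
  using closed_immersion_shift(2)[OF immersion[OF assms]] by (simp add: pt_def)

lemma (in vdiag) tangent_frac:
  assumes "i < ncomp D"
  shows "tangent D (i, frac t) = vector_derivative (crv D i) (at t)"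
  using closed_immersion_deriv(2)[OF immersion[OF assms]] by (simp add: tangent_def)

text \<open>The Jacobian determinant is continuous in time, never zero and equal to 1 at time 0, so
  it stays positive.\<close>

lemma planar_isotopy_orient:
  assumes "planar_isotopy H"
  shows "orient_diffeo (H 1)"
proof -
  obtain H' where H0: "H 0 = id" and d: "\<And>t. t \<in> {0..1} \<Longrightarrow> plane_diffeo (H t) (H' t)"
    and c: "continuous_on ({0..1} \<times> UNIV) (\<lambda>(t, z). H' t z)"
    using assms unfolding planar_isotopy_def by blast
  define \<delta> where "\<delta> z t = cross (blinfun_apply (H' t z) 1) (blinfun_apply (H' t z) \<i>)" for z t
  have nz: "\<delta> z t \<noteq> 0" if "t \<in> {0..1}" for z t
    using d[OF that] by (simp add: plane_diffeo_def \<delta>_def)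
  have cont: "continuous_on {0..1} (\<delta> z)" for z
  proof -
    have "continuous_on {0..1} ((\<lambda>(t, z). H' t z) \<circ> (\<lambda>t. (t, z)))"
      by (rule continuous_on_compose) (auto intro!: continuous_intros continuous_on_subset[OF c])
    then have "continuous_on {0..1} (\<lambda>t. H' t z)" by (simp add: o_def)
    then show ?thesis unfolding \<delta>_def cross_def by (intro continuous_intros)
  qed
  have "H' 0 z = id_blinfun" for z
  proof (rule blinfun_eqI)
    fix w
    have "(H 0 has_derivative blinfun_apply (H' 0 z)) (at z)"
      using d[of 0] by (simp add: plane_diffeo_def)
    moreover have "(H 0 has_derivative (\<lambda>x. x)) (at z)" by (simp add: H0 id_def)
    ultimately have "blinfun_apply (H' 0 z) = (\<lambda>x. x)" by (rule has_derivative_unique)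
    then show "blinfun_apply (H' 0 z) w = blinfun_apply id_blinfun w" by simp
  qed
  then have pos0: "\<delta> z 0 > 0" for z by (simp add: \<delta>_def cross_def)
  have "\<delta> z 1 > 0" for z
  proof (rule ccontr)
    assume "\<not> \<delta> z 1 > 0"
    then have "\<exists>x\<ge>0. x \<le> 1 \<and> \<delta> z x = 0"
      using pos0[of z] by (intro IVT2'[OF _ _ _ cont]) auto
    then show False using nz[of _ z] by auto
  qed
  then show ?thesis unfolding orient_diffeo_def using d[of 1] by (auto simp: \<delta>_def)
qed

lemma isotopy_move_f_poly:
  assumes D: "is_vdiagram D" and D': "is_vdiagram D'" and iso: "isotopy_move D D'"
  shows "f_poly D' = f_poly D"
proof -
  interpret A: vdiag D by unfold_locales (rule D)
  interpret B: vdiag D' by unfold_locales (rule D')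
  obtain H where H: "planar_isotopy H" "D' = VDiagram (ncomp D) (\<lambda>i t. H 1 (crv D i t)) (lvl D)"
    using iso unfolding isotopy_move_def by blast
  obtain h' where h': "plane_diffeo (H 1) h'" "\<And>z. cross (blinfun_apply (h' z) 1) (blinfun_apply (h' z) \<i>) > 0"
    using planar_isotopy_orient[OF H(1)] unfolding orient_diffeo_def by blast
  have inj: "H 1 z = H 1 w \<longleftrightarrow> z = w" for z w
    using h'(1) by (auto simp: plane_diffeo_def dest: bij_is_inj injD)
  have par: "params D' = params D" and pt: "pt D' x = H 1 (pt D x)" and lvl: "lvl D' = lvl D"
    and n: "ncomp D' = ncomp D" for x
    by (simp_all add: H(2) params_def pt_def)
  have dbl: "double_params D' = double_params D" unfolding double_params_def par pt inj ..
  have rl: "real_params D' = real_params D" by (simp add: real_params_def dbl lvl)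
  have partner: "partner D' x = partner D x" for x unfolding partner_def par pt inj ..
  have tan: "tangent D' x = h' (pt D x) (tangent D x)" if x: "x \<in> params D" for x
  proof -
    have "((H 1 \<circ> crv D (fst x)) has_vector_derivative h' (crv D (fst x) (snd x)) (tangent D x)) (at (snd x))"
      by (rule vector_derivative_diff_chain_within[OF A.tangent_deriv[OF x]])
         (use h'(1) in \<open>auto simp: plane_diffeo_def intro: has_derivative_at_withinI\<close>)
    moreover have "H 1 \<circ> crv D (fst x) = crv D' (fst x)" by (simp add: H(2) o_def)
    ultimately show ?thesis by (simp add: tangent_def[of D'] vector_derivative_at pt_def)
  qed
  have sg: "sg D' x = sg D x" if "x \<in> real_params D" for x
  proof -
    note p = A.partner_props[OF A.real_double[OF that]]
    have "cross (tangent D' x) (tangent D' (partner D' x)) =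
      cross (blinfun_apply (h' (pt D x)) 1) (blinfun_apply (h' (pt D x)) \<i>) *
        cross (tangent D x) (tangent D (partner D x))"
      unfolding partner tan[OF p(1)] tan[OF p(2)] p(4) by (rule cross_linear)
    then show ?thesis unfolding sg_def using h'(2)[of "pt D x"]
      by (metis mult_pos_pos zero_less_mult_pos)
  qed
  show ?thesis
    by (rule f_poly_gauss_cong[OF D D' n rl]) (simp add: partner lvl sg)
qed

text \<open>\<open>\<phi>\<close> carries parameters of \<open>D'\<close> to parameters of
  \<open>D\<close>. As \<theta> need not send base points to base points, \<open>D\<close> is marked
  by the image of the marks of \<open>D'\<close> and not by its own base points.\<close>

lemma same_diagram_f_poly:
  assumes D: "is_vdiagram D" and D': "is_vdiagram D'" and same: "same_diagram D D'"
  shows "f_poly D' = f_poly D"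
proof -
  interpret A: vdiag D by unfold_locales (rule D)
  interpret B: vdiag D' by unfold_locales (rule D')
  obtain \<pi> \<theta> \<theta>' where pi: "bij_betw \<pi> {..<ncomp D'} {..<ncomp D}"
    and th: "\<And>i t. i < ncomp D' \<Longrightarrow> (\<theta> i has_real_derivative \<theta>' i t) (at t)"
      "\<And>i t. i < ncomp D' \<Longrightarrow> \<theta>' i t > 0" "\<And>i t. i < ncomp D' \<Longrightarrow> \<theta> i (t + 1) = \<theta> i t + 1"
      "\<And>i t. i < ncomp D' \<Longrightarrow> crv D' i t = crv D (\<pi> i) (\<theta> i t)"
    and lv: "\<And>i t. (i, t) \<in> double_params D' \<Longrightarrow> lvl D' (i, t) = lvl D (\<pi> i, frac (\<theta> i t))"
    using same unfolding same_diagram_def by (elim exE conjE) (rule that; blast)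
  have pi_less: "i < ncomp D' \<Longrightarrow> \<pi> i < ncomp D" for i using pi by (auto simp: bij_betw_def)
  have pi_inj: "i < ncomp D' \<Longrightarrow> j < ncomp D' \<Longrightarrow> \<pi> i = \<pi> j \<longleftrightarrow> i = j" for i j
    using pi by (auto simp: bij_betw_def inj_on_def)
  have mono: "\<theta> i a < \<theta> i b" if "i < ncomp D'" "a < b" for i a b
    by (rule DERIV_pos_imp_increasing[OF that(2)]) (use th(1,2) that(1) in blast)
  have mono_iff: "\<theta> i a < \<theta> i b \<longleftrightarrow> a < b" and inj: "\<theta> i a = \<theta> i b \<longleftrightarrow> a = b" if "i < ncomp D'" for i a b
    using mono[OF that, of a b] mono[OF that, of b a] by (cases a b rule: linorder_cases; simp)+
  have shiftn: "\<theta> i (t + real k) = \<theta> i t + real k" if "i < ncomp D'" for i t k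
  proof (induction k)
    case (Suc k)
    have "\<theta> i (t + real (Suc k)) = \<theta> i ((t + real k) + 1)" by (simp add: algebra_simps)
    then show ?case using th(3)[OF that, of "t + real k"] Suc by simp
  qed simp
  have shift: "\<theta> i (t + of_int k) = \<theta> i t + of_int k" if "i < ncomp D'" for i t k
  proof (cases "k \<ge> 0")
    case True
    then show ?thesis using shiftn[OF that, of t "nat k"] by simp
  next
    case False
    then show ?thesis using shiftn[OF that, of "t + of_int k" "nat (- k)"] by simp
  qed
  have frac_th: "frac (\<theta> i (frac t)) = frac (\<theta> i t)" if "i < ncomp D'" for i t
    using shift[OF that, of t "- \<lfloor>t\<rfloor>"] frac_shift(2)[of "\<theta> i t" "\<lfloor>t\<rfloor>"] by (simp add: frac_def[of t])
  have surj: "\<exists>t. \<theta> i t = y" if i: "i < ncomp D'" for i y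
  proof -
    \<comment> \<open>\<open>\<theta> i\<close> sends an integer k to
      \<open>\<theta> i 0 + k\<close>, so on the unit interval starting at \<open>?k\<close> its end
      values enclose \<open>y\<close>.\<close>
    let ?k = "\<lfloor>y - \<theta> i 0\<rfloor>"
    have a: "\<theta> i (of_int ?k) \<le> y" using shift[OF i, of 0 ?k] by (simp add: le_diff_eq[symmetric] del: of_int_floor_le) linarith
    have b: "y \<le> \<theta> i (of_int (?k + 1))" using shift[OF i, of 0 "?k + 1"] by simp linarith
    have "continuous_on {of_int ?k..of_int (?k + 1)} (\<theta> i)"
      using th(1)[OF i] by (intro DERIV_continuous_on) (auto intro: has_field_derivative_at_within)
    then have "\<exists>t\<ge>of_int ?k. t \<le> of_int (?k + 1) \<and> \<theta> i t = y"
      by (intro IVT') (use a b in auto)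
    then show ?thesis by blast
  qed
  have frac_eq_iff: "frac (\<theta> i s) = frac (\<theta> i t) \<longleftrightarrow> frac s = frac t" if i: "i < ncomp D'" for i s t
  proof
    assume "frac (\<theta> i s) = frac (\<theta> i t)"
    then obtain k :: int where "\<theta> i s = \<theta> i t + of_int k" using frac_eq_imp by blast
    then have "\<theta> i s = \<theta> i (t + of_int k)" using shift[OF i] by simp
    then have "s = t + of_int k" using inj[OF i] by simp
    then show "frac s = frac t" by (simp add: frac_shift)
  next
    assume "frac s = frac t"
    then show "frac (\<theta> i s) = frac (\<theta> i t)" using frac_th[OF i, of s] frac_th[OF i, of t] by simp
  qed
  define \<phi> where "\<phi> x = (\<pi> (fst x), frac (\<theta> (fst x) (snd x)))" for x :: param
  have par: "i < ncomp D' \<and> 0 \<le> t \<and> t < 1" if "(i, t) \<in> params D'" for i t using that by (auto simp: params_def)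
  have phi_in: "\<phi> x \<in> params D" if "x \<in> params D'" for x
    using that pi_less by (auto simp: \<phi>_def params_def frac_lt_1)
  have phi_inj: "\<phi> x = \<phi> y \<longleftrightarrow> x = y" if xy: "x \<in> params D'" "y \<in> params D'" for x y
  proof -
    obtain i s j t where [simp]: "x = (i, s)" "y = (j, t)" by (cases x, cases y)
    note b = par[of i s] par[of j t]
    show ?thesis using xy b pi_inj[of i j] frac_eq_iff[of i s t] by (auto simp: \<phi>_def frac_id)
  qed
  have phi_surj: "\<exists>x\<in>params D'. y = \<phi> x" if y: "y \<in> params D" for y
  proof -
    obtain j s where [simp]: "y = (j, s)" by (cases y)
    have b: "j < ncomp D" "0 \<le> s" "s < 1" using y by (auto simp: params_def)
    have "j \<in> \<pi> ` {..<ncomp D'}" using b(1) pi by (simp add: bij_betw_def)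
    then obtain i where i: "i < ncomp D'" "\<pi> i = j" by auto
    obtain t where t: "\<theta> i t = s" using surj[OF i(1)] by blast
    have "(i, frac t) \<in> params D'" using i by (simp add: params_def frac_lt_1)
    moreover have "y = \<phi> (i, frac t)" using i t b by (simp add: \<phi>_def frac_th frac_id)
    ultimately show ?thesis by blast
  qed
  have pt: "pt D (\<phi> x) = pt D' x" if "x \<in> params D'" for x
    using that A.pt_frac[OF pi_less, of "fst x"] th(4)[of "fst x" "snd x"]
    by (cases x) (simp add: \<phi>_def params_def pt_def[of D'])
  have dbl: "\<phi> x \<in> double_params D \<longleftrightarrow> x \<in> double_params D'" if x: "x \<in> params D'" for x
  proof
    assume "\<phi> x \<in> double_params D"
    then obtain y where y: "y \<in> params D" "y \<noteq> \<phi> x" "pt D y = pt D (\<phi> x)" by (auto simp: double_params_def)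
    obtain z where "z \<in> params D'" "y = \<phi> z" using phi_surj y(1) by blast
    then show "x \<in> double_params D'" using x y pt[of x] pt[of z] by (auto simp: double_params_def)
  next
    assume "x \<in> double_params D'"
    then obtain y where "y \<in> params D'" "y \<noteq> x" "pt D' y = pt D' x" by (auto simp: double_params_def)
    then have "\<phi> y \<in> params D" "\<phi> y \<noteq> \<phi> x" "pt D (\<phi> y) = pt D (\<phi> x)"
      using x phi_in phi_inj pt by auto
    then show "\<phi> x \<in> double_params D" using phi_in[OF x] by (auto simp: double_params_def)
  qed
  have lvl: "lvl D' x = lvl D (\<phi> x)" if "x \<in> double_params D'" for x
    using lv[of "fst x" "snd x"] that by (simp add: \<phi>_def)
  have rl: "\<phi> x \<in> real_params D \<longleftrightarrow> x \<in> real_params D'" if "x \<in> params D'" for x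
    using dbl[OF that] lvl[of x] by (auto simp: real_params_def)
  have ov: "\<phi> x \<in> Ov D \<longleftrightarrow> x \<in> Ov D'" if "x \<in> params D'" for x
    using rl[OF that] lvl[of x] B.real_double[of x] by (auto simp: Ov_def)
  have partner: "partner D (\<phi> x) = \<phi> (partner D' x)" if "x \<in> double_params D'" for x
    using B.partner_props[OF that] phi_in phi_inj pt by (intro A.partner_eq) auto
  have tan: "tangent D' x = \<theta>' (fst x) (snd x) *\<^sub>R tangent D (\<phi> x)" if x: "x \<in> params D'" for x
  proof -
    obtain i t where [simp]: "x = (i, t)" by (cases x)
    have i: "i < ncomp D'" using par x by simp
    have "((crv D (\<pi> i) \<circ> \<theta> i) has_vector_derivative
        (\<theta>' i t *\<^sub>R vector_derivative (crv D (\<pi> i)) (at (\<theta> i t)))) (at t)"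
      by (rule vector_diff_chain_at)
         (use th(1)[OF i] closed_immersion_deriv(1)[OF A.immersion[OF pi_less[OF i]]]
           in \<open>simp_all add: has_real_derivative_iff_has_vector_derivative\<close>)
    moreover have "crv D (\<pi> i) \<circ> \<theta> i = crv D' i" using th(4)[OF i] by (simp add: fun_eq_iff)
    ultimately show ?thesis
      using A.tangent_frac[OF pi_less[OF i]] by (simp add: tangent_def[of D'] vector_derivative_at \<phi>_def)
  qed
  have sg: "sg D (\<phi> x) = sg D' x" if "x \<in> double_params D'" for x
  proof -
    note p = B.partner_props[OF that]
    have "fst y < ncomp D'" if "y \<in> params D'" for y using that by (auto simp: params_def)
    then have pos: "\<theta>' (fst x) (snd x) * \<theta>' (fst (partner D' x)) (snd (partner D' x)) > 0"
      using th(2) p(1,2) by (intro mult_pos_pos) auto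
    have "cross (tangent D' x) (tangent D' (partner D' x)) =
      (\<theta>' (fst x) (snd x) * \<theta>' (fst (partner D' x)) (snd (partner D' x))) *
        cross (tangent D (\<phi> x)) (tangent D (partner D (\<phi> x)))"
      unfolding partner[OF that] tan[OF p(1)] tan[OF p(2)] by (rule cross_scaleR)
    then show ?thesis unfolding sg_def using pos
      by (metis mult_pos_pos zero_less_mult_pos)
  qed
  have Ov_img: "Ov D = \<phi> ` Ov D'"
  proof
    show "\<phi> ` Ov D' \<subseteq> Ov D" using ov B.real_params_subset B.Ov_real by blast
    show "Ov D \<subseteq> \<phi> ` Ov D'"
    proof
      fix y assume y: "y \<in> Ov D"
      then obtain x where "x \<in> params D'" "y = \<phi> x" using phi_surj A.real_params_subset A.Ov_real by blast
      then show "y \<in> \<phi> ` Ov D'" using y ov by blast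
    qed
  qed
  define M' where "M' = real_params D' \<union> bases D'"
  define M where "M = \<phi> ` M'"
  have M': "finite M'" "M' \<subseteq> params D'" "real_params D' \<subseteq> M'" "{..<ncomp D'} \<subseteq> fst ` M'"
    using B.fin_real B.real_params_subset by (auto simp: M'_def bases_def params_def image_Un)
  have injM: "inj_on \<phi> M'" using M'(2) phi_inj by (intro inj_onI) blast
  have M: "finite M" "M \<subseteq> params D" "real_params D \<subseteq> M" "{..<ncomp D} \<subseteq> fst ` M"
  proof -
    show "finite M" "M \<subseteq> params D" using M' phi_in by (auto simp: M_def)
    show "real_params D \<subseteq> M"
    proof
      fix y assume y: "y \<in> real_params D"
      then obtain x where "x \<in> params D'" "y = \<phi> x" using phi_surj A.real_params_subset by blast
      then show "y \<in> M" using y rl M'(3) by (auto simp: M_def)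
    qed
    have "{..<ncomp D} = \<pi> ` {..<ncomp D'}" using pi by (simp add: bij_betw_def)
    also have "\<dots> \<subseteq> \<pi> ` fst ` M'" using M'(4) by blast
    also have "\<dots> = fst ` M" by (simp add: M_def image_image \<phi>_def)
    finally show "{..<ncomp D} \<subseteq> fst ` M" .
  qed
  have mk: "marking M'" "marking M" using M M' A.marking_params B.marking_params by auto
  have nxt: "nxt M (\<phi> x) = \<phi> (nxt M' x)" if x: "x \<in> M'" for x
  proof -
    obtain i t where [simp]: "x = (i, t)" by (cases x)
    have i: "i < ncomp D'" "0 \<le> t" "t < 1" using M'(2) x par by auto
    obtain r where r: "succ_lift M' x r" "nxt M' x = (i, frac r)" using nxt_ex[OF mk(1) x] by auto
    \<comment> \<open>The lift \<open>r\<close> is sent through \<theta> and shifted back by the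
      integer that brings the image of \<open>t\<close> into [0, 1).\<close>
    have "succ_lift M (\<phi> x) (\<theta> i r - of_int \<lfloor>\<theta> i t\<rfloor>)"
      unfolding succ_lift_def
    proof (intro conjI allI impI)
      have "\<theta> i t < \<theta> i r" using mono_iff[OF i(1)] r(1) by (simp add: succ_lift_def)
      then show "snd (\<phi> x) < \<theta> i r - of_int \<lfloor>\<theta> i t\<rfloor>" by (simp add: \<phi>_def frac_def)
      have "(i, frac r) \<in> M'" using r(1) by (simp add: succ_lift_def)
      then have "\<phi> (i, frac r) \<in> M" by (simp add: M_def)
      then show "(fst (\<phi> x), frac (\<theta> i r - of_int \<lfloor>\<theta> i t\<rfloor>)) \<in> M"
        by (simp add: \<phi>_def frac_shift frac_th[OF i(1)])
      fix s assume s: "snd (\<phi> x) < s \<and> s < \<theta> i r - of_int \<lfloor>\<theta> i t\<rfloor>"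
      obtain v where v: "\<theta> i v = s + of_int \<lfloor>\<theta> i t\<rfloor>" using surj[OF i(1)] by blast
      have "t < v" "v < r" using s v mono_iff[OF i(1), of t v] mono_iff[OF i(1), of v r]
        by (auto simp: \<phi>_def frac_def)
      then have nv: "(i, frac v) \<notin> M'" using r(1) by (simp add: succ_lift_def)
      show "(fst (\<phi> x), frac s) \<notin> M"
      proof
        assume "(fst (\<phi> x), frac s) \<in> M"
        then obtain j w where jw: "(j, w) \<in> M'" "\<phi> (j, w) = (\<pi> i, frac s)" by (auto simp: M_def \<phi>_def)
        have b: "j < ncomp D'" "0 \<le> w" "w < 1" using jw(1) M'(2) par by auto
        have ji: "j = i" using jw(2) pi_inj[OF b(1) i(1)] by (simp add: \<phi>_def)
        have "frac s = frac (\<theta> i v)" by (simp add: v frac_shift)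
        then have "frac (\<theta> i w) = frac (\<theta> i v)" using jw(2) ji by (simp add: \<phi>_def)
        then have "w = frac v" using frac_eq_iff[OF i(1)] b by (simp add: frac_id)
        then show False using nv jw(1) ji by simp
      qed
    qed
    moreover have "\<phi> x \<in> M" using x unfolding M_def by (rule imageI)
    ultimately have "nxt M (\<phi> x) = (fst (\<phi> x), frac (\<theta> i r - of_int \<lfloor>\<theta> i t\<rfloor>))"
      by (intro nxt_eqI[OF mk(2)])
    then have "nxt M (\<phi> x) = (\<pi> i, frac (\<theta> i r))" by (simp add: \<phi>_def frac_shift)
    then show ?thesis using r(2) by (simp add: \<phi>_def frac_th[OF i(1)])
  qed
  let ?f = "map_prod \<phi> (\<lambda>b. b) :: half_edge \<Rightarrow> half_edge"
  have gl: "relim ?f (B.gl M') = A.gl M"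
  proof -
    have "relim ?f (eds M') = eds M"
      unfolding relim_def eds_def M_def image_image
      by (rule image_cong) (use nxt in \<open>auto simp: M_def\<close>)
    moreover have "relim ?f (biv (M' - real_params D')) = biv (M - real_params D)"
    proof -
      have "\<phi> ` (M' - real_params D') \<subseteq> M - real_params D"
      proof (rule image_subsetI)
        fix x assume "x \<in> M' - real_params D'"
        then show "\<phi> x \<in> M - real_params D" using rl[of x] M'(2) unfolding M_def by blast
      qed
      moreover have "M - real_params D \<subseteq> \<phi> ` (M' - real_params D')"
      proof
        fix y assume "y \<in> M - real_params D"
        then obtain x where "x \<in> M'" "y = \<phi> x" "\<phi> x \<notin> real_params D" unfolding M_def by blast
        then show "y \<in> \<phi> ` (M' - real_params D')" using rl[of x] M'(2) by blast
      qed
      ultimately have "\<phi> ` (M' - real_params D') = M - real_params D" by simp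
      moreover have "relim ?f (biv X) = biv (\<phi> ` X)" for X by (simp add: relim_def biv_def image_image)
      ultimately show ?thesis by simp
    qed
    ultimately show ?thesis by (simp add: relim_Un)
  qed
  have spl: "relim ?f (Asp D' c) = Asp D (\<phi> c)" "relim ?f (Bsp D' c) = Bsp D (\<phi> c)" if "c \<in> Ov D'" for c
    using partner[OF B.real_double[OF B.Ov_real[OF that]]] sg[OF B.real_double[OF B.Ov_real[OF that]]]
    by (simp_all add: Asp_def Bsp_def relim_lks)
  have "ssum (M' \<times> UNIV) (B.gl M') (Ov D') (Asp D') (Bsp D') =
      ssum (M \<times> UNIV) (A.gl M) (\<phi> ` Ov D') (Asp D) (Bsp D)"
  proof (rule ssum_iso)
    show "inj_on \<phi> (Ov D')" by (rule inj_on_subset[OF injM]) (use M'(3) B.Ov_real in blast)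
    fix T assume "T \<subseteq> Ov D'"
    let ?R = "B.gl M' \<union> (\<Union>c\<in>Ov D'. if c \<in> T then Asp D' c else Bsp D' c)"
    have "?R \<subseteq> (M' \<times> UNIV) \<times> (M' \<times> UNIV)"
      using B.splices_subset[OF M'(3)] nxt_in[OF mk(1)] by (auto simp: eds_def biv_def)
    moreover have "inj_on ?f (M' \<times> UNIV)" using injM by (auto simp: inj_on_def)
    ultimately have "kc (M' \<times> UNIV) ?R = kc (?f ` (M' \<times> UNIV)) (map_prod ?f ?f ` ?R)"
      by (intro kc_inj_image[symmetric])
    also have "?f ` (M' \<times> UNIV) = M \<times> UNIV" by (rule map_prod_surj_on) (simp_all add: M_def)
    also have "map_prod ?f ?f ` ?R = A.gl M \<union> (\<Union>c\<in>Ov D'. if c \<in> T then Asp D (\<phi> c) else Bsp D (\<phi> c))"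
      unfolding relim_def[symmetric] relim_Un[of _ "B.gl M'"] gl relim_UN_if
      by (intro arg_cong2[where f = "(\<union>)"] refl SUP_cong) (simp_all add: spl)
    finally show "kc (M' \<times> UNIV) ?R = kc (M \<times> UNIV)
      (A.gl M \<union> (\<Union>c\<in>Ov D'. if c \<in> T then Asp D (\<phi> c) else Bsp D (\<phi> c)))" .
  qed
  then have "bracket D' = bracket D"
    using A.ssum_marks[OF M] B.ssum_marks[OF M'] Ov_img by simp
  moreover have "writhe D' = writhe D"
    unfolding A.writhe_sg B.writhe_sg Ov_img
  proof (subst sum.reindex)
    show "inj_on \<phi> (Ov D')" by (rule inj_on_subset[OF injM]) (use M'(3) B.Ov_real in blast)
    show "(\<Sum>x\<in>Ov D'. if sg D' x then 1 else - 1) = sum ((\<lambda>x. if sg D x then 1 else - 1) \<circ> \<phi>) (Ov D')"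
      by (rule sum.cong) (use sg B.real_double B.Ov_real in auto)
  qed
  ultimately show ?thesis by (simp add: f_poly_unit)
qed

section \<open>Tangles\<close>

text \<open>\<open>sp s u\<close> is the parameter of \<open>D\<close> at parameter \<open>u\<close> of the model curve of the strand \<open>s\<close>, and
  \<open>nd s u f\<close> the half-edge leaving it forwards (\<open>f = True\<close>) or backwards along the model curve.\<close>

fun sp :: "strand \<Rightarrow> real \<Rightarrow> param" where
  "sp (i, a, b, d) u = (i, a + (b - a) * (d * u + 1) / 2)"

fun sdir :: "strand \<Rightarrow> bool" where
  "sdir (i, a, b, d) \<longleftrightarrow> d = 1"

definition nd :: "strand \<Rightarrow> real \<Rightarrow> bool \<Rightarrow> half_edge" where
  "nd s u f = (sp s u, f = sdir s)"

definition Zs :: "strand list \<Rightarrow> param set" where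
  "Zs ss = (\<Union>s\<in>set ss. strand_set s)"

definition ends :: "strand list \<Rightarrow> param set" where
  "ends ss = (\<Union>s\<in>set ss. {sp s (- 1), sp s 1})"

definition starts :: "strand list \<Rightarrow> param set" where
  "starts ss = (\<lambda>s. sp s (if sdir s then - 1 else 1)) ` set ss"

text \<open>The marks that a move cannot change: outer crossings, base points, and the ends of the
  strands as vertices separating inside from outside.\<close>

definition M0 :: "vdiagram \<Rightarrow> strand list \<Rightarrow> param set" where
  "M0 D ss = (real_params D - Zs ss) \<union> bases D \<union> ends ss"

text \<open>The edges leaving \<open>starts ss\<close>, where the orientation enters the tangle, are
  omitted: they run inside and are replaced by chains along the strands.\<close>

definition base_rel :: "vdiagram \<Rightarrow> strand list \<Rightarrow> (half_edge \<times> half_edge) set" where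
  "base_rel D ss = (\<lambda>x. ((x, True), (nxt (M0 D ss) x, False))) ` (M0 D ss - starts ss)
     \<union> biv (M0 D ss - (real_params D - Zs ss))"

text \<open>The edges along a strand, from its end at -1 through the marks at \<open>us\<close> to
  its end at 1, in the direction of the model curve even where the circle runs backwards.\<close>

definition chain :: "strand \<Rightarrow> real list \<Rightarrow> (half_edge \<times> half_edge) list" where
  "chain s us = map (\<lambda>(u, v). (nd s u True, nd s v False)) (zip (- 1 # us) (us @ [1]))"

lemma fst_sp: "fst (sp s u) = fst s"
  by (cases s) simp

lemma sp_eq:
  assumes "strand_ok D s"
  shows "sp s u = sp s v \<longleftrightarrow> u = v"
  using assms by (cases s) auto

lemma nd_eq:
  assumes "strand_ok D s"
  shows "nd s u f = nd s v g \<longleftrightarrow> u = v \<and> f = g"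
  using sp_eq[OF assms] by (auto simp: nd_def)

lemma sp_less:
  assumes "strand_ok D s"
  shows "snd (sp s u) < snd (sp s v) \<longleftrightarrow> (if sdir s then u < v else v < u)"
  using assms by (cases s) (auto simp: divide_less_cancel)

lemma sp_ends:
  assumes "strand_ok D (i, a, b, d)"
  shows "sp (i, a, b, d) (if d = 1 then - 1 else 1) = (i, a)" "sp (i, a, b, d) (if d = 1 then 1 else - 1) = (i, b)"
  using assms by (auto simp: field_simps)

lemma sp_image:
  assumes "strand_ok D s"
  shows "strand_set s = sp s ` {- 1..1}"
proof -
  obtain i a b d where s: "s = (i, a, b, d)" by (cases s)
  have ab: "a < b" "d = 1 \<or> d = - 1" using assms s by auto
  have "\<exists>u\<in>{- 1..1}. t = a + (b - a) * (d * u + 1) / 2" if "t \<in> {a..b}" for t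
  proof
    let ?w = "2 * (t - a) / (b - a) - 1"
    have "0 \<le> 2 * (t - a) / (b - a)" "2 * (t - a) / (b - a) \<le> 2" using that ab by (auto simp: field_simps)
    then show "d * ?w \<in> {- 1..1}" using ab(2) by auto
    have ddw: "d * (d * ?w) = ?w" using ab(2) by auto
    have "(b - a) * (?w + 1) / 2 = t - a" using ab(1) by (simp add: field_simps)
    then show "t = a + (b - a) * (d * (d * ?w) + 1) / 2" unfolding ddw by linarith
  qed
  moreover have "a + (b - a) * (d * u + 1) / 2 \<in> {a..b}" if "u \<in> {- 1..1}" for u
  proof -
    have "0 \<le> (d * u + 1) / 2" "(d * u + 1) / 2 \<le> 1" using that ab(2) by auto
    then have "0 \<le> (b - a) * ((d * u + 1) / 2)" "(b - a) * ((d * u + 1) / 2) \<le> (b - a) * 1"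
      using ab(1) by (auto intro!: mult_left_mono simp del: times_divide_eq_right)
    then show ?thesis by simp
  qed
  ultimately show ?thesis unfolding s by (auto simp: image_iff)
qed

lemma sp_open:
  assumes "strand_ok D (i, a, b, d)" "u \<in> {- 1<..<1}"
  shows "a < snd (sp (i, a, b, d) u)" "snd (sp (i, a, b, d) u) < b"
proof -
  let ?s = "(i, a, b, d)"
  have "snd (sp ?s (if d = 1 then - 1 else 1)) < snd (sp ?s u)" "snd (sp ?s u) < snd (sp ?s (if d = 1 then 1 else - 1))"
    unfolding sp_less[OF assms(1)] using assms(2) by auto
  then show "a < snd (sp ?s u)" "snd (sp ?s u) < b" unfolding sp_ends[OF assms(1)] by simp_all
qed

declare sp.simps [simp del] sdir.simps [simp del]

text \<open>The delicate case is near the base point: \<open>frac\<close> jumps there, but strands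
  stay away from it on both sides.\<close>

lemma not_in_strand_near:
  fixes a b t :: real
  assumes "0 < a" "a < b" "b < 1" "0 \<le> t" "t < 1" "t \<notin> {a..b}"
  shows "eventually (\<lambda>r. frac r \<notin> {a..b}) (nhds t)"
proof -
  have "\<exists>S. open S \<and> t \<in> S \<and> (\<forall>r\<in>S. frac r \<notin> {a..b})"
  proof (cases "t < a")
    case True
    have "frac r \<notin> {a..b}" if "r \<in> {b - 1<..<a}" for r
    proof (cases "r \<ge> 0")
      case True
      then show ?thesis using that assms frac_id[of r] by auto
    next
      case False
      then show ?thesis using that assms frac_id[of "r + 1"] frac_shift(3)[of r] by auto
    qed
    then show ?thesis using True assms by (intro exI[of _ "{b - 1<..<a}"] conjI open_greaterThanLessThan) auto
  next
    case False
    have "frac r \<notin> {a..b}" if "r \<in> {b<..<1 + a}" for r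
    proof (cases "r < 1")
      case True
      then show ?thesis using that assms frac_id[of r] by auto
    next
      case False
      then show ?thesis using that assms frac_id[of "r - 1"] frac_shift(4)[of r] by auto
    qed
    then show ?thesis using False assms by (intro exI[of _ "{b<..<1 + a}"] conjI open_greaterThanLessThan) auto
  qed
  then show ?thesis unfolding eventually_nhds by blast
qed

section \<open>Parameters, tangents and marks of one tangle\<close>

locale tangled = vdiag D for D +
  fixes L :: "(strand \<times> (real \<Rightarrow> complex)) list" and h and ss
  assumes h: "orient_diffeo h" and tg: "tangle D h L" and ssL: "map fst L = ss"
begin

lemma h_eq: "h z = h w \<longleftrightarrow> z = w"
  using h by (auto simp: orient_diffeo_def plane_diffeo_def dest: bij_is_inj injD)

lemma ok: "s \<in> set ss \<Longrightarrow> strand_ok D s"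
  using tg unfolding tangle_def ssL[symmetric] by fastforce

lemma runs: "(s, \<sigma>) \<in> set L \<Longrightarrow> runs_along D h s \<sigma>"
  using tg unfolding tangle_def by blast

lemma in_ss: "(s, \<sigma>) \<in> set L \<Longrightarrow> s \<in> set ss"
  unfolding ssL[symmetric] by force

lemma Zs_eq: "Zs ss = {x \<in> params D. pt D x \<in> h ` square}"
proof -
  have "{x \<in> params D. pt D x \<in> h ` square} = (\<Union>(s, \<sigma>) \<in> set L. strand_set s)"
    using tg unfolding tangle_def by blast
  also have "\<dots> = Zs ss" by (auto simp: Zs_def ssL[symmetric])
  finally show ?thesis by simp
qed

lemma Zs_params: "x \<in> Zs ss \<Longrightarrow> x \<in> params D"
  unfolding Zs_eq by simp

lemma disjoint:
  assumes "s \<in> set ss" "s' \<in> set ss" "s \<noteq> s'"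
  shows "strand_set s \<inter> strand_set s' = {}"
proof -
  obtain k where k: "k < length L" "s = fst (L ! k)" using assms(1) by (auto simp: in_set_conv_nth ssL[symmetric])
  obtain l where l: "l < length L" "s' = fst (L ! l)" using assms(2) by (auto simp: in_set_conv_nth ssL[symmetric])
  have "\<forall>k < length L. \<forall>l < length L. k \<noteq> l \<longrightarrow> strand_set (fst (L ! k)) \<inter> strand_set (fst (L ! l)) = {}"
    using tg unfolding tangle_def by blast
  moreover have "k \<noteq> l" using assms(3) k l by auto
  ultimately show ?thesis using k l by blast
qed

lemma sp_in: "s \<in> set ss \<Longrightarrow> u \<in> {- 1..1} \<Longrightarrow> sp s u \<in> strand_set s"
  using sp_image[OF ok] by blast

lemma sp_Zs: "s \<in> set ss \<Longrightarrow> u \<in> {- 1..1} \<Longrightarrow> sp s u \<in> Zs ss"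
  using sp_in unfolding Zs_def by blast

lemma sp_eq_iff:
  assumes "s \<in> set ss" "s' \<in> set ss" "u \<in> {- 1..1}" "v \<in> {- 1..1}"
  shows "sp s u = sp s' v \<longleftrightarrow> s = s' \<and> u = v"
proof (cases "s = s'")
  case False
  then show ?thesis using disjoint[OF assms(1,2)] sp_in[OF assms(1,3)] sp_in[OF assms(2,4)] by auto
qed (use sp_eq[OF ok[OF assms(1)]] in auto)

lemma nd_eq_iff:
  assumes "s \<in> set ss" "s' \<in> set ss" "u \<in> {- 1..1}" "v \<in> {- 1..1}"
  shows "nd s u f = nd s' v g \<longleftrightarrow> s = s' \<and> u = v \<and> f = g"
  using sp_eq_iff[OF assms] by (auto simp: nd_def)

lemma Zs_cases:
  assumes "x \<in> Zs ss"
  obtains s \<sigma> u where "(s, \<sigma>) \<in> set L" "u \<in> {- 1..1}" "x = sp s u"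
proof -
  obtain s where s: "s \<in> set ss" "x \<in> strand_set s" using assms unfolding Zs_def by blast
  obtain \<sigma> where "(s, \<sigma>) \<in> set L" using s(1) unfolding ssL[symmetric] by auto
  moreover obtain u where "u \<in> {- 1..1}" "x = sp s u" using s(2) sp_image[OF ok[OF s(1)]] by blast
  ultimately show ?thesis using that by blast
qed

lemma pt_sp:
  assumes "(s, \<sigma>) \<in> set L" "u \<in> {- 1..1}"
  shows "pt D (sp s u) = h (\<sigma> u)"
proof -
  obtain i a b d where s: "s = (i, a, b, d)" by (cases s)
  have ok': "strand_ok D s" using ok in_ss assms by blast
  then have ab: "a < b" "d = 1 \<or> d = - 1" using s by auto
  let ?t = "a + (b - a) * (d * u + 1) / 2"
  have "sp s u \<in> strand_set s" using sp_image[OF ok'] assms(2) by blast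
  then have "?t \<in> {a..b}" using s by (simp add: sp.simps)
  then have "crv D i ?t = h (\<sigma> (d * (2 * (?t - a) / (b - a) - 1)))"
    using runs[OF assms(1)] unfolding s by auto
  moreover have "d * (2 * (?t - a) / (b - a) - 1) = u"
  proof -
    have "2 * (?t - a) / (b - a) = d * u + 1" using ab(1) by (simp add: field_simps)
    then show ?thesis using ab(2) by auto
  qed
  ultimately show ?thesis by (simp add: s pt_def sp.simps)
qed

text \<open>Chain rule for \<open>h\<close>, the model curve and the affine parametrization; the
  last contributes a positive factor times the direction of the strand. At an end of the strand the
  curve outside the tangle would also matter, hence the open interval.\<close>

lemma tangent_sp:
  assumes "(s, \<sigma>) \<in> set L" "u \<in> {- 1<..<1}" "(\<sigma> has_vector_derivative v) (at u)"
    and h': "plane_diffeo h h'"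
  shows "\<exists>c>0. tangent D (sp s u) = (if sdir s then c else - c) *\<^sub>R h' (\<sigma> u) v"
proof -
  obtain i a b d where s: "s = (i, a, b, d)" by (cases s)
  have ok': "strand_ok D (i, a, b, d)" using ok in_ss assms s by blast
  then have ab: "a < b" "d = 1 \<or> d = - 1" by auto
  define t where "t = a + (b - a) * (d * u + 1) / 2"
  have t: "t \<in> {a<..<b}" using sp_open[OF ok' assms(2)] by (simp add: t_def sp.simps)
  define c where "c = 2 / (b - a)"
  have c: "c > 0" using ab by (simp add: c_def)
  let ?p = "\<lambda>t. d * (2 * (t - a) / (b - a) - 1)"
  have pt: "?p t = u"
  proof -
    have "2 * (t - a) / (b - a) = d * u + 1" using ab(1) by (simp add: field_simps t_def)
    then show ?thesis using ab(2) by auto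
  qed
  have p': "(?p has_vector_derivative d * c) (at t)"
  proof -
    have "((\<lambda>r. d * (c * (r - a) - 1)) has_vector_derivative d * c) (at t)"
      unfolding has_real_derivative_iff_has_vector_derivative[symmetric]
      by (auto intro!: derivative_eq_intros)
    then show ?thesis by (simp add: c_def)
  qed
  have 1: "(\<sigma> \<circ> ?p has_vector_derivative (d * c) *\<^sub>R v) (at t)"
    by (rule vector_diff_chain_at[OF p']) (use assms(3) pt in simp)
  have "(h \<circ> (\<sigma> \<circ> ?p) has_vector_derivative h' (\<sigma> u) ((d * c) *\<^sub>R v)) (at t)"
    by (rule vector_derivative_diff_chain_within[OF 1])
       (use h' pt in \<open>auto simp: plane_diffeo_def intro: has_derivative_at_withinI\<close>)
  then have "(crv D i has_vector_derivative h' (\<sigma> u) ((d * c) *\<^sub>R v)) (at t)"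
  proof (rule has_vector_derivative_transform_within_open)
    show "(h \<circ> (\<sigma> \<circ> ?p)) r = crv D i r" if "r \<in> {a<..<b}" for r
      using runs[OF assms(1)] that unfolding s by auto
  qed (use t in auto)
  then have "tangent D (sp s u) = (d * c) *\<^sub>R h' (\<sigma> u) v"
    by (simp add: tangent_def s sp.simps t_def[symmetric] vector_derivative_at blinfun.scaleR_right)
  then show ?thesis using c ab(2) by (intro exI[of _ c]) (auto simp: s sdir.simps)
qed

text \<open>The sign is that of the model curves, since \<open>h\<close> has positive determinant,
  reversed once for each strand that is traversed backwards.\<close>

lemma crossing_sp:
  assumes s: "(s, \<sigma>) \<in> set L" "u \<in> {- 1<..<1}" "(\<sigma> has_vector_derivative v) (at u)"
    and s': "(s', \<sigma>') \<in> set L" "u' \<in> {- 1<..<1}" "(\<sigma>' has_vector_derivative v') (at u')"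
    and eq: "\<sigma> u = \<sigma>' u'" "s \<noteq> s' \<or> u \<noteq> u'" and nz: "cross v v' \<noteq> 0"
  shows "sp s u \<in> double_params D" "partner D (sp s u) = sp s' u'"
    "sg D (sp s u) \<longleftrightarrow> ((0 < cross v v') = (sdir s = sdir s'))"
proof -
  have u: "u \<in> {- 1..1}" "u' \<in> {- 1..1}" using s s' by auto
  have par: "sp s u \<in> params D" "sp s' u' \<in> params D"
    using sp_Zs Zs_params in_ss s s' u by blast+
  have ne: "sp s' u' \<noteq> sp s u" using sp_eq_iff[OF in_ss[OF s'(1)] in_ss[OF s(1)] u(2,1)] eq by auto
  have pt: "pt D (sp s' u') = pt D (sp s u)" using pt_sp s s' u eq by simp
  show "sp s u \<in> double_params D" using par ne pt by (auto simp: double_params_def)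
  show p: "partner D (sp s u) = sp s' u'" by (rule partner_eq) (use par ne pt in auto)
  obtain h' where h': "plane_diffeo h h'" "\<And>z. cross (blinfun_apply (h' z) 1) (blinfun_apply (h' z) \<i>) > 0"
    using h unfolding orient_diffeo_def by blast
  obtain c where c: "c > 0" "tangent D (sp s u) = (if sdir s then c else - c) *\<^sub>R h' (\<sigma> u) v"
    using tangent_sp[OF s h'(1)] by blast
  obtain c' where c': "c' > 0" "tangent D (sp s' u') = (if sdir s' then c' else - c') *\<^sub>R h' (\<sigma>' u') v'"
    using tangent_sp[OF s' h'(1)] by blast
  define k where "k = c * c' * cross (blinfun_apply (h' (\<sigma> u)) 1) (blinfun_apply (h' (\<sigma> u)) \<i>)"
  have k: "k > 0" using c c' h'(2) by (simp add: k_def)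
  have "cross (tangent D (sp s u)) (tangent D (sp s' u')) =
     (if sdir s then c else - c) * (if sdir s' then c' else - c') *
       (cross (blinfun_apply (h' (\<sigma> u)) 1) (blinfun_apply (h' (\<sigma> u)) \<i>) * cross v v')"
    unfolding c c' eq(1)[symmetric] cross_scaleR by (subst cross_linear) simp
  also have "\<dots> = (if sdir s = sdir s' then k * cross v v' else - (k * cross v v'))"
    by (auto simp: k_def)
  finally have "sg D (sp s u) \<longleftrightarrow> 0 < (if sdir s = sdir s' then k * cross v v' else - (k * cross v v'))"
    unfolding sg_def p by simp
  moreover have "0 < k * cross v v' \<longleftrightarrow> 0 < cross v v'" "0 < - (k * cross v v') \<longleftrightarrow> \<not> 0 < cross v v'"
    using k nz by (auto simp: zero_less_mult_iff mult_less_0_iff)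
  ultimately show "sg D (sp s u) \<longleftrightarrow> ((0 < cross v v') = (sdir s = sdir s'))" by auto
qed

text \<open>The other preimage of a double point in the tangle also lies in the tangle, because
  membership depends only on the image point.\<close>

lemma double_sp:
  assumes "(s, \<sigma>) \<in> set L" "u \<in> {- 1..1}" "sp s u \<in> double_params D"
  obtains s' \<sigma>' u' where "(s', \<sigma>') \<in> set L" "u' \<in> {- 1..1}" "\<sigma>' u' = \<sigma> u" "s \<noteq> s' \<or> u \<noteq> u'"
proof -
  obtain y where y: "y \<in> params D" "y \<noteq> sp s u" "pt D y = pt D (sp s u)"
    using assms(3) by (auto simp: double_params_def)
  have "sp s u \<in> Zs ss" using sp_Zs in_ss assms by blast
  then have "y \<in> Zs ss" using y unfolding Zs_eq by simp
  then obtain s' \<sigma>' u' where s': "(s', \<sigma>') \<in> set L" "u' \<in> {- 1..1}" "y = sp s' u'"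
    by (rule Zs_cases)
  moreover have "\<sigma>' u' = \<sigma> u" using y(3) pt_sp s' assms h_eq by simp
  moreover have "s \<noteq> s' \<or> u \<noteq> u'" using y(2) s' by auto
  ultimately show ?thesis using that by blast
qed

lemma partner_outside:
  assumes "x \<in> double_params D" "x \<notin> Zs ss"
  shows "partner D x \<notin> Zs ss"
  using partner_props[OF assms(1)] assms(2) unfolding Zs_eq by simp

lemma ends_Zs: "ends ss \<subseteq> Zs ss"
  unfolding ends_def by (intro UN_least) (simp add: sp_Zs)

lemma base_not_Zs: "(i, 0) \<notin> Zs ss"
proof
  assume "(i, 0) \<in> Zs ss"
  then obtain s where s: "s \<in> set ss" "(i, 0) \<in> strand_set s" unfolding Zs_def by blast
  have "strand_ok D s" using ok[OF s(1)] .
  with s(2) show False by (cases s) auto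
qed

lemma M0_facts: "finite (M0 D ss)" "M0 D ss \<subseteq> params D" "{..<ncomp D} \<subseteq> fst ` M0 D ss"
  "M0 D ss \<inter> Zs ss = ends ss"
proof -
  show "finite (M0 D ss)" using fin_real by (auto simp: M0_def bases_def ends_def)
  show "M0 D ss \<subseteq> params D"
    using real_params_subset ends_Zs Zs_params by (auto simp: M0_def bases_def params_def)
  show "{..<ncomp D} \<subseteq> fst ` M0 D ss" by (auto simp: M0_def bases_def image_Un)
  show "M0 D ss \<inter> Zs ss = ends ss"
    using ends_Zs base_not_Zs by (auto simp: M0_def bases_def)
qed

lemma starts_ends: "starts ss \<subseteq> ends ss"
  by (auto simp: starts_def ends_def)

lemma outer_locale: "outer (M0 D ss \<times> UNIV) (base_rel D ss) (Ov D - Zs ss) (Asp D) (Bsp D)"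
proof
  have mk: "marking (M0 D ss)" using M0_facts marking_params by blast
  show "finite (M0 D ss \<times> (UNIV :: bool set))" using M0_facts(1) by simp
  show "M0 D ss \<times> UNIV \<noteq> {}" using M0_facts(3) ncomp_pos by (auto dest: subsetD[of _ _ 0])
  show "finite (Ov D - Zs ss)" using fin_Ov by simp
  show "base_rel D ss \<subseteq> (M0 D ss \<times> UNIV) \<times> (M0 D ss \<times> UNIV)"
    unfolding base_rel_def biv_def using nxt_in[OF mk] by (intro Un_least image_subsetI) auto
  fix c assume c: "c \<in> Ov D - Zs ss"
  then have "c \<in> M0 D ss" "partner D c \<in> M0 D ss"
    using Ov_real real_partner(1) partner_outside real_double by (auto simp: M0_def)
  then show "Asp D c \<subseteq> (M0 D ss \<times> UNIV) \<times> (M0 D ss \<times> UNIV)" "Bsp D c \<subseteq> (M0 D ss \<times> UNIV) \<times> (M0 D ss \<times> UNIV)"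
    unfolding Asp_def Bsp_def by (intro lks_subset; simp)+
qed

lemma strand_unique:
  assumes "s \<in> set ss" "x \<in> strand_set s" "x = sp s' u" "s' \<in> set ss" "u \<in> {- 1..1}"
  shows "s = s'"
  using disjoint[OF assms(1,4)] sp_in[OF assms(4,5)] assms(2,3) by auto

end

lemma list_all_concat_map: "list_all P (concat (map f xs)) \<longleftrightarrow> (\<forall>x\<in>set xs. list_all P (f x))"
  by (induction xs) auto

section \<open>Marks at the crossings inside a tangle\<close>

context tangled
begin

context
  fixes us :: "strand \<Rightarrow> real list"
  assumes us: "\<And>s. s \<in> set ss \<Longrightarrow> sorted_wrt (<) (us s)" "\<And>s. s \<in> set ss \<Longrightarrow> set (us s) \<subseteq> {- 1<..<1}"
    and inner: "real_params D \<inter> Zs ss = (\<Union>s\<in>set ss. sp s ` set (us s))"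
begin

definition MM :: "param set" where "MM = M0 D ss \<union> (real_params D \<inter> Zs ss)"

lemma MM_facts: "finite MM" "MM \<subseteq> params D" "real_params D \<subseteq> MM" "{..<ncomp D} \<subseteq> fst ` MM" "marking MM"
proof -
  show 1: "finite MM" "MM \<subseteq> params D" using M0_facts(1,2) fin_real real_params_subset by (auto simp: MM_def)
  show "real_params D \<subseteq> MM" by (auto simp: MM_def M0_def)
  show "{..<ncomp D} \<subseteq> fst ` MM" using M0_facts(3) by (auto simp: MM_def)
  show "marking MM" using 1 marking_params by blast
qed

lemma ends_not_real: "ends ss \<inter> real_params D = {}"
proof -
  have False if x: "x \<in> ends ss" "x \<in> real_params D" for x
  proof -
    obtain s e where s: "s \<in> set ss" "x = sp s e" "e = - 1 \<or> e = 1" using x(1) by (auto simp: ends_def)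
    have "x \<in> real_params D \<inter> Zs ss" using x ends_Zs by blast
    then obtain s' w where s': "s' \<in> set ss" "w \<in> set (us s')" "x = sp s' w" unfolding inner by blast
    have w: "w \<in> {- 1<..<1}" using us(2)[OF s'(1)] s'(2) by blast
    then have "w = e" using sp_eq_iff[OF s(1) s'(1), of e w] s s' by auto
    then show False using w s(3) by auto
  qed
  then show ?thesis by blast
qed

lemma biv_MM: "MM - real_params D = M0 D ss - (real_params D - Zs ss)"
proof -
  have "M0 D ss \<inter> (real_params D \<inter> Zs ss) = {}" using M0_facts(4) ends_not_real by blast
  then show ?thesis by (auto simp: MM_def)
qed

lemma MM_strand:
  assumes "s \<in> set ss" "u \<in> {- 1..1}"
  shows "sp s u \<in> MM \<longleftrightarrow> u \<in> set (- 1 # us s @ [1])"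
proof
  have Z: "sp s u \<in> Zs ss" using sp_Zs assms by blast
  assume "sp s u \<in> MM"
  then have "sp s u \<in> ends ss \<or> sp s u \<in> real_params D \<inter> Zs ss" using M0_facts(4) Z by (auto simp: MM_def)
  then show "u \<in> set (- 1 # us s @ [1])"
  proof
    assume "sp s u \<in> ends ss"
    then obtain s' e where "s' \<in> set ss" "sp s u = sp s' e" "e = - 1 \<or> e = 1" by (auto simp: ends_def)
    then show ?thesis using sp_eq_iff[OF assms(1) _ assms(2), of s' e] by auto
  next
    assume "sp s u \<in> real_params D \<inter> Zs ss"
    then obtain s' w where s': "s' \<in> set ss" "w \<in> set (us s')" "sp s u = sp s' w" unfolding inner by blast
    have "w \<in> {- 1..1}" using us(2)[OF s'(1)] s'(2) by auto
    then show ?thesis using sp_eq_iff[OF assms(1) s'(1) assms(2)] s' by auto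
  qed
next
  assume "u \<in> set (- 1 # us s @ [1])"
  then have "sp s u \<in> ends ss \<or> sp s u \<in> real_params D \<inter> Zs ss"
    unfolding inner using assms(1) by (auto simp: ends_def)
  then show "sp s u \<in> MM" using M0_facts(4) by (auto simp: MM_def)
qed

text \<open>A circle reaches an inner mark only after passing the start of that strand, which is a
  mark of \<open>M0\<close>; so an outer mark that is no start keeps its successor.\<close>

lemma nxt_outer:
  assumes x: "x \<in> M0 D ss" "x \<notin> starts ss"
  shows "nxt MM x = nxt (M0 D ss) x"
proof -
  have mk: "marking (M0 D ss)" using M0_facts marking_params by blast
  obtain r where r: "succ_lift (M0 D ss) x r" "nxt (M0 D ss) x = (fst x, frac r)"
    using nxt_ex[OF mk x(1)] by blast
  obtain t where xt: "x = (fst x, t)" "0 \<le> t" "t < 1"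
    using x(1) M0_facts(2) by (cases x) (auto simp: params_def)
  have "(fst x, frac v) \<notin> MM" if v: "t < v" "v < r" for v
  proof
    assume "(fst x, frac v) \<in> MM"
    moreover have n0: "(fst x, frac v) \<notin> M0 D ss" using r(1) v xt by (metis snd_conv succ_lift_def)
    ultimately have "(fst x, frac v) \<in> real_params D \<inter> Zs ss" by (auto simp: MM_def)
    then obtain s w where s: "s \<in> set ss" "w \<in> set (us s)" "(fst x, frac v) = sp s w" unfolding inner by blast
    obtain i a b d where sd: "s = (i, a, b, d)" by (cases s)
    have ok': "strand_ok D (i, a, b, d)" using ok s(1) sd by blast
    have ab: "0 < a" "b < 1" using ok' by auto
    have w: "w \<in> {- 1<..<1}" using us(2) s by blast
    have i: "i = fst x" using s(3) fst_sp[of s w] sd by (metis fst_conv)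
    have f: "a < frac v" "frac v < b" using sp_open[OF ok' w] s(3) sd by (metis snd_conv)+
    have a: "(fst x, a) \<in> starts ss"
      using s(1) sp_ends(1)[OF ok'] i unfolding starts_def sd by (intro rev_image_eqI[of "(i, a, b, d)"]) (simp_all add: sdir.simps)
    \<comment> \<open>The lift of the start of the strand in the same turn as
      \<open>v\<close>.\<close>
    define v' where "v' = of_int \<lfloor>v\<rfloor> + a"
    have v': "v = of_int \<lfloor>v\<rfloor> + frac v" by (simp add: frac_def)
    have fv': "frac v' = a" using frac_shift(1)[of a "\<lfloor>v\<rfloor>"] ab ok' by (simp add: v'_def frac_id add.commute)
    have "(fst x, frac v') \<in> M0 D ss" using a fv' starts_ends by (auto simp: M0_def)
    moreover have "v' < r" using v' f v by (simp add: v'_def)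
    ultimately have le: "v' \<le> t" using r(1) xt by (metis not_le snd_conv succ_lift_def)
    \<comment> \<open>As \<open>v'\<close> is not after \<open>t\<close>, the point \<open>v\<close>
      lies in the first turn and \<open>x\<close> inside the strand; then \<open>x\<close> is one of
      its ends, and both ends are impossible.\<close>
    have "of_int \<lfloor>v\<rfloor> < (1 :: real)" "(-1 :: real) < of_int \<lfloor>v\<rfloor>"
      using le xt ab v v' f unfolding v'_def by linarith+
    then have "\<lfloor>v\<rfloor> = 0" by linarith
    then have "a \<le> t" "t < b" using le v v' f by (simp_all add: v'_def)
    then have "(i, t) \<in> strand_set s" unfolding sd by simp
    then have "x \<in> strand_set s" using xt(1) i by simp
    then have "x \<in> ends ss" using M0_facts(4) x(1) s(1) by (auto simp: Zs_def)
    then obtain s' e where s': "s' \<in> set ss" "x = sp s' e" "e = - 1 \<or> e = 1" by (auto simp: ends_def)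
    have "s = s'" using strand_unique[OF s(1) \<open>x \<in> strand_set s\<close> s'(2,1)] s'(3) by auto
    then have "x = (i, a) \<or> x = (i, b)" using s' sp_ends[OF ok'] sd by (auto split: if_splits)
    then show False using a x(2) i \<open>t < b\<close> xt by (metis less_irrefl prod.inject)
  qed
  then have "succ_lift MM x r" using r(1) xt unfolding succ_lift_def
    by (metis (no_types, lifting) MM_def UnI1 snd_conv)
  from nxt_eqI[OF MM_facts(5) _ this] show ?thesis using x(1) r(2) by (simp add: MM_def)
qed

lemma nxt_strand:
  assumes s: "s \<in> set ss" and u: "u \<in> set (- 1 # us s @ [1])" and v: "v \<in> set (- 1 # us s @ [1])"
    and uv: "if sdir s then u < v else v < u"
    and gap: "\<And>w. w \<in> set (- 1 # us s @ [1]) \<Longrightarrow> \<not> (min u v < w \<and> w < max u v)"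
  shows "nxt MM (sp s u) = sp s v"
proof -
  have U: "w \<in> {- 1..1}" if "w \<in> set (- 1 # us s @ [1])" for w using that us(2)[OF s] by auto
  have M: "sp s u \<in> MM" "sp s v \<in> MM" using MM_strand[OF s] U u v by blast+
  then have b: "0 \<le> snd (sp s u)" "snd (sp s v) < 1" "0 \<le> snd (sp s v)"
    using MM_facts(2) by (auto simp: params_def)
  have less: "snd (sp s u) < snd (sp s v)" using sp_less[OF ok[OF s]] uv by simp
  have "succ_lift MM (sp s u) (snd (sp s v))"
    unfolding succ_lift_def
  proof (intro conjI allI impI)
    show "(fst (sp s u), frac (snd (sp s v))) \<in> MM"
      using M(2) b by (simp add: frac_id fst_sp) (metis fst_sp prod.collapse)
    fix r assume r: "snd (sp s u) < r \<and> r < snd (sp s v)"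
    have fr: "frac r = r" using r b by (intro frac_id) auto
    show "(fst (sp s u), frac r) \<notin> MM"
    proof
      assume inM: "(fst (sp s u), frac r) \<in> MM"
      obtain i a b d where sd: "s = (i, a, b, d)" by (cases s)
      have "sp s u \<in> strand_set s" "sp s v \<in> strand_set s" using sp_in[OF s] U u v by auto
      then have "(fst (sp s u), r) \<in> strand_set s" using r unfolding sd by auto
      then obtain w where w: "w \<in> {- 1..1}" "(fst (sp s u), r) = sp s w" using sp_image[OF ok[OF s]] by blast
      have "w \<in> set (- 1 # us s @ [1])" using MM_strand[OF s w(1)] inM fr w(2) by simp
      then have g: "\<not> (min u v < w \<and> w < max u v)" by (rule gap)
      have "snd (sp s u) < snd (sp s w)" "snd (sp s w) < snd (sp s v)" using r w(2) by (metis snd_conv)+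
      then show False using g uv sp_less[OF ok[OF s]] by (auto split: if_splits)
    qed
  qed (rule less)
  from nxt_eqI[OF MM_facts(5) M(1) this] show ?thesis
    using b by (simp add: frac_id fst_sp) (metis fst_sp prod.collapse)
qed

text \<open>Edges leaving a start or an inner mark are links of the chains, all others are edges of
  \<open>M0\<close>. The links carry both directions, so the two relations agree only up to
  converse.\<close>

lemma eqv_gl_MM:
  "eqv (gl MM) = eqv (base_rel D ss \<union> lks (concat (map (\<lambda>s. chain s (us s)) ss)))"
proof -
  let ?E0 = "(\<lambda>x. ((x, True), (nxt (M0 D ss) x, False))) ` (M0 D ss - starts ss)"
  let ?Ch = "lks (concat (map (\<lambda>s. chain s (us s)) ss))"
  define W where "W s = - 1 # us s @ [1]" for s
  have sorted: "sorted_wrt (<) (W s)" if "s \<in> set ss" for s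
    using us[OF that] by (fastforce simp: W_def sorted_wrt_append)
  have chain_nth: "chain s (us s) = map (\<lambda>k. (nd s (W s ! k) True, nd s (W s ! Suc k) False)) [0..<Suc (length (us s))]" for s
    by (rule nth_equalityI) (auto simp: chain_def W_def nth_append nth_Cons split: nat.split simp del: upt_Suc)
  have step: "nxt MM (sp s (if sdir s then W s ! k else W s ! Suc k)) = sp s (if sdir s then W s ! Suc k else W s ! k)"
    if s: "s \<in> set ss" and k: "k < Suc (length (us s))" for s k
  proof (rule nxt_strand[OF s])
    have len: "Suc k < length (W s)" using k by (simp add: W_def)
    have lt: "W s ! k < W s ! Suc k" using sorted_wrt_nth_less[OF sorted[OF s], of k "Suc k"] len by simp
    have "W s ! k \<in> set (W s)" "W s ! Suc k \<in> set (W s)" using len by auto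
    then show "(if sdir s then W s ! k else W s ! Suc k) \<in> set (- 1 # us s @ [1])"
      "(if sdir s then W s ! Suc k else W s ! k) \<in> set (- 1 # us s @ [1])" by (auto simp: W_def)
    show "if sdir s then (if sdir s then W s ! k else W s ! Suc k) < (if sdir s then W s ! Suc k else W s ! k)
      else (if sdir s then W s ! Suc k else W s ! k) < (if sdir s then W s ! k else W s ! Suc k)"
      using lt by simp
    fix w assume "w \<in> set (- 1 # us s @ [1])"
    then obtain l where l: "l < length (W s)" "w = W s ! l" by (auto simp: W_def[symmetric] in_set_conv_nth)
    have "\<not> (W s ! k < w \<and> w < W s ! Suc k)"
    proof (cases "l \<le> k")
      case True
      then have "w \<le> W s ! k" using sorted_wrt_nth_less[OF sorted[OF s], of l k] len l by (cases "l = k") auto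
      then show ?thesis by simp
    next
      case False
      then have "W s ! Suc k \<le> w" using sorted_wrt_nth_less[OF sorted[OF s], of "Suc k" l] l by (cases "l = Suc k") auto
      then show ?thesis by simp
    qed
    then show "\<not> (min (if sdir s then W s ! k else W s ! Suc k) (if sdir s then W s ! Suc k else W s ! k) < w \<and>
      w < max (if sdir s then W s ! k else W s ! Suc k) (if sdir s then W s ! Suc k else W s ! k))"
      using lt by (simp add: min_def max_def)
  qed
  have edge: "((x, True), (nxt MM x, False)) \<in> ?Ch"
    if "s \<in> set ss" "k < Suc (length (us s))" "x = sp s (if sdir s then W s ! k else W s ! Suc k)" for s k x
  proof -
    have "(nd s (W s ! k) True, nd s (W s ! Suc k) False) \<in> set (concat (map (\<lambda>s. chain s (us s)) ss))"
      unfolding set_concat set_map image_image chain_nth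
    proof (rule UN_I[OF that(1)])
      show "(nd s (W s ! k) True, nd s (W s ! Suc k) False)
        \<in> (\<lambda>k. (nd s (W s ! k) True, nd s (W s ! Suc k) False)) ` set [0..<Suc (length (us s))]"
        by (rule image_eqI[OF refl]) (use that(2) in \<open>simp del: upt_Suc\<close>)
    qed
    then have "lk (nd s (W s ! k) True) (nd s (W s ! Suc k) False) \<subseteq> ?Ch" by (auto simp: lks_def)
    then show ?thesis unfolding that(3) step[OF that(1,2)] by (cases "sdir s") (auto simp: lk_def nd_def)
  qed
  have "eds MM \<subseteq> ?E0 \<union> ?Ch"
  proof
    fix p assume "p \<in> eds MM"
    then obtain x where x: "x \<in> MM" "p = ((x, True), (nxt MM x, False))" by (auto simp: eds_def)
    show "p \<in> ?E0 \<union> ?Ch"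
    proof (cases "x \<in> M0 D ss - starts ss")
      case True
      then have "p \<in> ?E0" using nxt_outer[of x] x by auto
      then show ?thesis by simp
    next
      case False
      then have "x \<in> starts ss \<or> x \<in> real_params D \<inter> Zs ss" using x(1) by (auto simp: MM_def)
      then have "\<exists>s\<in>set ss. \<exists>k < Suc (length (us s)). x = sp s (if sdir s then W s ! k else W s ! Suc k)"
      proof
        assume "x \<in> starts ss"
        then obtain s where s: "s \<in> set ss" "x = sp s (if sdir s then - 1 else 1)" by (auto simp: starts_def)
        have "W s ! 0 = - 1" "W s ! Suc (length (us s)) = 1" by (simp_all add: W_def nth_append)
        then show ?thesis using s
          by (intro bexI[of _ s] exI[of _ "if sdir s then 0 else length (us s)"]) auto
      next
        assume "x \<in> real_params D \<inter> Zs ss"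
        then obtain s w where s: "s \<in> set ss" "w \<in> set (us s)" "x = sp s w" unfolding inner by blast
        obtain l where l: "l < length (us s)" "w = us s ! l" using s(2) by (auto simp: in_set_conv_nth)
        have "W s ! Suc l = w" using l by (simp add: W_def nth_append)
        then show ?thesis using s l
          by (intro bexI[of _ s] exI[of _ "if sdir s then Suc l else l"]) auto
      qed
      then show ?thesis using edge x(2) by blast
    qed
  qed
  moreover have "?E0 \<subseteq> eds MM"
    using nxt_outer by (auto simp: eds_def MM_def intro!: rev_image_eqI)
  moreover have "?Ch \<subseteq> eds MM \<union> (eds MM)\<inverse>"
  proof -
    have "lk (nd s (W s ! k) True) (nd s (W s ! Suc k) False) \<subseteq> eds MM \<union> (eds MM)\<inverse>"
      if s: "s \<in> set ss" and k: "k < Suc (length (us s))" for s k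
    proof -
      let ?u = "if sdir s then W s ! k else W s ! Suc k"
      have len: "Suc k < length (W s)" using k by (simp add: W_def)
      have "W s ! k \<in> set (W s)" "W s ! Suc k \<in> set (W s)" using len by (simp_all del: nth_Cons_Suc)
      then have "?u \<in> set (W s)" by simp
      moreover from this have "?u \<in> {- 1..1}" using us(2)[OF s] by (auto simp: W_def)
      ultimately have "sp s ?u \<in> MM" using MM_strand[OF s] by (simp add: W_def)
      then have "((sp s ?u, True), (nxt MM (sp s ?u), False)) \<in> eds MM" by (simp add: eds_def)
      then show ?thesis unfolding step[OF s k] by (cases "sdir s") (auto simp: lk_def nd_def)
    qed
    then have "\<forall>s\<in>set ss. \<forall>p\<in>set (chain s (us s)). lk (fst p) (snd p) \<subseteq> eds MM \<union> (eds MM)\<inverse>"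
      unfolding chain_nth by (auto simp del: upt_Suc)
    then show ?thesis unfolding lks_def set_concat set_map by (intro UN_least) force
  qed
  ultimately have "gl MM \<subseteq> (base_rel D ss \<union> ?Ch)"
    "base_rel D ss \<union> ?Ch \<subseteq> gl MM \<union> (gl MM)\<inverse>"
    unfolding base_rel_def biv_MM by auto
  then show ?thesis
    by (intro eqv_eqI) (auto intro: eqv_base eqv_base')
qed

lemma bracket_tangled:
  "bracket D = ssum ((M0 D ss \<union> (real_params D \<inter> Zs ss)) \<times> UNIV)
     (base_rel D ss \<union> lks (concat (map (\<lambda>s. chain s (us s)) ss))) (Ov D) (Asp D) (Bsp D)"
  unfolding MM_def[symmetric] ssum_marks[OF MM_facts(1-4)]
  by (rule ssum_cong) (simp_all add: eqv_gl_MM)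

end

lemma bracket_no_inner:
  assumes "real_params D \<inter> Zs ss = {}"
  shows "bracket D = ssum (M0 D ss \<times> UNIV)
    (base_rel D ss \<union> lks (map (\<lambda>s. (nd s (- 1) True, nd s 1 False)) ss)) (Ov D - Zs ss) (Asp D) (Bsp D)"
proof -
  have "concat (map (\<lambda>s. chain s []) ss) = map (\<lambda>s. (nd s (- 1) True, nd s 1 False)) ss"
    by (induction ss) (simp_all add: chain_def)
  moreover have "Ov D - Zs ss = Ov D" using assms Ov_real by blast
  ultimately show ?thesis
    using bracket_tangled[of "\<lambda>_. []"] assms by simp
qed

text \<open>In the crossed position of each move with real crossings, every strand carries exactly
  two crossing parameters. Contracting its edges leaves one inner class, the arc between them,
  represented by \<open>nd s (u s) True\<close>; the outer halves are absorbed by the ends.\<close>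

lemma bracket_two_inner:
  assumes uv: "\<And>s. s \<in> set ss \<Longrightarrow> - 1 < u s \<and> u s < v s \<and> v s < (1 :: real)"
    and inner: "real_params D \<inter> Zs ss = (\<Union>s\<in>set ss. {sp s (u s), sp s (v s)})"
  obtains F where "\<And>z. z \<in> M0 D ss \<times> UNIV \<Longrightarrow> F z = z"
    "\<And>s. s \<in> set ss \<Longrightarrow> F (nd s (u s) False) = nd s (- 1) True \<and> F (nd s (u s) True) = nd s (u s) True \<and>
       F (nd s (v s) False) = nd s (u s) True \<and> F (nd s (v s) True) = nd s 1 False"
    "\<And>s. s \<in> set ss \<Longrightarrow> nd s (u s) True \<notin> M0 D ss \<times> UNIV"
    "bracket D = ssum (M0 D ss \<times> UNIV \<union> (\<lambda>s. nd s (u s) True) ` set ss) (base_rel D ss) (Ov D)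
       (\<lambda>c. relim F (Asp D c)) (\<lambda>c. relim F (Bsp D c))"
proof -
  interpret o: outer "M0 D ss \<times> UNIV" "base_rel D ss" "Ov D - Zs ss" "Asp D" "Bsp D" by (rule outer_locale)
  let ?us = "\<lambda>s. [u s, v s]"
  have ends_in: "nd s (- 1) f \<in> M0 D ss \<times> UNIV" "nd s 1 f \<in> M0 D ss \<times> UNIV" if "s \<in> set ss" for s f
    using that by (auto simp: nd_def M0_def ends_def)
  have I: "u s \<in> {- 1..1}" "v s \<in> {- 1..1}" "u s \<noteq> v s" "v s \<noteq> u s" if "s \<in> set ss" for s
    using uv[OF that] by auto
  have hyp: "\<And>s. s \<in> set ss \<Longrightarrow> sorted_wrt (<) (?us s)" "\<And>s. s \<in> set ss \<Longrightarrow> set (?us s) \<subseteq> {- 1<..<1}"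
    "real_params D \<inter> Zs ss = (\<Union>s\<in>set ss. sp s ` set (?us s))"
    using uv inner by (force, fastforce, simp)
  have notO: "nd s (u s) f \<notin> M0 D ss \<times> UNIV" "nd s (v s) f \<notin> M0 D ss \<times> UNIV" if "s \<in> set ss" for s f
  proof -
    have "M0 D ss \<inter> (real_params D \<inter> Zs ss) = {}"
      using M0_facts(4) ends_not_real[OF hyp] by blast
    then show "nd s (u s) f \<notin> M0 D ss \<times> UNIV" "nd s (v s) f \<notin> M0 D ss \<times> UNIV"
      unfolding inner using that by (auto simp: nd_def)
  qed
  \<comment> \<open>The strand of an inner half-edge is recovered by choice; it is unique because
    strands are disjoint.\<close>
  define F where "F z = (if z \<in> M0 D ss \<times> UNIV then z else
     (let s = (SOME s. s \<in> set ss \<and> fst z \<in> strand_set s) in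
      if z = nd s (u s) False then nd s (- 1) True else if z = nd s (v s) True then nd s 1 False else nd s (u s) True))" for z
  have some: "(SOME s'. s' \<in> set ss \<and> fst (nd s w f) \<in> strand_set s') = s" if "s \<in> set ss" "w \<in> {- 1..1}" for s w f
  proof (rule some_equality)
    show "s \<in> set ss \<and> fst (nd s w f) \<in> strand_set s" using that sp_in by (simp add: nd_def)
    show "s' = s" if "s' \<in> set ss \<and> fst (nd s w f) \<in> strand_set s'" for s'
      using strand_unique[of s' "sp s w" s w] that \<open>s \<in> set ss\<close> \<open>w \<in> {- 1..1}\<close> by (simp add: nd_def)
  qed
  have F0: "F z = z" if "z \<in> M0 D ss \<times> UNIV" for z using that by (simp add: F_def)
  have F1: "F (nd s (u s) False) = nd s (- 1) True" "F (nd s (u s) True) = nd s (u s) True"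
    "F (nd s (v s) False) = nd s (u s) True" "F (nd s (v s) True) = nd s 1 False" if s: "s \<in> set ss" for s
    using notO[OF s] some[OF s] I[OF s] nd_eq[OF ok[OF s]] by (simp_all add: F_def)
  let ?H = "(M0 D ss \<union> (real_params D \<inter> Zs ss)) \<times> (UNIV :: bool set)"
  let ?R = "base_rel D ss \<union> lks (concat (map (\<lambda>s. chain s (?us s)) ss))"
  have chain: "chain s (?us s) = [(nd s (- 1) True, nd s (u s) False), (nd s (u s) True, nd s (v s) False), (nd s (v s) True, nd s 1 False)]" for s
    by (simp add: chain_def)
  have H: "z \<in> M0 D ss \<times> UNIV \<or> (\<exists>s\<in>set ss. \<exists>f. z = nd s (u s) f \<or> z = nd s (v s) f)" if "z \<in> ?H" for z
  proof -
    obtain x b where z: "z = (x, b)" by (cases z)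
    show ?thesis
    proof (cases "x \<in> M0 D ss")
      case False
      then have "x \<in> (\<Union>s\<in>set ss. {sp s (u s), sp s (v s)})" using that z inner by auto
      then obtain s where s: "s \<in> set ss" "x = sp s (u s) \<or> x = sp s (v s)" by blast
      have "b = ((b = sdir s) = sdir s)" by (cases b; cases "sdir s"; simp)
      then show ?thesis using s z unfolding nd_def by blast
    qed (simp add: z)
  qed
  have ndH: "nd s (u s) f \<in> ?H" "nd s (v s) f \<in> ?H" "nd s (- 1) f \<in> ?H" "nd s 1 f \<in> ?H" if "s \<in> set ss" for s f
    using ends_in[OF that] that unfolding inner by (auto simp: nd_def)
  have RM: "real_params D \<subseteq> M0 D ss \<union> (real_params D \<inter> Zs ss)" by (auto simp: M0_def)
  have lkR: "lk a b \<subseteq> ?R" if "s \<in> set ss" "(a, b) \<in> set (chain s (?us s))" for s a b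
    using that unfolding lks_def by fastforce
  have cR: "(nd s (- 1) True, nd s (u s) False) \<in> eqv ?R" "(nd s (u s) True, nd s (v s) False) \<in> eqv ?R"
    "(nd s (v s) True, nd s 1 False) \<in> eqv ?R" if "s \<in> set ss" for s
    by (rule eqv_lk, rule lkR[OF that], simp add: chain)+
  have Rsub: "?R \<subseteq> ?H \<times> ?H"
  proof -
    have "list_all (\<lambda>(a, b). a \<in> ?H \<and> b \<in> ?H) (concat (map (\<lambda>s. chain s (?us s)) ss))"
      unfolding list_all_concat_map chain using ndH by simp
    then have "lks (concat (map (\<lambda>s. chain s (?us s)) ss)) \<subseteq> ?H \<times> ?H" by (rule lks_subset)
    moreover have "base_rel D ss \<subseteq> ?H \<times> ?H" using o.R by blast
    ultimately show ?thesis by blast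
  qed
  have "bracket D = ssum ?H ?R (Ov D) (Asp D) (Bsp D)" by (rule bracket_tangled[OF hyp])
  also have "\<dots> = ssum (M0 D ss \<times> UNIV \<union> (\<lambda>s. nd s (u s) True) ` set ss) (relim F ?R) (Ov D)
     (\<lambda>c. relim F (Asp D c)) (\<lambda>c. relim F (Bsp D c))"
  proof (rule ssum_contract[OF Rsub])
    show "F ` ?H = M0 D ss \<times> UNIV \<union> (\<lambda>s. nd s (u s) True) ` set ss"
    proof (intro subset_antisym subsetI)
      fix y assume "y \<in> F ` ?H"
      then obtain z where z: "z \<in> ?H" "y = F z" by blast
      from H[OF z(1)] show "y \<in> M0 D ss \<times> UNIV \<union> (\<lambda>s. nd s (u s) True) ` set ss"
      proof (elim disjE bexE exE)
        fix s f assume "s \<in> set ss" "z = nd s (u s) f"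
        then show ?thesis using F1[of s] ends_in[of s True] z(2) by (cases f) auto
      next
        fix s f assume "s \<in> set ss" "z = nd s (v s) f"
        then show ?thesis using F1[of s] ends_in[of s False] z(2) by (cases f) auto
      qed (use F0 z(2) in auto)
    next
      fix y assume "y \<in> M0 D ss \<times> UNIV \<union> (\<lambda>s. nd s (u s) True) ` set ss"
      then show "y \<in> F ` ?H"
      proof
        assume "y \<in> M0 D ss \<times> UNIV"
        then show ?thesis using F0[of y] by (intro image_eqI[of _ _ y]) auto
      next
        assume "y \<in> (\<lambda>s. nd s (u s) True) ` set ss"
        then obtain s where "s \<in> set ss" "y = nd s (u s) True" by blast
        then show ?thesis using F1(2)[of s] ndH(1)[of s True] by (intro image_eqI[of _ _ y]) auto
      qed
    qed
    show "M0 D ss \<times> UNIV \<union> (\<lambda>s. nd s (u s) True) ` set ss \<subseteq> ?H" using ndH(1) by blast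
    show "Asp D c \<subseteq> ?H \<times> ?H" "Bsp D c \<subseteq> ?H \<times> ?H" if "c \<in> Ov D" for c
      by (rule Asp_subset[OF that RM], rule Bsp_subset[OF that RM])
    show "(z, F z) \<in> eqv ?R" if z: "z \<in> ?H" for z
      using H[OF z]
    proof (elim disjE bexE exE)
      fix s f assume "s \<in> set ss" "z = nd s (u s) f"
      then show ?thesis using F1[of s] eqv_sym[OF cR(1)[of s]] by (cases f) auto
    next
      fix s f assume "s \<in> set ss" "z = nd s (v s) f"
      then show ?thesis using F1[of s] cR(3)[of s] eqv_sym[OF cR(2)[of s]] by (cases f) auto
    qed (use F0 in auto)
  qed
  also have "\<dots> = ssum (M0 D ss \<times> UNIV \<union> (\<lambda>s. nd s (u s) True) ` set ss) (base_rel D ss) (Ov D)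
     (\<lambda>c. relim F (Asp D c)) (\<lambda>c. relim F (Bsp D c))"
  proof (rule ssum_cong, simp, rule eqv_cong_Id)
    have "relim F (base_rel D ss) = base_rel D ss" by (rule relim_id[OF o.R]) (rule F0)
    \<comment> \<open>Both ends of every chain link have the same image under \<open>F\<close>, so
      the chains disappear.\<close>
    moreover have "relim F (lks (concat (map (\<lambda>s. chain s (?us s)) ss))) \<subseteq> lks [] \<union> Id"
      unfolding relim_lks
    proof (rule lks_cover)
      have "F a = F b" if "s \<in> set ss" "(a, b) \<in> set (chain s (?us s))" for s a b
        using that(2) F1[OF that(1)] F0[OF ends_in(1)[OF that(1), of True]] F0[OF ends_in(2)[OF that(1), of False]]
        by (auto simp: chain)
      then show "list_all (\<lambda>(a, b). a = b \<or> list_ex (\<lambda>(c, d). a = c \<and> b = d \<or> a = d \<and> b = c) [])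
        (map (map_prod F F) (concat (map (\<lambda>s. chain s (?us s)) ss)))"
        unfolding map_concat map_map list_all_concat_map comp_def by (auto simp: chain)
    qed
    ultimately show "relim F ?R \<union> Id = base_rel D ss \<union> Id" by (auto simp: relim_Un lks_def)
  qed simp_all
  finally have B: "bracket D = \<dots>" .
  show ?thesis by (rule that[OF F0 _ notO(1) B]) (use F1 in blast)+
qed

lemma ends_M0:
  assumes "s \<in> set ss"
  shows "nd s (- 1) f \<in> M0 D ss \<times> UNIV" "nd s 1 f \<in> M0 D ss \<times> UNIV"
  using assms by (auto simp: nd_def M0_def ends_def)

lemma outer_F:
  assumes F: "\<And>z. z \<in> M0 D ss \<times> UNIV \<Longrightarrow> F z = z"
  shows "c \<in> Ov D - Zs ss \<Longrightarrow> relim F (Asp D c) = Asp D c" "c \<in> Ov D - Zs ss \<Longrightarrow> relim F (Bsp D c) = Bsp D c"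
    "outer (M0 D ss \<times> UNIV) (base_rel D ss) (Ov D - Zs ss) (\<lambda>c. relim F (Asp D c)) (\<lambda>c. relim F (Bsp D c))"
proof -
  interpret o: outer "M0 D ss \<times> UNIV" "base_rel D ss" "Ov D - Zs ss" "Asp D" "Bsp D" by (rule outer_locale)
  have 1: "relim F (Asp D c) = Asp D c" "relim F (Bsp D c) = Bsp D c" if "c \<in> Ov D - Zs ss" for c
    by (rule relim_id[OF o.A[OF that] F], assumption) (rule relim_id[OF o.B[OF that] F], assumption)
  then show "c \<in> Ov D - Zs ss \<Longrightarrow> relim F (Asp D c) = Asp D c" "c \<in> Ov D - Zs ss \<Longrightarrow> relim F (Bsp D c) = Bsp D c" by blast+
  show "outer (M0 D ss \<times> UNIV) (base_rel D ss) (Ov D - Zs ss) (\<lambda>c. relim F (Asp D c)) (\<lambda>c. relim F (Bsp D c))"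
    by unfold_locales (use o.fin o.R o.A o.B 1 in auto)
qed

text \<open>The splices at a crossing, expressed in the model. \<kappa> is the sign of the model
  crossing, and \<open>e\<close> tells whether the first strand is the lower one. The directions of
  the strands drop out, because a splice does not depend on orientations.\<close>

lemma splice_sp:
  assumes s: "(s, \<sigma>) \<in> set L" "u \<in> {- 1<..<1}" "(\<sigma> has_vector_derivative v) (at u)"
    and s': "(s', \<sigma>') \<in> set L" "u' \<in> {- 1<..<1}" "(\<sigma>' has_vector_derivative v') (at u')"
    and eq: "\<sigma> u = \<sigma>' u'" "s \<noteq> s' \<or> u \<noteq> u'" and nz: "cross v v' \<noteq> 0"
    and lv: "lvl D (sp s u) \<noteq> Virt" and \<kappa>: "\<kappa> \<longleftrightarrow> 0 < cross v v'"
    and c: "c = (if lvl D (sp s u) = level.Under then sp s' u' else sp s u)"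
    and e: "e = (if lvl D (sp s u) = level.Under then 1 else - 1 :: int)"
  shows "{sp s u, sp s' u'} \<inter> Ov D = {c}" "sg D c \<longleftrightarrow> ((e = - 1) = (\<kappa> = (sdir s = sdir s')))"
    "e = 1 \<and> relim F (Asp D c) = lks [(F (nd s u True), F (nd s' u' \<kappa>)), (F (nd s u False), F (nd s' u' (\<not> \<kappa>)))] \<and>
       relim F (Bsp D c) = lks [(F (nd s' u' True), F (nd s u (\<not> \<kappa>))), (F (nd s' u' False), F (nd s u \<kappa>))] \<or>
     e = - 1 \<and> relim F (Asp D c) = lks [(F (nd s' u' True), F (nd s u (\<not> \<kappa>))), (F (nd s' u' False), F (nd s u \<kappa>))] \<and>
       relim F (Bsp D c) = lks [(F (nd s u True), F (nd s' u' \<kappa>)), (F (nd s u False), F (nd s' u' (\<not> \<kappa>)))]"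
proof -
  note cr = crossing_sp[OF s s' eq nz, folded \<kappa>]
  note pp = partner_props[OF cr(1)]
  show 1: "{sp s u, sp s' u'} \<inter> Ov D = {c}"
    using pp(8) lv c cr(1,2) pp(5) by (auto simp: Ov_def real_params_def)
  show 2: "sg D c \<longleftrightarrow> ((e = - 1) = (\<kappa> = (sdir s = sdir s')))"
    using cr(2,3) pp(9) c e by auto
  let ?\<alpha> = "[(nd s u True, nd s' u' \<kappa>), (nd s u False, nd s' u' (\<not> \<kappa>))]"
  let ?\<beta> = "[(nd s' u' True, nd s u (\<not> \<kappa>)), (nd s' u' False, nd s u \<kappa>)]"
  have *: "e = 1 \<and> Asp D c = lks ?\<alpha> \<and> Bsp D c = lks ?\<beta> \<or> e = - 1 \<and> Asp D c = lks ?\<beta> \<and> Bsp D c = lks ?\<alpha>"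
  proof (cases "lvl D (sp s u) = level.Under")
    case True
    then have "c = sp s' u'" "e = 1" "partner D c = sp s u" using c e cr(2) pp(6) by auto
    then show ?thesis unfolding Asp_def Bsp_def 2
      by (cases \<kappa>; cases "sdir s"; cases "sdir s'") (simp_all add: nd_def lks_def lk_def insert_commute)
  next
    case False
    then have "c = sp s u" "e = - 1" "partner D c = sp s' u'" using c e cr(2) by auto
    then show ?thesis unfolding Asp_def Bsp_def 2
      by (cases \<kappa>; cases "sdir s"; cases "sdir s'") (simp_all add: nd_def lks_def lk_def insert_commute)
  qed
  show "e = 1 \<and> relim F (Asp D c) = lks [(F (nd s u True), F (nd s' u' \<kappa>)), (F (nd s u False), F (nd s' u' (\<not> \<kappa>)))] \<and>
       relim F (Bsp D c) = lks [(F (nd s' u' True), F (nd s u (\<not> \<kappa>))), (F (nd s' u' False), F (nd s u \<kappa>))] \<or>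
     e = - 1 \<and> relim F (Asp D c) = lks [(F (nd s' u' True), F (nd s u (\<not> \<kappa>))), (F (nd s' u' False), F (nd s u \<kappa>))] \<and>
       relim F (Bsp D c) = lks [(F (nd s u True), F (nd s' u' \<kappa>)), (F (nd s u False), F (nd s' u' (\<not> \<kappa>)))]"
    using * by (elim disjE conjE) (simp_all only: relim_lks list.map map_prod_simp simp_thms)
qed

end

section \<open>Two diagrams that agree outside a common tangle\<close>

locale tangled_pair = A: tangled D L h ss + B: tangled D' L' h ss for D L h D' L' ss +
  assumes agree: "agree_off ss D D'"
begin

lemma ncomp_eq: "ncomp D' = ncomp D"
  using agree by (simp add: agree_off_def)

lemma params_eq: "params D' = params D"
  by (simp add: params_def ncomp_eq)

lemma outside:
  assumes "x \<in> params D" "x \<notin> Zs ss"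
  shows "pt D' x = pt D x" "lvl D' x = lvl D x"
  using agree assms by (auto simp: agree_off_def Zs_def)

text \<open>A derivative needs agreement near the point and not only at it. The strands are finitely
  many closed arcs, so a point outside all of them has a neighbourhood outside.\<close>

lemma tangent_outside:
  assumes x: "x \<in> params D" "x \<notin> Zs ss"
  shows "tangent D' x = tangent D x"
proof -
  obtain i t where xt: "x = (i, t)" by (cases x)
  have i: "i < ncomp D" "0 \<le> t" "t < 1" using x xt by (auto simp: params_def)
  have "\<forall>s\<in>set ss. eventually (\<lambda>r. (i, frac r) \<notin> strand_set s) (nhds t)"
  proof
    fix s assume s: "s \<in> set ss"
    obtain j a b d where sd: "s = (j, a, b, d)" by (cases s)
    have okk: "strand_ok D (j, a, b, d)" using A.ok s sd by blast
    show "eventually (\<lambda>r. (i, frac r) \<notin> strand_set s) (nhds t)"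
    proof (cases "j = i")
      case True
      then have "t \<notin> {a..b}" using x(2) s sd xt by (auto simp: Zs_def)
      then have "eventually (\<lambda>r. frac r \<notin> {a..b}) (nhds t)"
        using okk i by (intro not_in_strand_near) auto
      then show ?thesis by (rule eventually_mono) (auto simp: sd)
    qed (simp add: sd)
  qed
  then have "eventually (\<lambda>r. \<forall>s\<in>set ss. (i, frac r) \<notin> strand_set s) (nhds t)"
    by (intro eventually_ball_finite) auto
  then have "eventually (\<lambda>r. r \<in> UNIV \<longrightarrow> crv D' i r = crv D i r) (nhds t)"
  proof (rule eventually_mono)
    fix r assume "\<forall>s\<in>set ss. (i, frac r) \<notin> strand_set s"
    then have "(i, frac r) \<notin> Zs ss" by (auto simp: Zs_def)
    moreover have "(i, frac r) \<in> params D" using i by (simp add: params_def frac_lt_1)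
    ultimately have "pt D' (i, frac r) = pt D (i, frac r)" using outside by blast
    then show "r \<in> UNIV \<longrightarrow> crv D' i r = crv D i r" using A.pt_frac[of i r] B.pt_frac[of i r] i ncomp_eq by simp
  qed
  then show ?thesis unfolding xt tangent_def by (simp add: vector_derivative_cong_eq)
qed

text \<open>A point of the tangle and a point outside it never have the same image, so the double
  points outside are the same for both diagrams.\<close>

lemma double_outside:
  assumes x: "x \<in> params D" "x \<notin> Zs ss"
  shows "x \<in> double_params D' \<longleftrightarrow> x \<in> double_params D"
    "x \<in> double_params D \<Longrightarrow> partner D' x = partner D x"
    "x \<in> double_params D \<Longrightarrow> sg D' x = sg D x"
proof -
  have Z: "Zs ss = {x \<in> params D. pt D x \<in> h ` square}" "Zs ss = {x \<in> params D. pt D' x \<in> h ` square}"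
    using A.Zs_eq B.Zs_eq unfolding params_eq by blast+
  have *: "y \<in> params D \<and> y \<noteq> x \<and> pt D' y = pt D' x \<longleftrightarrow> y \<in> params D \<and> y \<noteq> x \<and> pt D y = pt D x" for y
  proof (cases "y \<in> Zs ss")
    case True
    then have "pt D y \<noteq> pt D x" "pt D' y \<noteq> pt D' x" using x Z by (metis (mono_tags, lifting) mem_Collect_eq)+
    then show ?thesis by simp
  next
    case False
    then show ?thesis using outside[of y] outside[of x] x by auto
  qed
  then show 1: "x \<in> double_params D' \<longleftrightarrow> x \<in> double_params D"
    using x(1) unfolding double_params_def params_eq by blast
  show 2: "partner D' x = partner D x"
    unfolding partner_def params_eq using * by simp
  assume d: "x \<in> double_params D"
  then have "partner D x \<in> params D" "partner D x \<notin> Zs ss"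
    using A.partner_props(2) A.partner_outside x by blast+
  then show "sg D' x = sg D x" unfolding sg_def 2 using tangent_outside x by simp
qed

lemma real_outside: "real_params D' - Zs ss = real_params D - Zs ss"
proof (intro set_eqI)
  fix x show "x \<in> real_params D' - Zs ss \<longleftrightarrow> x \<in> real_params D - Zs ss"
  proof (cases "x \<in> params D \<and> x \<notin> Zs ss")
    case True
    then show ?thesis using double_outside(1)[of x] outside(2)[of x] by (simp add: real_params_def)
  next
    case False
    then show ?thesis using A.real_params_subset B.real_params_subset params_eq by blast
  qed
qed

lemma M0_eq: "M0 D' ss = M0 D ss"
  by (simp add: M0_def real_outside bases_def ncomp_eq)

lemma base_rel_eq: "base_rel D' ss = base_rel D ss"
  by (simp add: base_rel_def real_outside M0_eq)

lemma Ov_outside: "Ov D' - Zs ss = Ov D - Zs ss"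
proof (intro set_eqI)
  fix x
  have "x \<in> real_params D' - Zs ss \<longleftrightarrow> x \<in> real_params D - Zs ss" using real_outside by simp
  then show "x \<in> Ov D' - Zs ss \<longleftrightarrow> x \<in> Ov D - Zs ss"
    using outside(2)[of x] A.real_params_subset by (auto simp: Ov_def)
qed

lemma gauss_outside:
  assumes "x \<in> real_params D" "x \<notin> Zs ss"
  shows "partner D' x = partner D x" "lvl D' x = lvl D x" "sg D' x = sg D x"
proof -
  have x: "x \<in> params D" "x \<in> double_params D" using assms A.real_params_subset A.real_double by blast+
  show "partner D' x = partner D x" "lvl D' x = lvl D x" "sg D' x = sg D x"
    using double_outside(2,3)[OF x(1) assms(2) x(2)] outside(2)[OF x(1) assms(2)] by blast+
qed

lemma splices_outside:
  assumes "c \<in> Ov D - Zs ss"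
  shows "Asp D' c = Asp D c" "Bsp D' c = Bsp D c" "sg D' c = sg D c"
  using gauss_outside[of c] A.Ov_real[of c] assms by (auto simp: Asp_def Bsp_def)

lemma f_poly_same_inner:
  assumes "real_params D' \<inter> Zs ss = real_params D \<inter> Zs ss"
    and "\<And>x. x \<in> real_params D \<Longrightarrow> x \<in> Zs ss \<Longrightarrow> partner D' x = partner D x \<and> lvl D' x = lvl D x \<and> sg D' x = sg D x"
  shows "f_poly D' = f_poly D"
proof (rule f_poly_gauss_cong[OF A.D B.D ncomp_eq])
  show "real_params D' = real_params D" using assms(1) real_outside by blast
  fix x assume "x \<in> real_params D"
  then show "partner D' x = partner D x \<and> lvl D' x = lvl D x \<and> sg D' x = sg D x"
    using assms(2)[of x] gauss_outside[of x] by blast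
qed

lemma bracket_no_inner_pair:
  assumes "real_params D \<inter> Zs ss = {}"
  shows "bracket D = ssum (M0 D' ss \<times> UNIV)
    (base_rel D' ss \<union> lks (map (\<lambda>s. (nd s (- 1) True, nd s 1 False)) ss)) (Ov D' - Zs ss) (Asp D') (Bsp D')"
  unfolding A.bracket_no_inner[OF assms] M0_eq base_rel_eq Ov_outside
  by (rule ssum_cong) (simp_all add: splices_outside)

lemma writhe_pair:
  "writhe D' = writhe D + (\<Sum>x\<in>Ov D' \<inter> Zs ss. if sg D' x then 1 else - 1) -
     (\<Sum>x\<in>Ov D \<inter> Zs ss. if sg D x then 1 else - 1)"
proof -
  have "writhe D = (\<Sum>x\<in>Ov D \<inter> Zs ss. if sg D x then 1 else - 1) + (\<Sum>x\<in>Ov D - Zs ss. if sg D x then 1 else - 1)"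
    unfolding A.writhe_sg by (rule sum.Int_Diff[OF A.fin_Ov])
  moreover have "writhe D' = (\<Sum>x\<in>Ov D' \<inter> Zs ss. if sg D' x then 1 else - 1) + (\<Sum>x\<in>Ov D' - Zs ss. if sg D' x then 1 else - 1)"
    unfolding B.writhe_sg by (rule sum.Int_Diff[OF B.fin_Ov])
  moreover have "(\<Sum>x\<in>Ov D' - Zs ss. if sg D' x then 1 else - 1 :: int) = (\<Sum>x\<in>Ov D - Zs ss. if sg D x then 1 else - 1)"
    unfolding Ov_outside by (rule sum.cong) (simp_all add: splices_outside)
  ultimately show ?thesis by simp
qed

end

section \<open>Invariance under the Reidemeister moves\<close>

lemma vd_Complex:
  assumes "(p has_real_derivative p') (at u)" "(q has_real_derivative q') (at u)"
  shows "((\<lambda>u. Complex (p u) (q u)) has_vector_derivative Complex p' q') (at u)"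
  using assms by (simp add: has_vector_derivative_complex_iff)

lemma lks_pair:
  "lks [(a, b), (c, d)] = lks [(c, d), (a, b)]"
  "lks [(a, b), (c, d)] = lks [(b, a), (c, d)]"
  "lks [(a, b), (c, d)] = lks [(a, b), (d, c)]"
  by (auto simp: lks_def lk_def)

text \<open>Two equal entries of the list would have disjoint, hence empty, parameter sets.\<close>

lemma (in tangled) distinct_ss: "distinct ss"
proof -
  have "map fst L ! k \<noteq> map fst L ! l" if kl: "k < length L" "l < length L" "k \<noteq> l" for k l
  proof
    assume eq: "map fst L ! k = map fst L ! l"
    have "\<forall>k < length L. \<forall>l < length L. k \<noteq> l \<longrightarrow> strand_set (fst (L ! k)) \<inter> strand_set (fst (L ! l)) = {}"
      using tg unfolding tangle_def by blast
    then have "strand_set (fst (L ! k)) \<inter> strand_set (fst (L ! l)) = {}" using kl by blast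
    then have e: "strand_set (fst (L ! k)) = {}" using eq kl by simp
    have "fst (L ! k) \<in> set ss" using kl unfolding ssL[symmetric] by simp
    from sp_in[OF this, of 0] show False using e by simp
  qed
  then show ?thesis unfolding ssL[symmetric] distinct_conv_nth by simp
qed

lemma (in tangled) real_sp:
  assumes "x \<in> real_params D" "x \<in> Zs ss"
  obtains s \<sigma> u s' \<sigma>' u' where "(s, \<sigma>) \<in> set L" "u \<in> {- 1..1}" "x = sp s u"
    "(s', \<sigma>') \<in> set L" "u' \<in> {- 1..1}" "\<sigma>' u' = \<sigma> u" "s \<noteq> s' \<or> u \<noteq> u'"
proof -
  obtain s \<sigma> u where s: "(s, \<sigma>) \<in> set L" "u \<in> {- 1..1}" "x = sp s u" using Zs_cases[OF assms(2)] .
  obtain s' \<sigma>' u' where s': "(s', \<sigma>') \<in> set L" "u' \<in> {- 1..1}" "\<sigma>' u' = \<sigma> u" "s \<noteq> s' \<or> u \<noteq> u'"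
    using double_sp[OF s(1,2)] real_double[OF assms(1)] s(3) by metis
  show ?thesis by (rule that[OF s s'])
qed

text \<open>Equal imaginary parts give u'^2 = u^2, so u' = -u. The real part is odd and must vanish,
  which for nonzero u means u^2 = 1/2.\<close>

lemma kink_eq:
  fixes v :: real
  assumes v: "v\<^sup>2 = 1 / 2" "0 < v" and u: "u \<in> {- 1..1}" "u' \<in> {- 1..1}" "u \<noteq> u'"
    and eps: "\<epsilon> = 1 \<or> \<epsilon> = - 1" and eq: "kink \<epsilon> u' = kink \<epsilon> u"
  shows "u = v \<and> u' = - v \<or> u = - v \<and> u' = v"
proof -
  have sq: "w\<^sup>2 \<le> 1" if "w \<in> {- 1..1}" for w :: real
    using that by (simp add: abs_square_le_1 abs_le_iff)
  have im: "(1 - u'\<^sup>2)\<^sup>2 = (1 - u\<^sup>2)\<^sup>2" and re: "u' * (1 - 4 * (1 - u'\<^sup>2)\<^sup>2) = u * (1 - 4 * (1 - u\<^sup>2)\<^sup>2)"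
    using eq eps by (auto simp: kink_def)
  have "1 - u'\<^sup>2 = 1 - u\<^sup>2" using power2_eq_imp_eq[OF im] sq u by simp
  then have "u'\<^sup>2 = u\<^sup>2" by simp
  then have u': "u' = - u" using u(3) by (auto simp: power2_eq_iff)
  then have "2 * u * (1 - 4 * (1 - u\<^sup>2)\<^sup>2) = 0" using re by simp
  moreover have "u \<noteq> 0" using u' u(3) by auto
  ultimately have "(1 - u\<^sup>2)\<^sup>2 = (1 / 2)\<^sup>2" by (simp add: power_divide)
  then have "1 - u\<^sup>2 = 1 / 2" by (rule power2_eq_imp_eq) (use sq u in auto)
  then have "u\<^sup>2 = v\<^sup>2" using v by simp
  then show ?thesis using u' by (auto simp: power2_eq_iff)
qed

lemma kink_facts:
  fixes v :: real
  assumes v: "v\<^sup>2 = 1 / 2"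
  shows "kink \<epsilon> (- v) = kink \<epsilon> v" "w = v \<or> w = - v \<Longrightarrow> (kink \<epsilon> has_vector_derivative Complex 4 (- \<epsilon> * w)) (at w)"
proof -
  have "(1 - v\<^sup>2)\<^sup>2 = 1 / 4" unfolding v by (simp add: power2_eq_square)
  then show "kink \<epsilon> (- v) = kink \<epsilon> v" by (simp add: kink_def)
  assume w: "w = v \<or> w = - v"
  then have w2: "w\<^sup>2 = 1 / 2" using v by auto
  have w4: "w * w = 1 / 2" using w2 by (simp add: power2_eq_square)
  have "((\<lambda>u. u * (1 - 4 * (1 - u\<^sup>2)\<^sup>2)) has_real_derivative
      (1 * (1 - 4 * (1 - w\<^sup>2)\<^sup>2) + (- (4 * (2 * (1 - w\<^sup>2) * - (2 * w)))) * w)) (at w)"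
    by (auto intro!: derivative_eq_intros)
  also have "(1 * (1 - 4 * (1 - w\<^sup>2)\<^sup>2) + (- (4 * (2 * (1 - w\<^sup>2) * - (2 * w)))) * w) = 4"
    using w4 by (simp add: w2 power_divide)
  finally have 1: "((\<lambda>u. u * (1 - 4 * (1 - u\<^sup>2)\<^sup>2)) has_real_derivative 4) (at w)" .
  have "((\<lambda>u. \<epsilon> * (1 - u\<^sup>2)\<^sup>2 / 2) has_real_derivative (\<epsilon> * (2 * (1 - w\<^sup>2) * - (2 * w)) / 2)) (at w)"
    by (auto intro!: derivative_eq_intros)
  also have "\<epsilon> * (2 * (1 - w\<^sup>2) * - (2 * w)) / 2 = - \<epsilon> * w" by (simp add: w2)
  finally have 2: "((\<lambda>u. \<epsilon> * (1 - u\<^sup>2)\<^sup>2 / 2) has_real_derivative (- \<epsilon> * w)) (at w)" .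
  have "kink \<epsilon> = (\<lambda>u. Complex (u * (1 - 4 * (1 - u\<^sup>2)\<^sup>2)) (\<epsilon> * (1 - u\<^sup>2)\<^sup>2 / 2))"
    by (simp add: fun_eq_iff kink_def)
  then show "(kink \<epsilon> has_vector_derivative Complex 4 (- \<epsilon> * w)) (at w)"
    using vd_Complex[OF 1 2] by simp
qed

lemma move_I_f_poly:
  assumes D: "is_vdiagram D" and D': "is_vdiagram D'" and mv: "move_I D D'"
  shows "f_poly D' = f_poly D"
proof -
  obtain h s \<epsilon> where h: "orient_diffeo h" "\<epsilon> = 1 \<or> \<epsilon> = - 1" "agree_off [s] D D'"
    "tangle D h [(s, \<lambda>u. Complex u 0)]" "tangle D' h [(s, kink \<epsilon>)]"
    using mv unfolding move_I_def by blast
  interpret tangled_pair D "[(s, \<lambda>u. Complex u 0)]" h D' "[(s, kink \<epsilon>)]" "[s]"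
    by unfold_locales (use D D' h in simp_all)
  define v :: real where "v = sqrt (1 / 2)"
  have v: "v\<^sup>2 = 1 / 2" "0 < v" "v < 1"
    unfolding v_def by (rule real_sqrt_pow2, simp) simp_all
  have D0: "real_params D \<inter> Zs [s] = {}"
  proof -
    have False if x: "x \<in> real_params D" "x \<in> Zs [s]" for x
      using A.real_sp[OF x] by auto
    then show ?thesis by blast
  qed
  let ?x = "sp s (- v)" and ?y = "sp s v"
  have L: "(s, kink \<epsilon>) \<in> set [(s, kink \<epsilon>)]" and I: "- v \<in> {- 1<..<1}" "v \<in> {- 1<..<1}" "- v \<noteq> v" using v by auto
  define \<kappa> where "\<kappa> \<longleftrightarrow> \<epsilon> = - 1"
  have cr: "cross (Complex 4 (- \<epsilon> * - v)) (Complex 4 (- \<epsilon> * v)) = - 8 * \<epsilon> * v"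
    by (simp add: cross_def)
  have cr': "\<kappa> \<longleftrightarrow> 0 < cross (Complex 4 (- \<epsilon> * - v)) (Complex 4 (- \<epsilon> * v))"
    "cross (Complex 4 (- \<epsilon> * - v)) (Complex 4 (- \<epsilon> * v)) \<noteq> 0"
    using h(2) v(2) unfolding cr \<kappa>_def by auto
  note C = L I(1) kink_facts(2)[OF v(1), of "- v" \<epsilon>, OF disjI2[OF refl]] L I(2) kink_facts(2)[OF v(1), of v \<epsilon>, OF disjI1[OF refl]]
    kink_facts(1)[OF v(1)] disjI2[OF I(3)] cr'(2)
  note cx = B.crossing_sp[OF C]
  note px = B.partner_props[OF cx(1), unfolded cx(2)]
  have sub: "real_params D' \<inter> Zs [s] \<subseteq> {?x, ?y}"
  proof
    fix z assume "z \<in> real_params D' \<inter> Zs [s]"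
    then have z: "z \<in> real_params D'" "z \<in> Zs [s]" by auto
    show "z \<in> {?x, ?y}" using B.real_sp[OF z] kink_eq[OF v(1,2) _ _ _ h(2)] by (auto; metis)
  qed
  have Z: "?x \<in> Zs [s]" "?y \<in> Zs [s]" using B.sp_Zs[of s] I by auto
  show ?thesis
  proof (cases "lvl D' ?x = Virt")
    case True
    then have "lvl D' ?y = Virt" using px(8) by auto
    then have "real_params D' \<inter> Zs [s] = {}" using sub True by (auto simp: real_params_def)
    then show ?thesis by (intro f_poly_same_inner) (use D0 in auto)
  next
    case False
    have xr: "?x \<in> real_params D'" using cx(1) False by (simp add: real_params_def)
    then have yr: "?y \<in> real_params D'" using B.real_partner(1)[OF xr] cx(2) by simp
    have inner: "real_params D' \<inter> Zs [s] = (\<Union>s\<in>set [s]. {sp s (- v), sp s v})"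
      using sub xr yr Z by auto
    define c where "c = (if lvl D' ?x = level.Under then ?y else ?x)"
    define e :: int where "e = (if lvl D' ?x = level.Under then 1 else - 1)"
    note spl = B.splice_sp[OF C False cr'(1) c_def e_def]
    obtain F where F: "\<And>z. z \<in> M0 D' [s] \<times> UNIV \<Longrightarrow> F z = z"
      "\<And>t. t \<in> set [s] \<Longrightarrow> F (nd t (- v) False) = nd t (- 1) True \<and> F (nd t (- v) True) = nd t (- v) True \<and>
         F (nd t v False) = nd t (- v) True \<and> F (nd t v True) = nd t 1 False"
      "\<And>t. t \<in> set [s] \<Longrightarrow> nd t (- v) True \<notin> M0 D' [s] \<times> UNIV"
      "bracket D' = ssum (M0 D' [s] \<times> UNIV \<union> (\<lambda>s. nd s (- v) True) ` set [s]) (base_rel D' [s]) (Ov D')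
       (\<lambda>c. relim F (Asp D' c)) (\<lambda>c. relim F (Bsp D' c))"
      by (rule B.bracket_two_inner[of "\<lambda>_. - v" "\<lambda>_. v", OF _ inner]) (use v in auto)
    note Fs = F(2)[of s, simplified]
    let ?p = "nd s (- 1) True" and ?q = "nd s 1 False" and ?m = "nd s (- v) True"
    interpret o: outer "M0 D' [s] \<times> UNIV" "base_rel D' [s]" "Ov D' - Zs [s]" "\<lambda>c. relim F (Asp D' c)" "\<lambda>c. relim F (Bsp D' c)"
      by (rule B.outer_F(3)[OF F(1)])
    have cZ: "Ov D' \<inter> Zs [s] = {c}"
    proof -
      have "Ov D' \<inter> Zs [s] = {?x, ?y} \<inter> Ov D'" using sub Z B.Ov_real by blast
      then show ?thesis using spl(1) by simp
    qed
    then have OvD': "Ov D' = insert c (Ov D' - Zs [s])" by blast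
    \<comment> \<open>The turning sense of the kink decides which splice closes off the small loop,
      so the sign \<open>e\<close> is corrected by \<kappa>.\<close>
    define e' where "e' = (if \<kappa> then e else - e)"
    have e1: "e = 1 \<or> e = - 1" by (simp add: e_def)
    have lk1: "lks [(?m, ?q), (?p, ?m)] = lks [(?p, ?m), (?m, ?q)]" "lks [(?q, ?p), (?m, ?m)] = lks [(?m, ?m), (?p, ?q)]"
      "lks [(?q, ?m), (?m, ?p)] = lks [(?p, ?m), (?m, ?q)]"
      by (simp_all only: lks_pair(1)[of ?m ?q] lks_pair(2)[of ?q ?p] lks_pair(1)[of ?p ?q]
           lks_pair(2)[of ?q ?m] lks_pair(1)[of ?m ?q] lks_pair(2)[of ?m ?p])
    have st: "e' = 1 \<and> relim F (Asp D' c) = lks [(?p, ?m), (?m, ?q)] \<and> relim F (Bsp D' c) = lks [(?m, ?m), (?p, ?q)] \<or>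
      e' = - 1 \<and> relim F (Asp D' c) = lks [(?m, ?m), (?p, ?q)] \<and> relim F (Bsp D' c) = lks [(?p, ?m), (?m, ?q)]"
      using spl(3)[of F] Fs lk1 e1 unfolding e'_def by (cases \<kappa>) auto
    have "bracket D' = ssum (insert ?m (M0 D' [s] \<times> UNIV)) (base_rel D' [s]) (insert c (Ov D' - Zs [s]))
       (\<lambda>c. relim F (Asp D' c)) (\<lambda>c. relim F (Bsp D' c))"
      using F(4) OvD' by simp
    also have "\<dots> = - Apow (- 3 * e') * ssum (M0 D' [s] \<times> UNIV) (base_rel D' [s] \<union> lks [(?p, ?q)]) (Ov D' - Zs [s])
       (\<lambda>c. relim F (Asp D' c)) (\<lambda>c. relim F (Bsp D' c))"
      by (rule o.state_move_I[OF _ _ _ _ st]) (use cZ F(3) B.ends_M0[of s] in auto)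
    also have "ssum (M0 D' [s] \<times> UNIV) (base_rel D' [s] \<union> lks [(?p, ?q)]) (Ov D' - Zs [s])
       (\<lambda>c. relim F (Asp D' c)) (\<lambda>c. relim F (Bsp D' c)) = bracket D"
      unfolding bracket_no_inner_pair[OF D0] by (rule ssum_cong) (simp_all add: B.outer_F(1,2)[OF F(1)])
    finally have br: "bracket D' = - Apow (- 3 * e') * bracket D" .
    have "Ov D \<inter> Zs [s] = {}" using D0 A.Ov_real by blast
    moreover have "(if sg D' c then 1 else - 1 :: int) = - e'"
      using spl(2) e1 unfolding e'_def by auto
    ultimately have wr: "writhe D' = writhe D + - e'" using writhe_pair cZ by simp
    have "- e' = 1 \<or> - e' = - 1" using e1 by (auto simp: e'_def)
    then have "unit_w (writhe D') = - Apow (- 3 * - e') * unit_w (writhe D)" unfolding wr by (rule unit_w_Suc)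
    \<comment> \<open>The minus signs of the two factors cancel; the exponents 3e' and -3e' add up
      to zero.\<close>
    then have "f_poly D' = (Apow (- 3 * - e') * Apow (- 3 * e')) * (unit_w (writhe D) * bracket D)"
      unfolding f_poly_unit br by simp
    then show ?thesis by (simp add: Apow_mult Apow_0 f_poly_unit)
  qed
qed

lemma move_II_f_poly:
  assumes D: "is_vdiagram D" and D': "is_vdiagram D'" and mv: "move_II D D'"
  shows "f_poly D' = f_poly D"
proof -
  let ?line = "\<lambda>u. Complex u 0" and ?up = "\<lambda>u. Complex u (1/2)"
    and ?dip = "\<lambda>u. Complex u (1/2 - (1 - u\<^sup>2)\<^sup>2)"
  obtain h s1 s2 l where h: "orient_diffeo h" "agree_off [s1, s2] D D'"
    "tangle D h [(s1, ?line), (s2, ?up)]" "tangle D' h [(s1, ?line), (s2, ?dip)]"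
    "\<And>x. x \<in> double_params D' \<Longrightarrow> x \<in> strand_set s2 \<Longrightarrow> lvl D' x = l"
    using mv unfolding move_II_def by blast
  let ?ss = "[s1, s2]"
  interpret tangled_pair D "[(s1, ?line), (s2, ?up)]" h D' "[(s1, ?line), (s2, ?dip)]" ?ss
    by unfold_locales (use D D' h in simp_all)
  have ne: "s1 \<noteq> s2" using A.distinct_ss by simp
  \<comment> \<open>The solution in [0, 1] of (1 - u^2)^2 = 1/2, where the pushed strand meets the
    line.\<close>
  define v where "v = sqrt (1 - sqrt (1 / 2))"
  have s12: "sqrt (1 / 2) < 1" "0 < sqrt (1 / 2 :: real)" by simp_all
  have v: "0 < v" "v < 1" "(1 - v\<^sup>2)\<^sup>2 = 1 / 2" "1 - v\<^sup>2 > 0"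
    using s12 by (simp_all add: v_def)
  have solve: "u = v \<or> u = - v" if "u \<in> {- 1..1}" "(1 - u\<^sup>2)\<^sup>2 = 1 / 2" for u :: real
  proof -
    have "u\<^sup>2 \<le> 1" using that(1) by (simp add: abs_square_le_1 abs_le_iff)
    moreover have "(1 - u\<^sup>2)\<^sup>2 = (1 - v\<^sup>2)\<^sup>2" using that v by simp
    ultimately have "1 - u\<^sup>2 = 1 - v\<^sup>2" using v(4) by (auto intro: power2_eq_imp_eq)
    then show ?thesis by (simp add: power2_eq_iff)
  qed
  have D0: "real_params D \<inter> Zs ?ss = {}"
  proof -
    have False if x: "x \<in> real_params D" "x \<in> Zs ?ss" for x
    proof -
      obtain s \<sigma> u s' \<sigma>' u' where
        *: "(s, \<sigma>) \<in> set [(s1, ?line), (s2, ?up)]" "u \<in> {- 1..1}" "x = sp s u"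
          "(s', \<sigma>') \<in> set [(s1, ?line), (s2, ?up)]" "u' \<in> {- 1..1}" "\<sigma>' u' = \<sigma> u" "s \<noteq> s' \<or> u \<noteq> u'"
        by (rule A.real_sp[OF x])
      have "(s = s1 \<and> \<sigma> = ?line \<or> s = s2 \<and> \<sigma> = ?up) \<and> (s' = s1 \<and> \<sigma>' = ?line \<or> s' = s2 \<and> \<sigma>' = ?up)"
        using *(1,4) by simp
      then show False using *(6,7) by (elim conjE disjE; simp)
    qed
    then show ?thesis by blast
  qed
  have L: "(s1, ?line) \<in> set [(s1, ?line), (s2, ?dip)]" "(s2, ?dip) \<in> set [(s1, ?line), (s2, ?dip)]" by auto
  have I: "- v \<in> {- 1<..<1}" "v \<in> {- 1<..<1}" "- v \<noteq> v" using v by auto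
  have d1: "(?line has_vector_derivative Complex 1 0) (at u)" for u
    by (rule vd_Complex) (auto intro!: derivative_eq_intros)
  have d2: "(?dip has_vector_derivative Complex 1 (4 * u * (1 - u\<^sup>2))) (at u)" for u
    by (rule vd_Complex) (auto intro!: derivative_eq_intros simp: algebra_simps)
  have c2: "cross (Complex 1 0) (Complex 1 (4 * u * (1 - u\<^sup>2))) = 4 * u * (1 - u\<^sup>2)" for u
    by (simp add: cross_def)
  have cn: "cross (Complex 1 0) (Complex 1 (4 * (- v) * (1 - (- v)\<^sup>2))) < 0"
    "0 < cross (Complex 1 0) (Complex 1 (4 * v * (1 - v\<^sup>2)))"
    unfolding c2 using v by (simp_all add: mult_neg_pos)
  have cn': "cross (Complex 1 0) (Complex 1 (4 * (- v) * (1 - (- v)\<^sup>2))) \<noteq> 0" "cross (Complex 1 0) (Complex 1 (4 * v * (1 - v\<^sup>2))) \<noteq> 0"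
    "False \<longleftrightarrow> 0 < cross (Complex 1 0) (Complex 1 (4 * (- v) * (1 - (- v)\<^sup>2)))" "True \<longleftrightarrow> 0 < cross (Complex 1 0) (Complex 1 (4 * v * (1 - v\<^sup>2)))"
    using cn by simp_all
  have meet: "?line (- v) = ?dip (- v)" "?line v = ?dip v" using v(3) by simp_all
  note C1 = L(1) I(1) d1 L(2) I(1) d2 meet(1) disjI1[OF ne] cn'(1)
  note C2 = L(1) I(2) d1 L(2) I(2) d2 meet(2) disjI1[OF ne] cn'(2)
  note x1 = B.crossing_sp[OF C1] and x2 = B.crossing_sp[OF C2]
  have sub: "real_params D' \<inter> Zs ?ss \<subseteq> {sp s1 (- v), sp s1 v, sp s2 (- v), sp s2 v}"
  proof
    fix z assume "z \<in> real_params D' \<inter> Zs ?ss"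
    then have z: "z \<in> real_params D'" "z \<in> Zs ?ss" by auto
    obtain s \<sigma> u s' \<sigma>' u' where
      *: "(s, \<sigma>) \<in> set [(s1, ?line), (s2, ?dip)]" "u \<in> {- 1..1}" "z = sp s u"
        "(s', \<sigma>') \<in> set [(s1, ?line), (s2, ?dip)]" "u' \<in> {- 1..1}" "\<sigma>' u' = \<sigma> u" "s \<noteq> s' \<or> u \<noteq> u'"
      by (rule B.real_sp[OF z])
    have "(s = s1 \<and> \<sigma> = ?line \<or> s = s2 \<and> \<sigma> = ?dip) \<and> (s' = s1 \<and> \<sigma>' = ?line \<or> s' = s2 \<and> \<sigma>' = ?dip)"
      using *(1,4) by simp
    then have "(s = s1 \<or> s = s2) \<and> (1 - u\<^sup>2)\<^sup>2 = 1 / 2" using *(6,7) by (elim conjE disjE; auto)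
    then show "z \<in> {sp s1 (- v), sp s1 v, sp s2 (- v), sp s2 v}" using solve[OF *(2)] *(3) by auto
  qed
  have Z: "sp s1 (- v) \<in> Zs ?ss" "sp s1 v \<in> Zs ?ss" "sp s2 (- v) \<in> Zs ?ss" "sp s2 v \<in> Zs ?ss"
    using B.sp_Zs[of s1] B.sp_Zs[of s2] I by auto
  note p1 = B.partner_props[OF x1(1), unfolded x1(2)] and p2 = B.partner_props[OF x2(1), unfolded x2(2)]
  have l: "lvl D' (sp s2 (- v)) = l" "lvl D' (sp s2 v) = l"
    using h(5)[OF p1(5)] h(5)[OF p2(5)] B.sp_in[of s2] I by auto
  show ?thesis
  proof (cases "l = Virt")
    case True
    then have "lvl D' (sp s1 (- v)) = Virt" "lvl D' (sp s1 v) = Virt" using p1(8) p2(8) l by auto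
    then have "real_params D' \<inter> Zs ?ss = {}" using sub True l by (auto simp: real_params_def)
    then show ?thesis by (intro f_poly_same_inner) (use D0 in auto)
  next
    case False
    have V: "lvl D' (sp s1 (- v)) \<noteq> Virt" "lvl D' (sp s1 v) \<noteq> Virt" and same: "lvl D' (sp s1 v) = lvl D' (sp s1 (- v))"
      using p1(8) p2(8) l False by auto
    have r: "sp s1 (- v) \<in> real_params D'" "sp s1 v \<in> real_params D'" using x1(1) x2(1) V by (auto simp: real_params_def)
    then have r': "sp s2 (- v) \<in> real_params D'" "sp s2 v \<in> real_params D'"
      using B.real_partner(1)[OF r(1)] B.real_partner(1)[OF r(2)] x1(2) x2(2) by auto
    have inner: "real_params D' \<inter> Zs ?ss = (\<Union>s\<in>set ?ss. {sp s (- v), sp s v})"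
      using sub r r' Z by auto
    define c1 where "c1 = (if lvl D' (sp s1 (- v)) = level.Under then sp s2 (- v) else sp s1 (- v))"
    define c2 where "c2 = (if lvl D' (sp s1 v) = level.Under then sp s2 v else sp s1 v)"
    define e :: int where "e = (if lvl D' (sp s1 (- v)) = level.Under then 1 else - 1)"
    \<comment> \<open>The second strand has the same level at both crossings, so one sign
      \<open>e\<close> serves for both.\<close>
    have e_def2: "e = (if lvl D' (sp s1 v) = level.Under then 1 else - 1)" using same by (simp add: e_def)
    note spl1 = B.splice_sp[OF C1 V(1) cn'(3) c1_def e_def]
    note spl2 = B.splice_sp[OF C2 V(2) cn'(4) c2_def e_def2]
    obtain F where F: "\<And>z. z \<in> M0 D' ?ss \<times> UNIV \<Longrightarrow> F z = z"
      "\<And>t. t \<in> set ?ss \<Longrightarrow> F (nd t (- v) False) = nd t (- 1) True \<and> F (nd t (- v) True) = nd t (- v) True \<and>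
         F (nd t v False) = nd t (- v) True \<and> F (nd t v True) = nd t 1 False"
      "\<And>t. t \<in> set ?ss \<Longrightarrow> nd t (- v) True \<notin> M0 D' ?ss \<times> UNIV"
      "bracket D' = ssum (M0 D' ?ss \<times> UNIV \<union> (\<lambda>s. nd s (- v) True) ` set ?ss) (base_rel D' ?ss) (Ov D')
       (\<lambda>c. relim F (Asp D' c)) (\<lambda>c. relim F (Bsp D' c))"
      by (rule B.bracket_two_inner[of "\<lambda>_. - v" "\<lambda>_. v", OF _ inner]) (use v in auto)
    have ins: "s1 \<in> set ?ss" "s2 \<in> set ?ss" by simp_all
    note F1 = F(2)[OF ins(1)] and F2 = F(2)[OF ins(2)]
    let ?p1 = "nd s1 (- 1) True" and ?q1 = "nd s1 1 False" and ?m1 = "nd s1 (- v) True"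
    let ?p2 = "nd s2 (- 1) True" and ?q2 = "nd s2 1 False" and ?m2 = "nd s2 (- v) True"
    interpret o: outer "M0 D' ?ss \<times> UNIV" "base_rel D' ?ss" "Ov D' - Zs ?ss" "\<lambda>c. relim F (Asp D' c)" "\<lambda>c. relim F (Bsp D' c)"
      by (rule B.outer_F(3)[OF F(1)])
    have cZ: "Ov D' \<inter> Zs ?ss = {c1, c2}"
    proof -
      have "Ov D' \<inter> Zs ?ss = ({sp s1 (- v), sp s2 (- v)} \<inter> Ov D') \<union> ({sp s1 v, sp s2 v} \<inter> Ov D')"
        using sub Z B.Ov_real by blast
      then show ?thesis using spl1(1) spl2(1) by auto
    qed
    then have OvD': "Ov D' = insert c1 (insert c2 (Ov D' - Zs ?ss))" by blast
    have cz: "c1 \<in> Ov D' \<inter> Zs ?ss" "c2 \<in> Ov D' \<inter> Zs ?ss" unfolding cZ by simp_all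
    have neq: "c1 \<noteq> c2"
      using B.sp_eq_iff[OF ins(1) ins(1), of v "- v"] B.sp_eq_iff[OF ins(1) ins(2), of v "- v"] B.sp_eq_iff[OF ins(1) ins(2), of "- v" v]
        B.sp_eq_iff[OF ins(2) ins(2), of v "- v"] v ne by (auto simp: c1_def c2_def)
    have st1: "e = 1 \<and> relim F (Asp D' c1) = lks [(?p1, ?m2), (?m1, ?p2)] \<and> relim F (Bsp D' c1) = lks [(?p1, ?p2), (?m1, ?m2)] \<or>
      e = - 1 \<and> relim F (Asp D' c1) = lks [(?p1, ?p2), (?m1, ?m2)] \<and> relim F (Bsp D' c1) = lks [(?p1, ?m2), (?m1, ?p2)]"
    proof -
      have "lks [(?m1, ?p2), (?p1, ?m2)] = lks [(?p1, ?m2), (?m1, ?p2)]" "lks [(?m2, ?m1), (?p2, ?p1)] = lks [(?p1, ?p2), (?m1, ?m2)]"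
        by (rule lks_pair(1)) (subst lks_pair(1), subst lks_pair(2), subst lks_pair(3), rule refl)
      then show ?thesis using spl1(3)[of F] F1 F2 by simp
    qed
    have st2: "e = 1 \<and> relim F (Asp D' c2) = lks [(?m1, ?m2), (?q1, ?q2)] \<and> relim F (Bsp D' c2) = lks [(?m1, ?q2), (?q1, ?m2)] \<or>
      e = - 1 \<and> relim F (Asp D' c2) = lks [(?m1, ?q2), (?q1, ?m2)] \<and> relim F (Bsp D' c2) = lks [(?m1, ?m2), (?q1, ?q2)]"
    proof -
      have "lks [(?q1, ?q2), (?m1, ?m2)] = lks [(?m1, ?m2), (?q1, ?q2)]" "lks [(?q2, ?m1), (?m2, ?q1)] = lks [(?m1, ?q2), (?q1, ?m2)]"
        by (rule lks_pair(1)) (subst lks_pair(2), subst lks_pair(3), rule refl)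
      then show ?thesis using spl2(3)[of F] F1 F2 by simp
    qed
    have mne: "?m1 \<noteq> ?m2" using B.nd_eq_iff[OF ins, of "- v" "- v" True True] v ne by auto
    have "bracket D' = ssum (insert ?m1 (insert ?m2 (M0 D' ?ss \<times> UNIV))) (base_rel D' ?ss) (insert c1 (insert c2 (Ov D' - Zs ?ss)))
       (\<lambda>c. relim F (Asp D' c)) (\<lambda>c. relim F (Bsp D' c))"
      using F(4) OvD' by (simp add: Un_commute insert_commute)
    also have "\<dots> = ssum (M0 D' ?ss \<times> UNIV) (base_rel D' ?ss \<union> lks [(?p1, ?q1), (?p2, ?q2)]) (Ov D' - Zs ?ss)
       (\<lambda>c. relim F (Asp D' c)) (\<lambda>c. relim F (Bsp D' c))"
    proof (rule o.state_move_II[OF _ _ neq _ _ mne _ _ _ _ st1 st2])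
      show "c1 \<notin> Ov D' - Zs ?ss" "c2 \<notin> Ov D' - Zs ?ss" using cz by simp_all
      show "?m1 \<notin> M0 D' ?ss \<times> UNIV" by (rule F(3)[OF ins(1)])
      show "?m2 \<notin> M0 D' ?ss \<times> UNIV" by (rule F(3)[OF ins(2)])
    qed (rule B.ends_M0; simp)+
    also have "\<dots> = bracket D"
      unfolding bracket_no_inner_pair[OF D0] by (rule ssum_cong) (simp_all add: B.outer_F(1,2)[OF F(1)])
    finally have br: "bracket D' = bracket D" .
    have "Ov D \<inter> Zs ?ss = {}" using D0 A.Ov_real by blast
    \<comment> \<open>The two new crossings have opposite signs, so the writhe does not
      change.\<close>
    moreover have "sg D' c1 \<longleftrightarrow> \<not> sg D' c2" using spl1(2) spl2(2) by auto
    ultimately have "writhe D' = writhe D" using writhe_pair cZ neq by simp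
    then show ?thesis by (simp add: f_poly_unit br)
  qed
qed

text \<open>The parameter at which the third strand meets the diagonal. On [0, 1] one side of the
  equation increases and the other decreases; a negative solution is impossible because (1 - u^2)^2
  is nonnegative.\<close>

lemma move_III_root:
  obtains r :: real where "0 < r" "r < 1" "r = (1 - r\<^sup>2)\<^sup>2 / 2"
    "\<And>u. u \<in> {- 1..1} \<Longrightarrow> u = (1 - u\<^sup>2)\<^sup>2 / 2 \<Longrightarrow> u = r"
proof -
  let ?g = "\<lambda>u :: real. u - (1 - u\<^sup>2)\<^sup>2 / 2"
  have "\<exists>r\<ge>0. r \<le> 1 \<and> ?g r = 0"
    by (rule IVT') (auto intro!: continuous_intros)
  then obtain r :: real where r: "0 \<le> r" "r \<le> 1" "r = (1 - r\<^sup>2)\<^sup>2 / 2" by auto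
  have "r \<noteq> 0" "r \<noteq> 1" using r(3) by auto
  have mono: "(1 - b\<^sup>2)\<^sup>2 \<le> (1 - a\<^sup>2)\<^sup>2" if "0 \<le> a" "a \<le> b" "b \<le> 1" for a b :: real
    using that by (intro power_mono) (auto simp: power_le_one power_mono)
  have uniq: "u = r" if u: "u \<in> {- 1..1}" "u = (1 - u\<^sup>2)\<^sup>2 / 2" for u
  proof -
    have "0 \<le> u" using u(2) by (metis divide_nonneg_pos zero_le_power2 zero_less_numeral)
    then show ?thesis
      using mono[of u r] mono[of r u] r u by (cases u r rule: linorder_cases) auto
  qed
  show ?thesis by (rule that[of r]) (use r \<open>r \<noteq> 0\<close> \<open>r \<noteq> 1\<close> uniq in auto)
qed

lemma move_III_f_poly:
  assumes D: "is_vdiagram D" and D': "is_vdiagram D'" and mv: "move_III D D'"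
  shows "f_poly D' = f_poly D"
proof -
  let ?d = "\<lambda>u. Complex u u" and ?a = "\<lambda>u. Complex u (- u)"
    and ?b = "\<lambda>u. Complex u ((1 - u\<^sup>2)\<^sup>2 / 2)" and ?b' = "\<lambda>u. Complex u (- ((1 - u\<^sup>2)\<^sup>2 / 2))"
  obtain h s1 s2 s3 l where h: "orient_diffeo h" "agree_off [s1, s2, s3] D D'"
    "tangle D h [(s1, ?d), (s2, ?a), (s3, ?b)]" "tangle D' h [(s1, ?d), (s2, ?a), (s3, ?b')]"
    "\<And>x. x \<in> double_params D \<Longrightarrow> x \<in> strand_set s3 \<Longrightarrow> lvl D x = l"
    "\<And>x. x \<in> double_params D' \<Longrightarrow> x \<in> strand_set s3 \<Longrightarrow> lvl D' x = l"
    "lvl D' (strand_mid s1) = lvl D (strand_mid s1)" "l = Virt \<or> lvl D (strand_mid s1) \<noteq> Virt"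
    using mv unfolding move_III_def by blast
  let ?ss = "[s1, s2, s3]" and ?L = "[(s1, ?d), (s2, ?a), (s3, ?b)]" and ?L' = "[(s1, ?d), (s2, ?a), (s3, ?b')]"
  interpret tangled_pair D ?L h D' ?L' ?ss
    by unfold_locales (use D D' h in simp_all)
  have ne: "s1 \<noteq> s2" "s1 \<noteq> s3" "s2 \<noteq> s3" "s3 \<noteq> s1" "s3 \<noteq> s2" "s2 \<noteq> s1" using A.distinct_ss by auto
  have ins: "s1 \<in> set ?ss" "s2 \<in> set ?ss" "s3 \<in> set ?ss" by simp_all
  obtain r :: real where r: "0 < r" "r < 1" "r = (1 - r\<^sup>2)\<^sup>2 / 2"
    "\<And>u. u \<in> {- 1..1} \<Longrightarrow> u = (1 - u\<^sup>2)\<^sup>2 / 2 \<Longrightarrow> u = r" by (rule move_III_root) blast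
  have r': "u = - r" if "u \<in> {- 1..1}" "- u = (1 - u\<^sup>2)\<^sup>2 / 2" for u
  proof -
    have "- u = r" by (rule r(4)) (use that in simp_all)
    then show ?thesis by simp
  qed
  have I: "- r \<in> {- 1<..<1}" "r \<in> {- 1<..<1}" "0 \<in> {- 1<..<(1 :: real)}" using r by auto
  have I': "- r \<in> {- 1..1}" "r \<in> {- 1..1}" "0 \<in> {- 1..(1 :: real)}" using r by auto
  have mid: "strand_mid s1 = sp s1 0" by (cases s1) (simp add: sp.simps field_simps)
  have dd: "(?d has_vector_derivative Complex 1 1) (at u)" for u
    by (rule vd_Complex) (auto intro!: derivative_eq_intros)
  have da: "(?a has_vector_derivative Complex 1 (- 1)) (at u)" for u
    by (rule vd_Complex) (auto intro!: derivative_eq_intros)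
  have db: "(?b has_vector_derivative Complex 1 (- (2 * u * (1 - u\<^sup>2)))) (at u)" for u
    by (rule vd_Complex) (auto intro!: derivative_eq_intros simp: field_simps)
  have db': "(?b' has_vector_derivative Complex 1 (2 * u * (1 - u\<^sup>2))) (at u)" for u
    by (rule vd_Complex) (auto intro!: derivative_eq_intros simp: field_simps)
  have pos: "0 < 2 * r * (1 - r\<^sup>2)" using r by (simp add: power_less_one_iff)
  have k12: "cross (Complex 1 1) (Complex 1 (- 1)) \<noteq> 0" "False \<longleftrightarrow> 0 < cross (Complex 1 1) (Complex 1 (- 1))"
    by (simp_all add: cross_def)
  have k13: "cross (Complex 1 (- (2 * r * (1 - r\<^sup>2)))) (Complex 1 1) \<noteq> 0" "True \<longleftrightarrow> 0 < cross (Complex 1 (- (2 * r * (1 - r\<^sup>2)))) (Complex 1 1)"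
    using pos by (simp_all add: cross_def)
  have k23: "cross (Complex 1 (- (2 * (- r) * (1 - (- r)\<^sup>2)))) (Complex 1 (- 1)) \<noteq> 0"
    "False \<longleftrightarrow> 0 < cross (Complex 1 (- (2 * (- r) * (1 - (- r)\<^sup>2)))) (Complex 1 (- 1))"
    using pos by (simp_all add: cross_def)
  have k13': "cross (Complex 1 (2 * (- r) * (1 - (- r)\<^sup>2))) (Complex 1 1) \<noteq> 0"
    "True \<longleftrightarrow> 0 < cross (Complex 1 (2 * (- r) * (1 - (- r)\<^sup>2))) (Complex 1 1)"
    using pos by (simp_all add: cross_def)
  have k23': "cross (Complex 1 (2 * r * (1 - r\<^sup>2))) (Complex 1 (- 1)) \<noteq> 0"
    "False \<longleftrightarrow> 0 < cross (Complex 1 (2 * r * (1 - r\<^sup>2))) (Complex 1 (- 1))"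
    using pos by (simp_all add: cross_def)
  have m12: "?d 0 = ?a 0" by simp
  have m13: "?b r = ?d r" and m23: "?b (- r) = ?a (- r)" and m13': "?b' (- r) = ?d (- r)" and m23': "?b' r = ?a r"
    using r(3) by simp_all
  have L: "(s1, ?d) \<in> set ?L" "(s2, ?a) \<in> set ?L" "(s3, ?b) \<in> set ?L" by simp_all
  have L': "(s1, ?d) \<in> set ?L'" "(s2, ?a) \<in> set ?L'" "(s3, ?b') \<in> set ?L'" by simp_all
  note C12 = L(1) I(3) dd L(2) I(3) da m12 disjI1[OF ne(1)] k12(1)
  note C13 = L(3) I(2) db L(1) I(2) dd m13 disjI1[OF ne(4)] k13(1)
  note C23 = L(3) I(1) db L(2) I(1) da m23 disjI1[OF ne(5)] k23(1)
  note C12' = L'(1) I(3) dd L'(2) I(3) da m12 disjI1[OF ne(1)] k12(1)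
  note C13' = L'(3) I(1) db' L'(1) I(1) dd m13' disjI1[OF ne(4)] k13'(1)
  note C23' = L'(3) I(2) db' L'(2) I(2) da m23' disjI1[OF ne(5)] k23'(1)
  note x12 = A.crossing_sp[OF C12] and x13 = A.crossing_sp[OF C13] and x23 = A.crossing_sp[OF C23]
  note x12' = B.crossing_sp[OF C12'] and x13' = B.crossing_sp[OF C13'] and x23' = B.crossing_sp[OF C23']
  note q12 = A.partner_props[OF x12(1), unfolded x12(2)] and q13 = A.partner_props[OF x13(1), unfolded x13(2)]
    and q23 = A.partner_props[OF x23(1), unfolded x23(2)]
  note q12' = B.partner_props[OF x12'(1), unfolded x12'(2)] and q13' = B.partner_props[OF x13'(1), unfolded x13'(2)]
    and q23' = B.partner_props[OF x23'(1), unfolded x23'(2)]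
  have in3: "sp s3 r \<in> strand_set s3" "sp s3 (- r) \<in> strand_set s3" using A.sp_in[OF ins(3)] I' by blast+
  have l3: "lvl D (sp s3 r) = l" "lvl D (sp s3 (- r)) = l" "lvl D' (sp s3 r) = l" "lvl D' (sp s3 (- r)) = l"
    using h(5)[OF x13(1) in3(1)] h(5)[OF x23(1) in3(2)] h(6)[OF x23'(1) in3(1)] h(6)[OF x13'(1) in3(2)] .
  have l12: "lvl D' (sp s1 0) = lvl D (sp s1 0)" using h(7) mid by simp
  have l12': "lvl D' (sp s2 0) = lvl D (sp s2 0)" using q12(8) q12'(8) l12 by auto
  have sub: "real_params D \<inter> Zs ?ss \<subseteq> {sp s1 0, sp s2 0, sp s3 r, sp s1 r, sp s3 (- r), sp s2 (- r)}"
  proof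
    fix z assume "z \<in> real_params D \<inter> Zs ?ss"
    then have z: "z \<in> real_params D" "z \<in> Zs ?ss" by auto
    obtain s \<sigma> u s' \<sigma>' u' where
      *: "(s, \<sigma>) \<in> set ?L" "u \<in> {- 1..1}" "z = sp s u" "(s', \<sigma>') \<in> set ?L" "u' \<in> {- 1..1}"
        "\<sigma>' u' = \<sigma> u" "s \<noteq> s' \<or> u \<noteq> u'"
      by (rule A.real_sp[OF z])
    have "(s = s1 \<and> \<sigma> = ?d \<or> s = s2 \<and> \<sigma> = ?a \<or> s = s3 \<and> \<sigma> = ?b) \<and>
        (s' = s1 \<and> \<sigma>' = ?d \<or> s' = s2 \<and> \<sigma>' = ?a \<or> s' = s3 \<and> \<sigma>' = ?b)"
      using *(1,4) by simp
    note cases = this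
    have "Re (\<sigma> u) = u" "Re (\<sigma>' u') = u'" using cases by (elim conjE disjE; simp)+
    then have u': "u' = u" using *(6) by metis
    have ss: "s \<noteq> s'" using *(7) u' by simp
    have e: "Im (\<sigma>' u) = Im (\<sigma> u)" using *(6) unfolding u' by simp
    define w where "w = (1 - u\<^sup>2)\<^sup>2 / 2"
    have im: "(s = s1 \<and> Im (\<sigma> u) = u \<or> s = s2 \<and> Im (\<sigma> u) = - u \<or> s = s3 \<and> Im (\<sigma> u) = w) \<and>
        (s' = s1 \<and> Im (\<sigma>' u) = u \<or> s' = s2 \<and> Im (\<sigma>' u) = - u \<or> s' = s3 \<and> Im (\<sigma>' u) = w)"
      using cases by (elim conjE disjE; simp add: w_def)
    have "s = s1 \<and> (u = 0 \<or> u = (1 - u\<^sup>2)\<^sup>2 / 2) \<or> s = s2 \<and> (u = 0 \<or> - u = (1 - u\<^sup>2)\<^sup>2 / 2) \<or>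
        s = s3 \<and> (u = (1 - u\<^sup>2)\<^sup>2 / 2 \<or> - u = (1 - u\<^sup>2)\<^sup>2 / 2)"
      unfolding w_def[symmetric] using im ss e by (smt (verit))
    then have "s = s1 \<and> (u = 0 \<or> u = r) \<or> s = s2 \<and> (u = 0 \<or> u = - r) \<or> s = s3 \<and> (u = r \<or> u = - r)"
      using r(4)[OF *(2)] r'[OF *(2)] by blast
    then show "z \<in> {sp s1 0, sp s2 0, sp s3 r, sp s1 r, sp s3 (- r), sp s2 (- r)}"
      unfolding *(3) by (elim disjE conjE; simp)
  qed
  have sub': "real_params D' \<inter> Zs ?ss \<subseteq> {sp s1 0, sp s2 0, sp s3 (- r), sp s1 (- r), sp s3 r, sp s2 r}"
  proof
    fix z assume "z \<in> real_params D' \<inter> Zs ?ss"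
    then have z: "z \<in> real_params D'" "z \<in> Zs ?ss" by auto
    obtain s \<sigma> u s' \<sigma>' u' where
      *: "(s, \<sigma>) \<in> set ?L'" "u \<in> {- 1..1}" "z = sp s u" "(s', \<sigma>') \<in> set ?L'" "u' \<in> {- 1..1}"
        "\<sigma>' u' = \<sigma> u" "s \<noteq> s' \<or> u \<noteq> u'"
      by (rule B.real_sp[OF z])
    have "(s = s1 \<and> \<sigma> = ?d \<or> s = s2 \<and> \<sigma> = ?a \<or> s = s3 \<and> \<sigma> = ?b') \<and>
        (s' = s1 \<and> \<sigma>' = ?d \<or> s' = s2 \<and> \<sigma>' = ?a \<or> s' = s3 \<and> \<sigma>' = ?b')"
      using *(1,4) by simp
    note cases = this
    have "Re (\<sigma> u) = u" "Re (\<sigma>' u') = u'" using cases by (elim conjE disjE; simp)+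
    then have u': "u' = u" using *(6) by metis
    have ss: "s \<noteq> s'" using *(7) u' by simp
    have e: "Im (\<sigma>' u) = Im (\<sigma> u)" using *(6) unfolding u' by simp
    define w where "w = (1 - u\<^sup>2)\<^sup>2 / 2"
    have im: "(s = s1 \<and> Im (\<sigma> u) = u \<or> s = s2 \<and> Im (\<sigma> u) = - u \<or> s = s3 \<and> Im (\<sigma> u) = - w) \<and>
        (s' = s1 \<and> Im (\<sigma>' u) = u \<or> s' = s2 \<and> Im (\<sigma>' u) = - u \<or> s' = s3 \<and> Im (\<sigma>' u) = - w)"
      using cases by (elim conjE disjE; simp add: w_def)
    have "s = s1 \<and> (u = 0 \<or> - u = (1 - u\<^sup>2)\<^sup>2 / 2) \<or> s = s2 \<and> (u = 0 \<or> u = (1 - u\<^sup>2)\<^sup>2 / 2) \<or>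
        s = s3 \<and> (u = (1 - u\<^sup>2)\<^sup>2 / 2 \<or> - u = (1 - u\<^sup>2)\<^sup>2 / 2)"
      unfolding w_def[symmetric] using im ss e by (smt (verit))
    then have "s = s1 \<and> (u = 0 \<or> u = - r) \<or> s = s2 \<and> (u = 0 \<or> u = r) \<or> s = s3 \<and> (u = r \<or> u = - r)"
      using r(4)[OF *(2)] r'[OF *(2)] by blast
    then show "z \<in> {sp s1 0, sp s2 0, sp s3 (- r), sp s1 (- r), sp s3 r, sp s2 r}"
      unfolding *(3) by (elim disjE conjE; simp)
  qed
  have Z: "sp t 0 \<in> Zs ?ss" "sp t r \<in> Zs ?ss" "sp t (- r) \<in> Zs ?ss" if "t \<in> set ?ss" for t
    using A.sp_Zs[OF that] I' by blast+
  show ?thesis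
  \<comment> \<open>For a virtual third strand, only the crossing of the first two strands can be
    real, and it keeps its parameters, levels and sign.\<close>
  proof (cases "l = Virt")
    case True
    have v: "lvl D (sp s1 r) = Virt" "lvl D (sp s2 (- r)) = Virt" "lvl D' (sp s1 (- r)) = Virt" "lvl D' (sp s2 r) = Virt"
      using q13(8) q23(8) q13'(8) q23'(8) l3 True by auto
    have R: "real_params D \<inter> Zs ?ss = {x \<in> {sp s1 0, sp s2 0}. lvl D x \<noteq> Virt}"
      using sub v l3 True x12(1) q12(5) Z(1)[OF ins(1)] Z(1)[OF ins(2)] by (auto simp: real_params_def)
    have R': "real_params D' \<inter> Zs ?ss = {x \<in> {sp s1 0, sp s2 0}. lvl D' x \<noteq> Virt}"
      using sub' v l3 True x12'(1) q12'(5) Z(1)[OF ins(1)] Z(1)[OF ins(2)] by (auto simp: real_params_def)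
    show ?thesis
    proof (rule f_poly_same_inner)
      show "real_params D' \<inter> Zs ?ss = real_params D \<inter> Zs ?ss" unfolding R R' using l12 l12' by auto
      fix x assume "x \<in> real_params D" "x \<in> Zs ?ss"
      then have "x = sp s1 0 \<or> x = sp s2 0" using R by blast
      then show "partner D' x = partner D x \<and> lvl D' x = lvl D x \<and> sg D' x = sg D x"
        using x12 x12' q12(6,9) q12'(6,9) l12 l12' by auto
    qed
  next
    case False
    then have V12: "lvl D (sp s1 0) \<noteq> Virt" "lvl D' (sp s1 0) \<noteq> Virt" using h(8) mid l12 by auto
    have V3: "lvl D (sp s3 r) \<noteq> Virt" "lvl D (sp s3 (- r)) \<noteq> Virt" "lvl D' (sp s3 r) \<noteq> Virt" "lvl D' (sp s3 (- r)) \<noteq> Virt"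
      using l3 False by auto
    have R12: "sp s1 0 \<in> real_params D" "sp s3 r \<in> real_params D" "sp s3 (- r) \<in> real_params D"
      "sp s1 0 \<in> real_params D'" "sp s3 (- r) \<in> real_params D'" "sp s3 r \<in> real_params D'"
      using x12(1) x13(1) x23(1) x12'(1) x13'(1) x23'(1) V12 V3 by (simp_all add: real_params_def)
    have R21: "sp s2 0 \<in> real_params D" "sp s1 r \<in> real_params D" "sp s2 (- r) \<in> real_params D"
      "sp s2 0 \<in> real_params D'" "sp s1 (- r) \<in> real_params D'" "sp s2 r \<in> real_params D'"
      using A.real_partner(1)[OF R12(1)] A.real_partner(1)[OF R12(2)] A.real_partner(1)[OF R12(3)]
        B.real_partner(1)[OF R12(4)] B.real_partner(1)[OF R12(5)] B.real_partner(1)[OF R12(6)]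
      unfolding x12(2) x13(2) x23(2) x12'(2) x13'(2) x23'(2) .
    define w :: int where "w = (if lvl D (sp s1 0) = level.Under then 1 else - 1)"
    define e :: int where "e = (if l = level.Under then 1 else - 1)"
    have w': "w = (if lvl D' (sp s1 0) = level.Under then 1 else - 1)" by (simp add: w_def l12)
    have e1: "e = (if lvl D (sp s3 r) = level.Under then 1 else - 1)" "e = (if lvl D (sp s3 (- r)) = level.Under then 1 else - 1)"
      "e = (if lvl D' (sp s3 r) = level.Under then 1 else - 1)" "e = (if lvl D' (sp s3 (- r)) = level.Under then 1 else - 1)"
      using l3 by (simp_all add: e_def)
    define c12 where "c12 = (if lvl D (sp s1 0) = level.Under then sp s2 0 else sp s1 0)"
    define c13 where "c13 = (if lvl D (sp s3 r) = level.Under then sp s1 r else sp s3 r)"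
    define c23 where "c23 = (if lvl D (sp s3 (- r)) = level.Under then sp s2 (- r) else sp s3 (- r))"
    define d12 where "d12 = (if lvl D' (sp s1 0) = level.Under then sp s2 0 else sp s1 0)"
    define d13 where "d13 = (if lvl D' (sp s3 (- r)) = level.Under then sp s1 (- r) else sp s3 (- r))"
    define d23 where "d23 = (if lvl D' (sp s3 r) = level.Under then sp s2 r else sp s3 r)"
    note t12 = A.splice_sp[OF C12 V12(1) k12(2) c12_def w_def] and t13 = A.splice_sp[OF C13 V3(1) k13(2) c13_def e1(1)]
      and t23 = A.splice_sp[OF C23 V3(2) k23(2) c23_def e1(2)]
    note t12' = B.splice_sp[OF C12' V12(2) k12(2) d12_def w'] and t13' = B.splice_sp[OF C13' V3(4) k13'(2) d13_def e1(4)]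
      and t23' = B.splice_sp[OF C23' V3(3) k23'(2) d23_def e1(3)]
    have cZ: "Ov D \<inter> Zs ?ss = {c12, c13, c23}"
    proof -
      have "Ov D \<inter> Zs ?ss = ({sp s1 0, sp s2 0} \<inter> Ov D) \<union> ({sp s3 r, sp s1 r} \<inter> Ov D) \<union> ({sp s3 (- r), sp s2 (- r)} \<inter> Ov D)"
        using sub Z ins A.Ov_real by blast
      then show ?thesis unfolding t12(1) t13(1) t23(1) by auto
    qed
    have cZ': "Ov D' \<inter> Zs ?ss = {d12, d13, d23}"
    proof -
      have "Ov D' \<inter> Zs ?ss = ({sp s1 0, sp s2 0} \<inter> Ov D') \<union> ({sp s3 (- r), sp s1 (- r)} \<inter> Ov D') \<union> ({sp s3 r, sp s2 r} \<inter> Ov D')"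
        using sub' Z ins B.Ov_real by blast
      then show ?thesis unfolding t12'(1) t13'(1) t23'(1) by auto
    qed
    have OvD: "Ov D = insert c12 (insert c13 (insert c23 (Ov D - Zs ?ss)))" using cZ by blast
    have OvD': "Ov D' = insert d12 (insert d13 (insert d23 (Ov D' - Zs ?ss)))" using cZ' by blast
    have spne: "sp a x \<noteq> sp b y" if "a \<in> set ?ss" "b \<in> set ?ss" "x \<in> {- 1..1}" "y \<in> {- 1..1}" "a \<noteq> b \<or> x \<noteq> y" for a b x y
      using A.sp_eq_iff[OF that(1-4)] that(5) by blast
    have cne: "c12 \<noteq> c13" "c12 \<noteq> c23" "c13 \<noteq> c23"
      unfolding c12_def c13_def c23_def using spne ins ne I' r(1) by (auto split: if_split)
    have dne: "d12 \<noteq> d13" "d12 \<noteq> d23" "d13 \<noteq> d23"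
      unfolding d12_def d13_def d23_def using spne ins ne I' r(1) by (auto split: if_split)
    \<comment> \<open>Earlier and later crossing parameter on each strand. The first two strands
      meet at 0. The third meets the second at -r and the first at r before the move, and the other
      way round after it.\<close>
    define u where "u s = (if s = s1 then 0 else - r)" for s
    define v where "v s = (if s = s2 then 0 else r)" for s
    define u' where "u' s = (if s = s2 then 0 else - r)" for s
    define v' where "v' s = (if s = s1 then 0 else r)" for s
    have uv: "u s1 = 0" "u s2 = - r" "u s3 = - r" "v s1 = r" "v s2 = 0" "v s3 = r"
      "u' s1 = - r" "u' s2 = 0" "u' s3 = - r" "v' s1 = 0" "v' s2 = r" "v' s3 = r"
      using ne by (simp_all add: u_def v_def u'_def v'_def)
    have inner: "real_params D \<inter> Zs ?ss = (\<Union>s\<in>set ?ss. {sp s (u s), sp s (v s)})"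
    proof -
      have "real_params D \<inter> Zs ?ss = {sp s1 0, sp s2 0, sp s3 r, sp s1 r, sp s3 (- r), sp s2 (- r)}"
        by (rule equalityI[OF sub]) (use R12(1-3) R21(1-3) Z[OF ins(1)] Z[OF ins(2)] Z[OF ins(3)] in blast)
      then show ?thesis by (simp add: uv insert_commute)
    qed
    have inner': "real_params D' \<inter> Zs ?ss = (\<Union>s\<in>set ?ss. {sp s (u' s), sp s (v' s)})"
    proof -
      have "real_params D' \<inter> Zs ?ss = {sp s1 0, sp s2 0, sp s3 (- r), sp s1 (- r), sp s3 r, sp s2 r}"
        by (rule equalityI[OF sub']) (use R12(4-6) R21(4-6) Z[OF ins(1)] Z[OF ins(2)] Z[OF ins(3)] in blast)
      then show ?thesis by (simp add: uv insert_commute)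
    qed
    obtain F where F: "\<And>z. z \<in> M0 D ?ss \<times> UNIV \<Longrightarrow> F z = z"
      "\<And>t. t \<in> set ?ss \<Longrightarrow> F (nd t (u t) False) = nd t (- 1) True \<and> F (nd t (u t) True) = nd t (u t) True \<and>
         F (nd t (v t) False) = nd t (u t) True \<and> F (nd t (v t) True) = nd t 1 False"
      "\<And>t. t \<in> set ?ss \<Longrightarrow> nd t (u t) True \<notin> M0 D ?ss \<times> UNIV"
      "bracket D = ssum (M0 D ?ss \<times> UNIV \<union> (\<lambda>s. nd s (u s) True) ` set ?ss) (base_rel D ?ss) (Ov D)
       (\<lambda>c. relim F (Asp D c)) (\<lambda>c. relim F (Bsp D c))"
      by (rule A.bracket_two_inner[of u v, OF _ inner]) (use r(1,2) uv in auto)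
    obtain F' where F': "\<And>z. z \<in> M0 D' ?ss \<times> UNIV \<Longrightarrow> F' z = z"
      "\<And>t. t \<in> set ?ss \<Longrightarrow> F' (nd t (u' t) False) = nd t (- 1) True \<and> F' (nd t (u' t) True) = nd t (u' t) True \<and>
         F' (nd t (v' t) False) = nd t (u' t) True \<and> F' (nd t (v' t) True) = nd t 1 False"
      "\<And>t. t \<in> set ?ss \<Longrightarrow> nd t (u' t) True \<notin> M0 D' ?ss \<times> UNIV"
      "bracket D' = ssum (M0 D' ?ss \<times> UNIV \<union> (\<lambda>s. nd s (u' s) True) ` set ?ss) (base_rel D' ?ss) (Ov D')
       (\<lambda>c. relim F' (Asp D' c)) (\<lambda>c. relim F' (Bsp D' c))"
      by (rule B.bracket_two_inner[of u' v', OF _ inner']) (use r(1,2) uv in auto)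
    note f = F(2)[OF ins(1), unfolded uv] F(2)[OF ins(2), unfolded uv] F(2)[OF ins(3), unfolded uv]
    note f' = F'(2)[OF ins(1), unfolded uv] F'(2)[OF ins(2), unfolded uv] F'(2)[OF ins(3), unfolded uv]
    define p1 q1 p2 q2 p3 q3 where "p1 = nd s1 (- 1) True" and "q1 = nd s1 1 False" and "p2 = nd s2 (- 1) True"
      and "q2 = nd s2 1 False" and "p3 = nd s3 (- 1) True" and "q3 = nd s3 1 False"
    note pq = p1_def[symmetric] q1_def[symmetric] p2_def[symmetric] q2_def[symmetric] p3_def[symmetric] q3_def[symmetric]
    define m1 m2 m3 n1 n2 where "m1 = nd s1 0 True" and "m2 = nd s2 (- r) True" and "m3 = nd s3 (- r) True"
      and "n1 = nd s1 (- r) True" and "n2 = nd s2 0 True"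
    note mm = m1_def[symmetric] m2_def[symmetric] m3_def[symmetric] n1_def[symmetric] n2_def[symmetric]
    interpret o: outer "M0 D ?ss \<times> UNIV" "base_rel D ?ss" "Ov D - Zs ?ss" "\<lambda>c. relim F (Asp D c)" "\<lambda>c. relim F (Bsp D c)"
      by (rule A.outer_F(3)[OF F(1)])
    interpret o': outer "M0 D' ?ss \<times> UNIV" "base_rel D' ?ss" "Ov D' - Zs ?ss" "\<lambda>c. relim F' (Asp D' c)" "\<lambda>c. relim F' (Bsp D' c)"
      by (rule B.outer_F(3)[OF F'(1)])
    have sw: "lks [(a, b), (c, d)] = lks [(c, d), (a, b)]" "lks [(b, a), (d, c)] = lks [(c, d), (a, b)]"
      "lks [(b, a), (d, c)] = lks [(a, b), (c, d)]" for a b c d :: half_edge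
      by (auto simp: lks_def lk_def)
    have S12: "w = 1 \<and> relim F (Asp D c12) = lks [(p1, q2), (m1, m2)] \<and> relim F (Bsp D c12) = lks [(p1, m2), (m1, q2)] \<or>
      w = - 1 \<and> relim F (Asp D c12) = lks [(p1, m2), (m1, q2)] \<and> relim F (Bsp D c12) = lks [(p1, q2), (m1, m2)]"
      using t12(3)[of F] f unfolding pq mm
      by (simp add: pq mm sw(1)[of m1 m2 p1 q2] sw(2)[of q2 m1 m2 p1])
    have S23: "e = 1 \<and> relim F (Asp D c23) = lks [(p3, m2), (m3, p2)] \<and> relim F (Bsp D c23) = lks [(p3, p2), (m3, m2)] \<or>
      e = - 1 \<and> relim F (Asp D c23) = lks [(p3, p2), (m3, m2)] \<and> relim F (Bsp D c23) = lks [(p3, m2), (m3, p2)]"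
      using t23(3)[of F] f unfolding pq mm
      by (simp add: pq mm sw(1)[of m3 p2 p3 m2] sw(2)[of m2 m3 p2 p3])
    have S13: "e = 1 \<and> relim F (Asp D c13) = lks [(m3, m1), (q3, q1)] \<and> relim F (Bsp D c13) = lks [(m3, q1), (q3, m1)] \<or>
      e = - 1 \<and> relim F (Asp D c13) = lks [(m3, q1), (q3, m1)] \<and> relim F (Bsp D c13) = lks [(m3, m1), (q3, q1)]"
      using t13(3)[of F] f unfolding pq mm
      by (simp add: pq mm sw(1)[of q3 q1 m3 m1] sw(3)[of q1 m3 m1 q3])
    have S12': "w = 1 \<and> relim F' (Asp D' d12) = lks [(n1, n2), (q1, p2)] \<and> relim F' (Bsp D' d12) = lks [(n1, p2), (q1, n2)] \<or>
      w = - 1 \<and> relim F' (Asp D' d12) = lks [(n1, p2), (q1, n2)] \<and> relim F' (Bsp D' d12) = lks [(n1, n2), (q1, p2)]"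
      using t12'(3)[of F'] f' unfolding pq mm
      by (simp add: pq mm sw(1)[of q1 p2 n1 n2] sw(2)[of n2 q1 p2 n1])
    have S13': "e = 1 \<and> relim F' (Asp D' d13) = lks [(p3, p1), (m3, n1)] \<and> relim F' (Bsp D' d13) = lks [(p3, n1), (m3, p1)] \<or>
      e = - 1 \<and> relim F' (Asp D' d13) = lks [(p3, n1), (m3, p1)] \<and> relim F' (Bsp D' d13) = lks [(p3, p1), (m3, n1)]"
      using t13'(3)[of F'] f' unfolding pq mm
      by (simp add: pq mm sw(1)[of m3 n1 p3 p1] sw(3)[of n1 p3 p1 m3])
    have S23': "e = 1 \<and> relim F' (Asp D' d23) = lks [(m3, q2), (q3, n2)] \<and> relim F' (Bsp D' d23) = lks [(m3, n2), (q3, q2)] \<or>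
      e = - 1 \<and> relim F' (Asp D' d23) = lks [(m3, n2), (q3, q2)] \<and> relim F' (Bsp D' d23) = lks [(m3, q2), (q3, n2)]"
      using t23'(3)[of F'] f' unfolding pq mm
      by (simp add: pq mm sw(1)[of q3 n2 m3 q2] sw(2)[of q2 q3 n2 m3])
    have ndne: "nd a x True \<noteq> nd b y True" if "a \<in> set ?ss" "b \<in> set ?ss" "x \<in> {- 1..1}" "y \<in> {- 1..1}" "a \<noteq> b" for a b x y
      using A.nd_eq_iff[OF that(1-4)] that(5) by blast
    have mne: "m1 \<noteq> m2" "m1 \<noteq> m3" "m2 \<noteq> m3" "n1 \<noteq> n2" "n1 \<noteq> m3" "n2 \<noteq> m3"
      unfolding m1_def m2_def m3_def n1_def n2_def using ndne ins ne I' by blast+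
    have mO: "m1 \<notin> M0 D ?ss \<times> UNIV" "m2 \<notin> M0 D ?ss \<times> UNIV" "m3 \<notin> M0 D ?ss \<times> UNIV"
      using F(3)[OF ins(1)] F(3)[OF ins(2)] F(3)[OF ins(3)] unfolding uv mm .
    have mO': "n1 \<notin> M0 D' ?ss \<times> UNIV" "n2 \<notin> M0 D' ?ss \<times> UNIV" "m3 \<notin> M0 D' ?ss \<times> UNIV"
      using F'(3)[OF ins(1)] F'(3)[OF ins(2)] F'(3)[OF ins(3)] unfolding uv mm .
    have pO: "p1 \<in> M0 D ?ss \<times> UNIV" "q1 \<in> M0 D ?ss \<times> UNIV" "p2 \<in> M0 D ?ss \<times> UNIV" "q2 \<in> M0 D ?ss \<times> UNIV"
      "p3 \<in> M0 D ?ss \<times> UNIV" "q3 \<in> M0 D ?ss \<times> UNIV"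
      unfolding p1_def q1_def p2_def q2_def p3_def q3_def by (rule A.ends_M0, rule ins)+
    have cO: "c12 \<notin> Ov D - Zs ?ss" "c13 \<notin> Ov D - Zs ?ss" "c23 \<notin> Ov D - Zs ?ss" using cZ by blast+
    have dO: "d12 \<notin> Ov D' - Zs ?ss" "d13 \<notin> Ov D' - Zs ?ss" "d23 \<notin> Ov D' - Zs ?ss" using cZ' by blast+
    have HD: "M0 D ?ss \<times> UNIV \<union> (\<lambda>s. nd s (u s) True) ` set ?ss = insert m1 (insert m2 (insert m3 (M0 D ?ss \<times> UNIV)))"
      by (simp add: uv m1_def m2_def m3_def Un_commute)
    have HD': "M0 D' ?ss \<times> UNIV \<union> (\<lambda>s. nd s (u' s) True) ` set ?ss = insert n1 (insert n2 (insert m3 (M0 D' ?ss \<times> UNIV)))"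
      by (simp add: uv n1_def n2_def m3_def Un_commute)
    \<comment> \<open>Outside the tangle both diagrams have the same arcs, crossings and splices,
      and both \<open>F\<close> and \<open>F'\<close> fix the outer half-edges.\<close>
    have Zeq: "ssum (M0 D' ?ss \<times> UNIV) (base_rel D' ?ss \<union> P) (Ov D' - Zs ?ss) (\<lambda>c. relim F' (Asp D' c)) (\<lambda>c. relim F' (Bsp D' c)) =
      ssum (M0 D ?ss \<times> UNIV) (base_rel D ?ss \<union> P) (Ov D - Zs ?ss) (\<lambda>c. relim F (Asp D c)) (\<lambda>c. relim F (Bsp D c))" for P
    proof -
      have "relim F' (Asp D' c) = relim F (Asp D c)" "relim F' (Bsp D' c) = relim F (Bsp D c)" if c: "c \<in> Ov D - Zs ?ss" for c
      proof -
        have c': "c \<in> Ov D' - Zs ?ss" using c Ov_outside by simp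
        show "relim F' (Asp D' c) = relim F (Asp D c)" "relim F' (Bsp D' c) = relim F (Bsp D c)"
          using A.outer_F(1,2)[OF F(1) c] B.outer_F(1,2)[OF F'(1) c'] splices_outside[OF c] by simp_all
      qed
      then show ?thesis unfolding M0_eq base_rel_eq Ov_outside by (intro ssum_cong) simp_all
    qed
    have "bracket D = ssum (insert m1 (insert m2 (insert m3 (M0 D ?ss \<times> UNIV)))) (base_rel D ?ss)
        (insert c12 (insert c13 (insert c23 (Ov D - Zs ?ss)))) (\<lambda>c. relim F (Asp D c)) (\<lambda>c. relim F (Bsp D c))"
      using F(4) unfolding HD OvD[symmetric] .
    note b1 = this[unfolded o.state_move_III[OF cO cne mO mne(1-3) pO S12 S23 S13]]
    have "bracket D' = ssum (insert n1 (insert n2 (insert m3 (M0 D' ?ss \<times> UNIV)))) (base_rel D' ?ss)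
        (insert d12 (insert d13 (insert d23 (Ov D' - Zs ?ss)))) (\<lambda>c. relim F' (Asp D' c)) (\<lambda>c. relim F' (Bsp D' c))"
      using F'(4) unfolding HD' OvD'[symmetric] .
    note b2 = this[unfolded o'.state_move_III'[OF dO dne mO' mne(4-6) pO[folded M0_eq] S12' S13' S23'] Zeq]
    have br: "bracket D' = bracket D" unfolding b1 b2 ..
    \<comment> \<open>Corresponding model crossings have the same \<kappa>, so every crossing keeps
      its sign.\<close>
    have "sg D' d12 = sg D c12" "sg D' d13 = sg D c13" "sg D' d23 = sg D c23"
      using t12(2) t13(2) t23(2) t12'(2) t13'(2) t23'(2) by auto
    then have "writhe D' = writhe D" using writhe_pair cZ cZ' cne dne by simp
    then show ?thesis by (simp add: f_poly_unit br)
  qed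
qed

theorem f_poly_moves:
  assumes "(D, D') \<in> (moves \<union> moves\<inverse>)\<^sup>*"
  shows "f_poly D' = f_poly D"
  using assms
proof (induction rule: rtrancl_induct)
  case (step D' D'')
  have inv: "f_poly E' = f_poly E" if "(E, E') \<in> moves" for E E'
  proof -
    have E: "is_vdiagram E" "is_vdiagram E'" and
      "same_diagram E E' \<or> isotopy_move E E' \<or> move_I E E' \<or> move_II E E' \<or> move_III E E'"
      using that by (auto simp: moves_def)
    then show ?thesis
      using same_diagram_f_poly[OF E] isotopy_move_f_poly[OF E] move_I_f_poly[OF E] move_II_f_poly[OF E] move_III_f_poly[OF E]
      by blast
  qed
  show ?case using step.hyps(2) inv[of D' D''] inv[of D'' D'] step.IH by auto
qed simp

section \<open>Genus of a pair of permutations\<close>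

definition gr :: "'a set \<Rightarrow> ('a \<Rightarrow> 'a) \<Rightarrow> ('a \<times> 'a) set" where
  "gr H f = (\<lambda>x. (x, f x)) ` H"

text \<open>If \<open>\<rho>\<close> and \<open>\<epsilon>\<close> are the rotation and the edge involution of a cellulated surface with darts
  \<open>H\<close>, then \<open>dfc\<close> is twice its genus. In this form the definition makes sense for all pairs of permutations,
  and removing a dart from a cycle of \<open>\<rho>\<close> or \<open>\<epsilon>\<close>, that is, composing with a transposition, decreases it by 0 or 2.\<close>

definition dfc :: "'a set \<Rightarrow> ('a \<Rightarrow> 'a) \<Rightarrow> ('a \<Rightarrow> 'a) \<Rightarrow> int" where
  "dfc H \<rho> \<epsilon> = 2 * int (kc H (gr H \<rho> \<union> gr H \<epsilon>)) + int (card H)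
     - int (kc H (gr H \<rho>)) - int (kc H (gr H \<epsilon>)) - int (kc H (gr H (\<epsilon> \<circ> \<rho>)))"

abbreviation (input) tr where "tr \<equiv> Transposition.transpose"

lemma gr_sub: "bij_betw f H H \<Longrightarrow> gr H f \<subseteq> H \<times> H"
  by (auto simp: gr_def bij_betw_def)

lemma gr_mem: "x \<in> H \<Longrightarrow> (x, f x) \<in> gr H f"
  by (simp add: gr_def)

lemma gr_cong: "(\<And>x. x \<in> H \<Longrightarrow> f x = g x) \<Longrightarrow> gr H f = gr H g"
  by (simp add: gr_def)

text \<open>A permutation of a finite set returns to every point of a cycle, so its orbits are
  already symmetric and agree with the classes of the generated equivalence.\<close>

lemma orbit_eqv:
  assumes fin: "finite H" and f: "bij_betw f H H" and x: "x \<in> H"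
  shows "y \<in> orbit f x \<longleftrightarrow> (x, y) \<in> eqv (gr H f)" "x \<in> orbit f x" "orbit f x \<subseteq> H"
proof -
  define p where "p y = (if y \<in> H then f y else y)" for y
  have p: "p permutes H"
    using f by (intro bij_imp_permutes bij_betw_cong[THEN iffD1, OF _ f]) (auto simp: p_def)
  then have perm: "permutation p" using fin permutation_permutes by blast
  have img: "f y \<in> H" if "y \<in> H" for y using f that by (auto simp: bij_betw_def)
  have eq: "orbit f x = orbit p x"
    by (rule orbit_cong0[OF x]) (use img in \<open>auto simp: p_def\<close>)
  have self: "y \<in> orbit p y" for y using permutation_self_in_orbit[OF perm] .
  show "x \<in> orbit f x" using self eq by simp
  have inH: "y \<in> H \<and> (x, y) \<in> eqv (gr H f)" if "y \<in> orbit f x" for y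
    using that
  proof (induction rule: orbit.induct)
    case base
    then show ?case using img[OF x] eqv_base[OF gr_mem[OF x]] by simp
  next
    case (step y)
    then show ?case using img[of y] eqv_trans[of x y "gr H f" "f y"] eqv_base[OF gr_mem[of y H f]] by simp
  qed
  then show "orbit f x \<subseteq> H" by blast
  show "y \<in> orbit f x \<longleftrightarrow> (x, y) \<in> eqv (gr H f)"
  proof
    assume "(x, y) \<in> eqv (gr H f)"
    then show "y \<in> orbit f x" unfolding eq
    proof (rule eqv_inv)
      show "x \<in> orbit p x" by (rule self)
      fix a b assume ab: "(a, b) \<in> gr H f"
      then have b: "b = p a" by (auto simp: gr_def p_def)
      have "a \<in> orbit p (p a)" by (rule orbit_swap[OF self]) (rule orbit.base)
      then show "a \<in> orbit p x \<longleftrightarrow> b \<in> orbit p x"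
        unfolding b using orbit.step[of a p x] orbit_trans[of a p "p a" x] by blast
    qed
  qed (use inH in blast)
qed

lemma card_orbits:
  assumes "finite H" "bij_betw f H H"
  shows "card (orbit f ` H) = kc H (gr H f)"
  unfolding kc_card_image
proof (rule card_image_eq_if_same_kernel)
  fix x y assume xy: "x \<in> H" "y \<in> H"
  have "orbit f z = eqv (gr H f) `` {z}" if "z \<in> H" for z
    using orbit_eqv(1)[OF assms that] by blast
  then show "orbit f x = orbit f y \<longleftrightarrow> eqv (gr H f) `` {x} = eqv (gr H f) `` {y}"
    using xy by simp
qed

lemma bij_comp_transpose:
  assumes "bij_betw f H H" "a \<in> H" "b \<in> H"
  shows "bij_betw (f \<circ> tr a b) H H"
proof -
  have "bij_betw (tr a b) H H"
    by (rule bij_betwI[of _ _ _ "tr a b"]) (use assms(2,3) in \<open>auto simp: Transposition.transpose_def\<close>)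
  then show ?thesis using assms(1) bij_betw_trans by blast
qed

text \<open>Starting from \<open>b\<close>, the new map runs through the whole old cycle of
  \<open>a\<close>, because \<open>b\<close> does not lie on that cycle; thus two cycles are
  merged.\<close>

lemma eqv_transpose_merge:
  assumes fin: "finite H" and f: "bij_betw f H H" and ab: "a \<in> H" "b \<in> H"
    and sep: "(a, b) \<notin> eqv (gr H f)"
  shows "eqv (gr H (f \<circ> tr a b)) = eqv (insert (a, b) (gr H f))"
proof -
  define g where "g = f \<circ> tr a b"
  let ?S = "insert (a, b) (gr H f)"
  have g: "g a = f b" "g b = f a" "\<And>x. x \<noteq> a \<Longrightarrow> x \<noteq> b \<Longrightarrow> g x = f x"
    by (auto simp: g_def Transposition.transpose_def)
  have gE: "(x, g x) \<in> eqv (gr H g)" if "x \<in> H" for x using eqv_base[OF gr_mem[OF that]] .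
  have bx: "(b, x) \<in> eqv (gr H g)" if "x \<in> orbit f a" for x
    using that
  proof (induction rule: orbit.induct)
    case base
    then show ?case using gE[OF ab(2)] g by simp
  next
    case (step x)
    have xH: "x \<in> H" using orbit_eqv(3)[OF fin f ab(1)] step.hyps by blast
    have xb: "x \<noteq> b" using orbit_eqv(1)[OF fin f ab(1)] step.hyps sep by blast
    show ?case
    proof (cases "x = a")
      case True
      then show ?thesis using gE[OF ab(2)] g by simp
    next
      case False
      then show ?thesis using eqv_trans[OF step.IH gE[OF xH]] g(3) xb by simp
    qed
  qed
  have ba: "(b, a) \<in> eqv (gr H g)" using bx orbit_eqv(2)[OF fin f ab(1)] by blast
  have "?S \<subseteq> eqv (gr H g)"
  proof
    fix p assume "p \<in> ?S"
    then consider "p = (a, b)" | x where "x \<in> H" "p = (x, f x)" by (auto simp: gr_def)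
    then show "p \<in> eqv (gr H g)"
    proof cases
      case 1
      then show ?thesis using eqv_sym[OF ba] by simp
    next
      case 2
      consider "x = a" | "x = b" | "x \<noteq> a" "x \<noteq> b" by blast
      then show ?thesis
      proof cases
        case 1
        then show ?thesis using 2 eqv_trans[OF eqv_sym[OF ba] gE[OF ab(2)]] g by simp
      next
        case b: 2
        then show ?thesis using 2 eqv_trans[OF ba gE[OF ab(1)]] g by simp
      next
        case 3
        then show ?thesis using 2 gE[of x] g(3)[of x] by simp
      qed
    qed
  qed
  moreover have "gr H g \<subseteq> eqv ?S"
  proof
    fix p assume "p \<in> gr H g"
    then obtain x where x: "x \<in> H" "p = (x, g x)" by (auto simp: gr_def)
    have fE: "(y, f y) \<in> eqv ?S" if "y \<in> H" for y by (rule eqv_base) (simp add: gr_mem that)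
    have E: "(a, b) \<in> eqv ?S" by (rule eqv_base) simp
    consider "x = a" | "x = b" | "x \<noteq> a" "x \<noteq> b" by blast
    then show "p \<in> eqv ?S"
    proof cases
      case 1
      then show ?thesis using x eqv_trans[OF E fE[OF ab(2)]] g by simp
    next
      case 2
      then show ?thesis using x eqv_trans[OF eqv_sym[OF E] fE[OF ab(1)]] g by simp
    next
      case 3
      then show ?thesis using x fE[of x] g(3)[of x] by simp
    qed
  qed
ultimately have "eqv (gr H g) = eqv ?S" by (intro eqv_eqI)
  then show ?thesis by (simp only: g_def)
qed

lemma kc_transpose_merge:
  assumes "finite H" "bij_betw f H H" "a \<in> H" "b \<in> H" "(a, b) \<notin> eqv (gr H f)"
  shows "kc H (gr H f) = Suc (kc H (gr H (f \<circ> tr a b)))"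
  using kc_add_pair[OF assms(1,3,4,5)] kc_cong[OF eqv_transpose_merge[OF assms]] by simp

text \<open>\<open>S\<close> is the stretch of the cycle from \<open>f a\<close> to
  \<open>b\<close>. The new map sends \<open>b\<close> back to \<open>f a\<close>, so it maps
  \<open>S\<close> onto itself, and \<open>a\<close> lies outside \<open>S\<close>.\<close>

lemma transpose_split:
  assumes fin: "finite H" and f: "bij_betw f H H" and ab: "a \<in> H" "b \<in> H" "a \<noteq> b"
    and con: "(a, b) \<in> eqv (gr H f)"
  shows "(a, b) \<notin> eqv (gr H (f \<circ> tr a b))"
proof
  let ?g = "f \<circ> tr a b"
  assume g_con: "(a, b) \<in> eqv (gr H ?g)"
  have "b \<in> orbit f a" using orbit_eqv(1)[OF fin f ab(1)] con by simp
  then have "\<exists>n>0. b = (f ^^ n) a" by (auto simp: orbit_altdef)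
  define j where "j = (LEAST n. 0 < n \<and> b = (f ^^ n) a)"
  have j: "0 < j" "b = (f ^^ j) a"
    using LeastI_ex[OF \<open>\<exists>n>0. b = (f ^^ n) a\<close>] by (simp_all add: j_def)
  have jmin: "(f ^^ n) a \<noteq> b" if "0 < n" "n < j" for n
    using not_less_Least[of n "\<lambda>n. 0 < n \<and> b = (f ^^ n) a"] that by (auto simp: j_def)
  have na: "(f ^^ i) a \<noteq> a" if "0 < i" "i < j" for i
  proof
    assume "(f ^^ i) a = a"
    then have "(f ^^ (j - i)) a = (f ^^ (j - i)) ((f ^^ i) a)" by simp
    also have "\<dots> = b" using that j(2) by (simp add: funpow_add[symmetric, unfolded comp_def fun_eq_iff, rule_format])
    finally show False using jmin[of "j - i"] that by simp
  qed
  define S where "S = (\<lambda>i. (f ^^ i) a) ` {1..j}"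
  have aS: "a \<notin> S"
  proof
    assume "a \<in> S"
    then obtain i where i: "1 \<le> i" "i \<le> j" "a = (f ^^ i) a" by (auto simp: S_def)
    then show False using na[of i] j(2) ab(3) by (cases "i = j") auto
  qed
  have bS: "b \<in> S" using j by (auto simp: S_def)
  have fx: "f x \<in> S" if x: "x \<in> S" "x \<noteq> b" for x
  proof -
    obtain i where i: "1 \<le> i" "i \<le> j" "x = (f ^^ i) a" using x(1) by (auto simp: S_def)
    then have "i < j" using x(2) j(2) by (cases "i = j") auto
    then show ?thesis using i by (auto simp: S_def intro!: image_eqI[of _ _ "Suc i"])
  qed
  have fa: "f a \<in> S" using j(1) by (auto simp: S_def intro!: image_eqI[of _ _ 1])
  have gS: "?g x \<in> S" if "x \<in> S" for x
    using fx[OF that] fa that aS by (cases "x = b"; cases "x = a") (auto simp: Transposition.transpose_def)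
  have SH: "S \<subseteq> H"
  proof -
    have "(f ^^ i) a \<in> H" for i
      by (induction i) (use ab(1) f in \<open>auto simp: bij_betw_def\<close>)
    then show ?thesis by (auto simp: S_def)
  qed
  have "finite S" by (simp add: S_def)
  moreover have "inj_on ?g S" using bij_comp_transpose[OF f ab(1,2)] SH by (auto simp: bij_betw_def inj_on_def)
  ultimately have gSS: "?g ` S = S" using gS by (intro endo_inj_surj) auto
  have "a \<in> S \<longleftrightarrow> b \<in> S"
  proof -
    have "(x \<in> S) = (y \<in> S)" if xy: "(x, y) \<in> gr H ?g" for x y
    proof
      have x: "x \<in> H" "y = ?g x" using xy by (auto simp: gr_def)
      show "x \<in> S \<Longrightarrow> y \<in> S" using gS x by simp
      assume "y \<in> S"
      then obtain w where w: "w \<in> S" "?g x = ?g w" using gSS x(2) by auto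
      have "x = w" using inj_onD[OF bij_betw_imp_inj_on[OF bij_comp_transpose[OF f ab(1,2)]] w(2) x(1)] w(1) SH by blast
      then show "x \<in> S" using w(1) by simp
    qed
    then have "b \<in> S = (a \<in> S)"
      by (intro eqv_inv[OF g_con, of "\<lambda>x. (x \<in> S) = (a \<in> S)"]) auto
    then show ?thesis by simp
  qed
  then show False using aS bS by simp
qed

lemma transpose_transpose: "f \<circ> tr a b \<circ> tr a b = f"
  by (simp add: fun_eq_iff)

lemma kc_transpose_split:
  assumes "finite H" "bij_betw f H H" "a \<in> H" "b \<in> H" "a \<noteq> b" "(a, b) \<in> eqv (gr H f)"
  shows "kc H (gr H (f \<circ> tr a b)) = Suc (kc H (gr H f))"
  using kc_transpose_merge[OF assms(1) bij_comp_transpose[OF assms(2-4)] assms(3,4) transpose_split[OF assms]]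
  by (simp add: transpose_transpose)

lemma gr_comp_sub:
  assumes "bij_betw \<rho> H H"
  shows "gr H (\<epsilon> \<circ> \<rho>) \<subseteq> eqv (gr H \<rho> \<union> gr H \<epsilon>)"
proof -
  have "(x, \<epsilon> (\<rho> x)) \<in> eqv (gr H \<rho> \<union> gr H \<epsilon>)" if "x \<in> H" for x
  proof -
    have "\<rho> x \<in> H" using assms that by (auto simp: bij_betw_def)
    then show ?thesis using that by (intro eqv_trans[OF eqv_base eqv_base, of x "\<rho> x"]) (auto simp: gr_def)
  qed
  then show ?thesis by (auto simp: gr_def)
qed

text \<open>\<open>\<rho> \<circ> tr e d\<close> fixes \<open>e\<close> and lets \<open>d\<close>
  skip it, so \<rho> gains a cycle. If \<open>e\<close> and \<open>d\<close> stay connected, the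
  product gains or loses one cycle. Otherwise a component splits off, which counts twice, and the
  product must gain a cycle as well.\<close>

lemma dfc_remove:
  assumes fin: "finite H" and \<rho>: "bij_betw \<rho> H H" and \<epsilon>: "bij_betw \<epsilon> H H"
    and d: "e \<in> H" "d \<in> H" "\<rho> d = e"
  shows "dfc H (\<rho> \<circ> tr e d) \<epsilon> \<le> dfc H \<rho> \<epsilon>" "even (dfc H (\<rho> \<circ> tr e d) \<epsilon> - dfc H \<rho> \<epsilon>)"
proof -
  let ?\<rho>' = "\<rho> \<circ> tr e d"
  have "dfc H ?\<rho>' \<epsilon> = dfc H \<rho> \<epsilon> \<or> dfc H ?\<rho>' \<epsilon> = dfc H \<rho> \<epsilon> - 2"
  proof (cases "e = d")
    case False
    let ?\<phi> = "\<epsilon> \<circ> \<rho>" and ?\<phi>' = "\<epsilon> \<circ> ?\<rho>'"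
    have \<rho>': "bij_betw ?\<rho>' H H" by (rule bij_comp_transpose[OF \<rho> d(1,2)])
    have \<phi>: "bij_betw ?\<phi> H H" by (rule bij_betw_trans[OF \<rho> \<epsilon>])
    have \<phi>': "bij_betw ?\<phi>' H H" by (rule bij_betw_trans[OF \<rho>' \<epsilon>])
    have \<phi>'_eq: "?\<phi>' = ?\<phi> \<circ> tr e d" "?\<phi> = ?\<phi>' \<circ> tr e d"
      by (simp_all add: fun_eq_iff)
    have con: "(e, d) \<in> eqv (gr H \<rho>)" using eqv_base'[OF gr_mem[OF d(2), of \<rho>]] d(3) by simp
    have z\<rho>: "kc H (gr H ?\<rho>') = Suc (kc H (gr H \<rho>))"
      by (rule kc_transpose_split[OF fin \<rho> d(1,2) False con])
    have eq: "eqv (gr H \<rho>) = eqv (insert (e, d) (gr H ?\<rho>'))"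
      using eqv_transpose_merge[OF fin \<rho>' d(1,2) transpose_split[OF fin \<rho> d(1,2) False con]]
      by (simp add: transpose_transpose)
    have \<kappa>: "kc H (gr H \<rho> \<union> gr H \<epsilon>) = kc H (insert (e, d) (gr H ?\<rho>' \<union> gr H \<epsilon>))"
      using kc_cong[OF eqv_Un_cong[OF eq, of "gr H \<epsilon>"], of H] by simp
    show ?thesis
    proof (cases "(e, d) \<in> eqv (gr H ?\<rho>' \<union> gr H \<epsilon>)")
      case True
      have "kc H (gr H ?\<phi>') = Suc (kc H (gr H ?\<phi>)) \<or> kc H (gr H ?\<phi>) = Suc (kc H (gr H ?\<phi>'))"
        using kc_transpose_split[OF fin \<phi> d(1,2) False] kc_transpose_merge[OF fin \<phi> d(1,2)]
        unfolding \<phi>'_eq(1) by blast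
      then show ?thesis using \<kappa> kc_add_redundant[OF True, of H] z\<rho> by (auto simp: dfc_def)
    next
      case sep: False
      have "(e, d) \<notin> eqv (gr H ?\<phi>')"
      proof
        assume "(e, d) \<in> eqv (gr H ?\<phi>')"
        then have "(e, d) \<in> eqv (gr H ?\<rho>' \<union> gr H \<epsilon>)"
          by (rule eqv_least) (use gr_comp_sub[OF \<rho>', of \<epsilon>] in blast)
        then show False using sep by blast
      qed
      then have "kc H (gr H ?\<phi>') = Suc (kc H (gr H ?\<phi>))"
        using kc_transpose_merge[OF fin \<phi>' d(1,2)] unfolding \<phi>'_eq(2)[symmetric] by blast
      then show ?thesis using \<kappa> kc_add_pair[OF fin d(1,2) sep] z\<rho> by (auto simp: dfc_def)
    qed
  qed simp
  then show "dfc H ?\<rho>' \<epsilon> \<le> dfc H \<rho> \<epsilon>" "even (dfc H ?\<rho>' \<epsilon> - dfc H \<rho> \<epsilon>)" by auto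
qed

text \<open>The products in the two orders are conjugate by \<rho> and have equally many cycles.
  This allows darts to be deleted from \<epsilon> too.\<close>

lemma dfc_swap:
  assumes "bij_betw \<rho> H H" "bij_betw \<epsilon> H H"
  shows "dfc H \<rho> \<epsilon> = dfc H \<epsilon> \<rho>"
proof -
  have "gr H (\<epsilon> \<circ> \<rho>) \<subseteq> H \<times> H" by (rule gr_sub[OF bij_betw_trans[OF assms]])
  then have "kc H (gr H (\<epsilon> \<circ> \<rho>)) = kc (\<rho> ` H) (map_prod \<rho> \<rho> ` gr H (\<epsilon> \<circ> \<rho>))"
    using assms(1) by (intro kc_inj_image[symmetric]) (auto simp: bij_betw_def)
  moreover have "map_prod \<rho> \<rho> ` gr H (\<epsilon> \<circ> \<rho>) = gr (\<rho> ` H) (\<rho> \<circ> \<epsilon>)"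
    by (simp add: gr_def image_image)
  moreover have "\<rho> ` H = H" using assms(1) by (simp add: bij_betw_def)
  ultimately show ?thesis by (simp add: dfc_def Un_commute)
qed

section \<open>First returns and the deletion of darts\<close>

definition returns :: "('a \<Rightarrow> 'a) \<Rightarrow> 'a set \<Rightarrow> 'a \<Rightarrow> 'a \<Rightarrow> bool" where
  "returns f X x y \<longleftrightarrow> y \<in> X \<and> (\<exists>k>0. (f ^^ k) x = y \<and> (\<forall>j. 0 < j \<and> j < k \<longrightarrow> (f ^^ j) x \<notin> X))"

lemma returns_first_return:
  assumes "returns f X x y"
  shows "first_return f X x = y"
proof -
  obtain k where k: "0 < k" "(f ^^ k) x = y" "\<forall>j. 0 < j \<and> j < k \<longrightarrow> (f ^^ j) x \<notin> X" and y: "y \<in> X"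
    using assms by (auto simp: returns_def)
  have "(LEAST k. 0 < k \<and> (f ^^ k) x \<in> X) = k"
    by (rule Least_equality) (use k y in \<open>auto simp: not_less[symmetric]\<close>)
  then show ?thesis using k by (simp add: first_return_def)
qed

text \<open>Darts are deleted one at a time by \<open>dfc_remove\<close>. A deleted dart stays in
  \<open>H\<close> as a fixed point, so that the underlying set does not change during the
  induction.\<close>

lemma first_return_perm:
  assumes fin: "finite H" and \<rho>: "bij_betw \<rho> H H" and \<epsilon>: "bij_betw \<epsilon> H H" and N: "finite N" "N \<subseteq> H"
  shows "\<exists>g. bij_betw g H H \<and> (\<forall>x\<in>N. g x = x) \<and> (\<forall>x\<in>H - N. returns \<rho> (H - N) x (g x)) \<and>
     dfc H g \<epsilon> \<le> dfc H \<rho> \<epsilon> \<and> even (dfc H g \<epsilon> - dfc H \<rho> \<epsilon>)"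
  using N
proof (induction N rule: finite_induct)
  case empty
  have "returns \<rho> H x (\<rho> x)" if "x \<in> H" for x
    using that \<rho> unfolding returns_def by (auto simp: bij_betw_def intro!: exI[of _ 1])
  then show ?case using \<rho> by (intro exI[of _ \<rho>]) auto
next
  case (insert e N)
  then obtain g where g: "bij_betw g H H" "\<forall>x\<in>N. g x = x" "\<forall>x\<in>H - N. returns \<rho> (H - N) x (g x)"
     "dfc H g \<epsilon> \<le> dfc H \<rho> \<epsilon>" "even (dfc H g \<epsilon> - dfc H \<rho> \<epsilon>)" by auto
  have e: "e \<in> H" "e \<notin> N" using insert by auto
  have "e \<in> g ` H" using g(1) e(1) by (simp add: bij_betw_def)
  then obtain d where d: "d \<in> H" "g d = e" by blast
  have dN: "d \<notin> N" using d g(2) e(2) by auto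
  have inj: "g x = g y \<longleftrightarrow> x = y" if "x \<in> H" "y \<in> H" for x y
    using g(1) that by (auto simp: bij_betw_def inj_on_def)
  let ?g = "g \<circ> tr e d"
  have bij: "bij_betw ?g H H" by (rule bij_comp_transpose[OF g(1) e(1) d(1)])
  have fixN: "\<forall>x\<in>insert e N. ?g x = x"
    using g(2) d(2) dN e(2) by (auto simp: Transposition.transpose_def)
  have "returns \<rho> (H - insert e N) x (?g x)" if x: "x \<in> H - insert e N" for x
  proof (cases "x = d")
    case False
    then have gx: "?g x = g x" using x by (auto simp: Transposition.transpose_def)
    have "g x \<noteq> e" using inj[of x d] x d False by auto
    then show ?thesis using g(3) x unfolding gx returns_def by blast
  next
    case True
    \<comment> \<open>The predecessor \<open>d\<close> of the deleted dart now returns where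
      \<open>e\<close> did: the return path of \<open>d\<close> to \<open>e\<close> is followed by
      that of \<open>e\<close>, and the lengths add.\<close>
    have gx: "?g x = g e" using True by (simp add: Transposition.transpose_def)
    have ne: "g e \<noteq> e" using inj[of e d] x d e True by auto
    obtain k where k: "k > 0" "(\<rho> ^^ k) d = e" "\<forall>j. 0 < j \<and> j < k \<longrightarrow> (\<rho> ^^ j) d \<notin> H - N"
      using g(3) d dN unfolding returns_def by (metis DiffI)
    obtain l where l: "l > 0" "(\<rho> ^^ l) e = g e" "\<forall>j. 0 < j \<and> j < l \<longrightarrow> (\<rho> ^^ j) e \<notin> H - N" "g e \<in> H - N"
      using g(3) e unfolding returns_def by (metis DiffI)
    have add: "(\<rho> ^^ (j + k)) d = (\<rho> ^^ j) e" for j by (simp add: funpow_add k(2))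
    have "(\<rho> ^^ j) d \<notin> H - insert e N" if j: "0 < j" "j < l + k" for j
    proof -
      consider "j < k" | "j = k" | "0 < j - k" "j - k < l" "j = (j - k) + k" using j by linarith
      then show ?thesis
      proof cases
        case 3
        then have "(\<rho> ^^ j) d = (\<rho> ^^ (j - k)) e" using add[of "j - k"] by simp
        then show ?thesis using l(3) 3(1,2) by auto
      qed (use k j in auto)
    qed
    then show ?thesis unfolding gx True returns_def
      using l(2,4) ne add[of l] l(1) by (intro conjI exI[of _ "l + k"]) auto
  qed
  moreover have "dfc H ?g \<epsilon> \<le> dfc H \<rho> \<epsilon>" "even (dfc H ?g \<epsilon> - dfc H \<rho> \<epsilon>)"
    using dfc_remove[OF fin g(1) \<epsilon> e(1) d] g(4,5) by (simp, presburger)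
  ultimately show ?case using bij fixN by (intro exI[of _ ?g]) blast
qed

lemma kc_fixed:
  assumes "finite H" "X \<subseteq> H" "R \<subseteq> X \<times> X" "R \<subseteq> R'" "R' \<subseteq> R \<union> Id"
  shows "kc H R' = kc X R + card (H - X)"
proof -
  have "kc H R' = kc H R"
    by (rule kc_cong, rule eqv_cong_Id) (use assms(4,5) in blast)
  also have "kc (X \<union> N) R = kc X R + card N" if "finite N" "N \<inter> X = {}" for N
    using that
  proof (induction N rule: finite_induct)
    case (insert v N)
    have "finite X" using assms(1,2) finite_subset by blast
    then have "kc (insert v (X \<union> N)) R = Suc (kc (X \<union> N) R)"
      using insert assms(3) by (intro kc_isolated) (auto simp: Field_def)
    then show ?case using insert by simp
  qed simp
  from this[of "H - X"] have "kc H R = kc X R + card (H - X)"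
    using assms(1,2) by (simp add: Un_absorb1 Int_commute)
  finally show ?thesis .
qed

text \<open>A common fixed point is a component, a dart, and a cycle of both permutations and of
  their product; it contributes 2 + 1 - 1 - 1 - 1 = 0.\<close>

lemma dfc_restrict:
  assumes "finite H" "X \<subseteq> H" "bij_betw \<rho> X X" "bij_betw \<epsilon> X X"
    and "\<And>x. x \<in> H - X \<Longrightarrow> \<rho> x = x" "\<And>x. x \<in> H - X \<Longrightarrow> \<epsilon> x = x"
  shows "dfc H \<rho> \<epsilon> = dfc X \<rho> \<epsilon>"
proof -
  have \<phi>: "bij_betw (\<epsilon> \<circ> \<rho>) X X" by (rule bij_betw_trans[OF assms(3,4)])
  have s: "gr X f \<subseteq> gr H f" "gr H f \<subseteq> gr X f \<union> Id" if "\<And>x. x \<in> H - X \<Longrightarrow> f x = x" for f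
  proof -
    show "gr X f \<subseteq> gr H f" using assms(2) by (auto simp: gr_def)
    have "(x, f x) \<in> gr X f \<union> Id" if "x \<in> H" for x
      using that \<open>\<And>x. x \<in> H - X \<Longrightarrow> f x = x\<close>[of x] by (cases "x \<in> X") (auto simp: gr_def)
    then show "gr H f \<subseteq> gr X f \<union> Id" unfolding gr_def[of H] by blast
  qed
  have fx: "\<And>x. x \<in> H - X \<Longrightarrow> (\<epsilon> \<circ> \<rho>) x = x" using assms(5,6) by simp
  have "kc H (gr H \<rho>) = kc X (gr X \<rho>) + card (H - X)"
    by (rule kc_fixed[OF assms(1,2) gr_sub[OF assms(3)]]) (use s[of \<rho>, OF assms(5)] in auto)
  moreover have "kc H (gr H \<epsilon>) = kc X (gr X \<epsilon>) + card (H - X)"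
    by (rule kc_fixed[OF assms(1,2) gr_sub[OF assms(4)]]) (use s[of \<epsilon>, OF assms(6)] in auto)
  moreover have "kc H (gr H (\<epsilon> \<circ> \<rho>)) = kc X (gr X (\<epsilon> \<circ> \<rho>)) + card (H - X)"
    by (rule kc_fixed[OF assms(1,2) gr_sub[OF \<phi>]]) (use s[of "\<epsilon> \<circ> \<rho>", OF fx] in auto)
  moreover have "kc H (gr H \<rho> \<union> gr H \<epsilon>) = kc X (gr X \<rho> \<union> gr X \<epsilon>) + card (H - X)"
    by (rule kc_fixed[OF assms(1,2)])
       (use gr_sub[OF assms(3)] gr_sub[OF assms(4)] s[of \<rho>, OF assms(5)] s[of \<epsilon>, OF assms(6)] in auto)
  moreover have "card H = card X + card (H - X)"
    using assms(1,2) by (metis card_Diff_subset card_mono finite_subset le_add_diff_inverse)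
  ultimately show ?thesis by (simp add: dfc_def)
qed

text \<open>Deleting every dart from both permutations leaves identities, for which
  \<open>dfc\<close> is 0; each deletion lowers the value by an even amount or keeps it.\<close>

lemma dfc_nonneg_even:
  assumes fin: "finite H" and \<rho>: "bij_betw \<rho> H H" and \<epsilon>: "bij_betw \<epsilon> H H"
  shows "0 \<le> dfc H \<rho> \<epsilon>" "even (dfc H \<rho> \<epsilon>)"
proof -
  obtain g where g: "bij_betw g H H" "\<forall>x\<in>H. g x = x"
     "dfc H g \<epsilon> \<le> dfc H \<rho> \<epsilon>" "even (dfc H g \<epsilon> - dfc H \<rho> \<epsilon>)"
    using first_return_perm[OF fin \<rho> \<epsilon> fin] by auto
  obtain g' where g': "bij_betw g' H H" "\<forall>x\<in>H. g' x = x"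
     "dfc H g' g \<le> dfc H \<epsilon> g" "even (dfc H g' g - dfc H \<epsilon> g)"
    using first_return_perm[OF fin \<epsilon> g(1) fin] by auto
  have "dfc H g' g = dfc {} g' g"
    by (rule dfc_restrict) (use fin g(2) g'(2) in \<open>auto simp: bij_betw_def\<close>)
  also have "\<dots> = 0" by (simp add: dfc_def kc_card_image)
  finally have "dfc H g' g = 0" .
  moreover have "dfc H g \<epsilon> = dfc H \<epsilon> g" by (rule dfc_swap[OF g(1) \<epsilon>])
  ultimately show "0 \<le> dfc H \<rho> \<epsilon>" "even (dfc H \<rho> \<epsilon>)" using g(3,4) g'(3,4) by (simp, presburger)
qed

text \<open>The darts outside \<open>X\<close> are deleted from \<rho>, and then from \<epsilon> by
  \<open>dfc_swap\<close>. As \<epsilon> preserves \<open>X\<close>, its first return to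
  \<open>X\<close> is \<epsilon> itself. The remaining fixed points are dropped by
  \<open>dfc_restrict\<close>.\<close>

lemma dfc_first_return:
  assumes fin: "finite H" and \<rho>: "bij_betw \<rho> H H" and \<epsilon>: "bij_betw \<epsilon> H H"
    and X: "X \<subseteq> H" and \<epsilon>X: "\<And>x. x \<in> X \<Longrightarrow> \<epsilon> x \<in> X"
  shows "dfc X (first_return \<rho> X) \<epsilon> \<le> dfc H \<rho> \<epsilon>"
proof -
  have HX: "H - (H - X) = X" using X by blast
  have fN: "finite (H - X)" using fin by simp
  obtain g where g: "bij_betw g H H" "\<forall>x\<in>H - X. g x = x" "\<forall>x\<in>X. returns \<rho> X x (g x)" "dfc H g \<epsilon> \<le> dfc H \<rho> \<epsilon>"
    using first_return_perm[OF fin \<rho> \<epsilon> fN Diff_subset] unfolding HX by blast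
  obtain g' where g': "bij_betw g' H H" "\<forall>x\<in>H - X. g' x = x" "\<forall>x\<in>X. returns \<epsilon> X x (g' x)" "dfc H g' g \<le> dfc H \<epsilon> g"
    using first_return_perm[OF fin \<epsilon> g(1) fN Diff_subset] unfolding HX by blast
  have bijX: "bij_betw f X X" if "bij_betw f H H" "\<forall>x\<in>X. f x \<in> X" for f
  proof -
    have "inj_on f X" using that(1) X by (auto simp: bij_betw_def intro: inj_on_subset)
    moreover have "finite X" using fin X finite_subset by blast
    ultimately show ?thesis using that(2) endo_inj_surj[of X f] by (auto simp: bij_betw_def)
  qed
  have gX: "first_return \<rho> X x = g x" if "x \<in> X" for x
    by (rule returns_first_return) (use g(3) that in blast)
  have g'X: "\<epsilon> x = g' x" if "x \<in> X" for x
  proof -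
    have "returns \<epsilon> X x (\<epsilon> x)" using \<epsilon>X[OF that] by (auto simp: returns_def intro!: exI[of _ 1])
    moreover have "returns \<epsilon> X x (g' x)" using g'(3) that by blast
    ultimately show ?thesis using returns_first_return by metis
  qed
  have bg: "bij_betw g X X" by (rule bijX[OF g(1)]) (use g(3) in \<open>auto simp: returns_def\<close>)
  have bg': "bij_betw g' X X" by (rule bijX[OF g'(1)]) (use g'(3) in \<open>auto simp: returns_def\<close>)
  have g_in: "g x \<in> X" if "x \<in> X" for x using bg that by (auto simp: bij_betw_def)
  have "gr X (first_return \<rho> X) = gr X g" by (rule gr_cong) (rule gX)
  moreover have "gr X \<epsilon> = gr X g'" by (rule gr_cong) (rule g'X)
  moreover have "gr X (\<epsilon> \<circ> first_return \<rho> X) = gr X (g' \<circ> g)" by (rule gr_cong) (simp add: gX g'X g_in)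
  ultimately have "dfc X (first_return \<rho> X) \<epsilon> = dfc X g g'" by (simp add: dfc_def)
  also have "\<dots> = dfc H g g'"
    by (rule dfc_restrict[symmetric, OF fin X bg bg']) (use g(2) g'(2) in auto)
  also have "\<dots> = dfc H g' g" by (rule dfc_swap[OF g(1) g'(1)])
  also have "\<dots> \<le> dfc H \<epsilon> g" by (rule g'(4))
  also have "\<dots> = dfc H g \<epsilon>" by (rule dfc_swap[OF \<epsilon> g(1)])
  also have "\<dots> \<le> dfc H \<rho> \<epsilon>" by (rule g(4))
  finally show ?thesis .
qed

lemma dfc_iso:
  assumes inj: "inj_on \<iota> H" and \<rho>: "bij_betw \<rho> H H" and \<epsilon>: "bij_betw \<epsilon> H H"
    and "\<And>x. x \<in> H \<Longrightarrow> \<rho>' (\<iota> x) = \<iota> (\<rho> x)" "\<And>x. x \<in> H \<Longrightarrow> \<epsilon>' (\<iota> x) = \<iota> (\<epsilon> x)"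
  shows "dfc (\<iota> ` H) \<rho>' \<epsilon>' = dfc H \<rho> \<epsilon>"
proof -
  have \<phi>: "bij_betw (\<epsilon> \<circ> \<rho>) H H" by (rule bij_betw_trans[OF \<rho> \<epsilon>])
  have \<rho>H: "x \<in> H \<Longrightarrow> \<rho> x \<in> H" for x using \<rho> by (auto simp: bij_betw_def)
  have g: "gr (\<iota> ` H) f' = map_prod \<iota> \<iota> ` gr H f" if "\<And>x. x \<in> H \<Longrightarrow> f' (\<iota> x) = \<iota> (f x)" for f f'
    using that by (simp add: gr_def image_image)
  have g1: "gr (\<iota> ` H) \<rho>' = map_prod \<iota> \<iota> ` gr H \<rho>" by (rule g) (rule assms(4))
  have g2: "gr (\<iota> ` H) \<epsilon>' = map_prod \<iota> \<iota> ` gr H \<epsilon>" by (rule g) (rule assms(5))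
  have g3: "gr (\<iota> ` H) (\<epsilon>' \<circ> \<rho>') = map_prod \<iota> \<iota> ` gr H (\<epsilon> \<circ> \<rho>)"
    by (rule g) (simp add: assms(4,5) \<rho>H)
  have k: "kc (\<iota> ` H) (map_prod \<iota> \<iota> ` R) = kc H R" if "R \<subseteq> H \<times> H" for R
    by (rule kc_inj_image[OF inj that])
  show ?thesis
    unfolding dfc_def g1 g2 g3 image_Un[symmetric]
    using gr_sub[OF \<rho>] gr_sub[OF \<epsilon>] gr_sub[OF \<phi>] by (simp add: k card_image[OF inj])
qed

section \<open>Supporting genus\<close>

text \<open>Unlike \<open>cellulated_surface\<close>, this does not ask the maps to fix everything
  outside the darts, which \<open>rot D\<close> does not; so it applies to \<open>ald D\<close>
  directly.\<close>

definition proto_surface :: "'a cmap \<Rightarrow> bool" where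
  "proto_surface M \<longleftrightarrow> finite (darts M) \<and> bij_betw (rotation M) (darts M) (darts M) \<and>
     (\<forall>e\<in>darts M. opposite M e \<in> darts M \<and> opposite M e \<noteq> e \<and> opposite M (opposite M e) = e)"

lemma cellulated_proto: "cellulated_surface M \<Longrightarrow> proto_surface M"
  unfolding cellulated_surface_def proto_surface_def
  by (auto simp: permutes_imp_bij permutes_in_image)

lemma involution_bij:
  assumes "\<And>e. e \<in> H \<Longrightarrow> f e \<in> H \<and> f (f e) = e"
  shows "bij_betw f H H"
  by (rule bij_betwI[of _ _ _ f]) (use assms in auto)

text \<open>Every orbit is a pair. This counts edges here and gives the evenness in the parity
  argument later.\<close>

lemma involution_orbits:
  assumes fin: "finite H" and inv: "\<And>e. e \<in> H \<Longrightarrow> f e \<in> H \<and> f e \<noteq> e \<and> f (f e) = e"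
  shows "card H = 2 * card (orbit f ` H)"
proof -
  have orb: "orbit f e = {e, f e}" if e: "e \<in> H" for e
  proof (intro subset_antisym subsetI)
    fix y assume "y \<in> orbit f e"
    then show "y \<in> {e, f e}" by (induction rule: orbit.induct) (use inv[OF e] in auto)
  next
    fix y assume "y \<in> {e, f e}"
    then show "y \<in> orbit f e" using orbit.base[of f e] orbit.step[OF orbit.base[of f e]] inv[OF e] by auto
  qed
  have "card H = (\<Sum>W\<in>orbit f ` H. card W)"
  proof -
    have "H = \<Union> (orbit f ` H)" using orb inv by auto
    then have "card H = card (\<Union> (orbit f ` H))" by simp
    also have "\<dots> = (\<Sum>W\<in>orbit f ` H. card W)"
    proof (rule card_Union_disjoint)
      show "disjoint (orbit f ` H)"
        unfolding disjoint_def using orb inv by auto (metis (no_types, lifting))+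
      show "finite A" if "A \<in> orbit f ` H" for A using that orb by auto
    qed
    finally show ?thesis .
  qed
  also have "\<dots> = (\<Sum>W\<in>orbit f ` H. 2)"
  proof (rule sum.cong[OF refl])
    fix W assume "W \<in> orbit f ` H"
    then obtain e where e: "e \<in> H" "W = {e, f e}" using orb by blast
    then show "card W = 2" using inv[OF e(1)] by auto
  qed
  finally show ?thesis by simp
qed

lemma card_orbits_partition:
  assumes "finite H" "\<Union>P = H" "disjoint P" "\<And>C x. C \<in> P \<Longrightarrow> x \<in> C \<Longrightarrow> orbit f x \<subseteq> C \<and> x \<in> orbit f x"
  shows "card (orbit f ` H) = (\<Sum>C\<in>P. card (orbit f ` C))"
proof -
  have "finite P" using assms(1,2) finite_UnionD by blast
  have "orbit f ` H = (\<Union>C\<in>P. orbit f ` C)" using assms(2) by blast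
  then have "card (orbit f ` H) = card (\<Union>C\<in>P. orbit f ` C)" by simp
  also have "\<dots> = (\<Sum>C\<in>P. card (orbit f ` C))"
  proof (rule card_UN_disjoint[OF \<open>finite P\<close>])
    show "\<forall>C\<in>P. finite (orbit f ` C)"
      using assms(1,2) finite_subset by (metis Sup_upper finite_imageI)
    show "\<forall>C\<in>P. \<forall>C'\<in>P. C \<noteq> C' \<longrightarrow> orbit f ` C \<inter> orbit f ` C' = {}"
    proof (intro ballI impI)
      fix C C' assume C: "C \<in> P" "C' \<in> P" "C \<noteq> C'"
      then have "C \<inter> C' = {}" using assms(3) by (auto simp: disjoint_def)
      then show "orbit f ` C \<inter> orbit f ` C' = {}" using assms(4) C by blast
    qed
  qed
  finally show ?thesis .
qed

text \<open>On a component the edges are half as many as the darts, so 2 minus the Euler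
  characteristic is \<open>dfc\<close> of the component. By \<open>dfc_nonneg_even\<close> it is
  even and nonnegative, so \<open>nat\<close> and \<open>div\<close> in the definition of
  \<open>genus\<close> lose nothing.\<close>

lemma genus_dfc:
  assumes M: "proto_surface M"
  shows "2 * int (genus M) = dfc (darts M) (rotation M) (opposite M)"
proof -
  let ?H = "darts M" and ?\<rho> = "rotation M" and ?\<epsilon> = "opposite M"
  let ?\<phi> = "?\<epsilon> \<circ> ?\<rho>" and ?R = "surface_links M"
  have fin: "finite ?H" and \<rho>: "bij_betw ?\<rho> ?H ?H"
    and inv: "\<And>e. e \<in> ?H \<Longrightarrow> ?\<epsilon> e \<in> ?H \<and> ?\<epsilon> e \<noteq> e \<and> ?\<epsilon> (?\<epsilon> e) = e"
    using M by (auto simp: proto_surface_def)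
  have \<epsilon>: "bij_betw ?\<epsilon> ?H ?H" by (rule involution_bij) (use inv in auto)
  have \<phi>: "bij_betw ?\<phi> ?H ?H" by (rule bij_betw_trans[OF \<rho> \<epsilon>])
  have R: "?R = gr ?H ?\<rho> \<union> gr ?H ?\<epsilon>" by (auto simp: surface_links_def gr_def)
  have Rsub: "?R \<subseteq> ?H \<times> ?H" unfolding R using gr_sub[OF \<rho>] gr_sub[OF \<epsilon>] by blast
  define P where "P = surface_components M"
  have P: "P = ?H // eqv ?R" by (simp add: P_def surface_components_def eqv_def)
  have clsH: "y \<in> ?H" if "x \<in> ?H" "(x, y) \<in> eqv ?R" for x y
    by (rule eqv_inv[OF that(2), of "\<lambda>z. z \<in> ?H"]) (use that(1) Rsub in auto)
  have eC: "C = eqv ?R `` {x}" if C: "C \<in> P" "x \<in> C" for C x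
  proof -
    obtain z where z: "z \<in> ?H" "C = eqv ?R `` {z}" using C(1) unfolding P by (rule quotientE)
    then show ?thesis using C(2) eqv_class_eq[of ?R z x] by simp
  qed
  have UP: "\<Union>P = ?H" unfolding P quotient_def using clsH by auto
  have disj: "disjoint P" unfolding disjoint_def using eC by blast
  have closed: "y \<in> C" if "C \<in> P" "x \<in> C" "(x, y) \<in> eqv ?R" for C x y
    using eC[OF that(1,2)] that(3) by simp
  have inH: "x \<in> ?H" if "C \<in> P" "x \<in> C" for C x using that UP by blast
  have orb: "orbit f x \<subseteq> C \<and> x \<in> orbit f x"
    if f: "bij_betw f ?H ?H" "gr ?H f \<subseteq> eqv ?R" and C: "C \<in> P" "x \<in> C" for f C x
  proof -
    note o = orbit_eqv[OF fin f(1) inH[OF C]]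
    have "y \<in> C" if "y \<in> orbit f x" for y
    proof -
      have "(x, y) \<in> eqv (gr ?H f)" using o(1) that by blast
      then have "(x, y) \<in> eqv ?R" by (rule eqv_least) (use f(2) in blast)
      then show ?thesis using closed C by blast
    qed
    then show ?thesis using o(2) by blast
  qed
  have g: "gr ?H ?\<rho> \<subseteq> eqv ?R" "gr ?H ?\<epsilon> \<subseteq> eqv ?R" "gr ?H ?\<phi> \<subseteq> eqv ?R"
    using gr_comp_sub[OF \<rho>, of ?\<epsilon>] unfolding R by (auto intro: eqv_base)
  note part = card_orbits_partition[OF fin UP disj]
  have bijC: "bij_betw f C C" if f: "bij_betw f ?H ?H" "gr ?H f \<subseteq> eqv ?R" and C: "C \<in> P" for f C
  proof -
    have "f x \<in> C" if "x \<in> C" for x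
      using closed[OF C that, of "f x"] f(2) gr_mem[OF inH[OF C that], of f] by blast
    moreover have "inj_on f C" using f(1) C UP by (auto simp: bij_betw_def intro: inj_on_subset)
    moreover have "finite C" using fin UP C by (metis Sup_upper finite_subset)
    ultimately show ?thesis using endo_inj_surj[of C f] by (auto simp: bij_betw_def)
  qed
  have comp: "2 * int (nat ((2 - euler_char (submap M C)) div 2)) =
      2 + int (card C) - int (card (orbit ?\<rho> ` C)) - int (card (orbit ?\<epsilon> ` C)) - int (card (orbit ?\<phi> ` C))"
    if C: "C \<in> P" for C
  proof -
    have finC: "finite C" using fin UP C by (metis Sup_upper finite_subset)
    have b: "bij_betw ?\<rho> C C" "bij_betw ?\<epsilon> C C" "bij_betw ?\<phi> C C"
      using bijC[OF \<rho> g(1) C] bijC[OF \<epsilon> g(2) C] bijC[OF \<phi> g(3) C] .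
    have cardC: "card C = 2 * card (orbit ?\<epsilon> ` C)"
      by (rule involution_orbits[OF finC]) (use inv inH[OF C] b(2) in \<open>auto simp: bij_betw_def\<close>)
    have \<chi>: "euler_char (submap M C) = int (card (orbit ?\<rho> ` C)) - int (card (orbit ?\<epsilon> ` C)) + int (card (orbit ?\<phi> ` C))"
      by (simp add: euler_char_def submap_def boundary_component_def comp_def)
    have "kc C (gr C ?\<rho> \<union> gr C ?\<epsilon>) = 1"
    proof -
      obtain x where x: "x \<in> ?H" "C = eqv ?R `` {x}" using C unfolding P by (rule quotientE)
      have xC: "x \<in> C" using x by simp
      have "(x, y) \<in> eqv (gr C ?\<rho> \<union> gr C ?\<epsilon>)" if "y \<in> C" for y
      proof -
        have "y \<in> C \<and> (x, y) \<in> eqv (gr C ?\<rho> \<union> gr C ?\<epsilon>)"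
        proof (rule eqv_inv[of x y ?R])
          show "(x, y) \<in> eqv ?R" using that x by simp
          show "x \<in> C \<and> (x, x) \<in> eqv (gr C ?\<rho> \<union> gr C ?\<epsilon>)" using xC by simp
          fix a b' assume ab: "(a, b') \<in> ?R"
          have ab_iff: "a \<in> C \<longleftrightarrow> b' \<in> C" using closed[OF C, of a b'] closed[OF C, of b' a] eqv_base[OF ab] eqv_base'[OF ab] by blast
          have "(a, b') \<in> gr C ?\<rho> \<union> gr C ?\<epsilon>" if "a \<in> C" using ab that unfolding R by (auto simp: gr_def)
          then have "(a, b') \<in> eqv (gr C ?\<rho> \<union> gr C ?\<epsilon>)" if "a \<in> C" using that by (intro eqv_base) blast
          then show "(a \<in> C \<and> (x, a) \<in> eqv (gr C ?\<rho> \<union> gr C ?\<epsilon>)) = (b' \<in> C \<and> (x, b') \<in> eqv (gr C ?\<rho> \<union> gr C ?\<epsilon>))"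
            using ab_iff eqv_trans eqv_sym by metis
        qed
        then show ?thesis by simp
      qed
      then have "(\<lambda>y. eqv (gr C ?\<rho> \<union> gr C ?\<epsilon>) `` {y}) ` C = {eqv (gr C ?\<rho> \<union> gr C ?\<epsilon>) `` {x}}"
        using xC eqv_class_eq[of "gr C ?\<rho> \<union> gr C ?\<epsilon>" x] by blast
      then show ?thesis by (simp add: kc_card_image)
    qed
    then have d: "dfc C ?\<rho> ?\<epsilon> = 2 + int (card C) - int (card (orbit ?\<rho> ` C)) - int (card (orbit ?\<epsilon> ` C)) - int (card (orbit ?\<phi> ` C))"
      unfolding dfc_def card_orbits[OF finC b(1)] card_orbits[OF finC b(2)] card_orbits[OF finC b(3)] by simp
    then have e: "2 - euler_char (submap M C) = dfc C ?\<rho> ?\<epsilon>" using cardC \<chi> by simp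
    show ?thesis unfolding d[symmetric] e using dfc_nonneg_even[OF finC b(1,2)] by simp
  qed
  have cardH: "card ?H = (\<Sum>C\<in>P. card C)"
  proof -
    have "card (\<Union>P) = (\<Sum>C\<in>P. card C)"
      by (rule card_Union_disjoint[OF disj]) (use fin UP in \<open>metis Sup_upper finite_subset\<close>)
    then show ?thesis using UP by simp
  qed
  have "2 * int (genus M) = (\<Sum>C\<in>P. 2 * int (nat ((2 - euler_char (submap M C)) div 2)))"
    by (simp add: genus_def P_def sum_distrib_left)
  also have "\<dots> = (\<Sum>C\<in>P. 2 + int (card C) - int (card (orbit ?\<rho> ` C)) - int (card (orbit ?\<epsilon> ` C)) - int (card (orbit ?\<phi> ` C)))"
    by (rule sum.cong) (use comp in auto)
  also have "\<dots> = 2 * int (card P) + int (card ?H) - int (card (orbit ?\<rho> ` ?H)) - int (card (orbit ?\<epsilon> ` ?H)) - int (card (orbit ?\<phi> ` ?H))"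
    using part[OF orb[OF \<rho> g(1)]] part[OF orb[OF \<epsilon> g(2)]] part[OF orb[OF \<phi> g(3)]] cardH
    by (simp add: sum_subtractf sum.distrib)
  also have "\<dots> = dfc ?H ?\<rho> ?\<epsilon>"
    unfolding dfc_def card_orbits[OF fin \<rho>] card_orbits[OF fin \<epsilon>] card_orbits[OF fin \<phi>]
    by (simp add: P kc_def R)
  finally show ?thesis .
qed

text \<open>The upper bound is the surface of \<open>ald D\<close>, copied to the natural numbers
  and extended by the identity. For the lower bound, the first return in a realization is
  \<open>rot D\<close> up to renaming, and \<open>dfc_first_return\<close> applies.\<close>

lemma supporting_genus_eq:
  assumes M: "proto_surface (ald D)"
  shows "2 * int (supporting_genus D) = dfc (half_edges D) (rot D) (other_end D)"
proof -
  let ?H = "half_edges D"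
  have fin: "finite ?H" and \<rho>: "bij_betw (rot D) ?H ?H"
    and inv: "\<And>e. e \<in> ?H \<Longrightarrow> other_end D e \<in> ?H \<and> other_end D e \<noteq> e \<and> other_end D (other_end D e) = e"
    using M by (auto simp: proto_surface_def ald_def)
  have \<epsilon>: "bij_betw (other_end D) ?H ?H" by (rule involution_bij) (use inv in auto)
  have \<rho>H: "e \<in> ?H \<Longrightarrow> rot D e \<in> ?H" for e using \<rho> by (auto simp: bij_betw_def)
  let ?Ex = "\<lambda>g. \<exists>M :: nat cmap. cellulated_surface M \<and> realized_in D M \<and> genus M = g"
  obtain \<iota> :: "half_edge \<Rightarrow> nat" where \<iota>: "inj_on \<iota> ?H"
    using finite_imp_inj_to_nat_seg[OF fin] by blast
  define \<rho>' where "\<rho>' n = (if n \<in> \<iota> ` ?H then \<iota> (rot D (inv_into ?H \<iota> n)) else n)" for n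
  define \<epsilon>' where "\<epsilon>' n = (if n \<in> \<iota> ` ?H then \<iota> (other_end D (inv_into ?H \<iota> n)) else n)" for n
  have r': "\<rho>' (\<iota> e) = \<iota> (rot D e)" and e': "\<epsilon>' (\<iota> e) = \<iota> (other_end D e)" if "e \<in> ?H" for e
    using that \<iota> by (simp_all add: \<rho>'_def \<epsilon>'_def inv_into_f_f)
  have bij': "bij_betw f' (\<iota> ` ?H) (\<iota> ` ?H)" if f: "bij_betw f ?H ?H" "\<And>e. e \<in> ?H \<Longrightarrow> f' (\<iota> e) = \<iota> (f e)" for f f'
  proof -
    have "f' ` \<iota> ` ?H = \<iota> ` f ` ?H" using f(2) by (simp add: image_image)
    then have "f' ` \<iota> ` ?H = \<iota> ` ?H" using f(1) by (simp add: bij_betw_def)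
    then show ?thesis using fin by (simp add: bij_betw_def eq_card_imp_inj_on)
  qed
  let ?M = "CMap (\<iota> ` ?H) \<rho>' \<epsilon>'"
  have b\<rho>': "bij_betw \<rho>' (\<iota> ` ?H) (\<iota> ` ?H)" by (rule bij'[OF \<rho> r'])
  have b\<epsilon>': "bij_betw \<epsilon>' (\<iota> ` ?H) (\<iota> ` ?H)" by (rule bij'[OF \<epsilon> e'])
  have perm: "\<rho>' permutes \<iota> ` ?H" "\<epsilon>' permutes \<iota> ` ?H"
    by (rule bij_imp_permutes[OF b\<rho>'], simp add: \<rho>'_def) (rule bij_imp_permutes[OF b\<epsilon>'], simp add: \<epsilon>'_def)
  have cell: "cellulated_surface ?M"
    unfolding cellulated_surface_def
  proof (simp add: perm fin, intro ballI conjI)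
    fix e assume e: "e \<in> ?H"
    show "\<epsilon>' (\<iota> e) \<noteq> \<iota> e" "\<epsilon>' (\<epsilon>' (\<iota> e)) = \<iota> e"
      using inv[OF e] e e' \<iota> by (auto simp: inj_on_eq_iff)
  qed
  have real: "realized_in D ?M"
    unfolding realized_in_def
  proof (intro exI[of _ \<iota>] conjI ballI)
    fix e assume e: "e \<in> ?H"
    show "opposite ?M (\<iota> e) = \<iota> (other_end D e)" using e' e by simp
    \<comment> \<open>All darts of the copy belong to the diagram, so the first return takes a
      single step.\<close>
    have "returns \<rho>' (\<iota> ` ?H) (\<iota> e) (\<iota> (rot D e))"
      unfolding returns_def using r'[OF e] \<rho>H[OF e] by (auto intro!: exI[of _ 1])
    then show "first_return (rotation ?M) (\<iota> ` ?H) (\<iota> e) = \<iota> (rot D e)"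
      by (simp add: returns_first_return)
  qed (use \<iota> in auto)
  have gM: "2 * int (genus ?M) = dfc ?H (rot D) (other_end D)"
    using genus_dfc[OF cellulated_proto[OF cell]] dfc_iso[OF \<iota> \<rho> \<epsilon>, of \<rho>' \<epsilon>'] r' e' by simp
  have min: "genus ?M \<le> g" if "?Ex g" for g
  proof -
    obtain N :: "nat cmap" where N: "cellulated_surface N" "realized_in D N" "genus N = g" using \<open>?Ex g\<close> by blast
    obtain \<iota>' where i: "inj_on \<iota>' ?H" "\<iota>' ` ?H \<subseteq> darts N"
      "\<And>e. e \<in> ?H \<Longrightarrow> opposite N (\<iota>' e) = \<iota>' (other_end D e)"
      "\<And>e. e \<in> ?H \<Longrightarrow> first_return (rotation N) (\<iota>' ` ?H) (\<iota>' e) = \<iota>' (rot D e)"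
      using N(2) unfolding realized_in_def by blast
    have pN: "proto_surface N" by (rule cellulated_proto[OF N(1)])
    have "dfc (\<iota>' ` ?H) (first_return (rotation N) (\<iota>' ` ?H)) (opposite N) = dfc ?H (rot D) (other_end D)"
      by (rule dfc_iso[OF i(1) \<rho> \<epsilon>]) (use i in auto)
    moreover have "dfc (\<iota>' ` ?H) (first_return (rotation N) (\<iota>' ` ?H)) (opposite N) \<le>
      dfc (darts N) (rotation N) (opposite N)"
    proof (rule dfc_first_return)
      show "bij_betw (opposite N) (darts N) (darts N)"
        by (rule involution_bij) (use pN in \<open>auto simp: proto_surface_def\<close>)
      fix x assume "x \<in> \<iota>' ` ?H"
      then obtain e where e: "e \<in> ?H" "x = \<iota>' e" by blast
      then show "opposite N x \<in> \<iota>' ` ?H" using i(3)[OF e(1)] inv[OF e(1)] by simp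
    qed (use pN i(2) in \<open>auto simp: proto_surface_def\<close>)
    ultimately have "2 * int (genus ?M) \<le> 2 * int (genus N)" using gM genus_dfc[OF pN] by simp
    then show ?thesis using N(3) by simp
  qed
  have "supporting_genus D = genus ?M"
    unfolding supporting_genus_def by (rule Least_equality) (use cell real min in auto)
  then show ?thesis using gM by simp
qed

section \<open>The surface of a diagram\<close>

lemma kc_empty: "kc X {} = card X"
proof -
  have "eqv ({} :: ('a \<times> 'a) set) = Id" by (simp add: eqv_def)
  then show ?thesis by (simp add: kc_card_image card_image)
qed

text \<open>Induction on the number of marks after \<open>t\<close> up to \<open>s\<close>. No step
  passes the base point, since the next mark comes at \<open>s\<close> at the latest.\<close>

lemma nxt_connected:
  assumes M: "marking M" and "(i, t) \<in> M" "(i, s) \<in> M" "t < s"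
  shows "((i, t), (i, s)) \<in> eqv (gr M (nxt M))"
  using assms(2,4)
proof (induction "card {v. t < v \<and> v \<le> s \<and> (i, v) \<in> M}" arbitrary: t rule: less_induct)
  case less
  have fin: "finite {v. (i, v) \<in> M}"
  proof -
    have "{v. (i, v) \<in> M} \<subseteq> snd ` M" by force
    then show ?thesis using M finite_subset by (auto simp: marking_def)
  qed
  obtain r where r: "succ_lift M (i, t) r" "nxt M (i, t) = (i, frac r)"
    using nxt_ex[OF M less.prems(1)] by auto
  have b: "0 \<le> t" "s < 1" "0 \<le> s" using M less.prems(1) assms(3) by (auto simp: marking_def)
  have rs: "t < r" "r \<le> s"
  proof -
    show "t < r" using r(1) by (simp add: succ_lift_def)
    show "r \<le> s"
    proof (rule ccontr)
      assume "\<not> r \<le> s"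
      then have "(i, frac s) \<notin> M" using r(1) less.prems(2) by (simp add: succ_lift_def)
      then show False using assms(3) b by (simp add: frac_id)
    qed
  qed
  then have fr: "frac r = r" using b by (intro frac_id) auto
  have rM: "(i, r) \<in> M" using r(1) fr by (simp add: succ_lift_def)
  have step: "((i, t), (i, r)) \<in> eqv (gr M (nxt M))"
    using eqv_base[OF gr_mem[OF less.prems(1), of "nxt M"]] r(2) fr by simp
  show ?case
  proof (cases "r = s")
    case False
    have "card {v. r < v \<and> v \<le> s \<and> (i, v) \<in> M} < card {v. t < v \<and> v \<le> s \<and> (i, v) \<in> M}"
    proof (rule psubset_card_mono)
      show "finite {v. t < v \<and> v \<le> s \<and> (i, v) \<in> M}" by (rule finite_subset[OF _ fin]) auto
      show "{v. r < v \<and> v \<le> s \<and> (i, v) \<in> M} \<subset> {v. t < v \<and> v \<le> s \<and> (i, v) \<in> M}"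
        using rs rM by (intro psubsetI) (auto simp: set_eq_iff)
    qed
    from less.hyps[OF this rM] have "((i, r), (i, s)) \<in> eqv (gr M (nxt M))" using rs False by simp
    then show ?thesis by (rule eqv_trans[OF step])
  qed (use step in simp)
qed

section \<open>Vertices, edges, components and genus of the surface\<close>

context vdiag
begin

abbreviation "H \<equiv> half_edges D"
abbreviation "\<rho> \<equiv> rot D"
abbreviation "\<epsilon> \<equiv> other_end D"
abbreviation "\<psi> \<equiv> \<epsilon> \<circ> \<rho>"

lemma H_mem: "(x, b) \<in> H \<longleftrightarrow> x \<in> marks D"
  by (simp add: half_edges_def)

lemma fin_H: "finite H"
  using marks_facts(1) by (simp add: half_edges_def)

lemma real_marks: "x \<in> real_params D \<Longrightarrow> x \<in> marks D"
  using marks_facts(2) by blast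

lemma rho_H: "(x, b) \<in> H \<Longrightarrow> \<rho> (x, b) \<in> H"
  by (cases "x \<in> real_params D") (auto simp: rot_real rot_free H_mem intro: real_marks real_partner(1))

lemma rho_bij: "bij_betw \<rho> H H"
proof -
  have "inj_on \<rho> H"
  proof (rule inj_onI)
    fix e f assume ef: "e \<in> H" "f \<in> H" "\<rho> e = \<rho> f"
    obtain x b y c where [simp]: "e = (x, b)" "f = (y, c)" by (cases e, cases f)
    show "e = f"
    proof (cases "x \<in> real_params D"; cases "y \<in> real_params D")
      assume xy: "x \<in> real_params D" "y \<in> real_params D"
      have "(partner D x, b = sg D x) = (partner D y, c = sg D y)"
        using ef(3) by (simp only: \<open>e = (x, b)\<close> \<open>f = (y, c)\<close> rot_real[OF xy(1)] rot_real[OF xy(2)])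
      then have p: "partner D x = partner D y" and bc: "(b = sg D x) = (c = sg D y)"
        unfolding prod.inject by blast+
      have "x = partner D (partner D x)" by (rule partner_props(6)[OF real_double[OF xy(1)], symmetric])
      also have "\<dots> = y" unfolding p by (rule partner_props(6)[OF real_double[OF xy(2)]])
      finally have "x = y" .
      moreover from this bc have "b = c" by (cases "sg D y"; simp)
      ultimately show ?thesis by simp
    next
      assume xy: "x \<in> real_params D" "y \<notin> real_params D"
      then have "partner D x = y" using ef(3) by (simp add: rot_real[OF xy(1)] rot_free[OF xy(2)])
      then show ?thesis using real_partner(1)[OF xy(1)] xy(2) by simp
    next
      assume xy: "x \<notin> real_params D" "y \<in> real_params D"
      then have "x = partner D y" using ef(3) by (simp add: rot_real[OF xy(2)] rot_free[OF xy(1)])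
      then show ?thesis using real_partner(1)[OF xy(2)] xy(1) by simp
    next
      assume xy: "x \<notin> real_params D" "y \<notin> real_params D"
      then show ?thesis using ef(3) by (simp add: rot_free[OF xy(1)] rot_free[OF xy(2)])
    qed
  qed
  moreover have "\<rho> ` H \<subseteq> H" using rho_H by (intro image_subsetI) (metis prod.collapse)
  ultimately show ?thesis using endo_inj_surj[OF fin_H] unfolding bij_betw_def by blast
qed

lemma eps_inv:
  assumes "e \<in> H"
  shows "\<epsilon> e \<in> H" "\<epsilon> e \<noteq> e" "\<epsilon> (\<epsilon> e) = e" "snd (\<epsilon> e) = (\<not> snd e)" "fst (fst (\<epsilon> e)) = fst (fst e)"
proof -
  obtain x b where e: "e = (x, b)" "x \<in> marks D" using assms by (cases e) (auto simp: H_mem)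
  have "\<epsilon> e \<in> H \<and> \<epsilon> e \<noteq> e \<and> \<epsilon> (\<epsilon> e) = e \<and> snd (\<epsilon> e) = (\<not> snd e) \<and> fst (fst (\<epsilon> e)) = fst (fst e)"
  proof (cases b)
    case True
    then show ?thesis
      using e nxt_in[OF marking_marks e(2)] other_end_False[OF e(2)] other_end_True[of x]
      by (simp add: H_mem del: other_end.simps)
  next
    case False
    obtain y where y: "y \<in> marks D" "x = nxt (marks D) y" "\<epsilon> (x, False) = (y, True)"
      using other_end_False_ex[OF e(2)] .
    have "fst x = fst y" using y(2) by simp
    then show ?thesis
      using e y False other_end_True[of y] by (simp add: H_mem del: other_end.simps)
  qed
  then show "\<epsilon> e \<in> H" "\<epsilon> e \<noteq> e" "\<epsilon> (\<epsilon> e) = e" "snd (\<epsilon> e) = (\<not> snd e)" "fst (fst (\<epsilon> e)) = fst (fst e)" by blast+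
qed

lemma eps_bij: "bij_betw \<epsilon> H H"
  by (rule involution_bij) (use eps_inv in blast)

lemma psi_bij: "bij_betw \<psi> H H"
  by (rule bij_betw_trans[OF rho_bij eps_bij])

lemma proto_ald: "proto_surface (ald D)"
  unfolding proto_surface_def ald_def using fin_H rho_bij eps_inv by simp

lemma rho_rho:
  assumes "x \<in> real_params D"
  shows "\<rho> (\<rho> (x, b)) = (x, \<not> b)"
  using rot_real[OF assms] rot_real[OF real_partner(1)[OF assms]] partner_props(6,9)[OF real_double[OF assms]]
  by auto

lemma rho_sides:
  assumes "x \<in> marks D"
  shows "((x, b), (x, c)) \<in> eqv (gr H \<rho>)"
proof -
  have s: "(e, \<rho> e) \<in> eqv (gr H \<rho>)" if "e \<in> H" for e using eqv_base[OF gr_mem[OF that]] .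
  have h: "(x, b) \<in> H" for b using assms by (simp add: H_mem)
  have "((x, b), (x, \<not> b)) \<in> eqv (gr H \<rho>)"
  proof (cases "x \<in> real_params D")
    case True
    show ?thesis using eqv_trans[OF s[OF h] s[OF rho_H[OF h]], of b] unfolding rho_rho[OF True] .
  next
    case False
    then show ?thesis using s[OF h, of b] by (simp add: rot_free)
  qed
  then show ?thesis by (cases "b = c") auto
qed

lemma rho_partner:
  assumes "x \<in> real_params D"
  shows "((x, b), (partner D x, c)) \<in> eqv (gr H \<rho>)"
proof -
  have "(x, b) \<in> H" using real_marks[OF assms] by (simp add: H_mem)
  from eqv_base[OF gr_mem[OF this, of \<rho>]] have "((x, b), (partner D x, b = sg D x)) \<in> eqv (gr H \<rho>)"
    by (simp add: rot_real[OF assms])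
  then show ?thesis
    by (rule eqv_trans) (rule rho_sides[OF real_marks[OF real_partner(1)[OF assms]]])
qed

definition rep :: "param \<Rightarrow> param" where
  "rep x = (if x \<in> real_params D \<and> x \<notin> Ov D then partner D x else x)"

text \<open>The vertices of the surface: a crossing is represented by its over-strand, a circle
  without real crossings by its bivalent vertex.\<close>

lemma kc_rho: "kc H (gr H \<rho>) = card (Ov D) + card (marks D - real_params D)"
proof -
  let ?f = "rep \<circ> fst"
  have rep_partner: "rep (partner D x) = rep x" if x: "x \<in> real_params D" for x
    using real_partner[OF x] partner_props(6)[OF real_double[OF x]] x by (auto simp: rep_def Ov_def)
  have rep_cases: "x = rep x \<or> x \<in> real_params D \<and> rep x = partner D x" for x by (auto simp: rep_def)
  have "kc H (gr H \<rho>) = kc (Ov D \<union> (marks D - real_params D)) {}"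
  proof (rule kc_map[where f = ?f])
    show "?f ` H = Ov D \<union> (marks D - real_params D)"
    proof (intro subset_antisym subsetI)
      fix y assume "y \<in> ?f ` H"
      then obtain x where x: "x \<in> marks D" "y = rep x" by (auto simp: half_edges_def)
      show "y \<in> Ov D \<union> (marks D - real_params D)"
      proof (cases "x \<in> real_params D")
        case True
        then show ?thesis using x(2) by (cases rule: real_cases[OF True]) (auto simp: rep_def)
      qed (use x in \<open>auto simp: rep_def\<close>)
    next
      fix y assume y: "y \<in> Ov D \<union> (marks D - real_params D)"
      then have "(y, True) \<in> H" using y real_marks[of y] Ov_real[of y] by (auto simp: H_mem)
      moreover have "?f (y, True) = y" using y by (auto simp: rep_def)
      ultimately show "y \<in> ?f ` H" by (metis image_eqI)
    qed
    show "gr H \<rho> \<subseteq> H \<times> H" by (rule gr_sub[OF rho_bij])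
    fix a b assume "(a, b) \<in> gr H \<rho>"
    then have ab: "a \<in> H" "b = \<rho> a" by (auto simp: gr_def)
    obtain x c where a: "a = (x, c)" by (cases a)
    have "?f a = ?f b"
    proof (cases "x \<in> real_params D")
      case True
      then show ?thesis using ab a rot_real[OF True] rep_partner[OF True] by simp
    qed (simp add: ab a rot_free)
    then show "(?f a, ?f b) \<in> eqv {}" by simp
  next
    fix e f assume ef: "e \<in> H" "f \<in> H" "?f e = ?f f"
    obtain x b y c where e: "e = (x, b)" "f = (y, c)" by (cases e, cases f)
    have m: "x \<in> marks D" "y \<in> marks D" using ef e by (auto simp: H_mem)
    have to_rep: "((z, d), (rep z, True)) \<in> eqv (gr H \<rho>)" if "z \<in> marks D" for z d
      using rep_cases[of z] rho_sides[OF that] rho_partner[of z] by metis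
    show "(e, f) \<in> eqv (gr H \<rho>)"
    proof -
      have r: "rep x = rep y" using ef(3) e by simp
      show ?thesis
        using eqv_trans[OF to_rep[OF m(1), of b, unfolded r] eqv_sym[OF to_rep[OF m(2), of c]]] e by simp
    qed
  qed simp
  moreover have "Ov D \<inter> (marks D - real_params D) = {}" using Ov_real by blast
  ultimately show ?thesis using fin_Ov marks_facts(1) by (simp add: kc_empty card_Un_disjoint)
qed

lemma card_real: "card (real_params D) = 2 * card (Ov D)"
proof -
  have "real_params D = Ov D \<union> partner D ` Ov D"
  proof (intro subset_antisym subsetI)
    fix x assume x: "x \<in> real_params D"
    then show "x \<in> Ov D \<union> partner D ` Ov D"
    proof (cases rule: real_cases)
      case 2
      then have "x = partner D (partner D x)" by simp
      then show ?thesis using 2(1) by blast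
    qed simp
  qed (use Ov_real real_partner(1) in blast)
  moreover have "Ov D \<inter> partner D ` Ov D = {}"
    using real_partner(2)[OF Ov_real] by (auto simp: Ov_def)
  moreover have "inj_on (partner D) (Ov D)"
    by (rule inj_on_inverseI[of _ "partner D"]) (rule partner_props(6)[OF real_double[OF Ov_real]])
  ultimately show ?thesis using fin_Ov by (simp add: card_Un_disjoint card_image)
qed

lemma card_H: "card H = 2 * (2 * card (Ov D) + card (marks D - real_params D))"
proof -
  have "card (marks D) = card (real_params D) + card (marks D - real_params D)"
    using marks_facts(1,2) by (metis card_Diff_subset card_mono fin_real le_add_diff_inverse)
  then show ?thesis by (simp add: half_edges_def card_cartesian_product card_real)
qed

lemma kc_eps: "2 * kc H (gr H \<epsilon>) = card H"
  using involution_orbits[OF fin_H, of \<epsilon>] eps_inv card_orbits[OF fin_H eps_bij] by simp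

lemma same_circle:
  assumes "x \<in> marks D" "y \<in> marks D" "fst x = fst y"
  shows "((x, b), (y, c)) \<in> eqv (gr H \<rho> \<union> gr H \<epsilon>)"
proof -
  let ?R = "gr H \<rho> \<union> gr H \<epsilon>"
  have side: "((z, b), (z, c)) \<in> eqv ?R" if "z \<in> marks D" for z b c
    using rho_sides[OF that] by (rule eqv_rel_mono) simp
  have "((z, True), (w, True)) \<in> eqv ?R" if zw: "(z, w) \<in> gr (marks D) (nxt (marks D))" for z w
  proof -
    have z: "z \<in> marks D" "w = nxt (marks D) z" using zw by (auto simp: gr_def)
    have zH: "(z, True) \<in> H" using z by (simp add: H_mem)
    have "((z, True), \<epsilon> (z, True)) \<in> eqv (gr H \<epsilon>)" by (rule eqv_base[OF gr_mem[OF zH]])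
    then have "((z, True), \<epsilon> (z, True)) \<in> eqv ?R" by (rule eqv_rel_mono) simp
    then have "((z, True), (w, False)) \<in> eqv ?R" using z(2) other_end_True[of z] by simp
    then show ?thesis by (rule eqv_trans) (rule side, simp add: z nxt_in[OF marking_marks])
  qed
  then have conn: "(z, w) \<in> eqv (gr (marks D) (nxt (marks D))) \<Longrightarrow> ((z, True), (w, True)) \<in> eqv ?R" for z w
    using eqv_map[of z w _ "\<lambda>z. (z, True)"] by blast
  obtain i t s where xy: "x = (i, t)" "y = (i, s)" using assms(3) by (cases x, cases y) auto
  have "((x, True), (y, True)) \<in> eqv ?R"
  proof (cases t s rule: linorder_cases)
    case less
    then show ?thesis using conn nxt_connected[OF marking_marks] assms xy by blast
  next
    case greater
    then show ?thesis using eqv_sym[OF conn] nxt_connected[OF marking_marks] assms xy by blast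
  qed (simp add: xy)
  then show ?thesis using eqv_trans[OF eqv_trans[OF side[OF assms(1)]] side[OF assms(2)]] by blast
qed

text \<open>A half-edge is sent to the index of its circle. \<open>same_circle\<close> connects the
  half-edges of one circle, and rotation at a crossing links the circles that meet there.\<close>

lemma kc_components: "kc H (gr H \<rho> \<union> gr H \<epsilon>) = card (connected_components D)"
proof -
  let ?R = "gr H \<rho> \<union> gr H \<epsilon>"
  have "meets D \<union> (meets D)\<inverse> = meets D" by (auto simp: meets_def) metis+
  then have "card (connected_components D) = kc {..<ncomp D} (meets D)"
    by (simp add: connected_components_def kc_def eqv_def)
  also have "\<dots> = kc H ?R"
  proof (rule sym, rule kc_map[where f = "fst \<circ> fst"])
    have "(fst \<circ> fst) ` H = fst ` marks D" by (force simp: half_edges_def image_iff)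
    then show "(fst \<circ> fst) ` H = {..<ncomp D}" using marks_facts(5) by simp
    show "?R \<subseteq> H \<times> H" using gr_sub[OF rho_bij] gr_sub[OF eps_bij] by blast
    show "((fst \<circ> fst) a, (fst \<circ> fst) b) \<in> eqv (meets D)" if ab: "(a, b) \<in> ?R" for a b
    proof -
      from ab consider "a \<in> H" "b = \<rho> a" | "a \<in> H" "b = \<epsilon> a" by (auto simp: gr_def)
      then show ?thesis
      proof cases
        case 1
        obtain x c where a: "a = (x, c)" by (cases a)
        show ?thesis
        proof (cases "x \<in> real_params D")
          case True
          have "pt D (partner D x) = pt D x" by (rule partner_props(4)[OF real_double[OF True]])
          then have "(fst x, fst (partner D x)) \<in> meets D"
            using True real_partner(1)[OF True] unfolding meets_def
            by (intro CollectI case_prodI exI[of _ "snd x"] exI[of _ "snd (partner D x)"]) simp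
          then show ?thesis using 1 a rot_real[OF True] by (simp add: eqv_base)
        qed (simp add: 1 a rot_free)
      qed (use eps_inv(5) in simp)
    qed
    show "\<exists>a' b'. a' \<in> H \<and> b' \<in> H \<and> (a', b') \<in> eqv ?R \<and> (fst \<circ> fst) a' = i \<and> (fst \<circ> fst) b' = j"
      if ij: "(i, j) \<in> meets D" for i j
    proof -
      obtain t u where tu: "(i, t) \<in> real_params D" "(j, u) \<in> real_params D" "pt D (i, t) = pt D (j, u)"
        using ij by (auto simp: meets_def)
      have h: "((i, t), True) \<in> H" "((j, u), True) \<in> H" using tu real_marks by (simp_all add: H_mem)
      have "(((i, t), True), ((j, u), True)) \<in> eqv (gr H \<rho>)"
      proof (cases "(i, t) = (j, u)")
        case False
        then have "partner D (i, t) = (j, u)"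
          using tu real_params_subset by (intro partner_eq) auto
        then show ?thesis using rho_partner[OF tu(1), of True True] by simp
      qed simp
      then have "(((i, t), True), ((j, u), True)) \<in> eqv ?R" by (rule eqv_rel_mono) simp
      then show ?thesis using h by (intro exI[of _ "((i, t), True)"] exI[of _ "((j, u), True)"]) simp
    qed
    show "(e, f) \<in> eqv ?R" if ef: "e \<in> H" "f \<in> H" "(fst \<circ> fst) e = (fst \<circ> fst) f" for e f
    proof -
      have "fst e \<in> marks D" "fst f \<in> marks D" using ef by (auto simp: half_edges_def)
      from same_circle[OF this, of "snd e" "snd f"] show ?thesis using ef(3) by simp
    qed
  qed
  finally show ?thesis by simp
qed

text \<open>With c crossings and f free circles there are c + f vertices, 2c + f edges and 4c + 2f
  darts; f cancels.\<close>

lemma dfc_ald: "dfc H \<rho> \<epsilon> = 2 * int (card (connected_components D)) + int (crossing_number D) - int (kc H (gr H \<psi>))"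
proof -
  have "int (card H) = 2 * int (kc H (gr H \<epsilon>))" using kc_eps by simp
  moreover have "int (kc H (gr H \<epsilon>)) = 2 * int (card (Ov D)) + int (card (marks D - real_params D))"
    using kc_eps card_H by simp
  ultimately show ?thesis
    unfolding dfc_def kc_components kc_rho crossing_number by simp
qed

lemma genus_eq:
  "2 * int (supporting_genus D) = 2 * int (card (connected_components D)) + int (crossing_number D) - int (kc H (gr H \<psi>))"
  using supporting_genus_eq[OF proto_ald] dfc_ald by simp

end

section \<open>Alternating diagrams\<close>

locale alternating_vdiag = vdiag +
  assumes alt: "alternating D"
begin

text \<open>The darts at under-strands. The corners at these darts are the ones joined by the A-splices.\<close>

definition U :: "half_edge set" where
  "U = {e \<in> H. if fst e \<in> real_params D then lvl D (fst e) = level.Under else snd e}"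

lemma free_nxt:
  assumes "x \<in> marks D" "x \<notin> real_params D"
  shows "nxt (marks D) x = x"
proof -
  obtain i where i: "i \<in> free_circles D" "x = (i, 0)" using assms marks_facts(4) by blast
  have m: "nxt (marks D) x \<in> marks D" by (rule nxt_in[OF marking_marks assms(1)])
  have f: "fst (nxt (marks D) x) = i" using i by simp
  have "(i, t) \<notin> real_params D" for t using i(1) by (simp add: free_circles_def)
  then have "nxt (marks D) x \<notin> real_params D" using f by (metis prod.collapse)
  then obtain j where "nxt (marks D) x = (j, 0)" using m marks_facts(4) by blast
  then show ?thesis using f i(2) by simp
qed

lemma real_nxt:
  assumes "x \<in> real_params D"
  shows "nxt (marks D) x \<in> real_params D" "lvl D (nxt (marks D) x) \<noteq> lvl D x"
proof -
  have n: "nxt (marks D) x \<in> marks D" by (rule nxt_in[OF marking_marks real_marks[OF assms]])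
  show "nxt (marks D) x \<in> real_params D"
  proof (rule ccontr)
    assume "nxt (marks D) x \<notin> real_params D"
    then obtain i where "i \<in> free_circles D" "nxt (marks D) x = (i, 0)" using n marks_facts(4) by blast
    then show False using assms fst_nxt[of "marks D" x] by (cases x) (auto simp: free_circles_def)
  qed
  show "lvl D (nxt (marks D) x) \<noteq> lvl D x"
    using alt assms unfolding alternating_def next_mark_nxt by blast
qed

lemma real_lvl: "x \<in> real_params D \<Longrightarrow> lvl D x \<noteq> level.Under \<longleftrightarrow> lvl D x = Over"
  using real_partner(2)[of x] by auto

text \<open>Alternation enters here: the two ends of an edge have different levels. On a free circle
  \<open>U\<close> takes the outgoing half-edge, so that the exchange holds there too.\<close>

lemma swap_eps:
  assumes "e \<in> H"
  shows "\<epsilon> e \<in> U \<longleftrightarrow> e \<notin> U"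
proof -
  have T: "\<epsilon> (x, True) \<in> U \<longleftrightarrow> (x, True) \<notin> U" if x: "x \<in> marks D" for x
  proof -
    have h: "(x, True) \<in> H" "(nxt (marks D) x, False) \<in> H" using x nxt_in[OF marking_marks x] by (simp_all add: H_mem)
    show ?thesis
    proof (cases "x \<in> real_params D")
      case True
      then show ?thesis unfolding other_end_True U_def
        using h real_nxt[OF True] real_lvl[OF True] real_lvl[OF real_nxt(1)[OF True]] by auto
    next
      case False
      then show ?thesis unfolding other_end_True U_def using h free_nxt[OF x False] by auto
    qed
  qed
  obtain x b where e: "e = (x, b)" "x \<in> marks D" using assms by (cases e) (auto simp: H_mem)
  show ?thesis
  proof (cases b)
    case False
    obtain y where y: "y \<in> marks D" "x = nxt (marks D) y" "\<epsilon> (x, False) = (y, True)"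
      using other_end_False_ex[OF e(2)] .
    have "\<epsilon> (y, True) = e" using y e False other_end_True[of y] by simp
    then show ?thesis using T[OF y(1)] y(3) e False by simp
  qed (use T e in simp)
qed

lemma swap_rho:
  assumes "e \<in> H"
  shows "\<rho> e \<in> U \<longleftrightarrow> e \<notin> U"
proof -
  obtain x b where e: "e = (x, b)" "x \<in> marks D" using assms by (cases e) (auto simp: H_mem)
  have h: "\<rho> e \<in> H" using rho_H assms e by simp
  show ?thesis
  proof (cases "x \<in> real_params D")
    case True
    show ?thesis
      using h assms e True real_partner[OF True] by (auto simp: U_def rot_real)
  next
    case False
    then show ?thesis using h assms e by (auto simp: U_def rot_free)
  qed
qed

lemma U_sub: "U \<subseteq> H"
  by (auto simp: U_def)

text \<open>Every edge has exactly one end in \<open>W\<close>. Contracting the edges to these ends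
  turns a splice arc from e to \<rho> e into a pair e, \<psi> e, so the loops of the state are the
  boundary components through \<open>W\<close>. Half-edges of \<open>X\<close> outside
  \<open>W\<close> add nothing, as \<rho> and \<epsilon> agree there.\<close>

lemma state_boundary:
  assumes W: "W = U \<or> W = H - U" and X: "W \<subseteq> X" "X \<subseteq> H" "\<And>e. e \<in> X - W \<Longrightarrow> \<epsilon> e = \<rho> e"
    and R: "R = gr H \<epsilon> \<union> gr X \<rho>"
  shows "kc H R = kc W (gr W \<psi>)"
    "e \<in> W \<Longrightarrow> f \<in> W \<Longrightarrow> (e, f) \<in> eqv R \<Longrightarrow> orbit \<psi> e = orbit \<psi> f"
proof -
  have WH: "W \<subseteq> H" using W U_sub by auto
  have eW: "\<epsilon> e \<in> W \<longleftrightarrow> e \<notin> W" and rW: "\<rho> e \<in> W \<longleftrightarrow> e \<notin> W" if "e \<in> H" for e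
    using W swap_eps[OF that] swap_rho[OF that] that eps_inv(1)[OF that] rho_H[of "fst e" "snd e"] by auto
  have rH: "\<rho> e \<in> H" if "e \<in> H" for e using rho_H[of "fst e" "snd e"] that by simp
  define g where "g e = (if e \<in> W then e else \<epsilon> e)" for e
  have g_eps: "g (\<epsilon> e) = g e" if "e \<in> H" for e using eW[OF that] eps_inv(3)[OF that] by (simp add: g_def)
  have g_rho: "g (\<rho> e) = \<psi> e" if "e \<in> W" for e using rW[of e] WH that by (auto simp: g_def)
  have fwd: "(g a, g b) \<in> eqv (gr W \<psi>)" if ab: "(a, b) \<in> R" for a b
  proof -
    from ab consider "a \<in> H" "b = \<epsilon> a" | "a \<in> W" "b = \<rho> a" | "a \<in> X - W" "b = \<rho> a"
      unfolding R by (auto simp: gr_def)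
    then show ?thesis
    proof cases
      case 1
      then show ?thesis using g_eps by simp
    next
      case 2
      then have "(g a, g b) = (a, \<psi> a)" using g_rho by (simp add: g_def)
      then show ?thesis using eqv_base[OF gr_mem[OF 2(1), of \<psi>]] by simp
    next
      case 3
      then have "b = \<epsilon> a" "a \<in> H" using X by auto
      then show ?thesis using g_eps by simp
    qed
  qed
  show "kc H R = kc W (gr W \<psi>)"
  proof (rule kc_map[where f = g])
    show "g ` H = W"
    proof (intro subset_antisym subsetI)
      fix y assume "y \<in> g ` H"
      then show "y \<in> W" using eW by (auto simp: g_def)
    next
      fix y assume "y \<in> W"
      then show "y \<in> g ` H" using WH by (intro image_eqI[of _ _ y]) (auto simp: g_def)
    qed
    show "R \<subseteq> H \<times> H" unfolding R using gr_sub[OF eps_bij] rH X(2) by (auto simp: gr_def)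
    show "(g a, g b) \<in> eqv (gr W \<psi>)" if "(a, b) \<in> R" for a b by (rule fwd[OF that])
    show "\<exists>a' b'. a' \<in> H \<and> b' \<in> H \<and> (a', b') \<in> eqv R \<and> g a' = a \<and> g b' = b" if "(a, b) \<in> gr W \<psi>" for a b
    proof -
      have a: "a \<in> W" "b = \<psi> a" using that by (auto simp: gr_def)
      have "(a, \<rho> a) \<in> R" unfolding R using a(1) X(1) by (auto simp: gr_def)
      then show ?thesis using a WH rH[of a] g_rho[OF a(1)] eqv_base[of a "\<rho> a" R]
        by (intro exI[of _ a] exI[of _ "\<rho> a"]) (auto simp: g_def)
    qed
    show "(x, y) \<in> eqv R" if xy: "x \<in> H" "y \<in> H" "g x = g y" for x y
    proof -
      have "(z, g z) \<in> eqv R" if "z \<in> H" for z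
      proof (cases "z \<in> W")
        case False
        have "(z, \<epsilon> z) \<in> R" unfolding R using that by (auto simp: gr_def)
        then show ?thesis using False by (simp add: g_def eqv_base)
      qed (simp add: g_def)
      from eqv_trans[OF this[OF xy(1)]] eqv_sym[OF this[OF xy(2)]] show ?thesis using xy(3) by simp
    qed
  qed
  assume ef: "e \<in> W" "f \<in> W" "(e, f) \<in> eqv R"
  have "(g e, g f) \<in> eqv (gr W \<psi>)" by (rule eqv_map[OF ef(3) fwd])
  then have "(e, f) \<in> eqv (gr W \<psi>)" using ef by (simp add: g_def)
  then have "(e, f) \<in> eqv (gr H \<psi>)" by (rule eqv_rel_mono) (use WH in \<open>auto simp: gr_def\<close>)
  then have "eqv (gr H \<psi>) `` {e} = eqv (gr H \<psi>) `` {f}" by (simp add: eqv_class_eq)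
  moreover have "orbit \<psi> x = eqv (gr H \<psi>) `` {x}" if "x \<in> W" for x
    using orbit_eqv(1)[OF fin_H psi_bij, of x] that WH by blast
  ultimately show "orbit \<psi> e = orbit \<psi> f" using ef by simp
qed

text \<open>The half-edges at which the all-A state follows \<open>rot\<close>; in contrast to
  \<open>U\<close> it contains both half-edges of a free circle.\<close>

definition XA :: "half_edge set" where
  "XA = {e \<in> H. fst e \<in> real_params D \<longrightarrow> lvl D (fst e) = level.Under}"

definition XB :: "half_edge set" where
  "XB = {e \<in> H. fst e \<in> real_params D \<longrightarrow> lvl D (fst e) = Over}"

lemma free_eps_rho:
  assumes "e \<in> H" "fst e \<notin> real_params D"
  shows "\<epsilon> e = \<rho> e"
proof -
  obtain x b where e: "e = (x, b)" by (cases e)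
  have x: "x \<in> marks D" "x \<notin> real_params D" using assms e by (auto simp: H_mem)
  have "\<epsilon> (x, True) = (x, False)" using other_end_True[of x] free_nxt[OF x] by simp
  moreover have "\<epsilon> (x, False) = (x, True)" using other_end_False[OF x(1)] free_nxt[OF x] by simp
  ultimately show ?thesis using e rot_free[OF x(2)] by (cases b) simp_all
qed

lemma XA_props: "U \<subseteq> XA" "XA \<subseteq> H" "e \<in> XA - U \<Longrightarrow> \<epsilon> e = \<rho> e"
  and XB_props: "H - U \<subseteq> XB" "XB \<subseteq> H" "e \<in> XB - (H - U) \<Longrightarrow> \<epsilon> e = \<rho> e"
proof -
  show "U \<subseteq> XA" "XA \<subseteq> H" by (auto simp: U_def XA_def)
  show "XB \<subseteq> H" by (auto simp: XB_def)
  show "H - U \<subseteq> XB"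
  proof
    fix e assume "e \<in> H - U"
    then show "e \<in> XB" using real_lvl[of "fst e"] by (auto simp: U_def XB_def)
  qed
  show "e \<in> XA - U \<Longrightarrow> \<epsilon> e = \<rho> e" by (rule free_eps_rho) (auto simp: U_def XA_def)
  show "e \<in> XB - (H - U) \<Longrightarrow> \<epsilon> e = \<rho> e" by (rule free_eps_rho) (auto simp: U_def XB_def)
qed

lemma links_A: "state_links D (real_crossings D) = gr H \<epsilon> \<union> gr XA \<rho>"
proof -
  have "pt D x \<in> real_crossings D" if "x \<in> real_params D" for x using that by (simp add: real_crossings_def)
  then have "XA = {e \<in> H. fst e \<in> real_params D \<longrightarrow> lvl D (fst e) = (if pt D (fst e) \<in> real_crossings D then level.Under else Over)}"
    unfolding XA_def by auto
  then show ?thesis unfolding state_links_def gr_def by blast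
qed

lemma links_B: "state_links D {} = gr H \<epsilon> \<union> gr XB \<rho>"
  unfolding state_links_def gr_def XB_def by auto

text \<open>\<psi> preserves \<open>U\<close> and its complement, because \<rho> and \<epsilon> both
  exchange them; so every boundary component belongs to exactly one of the two states.\<close>

lemma boundary_loops: "kc H (gr H \<psi>) = loops D (real_crossings D) + loops D {}"
proof -
  have "loops D S = kc H (state_links D S)" for S by (simp add: loops_def kc_def eqv_def)
  then have l: "loops D (real_crossings D) = kc U (gr U \<psi>)" "loops D {} = kc (H - U) (gr (H - U) \<psi>)"
    using state_boundary(1)[OF disjI1[OF refl] XA_props links_A] state_boundary(1)[OF disjI2[OF refl] XB_props links_B] by simp_all
  have cl: "\<psi> e \<in> U \<longleftrightarrow> e \<in> U" if "e \<in> H" for e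
    using swap_rho[OF that] swap_eps[of "\<rho> e"] rho_H[of "fst e" "snd e"] that by simp
  have bij: "bij_betw \<psi> W W" if W: "W = U \<or> W = H - U" for W
  proof -
    have psiH: "\<psi> e \<in> H" if "e \<in> H" for e using psi_bij that by (auto simp: bij_betw_def)
    have "\<psi> ` W \<subseteq> W" using W cl psiH U_sub by auto
    moreover have "inj_on \<psi> W" using psi_bij W U_sub by (auto simp: bij_betw_def intro: inj_on_subset)
    moreover have "finite W" using W fin_H U_sub finite_subset by auto
    ultimately show ?thesis using endo_inj_surj[of W \<psi>] unfolding bij_betw_def by blast
  qed
  have fin: "finite U" "finite (H - U)" using fin_H U_sub finite_subset by auto
  have "card (orbit \<psi> ` H) = (\<Sum>C\<in>{U, H - U}. card (orbit \<psi> ` C))"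
  proof (rule card_orbits_partition[OF fin_H])
    show "\<Union> {U, H - U} = H" using U_sub by auto
    show "disjoint {U, H - U}" by (auto simp: disjoint_def)
    fix C x assume C: "C \<in> {U, H - U}" "x \<in> C"
    from C(1) have "C = U \<or> C = H - U" by simp
    then have "bij_betw \<psi> C C" "finite C" using bij fin by metis+
    from orbit_eqv(2,3)[OF this(2,1) C(2)] show "orbit \<psi> x \<subseteq> C \<and> x \<in> orbit \<psi> x" by simp
  qed
  moreover have "(\<Sum>C\<in>{U, H - U}. card (orbit \<psi> ` C)) = card (orbit \<psi> ` U) + card (orbit \<psi> ` (H - U))"
  \<comment> \<open>The sum over two sets collapses if they coincide, which happens only when both
    are empty.\<close>
  proof (cases "U = H - U")
    case True
    then have "U = {}" by blast
    moreover from this True have "H = {}" by blast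
    ultimately show ?thesis by simp
  qed simp
  ultimately show ?thesis
    unfolding card_orbits[OF fin_H psi_bij] card_orbits[OF fin(1) bij[OF disjI1[OF refl]]]
      card_orbits[OF fin(2) bij[OF disjI2[OF refl]]] l by simp
qed

end

section \<open>Adequacy\<close>

lemma pair_times_bool: "{a, b} \<times> (UNIV :: bool set) = {(a, True), (a, False), (b, True), (b, False)}"
  by (auto simp: UNIV_bool)

text \<open>Either splice together with one more pair identifies all four darts. Hence each of the
  two loop counts equals a common value or exceeds it by one.\<close>

lemma kc_switch_le:
  assumes "finite X" "P \<in> X" "Q \<in> X" "P' \<in> X" "Q' \<in> X"
  shows "kc X (R \<union> lks [(P, Q'), (Q, P')]) \<le> Suc (kc X (R \<union> lks [(P, Q), (P', Q')]))"
proof -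
  let ?A = "R \<union> lks [(P, Q), (P', Q')]" and ?B = "R \<union> lks [(P, Q'), (Q, P')]"
  have mA: "(P, Q) \<in> eqv S" "(P', Q') \<in> eqv S" if "?A \<subseteq> S" for S
    using that by (auto simp: lks_def lk_def intro!: eqv_base)
  have mB: "(P, Q') \<in> eqv S" "(Q, P') \<in> eqv S" if "?B \<subseteq> S" for S
    using that by (auto simp: lks_def lk_def intro!: eqv_base)
  have lk_in: "lks [(a, b), (c, d)] \<subseteq> eqv S" if "(a, b) \<in> eqv S" "(c, d) \<in> eqv S" for a b c d :: 'a and S
    using that eqv_sym by (auto simp: lks_def lk_def)
  have Rin: "R \<subseteq> eqv S" if "R \<subseteq> S" for S using that by (auto intro: eqv_base)
  let ?A' = "insert (Q, P') ?A" and ?B' = "insert (P, Q) ?B"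
  have a: "(P, Q) \<in> eqv ?A'" "(P', Q') \<in> eqv ?A'" "(Q, P') \<in> eqv ?A'" by (rule mA; blast)+ (rule eqv_base, simp)
  have b: "(P, Q') \<in> eqv ?B'" "(Q, P') \<in> eqv ?B'" "(P, Q) \<in> eqv ?B'" by (rule mB; blast)+ (rule eqv_base, simp)
  have aQ: "(P, Q') \<in> eqv ?A'" by (rule eqv_trans[OF eqv_trans[OF a(1,3)] a(2)])
  have bQ: "(P', Q') \<in> eqv ?B'" by (rule eqv_trans[OF eqv_sym[OF eqv_trans[OF b(3,2)]] b(1)])
  have "eqv ?A' = eqv ?B'"
  proof (rule eqv_eqI)
    show "?A' \<subseteq> eqv ?B'" using lk_in[OF b(3) bQ] b(2) Rin[of ?B'] by auto
    show "?B' \<subseteq> eqv ?A'" using lk_in[OF aQ a(3)] a(1) Rin[of ?A'] by auto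
  qed
  then have "kc X ?A' = kc X ?B'" by (rule kc_cong)
  then show ?thesis
    using kc_add_pair_le(1)[OF assms(1,2,3), of ?B] kc_add_pair_le(2)[OF assms(1,3,4), of ?A] by simp
qed

text \<open>A class of \<open>R\<close> is matched by \<open>\<epsilon>\<close>, and up to \<open>P, Q, P', Q'\<close> also by \<open>\<mu>\<close>, so it contains an even
  number of these four darts. Hence \<open>P\<close> and \<open>Q\<close> are already equivalent without the splice.\<close>

lemma parity_connected:
  assumes fin: "finite X" and mem: "P \<in> X" "Q \<in> X"
    and \<epsilon>: "\<And>z. z \<in> X \<Longrightarrow> \<epsilon> z \<in> X \<and> \<epsilon> z \<noteq> z \<and> \<epsilon> (\<epsilon> z) = z \<and> (z, \<epsilon> z) \<in> eqv R"
    and \<mu>: "\<And>z. z \<in> X - {P, Q, P', Q'} \<Longrightarrow> \<mu> z \<in> X - {P, Q, P', Q'} \<and> \<mu> z \<noteq> z \<and> \<mu> (\<mu> z) = z \<and> (z, \<mu> z) \<in> eqv R"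
    and sep: "(P, P') \<notin> eqv R" "(P, Q') \<notin> eqv R"
  shows "(P, Q) \<in> eqv R"
proof (rule ccontr)
  assume PQ: "(P, Q) \<notin> eqv R"
  define K where "K = {z \<in> X. (P, z) \<in> eqv R}"
  have "finite K" using fin by (simp add: K_def)
  have "card K = 2 * card (orbit \<epsilon> ` K)"
    by (rule involution_orbits) (use \<open>finite K\<close> \<epsilon> eqv_trans[of P _ R] in \<open>auto simp: K_def\<close>)
  moreover have "card (K - {P}) = 2 * card (orbit \<mu> ` (K - {P}))"
  proof (rule involution_orbits)
    fix z assume z: "z \<in> K - {P}"
    then have "z \<in> X - {P, Q, P', Q'}" using PQ sep by (auto simp: K_def)
    from \<mu>[OF this] show "\<mu> z \<in> K - {P} \<and> \<mu> z \<noteq> z \<and> \<mu> (\<mu> z) = z"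
      using z eqv_trans[of P z R "\<mu> z"] by (auto simp: K_def)
  qed (use \<open>finite K\<close> in simp)
  moreover have "card K = Suc (card (K - {P}))"
    using \<open>finite K\<close> mem(1) by (intro card.remove) (auto simp: K_def)
  ultimately show False by presburger
qed

text \<open>By parity the first splice merely closes two arcs, one from P to Q and one from P' to
  Q', which exist without it. By \<open>sep\<close> they lie on different loops, and the other
  splice joins these loops.\<close>

lemma kc_switch_merge:
  assumes fin: "finite X" and mem: "P \<in> X" "Q \<in> X" "P' \<in> X" "Q' \<in> X"
    and \<epsilon>: "\<And>z. z \<in> X \<Longrightarrow> \<epsilon> z \<in> X \<and> \<epsilon> z \<noteq> z \<and> \<epsilon> (\<epsilon> z) = z \<and> (z, \<epsilon> z) \<in> eqv R"
    and \<mu>: "\<And>z. z \<in> X - {P, Q, P', Q'} \<Longrightarrow> \<mu> z \<in> X - {P, Q, P', Q'} \<and> \<mu> z \<noteq> z \<and> \<mu> (\<mu> z) = z \<and> (z, \<mu> z) \<in> eqv R"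
    and sep: "(P, P') \<notin> eqv (R \<union> lks [(P, Q), (P', Q')])"
  shows "kc X (R \<union> lks [(P, Q), (P', Q')]) = Suc (kc X (R \<union> lks [(P, Q'), (Q, P')]))"
proof -
  let ?A = "R \<union> lks [(P, Q), (P', Q')]" and ?B = "R \<union> lks [(P, Q'), (Q, P')]"
  have A: "(P, Q) \<in> eqv ?A" "(P', Q') \<in> eqv ?A" by (auto simp: lks_def lk_def intro!: eqv_base)
  have up: "p \<in> eqv R \<Longrightarrow> p \<in> eqv ?A" "p \<in> eqv R \<Longrightarrow> p \<in> eqv ?B" for p
    using eqv_mono[of R ?A] eqv_mono[of R ?B] by auto
  have s1: "(P, P') \<notin> eqv R" using sep up by blast
  then have s1': "(P', P) \<notin> eqv R" using eqv_sym[of P' P R] by blast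
  have s2: "(P, Q') \<notin> eqv ?A" using sep eqv_trans[OF _ eqv_sym[OF A(2)]] by blast
  have s2': "(P, Q') \<notin> eqv R" using s2 up by blast
  have s3: "(P', Q) \<notin> eqv R" using up(1)[of "(P', Q)"] sep eqv_trans[OF A(1) eqv_sym, of P'] by blast
  have PQ: "(P, Q) \<in> eqv R"
    by (rule parity_connected[OF fin mem(1,2) \<epsilon> \<mu> s1 s2']) assumption+
  have set4: "{P', Q', P, Q} = {P, Q, P', Q'}" by auto
  have PQ': "(P', Q') \<in> eqv R"
    by (rule parity_connected[OF fin mem(3,4) \<epsilon> \<mu>[folded set4] s1' s3]) assumption+
  have lk_in: "lks [(a, b), (c, d)] \<subseteq> eqv S" if "(a, b) \<in> eqv S" "(c, d) \<in> eqv S" for a b c d :: 'a and S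
    using that eqv_sym by (auto simp: lks_def lk_def)
  have Rin: "R \<subseteq> eqv S" if "R \<subseteq> S" for S using that by (auto intro: eqv_base)
  have B: "(P, Q') \<in> eqv ?B" "(Q, P') \<in> eqv ?B" by (auto simp: lks_def lk_def intro!: eqv_base)
  let ?A' = "insert (P, Q') ?A"
  have "eqv ?A' = eqv ?B"
  proof (rule eqv_eqI)
    show "?A' \<subseteq> eqv ?B" using lk_in[OF up(2)[OF PQ] up(2)[OF PQ']] B(1) Rin[of ?B] by auto
    have a: "(P, Q) \<in> eqv ?A'" "(P', Q') \<in> eqv ?A'" "(P, Q') \<in> eqv ?A'"
      using eqv_mono[of ?A ?A'] A by (auto intro: eqv_base)
    have "(Q, P') \<in> eqv ?A'" by (rule eqv_trans[OF eqv_trans[OF eqv_sym[OF a(1)] a(3)] eqv_sym[OF a(2)]])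
    then show "?B \<subseteq> eqv ?A'" using lk_in[OF a(3)] Rin[of ?A'] by auto
  qed
  then have "kc X ?A' = kc X ?B" by (rule kc_cong)
  then show ?thesis using kc_add_pair[OF fin mem(1,4) s2] by simp
qed

section \<open>Loop counts of the states of a proper alternating diagram\<close>

locale proper_alternating = alternating_vdiag +
  assumes proper_D: "proper D"
begin

definition LL :: "param set \<Rightarrow> nat" where
  "LL T = kc H (gl (marks D) \<union> (\<Union>c\<in>Ov D. if c \<in> T then Asp D c else Bsp D c))"

lemma LL_loops: "LL (Ov D) = loops D (real_crossings D)" "LL {} = loops D {}"
proof -
  have "pt D c \<in> real_crossings D" if "c \<in> Ov D" for c using that pt_Ov by blast
  then have "(\<Union>c\<in>Ov D. if pt D c \<in> real_crossings D then Asp D c else Bsp D c) = (\<Union>c\<in>Ov D. if c \<in> Ov D then Asp D c else Bsp D c)"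
    by (intro SUP_cong) simp_all
  then show "LL (Ov D) = loops D (real_crossings D)" "LL {} = loops D {}"
    by (simp_all add: LL_def loops_kc half_edges_def)
qed

text \<open>The state with the crossing \<open>c\<close> left open; membership of \<open>c\<close>
  in \<open>T\<close> makes no difference.\<close>

definition rest :: "param \<Rightarrow> param set \<Rightarrow> (half_edge \<times> half_edge) set" where
  "rest c T = gl (marks D) \<union> (\<Union>d\<in>Ov D - {c}. if d \<in> T then Asp D d else Bsp D d)"

text \<open>Each splice is written in two ways, to fit the roles of P, Q, P', Q' in the switch
  lemmas: (1) and (3) for a switch from A to B, (2) and (4) for one from B to A.\<close>

lemma splices_alt:
  "Asp D c = lks [((partner D c, True), (c, \<not> sg D c)), ((partner D c, False), (c, sg D c))]"
  "Asp D c = lks [((c, sg D c), (partner D c, False)), ((partner D c, True), (c, \<not> sg D c))]"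
  "Bsp D c = lks [((partner D c, True), (c, sg D c)), ((c, \<not> sg D c), (partner D c, False))]"
  "Bsp D c = lks [((c, sg D c), (partner D c, True)), ((c, \<not> sg D c), (partner D c, False))]"
  by (cases "sg D c"; auto simp: Asp_def Bsp_def lks_def lk_def)+

lemma LL_split:
  assumes "c \<in> Ov D"
  shows "LL T = kc H (rest c T \<union> (if c \<in> T then Asp D c else Bsp D c))"
proof -
  let ?f = "\<lambda>d. if d \<in> T then Asp D d else Bsp D d"
  have "\<Union> (?f ` Ov D) = \<Union> (?f ` insert c (Ov D - {c}))" using assms by (simp only: insert_Diff)
  also have "\<dots> = \<Union> (?f ` (Ov D - {c})) \<union> ?f c" by (subst UN_insert) (rule Un_commute)
  finally show ?thesis unfolding LL_def rest_def by (simp only: Un_assoc)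
qed

lemma rest_cong: "rest c (insert c T) = rest c T" "rest c (T - {c}) = rest c T"
  unfolding rest_def by (rule arg_cong2[where f = "(\<union>)"] refl SUP_cong; simp)+

lemma crossing_darts:
  assumes "c \<in> Ov D"
  shows "(c, b) \<in> H" "(partner D c, b) \<in> H"
  using real_marks Ov_real[OF assms] real_partner(1)[OF Ov_real[OF assms]] by (simp_all add: H_mem)

lemma LL_step:
  assumes c: "c \<in> Ov D" "c \<notin> T"
  shows "LL T \<le> Suc (LL (insert c T))" "LL (insert c T) \<le> Suc (LL T)"
proof -
  note d = crossing_darts[OF c(1)]
  have 1: "LL T = kc H (rest c T \<union> Bsp D c)" "LL (insert c T) = kc H (rest c T \<union> Asp D c)"
    using LL_split[OF c(1), of T] LL_split[OF c(1), of "insert c T"] c(2) by (simp_all add: rest_cong)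
  show "LL T \<le> Suc (LL (insert c T))"
    unfolding 1 splices_alt(1,3) by (rule kc_switch_le[OF fin_H]) (rule d)+
  show "LL (insert c T) \<le> Suc (LL T)"
    unfolding 1 splices_alt(2,4) by (rule kc_switch_le[OF fin_H]) (rule d)+
qed

lemma rest_eps:
  assumes "z \<in> H"
  shows "(z, \<epsilon> z) \<in> eqv (rest c T)"
proof -
  have *: "((x, True), \<epsilon> (x, True)) \<in> eqv (rest c T)" if "x \<in> marks D" for x
  proof (rule eqv_base)
    show "((x, True), \<epsilon> (x, True)) \<in> rest c T"
      using that other_end_True[of x] by (auto simp: rest_def eds_def)
  qed
  obtain x b where z: "z = (x, b)" "x \<in> marks D" using assms by (cases z) (auto simp: H_mem)
  show ?thesis
  proof (cases b)
    case False
    obtain y where y: "y \<in> marks D" "\<epsilon> (x, False) = (y, True)" using other_end_False_ex[OF z(2)] by metis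
    then have "\<epsilon> (y, True) = z" using eps_inv(3)[OF assms] z False by simp
    then show ?thesis using eqv_sym[OF *[OF y(1)]] y(2) z False by simp
  qed (use * z in simp)
qed

text \<open>The matching of the darts around the crossings given by the all-A state (\<open>a = True\<close>) or the all-B state.\<close>

definition mu :: "bool \<Rightarrow> half_edge \<Rightarrow> half_edge" where
  "mu a e = (if fst e \<in> real_params D
     then (partner D (fst e), (snd e = sg D (fst e)) = ((fst e \<in> Ov D) \<noteq> a)) else (fst e, \<not> snd e))"

text \<open>Supplies the second matching for the parity argument: away from \<open>c\<close>, the
  darts are matched by the splices of the extreme state in which only \<open>c\<close> is
  open.\<close>

lemma mu_props:
  assumes c: "c \<in> Ov D" and z: "z \<in> H - {c, partner D c} \<times> UNIV"
  shows "mu a z \<in> H - {c, partner D c} \<times> UNIV \<and> mu a z \<noteq> z \<and> mu a (mu a z) = z \<and>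
    (z, mu a z) \<in> eqv (rest c (if a then Ov D else {}))"
proof -
  obtain x b where zx: "z = (x, b)" "x \<in> marks D" "x \<noteq> c" "x \<noteq> partner D c" using z by (cases z) (auto simp: H_mem)
  let ?T = "if a then Ov D else {}"
  show ?thesis
  proof (cases "x \<in> real_params D")
    case False
    have "((x, True), (x, False)) \<in> rest c ?T" using False zx(2) unfolding rest_def biv_def by blast
    then have "((x, True), (x, False)) \<in> eqv (rest c ?T)" by (rule eqv_base)
    then have "((x, b), (x, \<not> b)) \<in> eqv (rest c ?T)" using eqv_sym[of "(x, True)" "(x, False)"] by (cases b) simp_all
    moreover have "mu a z = (x, \<not> b)" "mu a (x, \<not> b) = z" using False zx(1) by (simp_all add: mu_def)
    ultimately show ?thesis using zx by (simp add: H_mem)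
  next
    case True
    note p = partner_props[OF real_double[OF True]] and rp = real_partner[OF True]
    have pne: "partner D x \<noteq> c" "partner D x \<noteq> partner D c"
      using zx(3,4) p(6) partner_props(6)[OF real_double[OF Ov_real[OF c]]] by auto
    have ovp: "partner D x \<in> Ov D \<longleftrightarrow> x \<notin> Ov D" using rp True by (auto simp: Ov_def)
    have m: "mu a z = (partner D x, (b = sg D x) = ((x \<in> Ov D) \<noteq> a))" using True zx by (simp add: mu_def)
    have "mu a (partner D x, b') = (partner D (partner D x), (b' = sg D (partner D x)) = ((partner D x \<in> Ov D) \<noteq> a))" for b'
      using rp(1) by (simp add: mu_def)
    then have "mu a (mu a z) = z"
      unfolding m unfolding p(6) p(9) ovp zx(1) by (cases b; cases "sg D x"; cases "x \<in> Ov D"; cases a; simp)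
    moreover have "mu a z \<in> H - {c, partner D c} \<times> UNIV" unfolding m using pne real_marks[OF rp(1)] by (simp add: H_mem)
    moreover have "mu a z \<noteq> z" unfolding m unfolding zx(1) using p(3) by simp
    moreover have "(z, mu a z) \<in> eqv (rest c ?T)"
    proof -
      define d where "d = rep x"
      have d: "d \<in> Ov D" "d \<noteq> c" "x = d \<or> x = partner D d \<and> partner D x = d"
      proof -
        have "d \<in> Ov D \<and> d \<noteq> c \<and> (x = d \<or> x = partner D d \<and> partner D x = d)"
        proof (cases rule: real_cases[OF True])
          case 1
          then have "d = x" by (simp add: d_def rep_def)
          then show ?thesis using 1 zx(3) by simp
        next
          case 2
          then have "d = partner D x" using True by (simp add: d_def rep_def)
          then show ?thesis using 2 pne(1) by simp
        qed
        then show "d \<in> Ov D" "d \<noteq> c" "x = d \<or> x = partner D d \<and> partner D x = d" by blast+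
      qed
      have spl: "(if a then Asp D d else Bsp D d) = (if d \<in> ?T then Asp D d else Bsp D d)" using d(1) by simp
      have sub: "(if a then Asp D d else Bsp D d) \<subseteq> rest c ?T" unfolding spl rest_def
        by (rule le_supI2, rule UN_upper[of d "Ov D - {c}" "\<lambda>d. if d \<in> ?T then Asp D d else Bsp D d"]) (use d in simp)
      have sgd: "sg D (partner D d) = (\<not> sg D d)" by (rule partner_props(9)[OF real_double[OF Ov_real[OF d(1)]]])
      have "(z, mu a z) \<in> (if a then Asp D d else Bsp D d)"
        using d(3)
      proof (elim disjE conjE)
        assume "x = d"
        then show ?thesis unfolding m unfolding zx(1) using d(1)
          by (cases a; cases b; cases "sg D d"; simp add: Asp_def Bsp_def lks_def lk_def)
      next
        assume xd: "x = partner D d" "partner D x = d"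
        have "x \<notin> Ov D" using ovp d(1) xd(2) by simp
        then show ?thesis unfolding m unfolding zx(1) xd(2) unfolding xd(1) using sgd
          by (cases a; cases b; cases "sg D d"; simp add: Asp_def Bsp_def lks_def lk_def)
      qed
      then show ?thesis by (rule eqv_base[OF subsetD[OF sub]])
    qed
    ultimately show ?thesis by blast
  qed
qed

text \<open>Corners are named by darts and \<psi> is the boundary map of \<open>ald D\<close>, so
  properness separates the \<psi>-orbits of the darts at a crossing.\<close>

lemma proper_sep:
  assumes c: "c \<in> Ov D"
  shows "orbit \<psi> (c, True) \<noteq> orbit \<psi> (c, False)" "orbit \<psi> (partner D c, True) \<noteq> orbit \<psi> (partner D c, False)"
proof -
  have "pt D c \<in> real_crossings D" using c pt_Ov by blast
  then have inj: "inj_on (boundary_component (ald D)) {e \<in> H. pt D (fst e) = pt D c \<and> fst e \<in> real_params D}"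
    using proper_D by (simp add: proper_def proper_crossing_def)
  have b: "boundary_component (ald D) e = orbit \<psi> e" for e
    by (simp add: boundary_component_def ald_def comp_def)
  have "pt D (partner D c) = pt D c" by (rule partner_props(4)[OF real_double[OF Ov_real[OF c]]])
  then have m: "(c, b) \<in> {e \<in> H. pt D (fst e) = pt D c \<and> fst e \<in> real_params D}"
    "(partner D c, b) \<in> {e \<in> H. pt D (fst e) = pt D c \<and> fst e \<in> real_params D}" for b
    using crossing_darts[OF c] Ov_real[OF c] real_partner(1)[OF Ov_real[OF c]] by simp_all
  show "orbit \<psi> (c, True) \<noteq> orbit \<psi> (c, False)" "orbit \<psi> (partner D c, True) \<noteq> orbit \<psi> (partner D c, False)"
    using inj_onD[OF inj, unfolded b, OF _ m(1) m(1), of True False] inj_onD[OF inj, unfolded b, OF _ m(2) m(2), of True False]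
    by auto
qed

lemma full_state:
  assumes c: "c \<in> Ov D"
  shows "eqv (rest c (Ov D) \<union> Asp D c) = eqv (state_links D (real_crossings D))"
    "eqv (rest c {} \<union> Bsp D c) = eqv (state_links D {})"
proof -
  have *: "rest c T \<union> (if c \<in> T then Asp D c else Bsp D c) =
      gl (marks D) \<union> (\<Union>d\<in>Ov D. if d \<in> T then Asp D d else Bsp D d)" for T
  proof -
    let ?f = "\<lambda>d. if d \<in> T then Asp D d else Bsp D d"
    have "\<Union> (?f ` Ov D) = \<Union> (?f ` insert c (Ov D - {c}))" using c by (simp only: insert_Diff)
    also have "\<dots> = \<Union> (?f ` (Ov D - {c})) \<union> ?f c" by (subst UN_insert) (rule Un_commute)
    finally show ?thesis unfolding rest_def by (simp only: Un_assoc)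
  qed
  have "pt D d \<in> real_crossings D" if "d \<in> Ov D" for d using that pt_Ov by blast
  then have "(\<Union>d\<in>Ov D. if pt D d \<in> real_crossings D then Asp D d else Bsp D d) = (\<Union>d\<in>Ov D. if d \<in> Ov D then Asp D d else Bsp D d)"
    by (intro SUP_cong) simp_all
  then show "eqv (rest c (Ov D) \<union> Asp D c) = eqv (state_links D (real_crossings D))"
    "eqv (rest c {} \<union> Bsp D c) = eqv (state_links D {})"
    using *[of "Ov D"] *[of "{}"] c eqv_state_links[of "real_crossings D"] eqv_state_links[of "{}"] by simp_all
qed

text \<open>Leaving an extreme state at one crossing merges two loops. The two arcs of the splice
  lie on boundary components that properness keeps apart: those at the under-strand for the all-A
  state, those at the over-strand for the all-B state.\<close>

lemma LL_first:
  assumes c: "c \<in> Ov D"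
  shows "LL (Ov D) = Suc (LL (Ov D - {c}))" "LL {} = Suc (LL {c})"
proof -
  note d = crossing_darts[OF c]
  let ?y = "partner D c" and ?s = "sg D c"
  have cr: "c \<in> real_params D" "lvl D ?y = level.Under" "?y \<in> real_params D" "lvl D c = Over"
  proof -
    show 1: "c \<in> real_params D" "lvl D c = Over" using c unfolding Ov_def by simp_all
    show "lvl D ?y = level.Under" "?y \<in> real_params D" using real_partner[OF 1(1)] 1(2) by simp_all
  qed
  have inU: "(?y, b) \<in> U" "(c, b) \<in> H - U" for b by (simp_all add: U_def d cr)
  have eps: "\<epsilon> z \<in> H \<and> \<epsilon> z \<noteq> z \<and> \<epsilon> (\<epsilon> z) = z \<and> (z, \<epsilon> z) \<in> eqv (rest c T)" if "z \<in> H" for z T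
    using eps_inv[OF that] rest_eps[OF that, of c T] by simp
  have four: "{(?y, True), (c, \<not> ?s), (?y, False), (c, ?s)} = {c, ?y} \<times> UNIV"
    "{(c, ?s), (?y, True), (c, \<not> ?s), (?y, False)} = {c, ?y} \<times> UNIV"
    unfolding pair_times_bool by (cases ?s; simp add: insert_commute)+
  have sepA: "((?y, True), (?y, False)) \<notin> eqv (rest c (Ov D) \<union> Asp D c)"
    using state_boundary(2)[OF disjI1[OF refl] XA_props links_A inU(1) inU(1)] proper_sep(2)[OF c]
    unfolding full_state(1)[OF c] by blast
  have "((c, ?s), (c, \<not> ?s)) \<notin> eqv (state_links D {})"
  proof
    assume "((c, ?s), (c, \<not> ?s)) \<in> eqv (state_links D {})"
    from state_boundary(2)[OF disjI2[OF refl] XB_props links_B inU(2) inU(2) this]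
    show False using proper_sep(1)[OF c] by (cases ?s) auto
  qed
  then have sepB: "((c, ?s), (c, \<not> ?s)) \<notin> eqv (rest c {} \<union> Bsp D c)" unfolding full_state(2)[OF c] .
  have muA: "mu True z \<in> H - {c, ?y} \<times> UNIV \<and> mu True z \<noteq> z \<and> mu True (mu True z) = z \<and> (z, mu True z) \<in> eqv (rest c (Ov D))"
    if "z \<in> H - {c, ?y} \<times> UNIV" for z using mu_props[OF c that, of True] by simp
  have muB: "mu False z \<in> H - {c, ?y} \<times> UNIV \<and> mu False z \<noteq> z \<and> mu False (mu False z) = z \<and> (z, mu False z) \<in> eqv (rest c {})"
    if "z \<in> H - {c, ?y} \<times> UNIV" for z using mu_props[OF c that, of False] by simp
  have "kc H (rest c (Ov D) \<union> Asp D c) = Suc (kc H (rest c (Ov D) \<union> Bsp D c))"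
    using kc_switch_merge[OF fin_H d(2)[of True] d(1)[of "\<not> ?s"] d(2)[of False] d(1)[of ?s] eps muA[folded four(1)] sepA[unfolded splices_alt(1)]]
    unfolding splices_alt(1,3) .
  then show "LL (Ov D) = Suc (LL (Ov D - {c}))"
    using LL_split[OF c, of "Ov D"] LL_split[OF c, of "Ov D - {c}"] c by (simp add: rest_cong)
  have "kc H (rest c {} \<union> Bsp D c) = Suc (kc H (rest c {} \<union> Asp D c))"
  proof -
    have flip: "Asp D c = lks [((c, ?s), (?y, False)), ((?y, True), (c, \<not> ?s))]" by (rule splices_alt(2))
    show ?thesis
      using kc_switch_merge[OF fin_H d(1)[of ?s] d(2)[of True] d(1)[of "\<not> ?s"] d(2)[of False] eps muB[folded four(2)] sepB[unfolded splices_alt(4)]]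
      unfolding splices_alt(4) flip .
  qed
  then show "LL {} = Suc (LL {c})"
    using LL_split[OF c, of "{}"] LL_split[OF c, of "{c}"] rest_cong(1)[of c "{}"] by simp
qed

text \<open>The first switch loses a loop and every further one gains at most one, whence the
  constant 2.\<close>

lemma LL_bound_A:
  assumes "N \<subseteq> Ov D" "N \<noteq> {}"
  shows "LL (Ov D - N) + 2 \<le> LL (Ov D) + card N"
proof -
  have "finite N" using assms(1) fin_Ov finite_subset by blast
  from this assms(2,1) show ?thesis
  proof (induction N rule: finite_ne_induct)
    case (singleton c)
    then show ?case using LL_first(1)[of c] by simp
  next
    case (insert c N)
    have "insert c (Ov D - insert c N) = Ov D - N" using insert by blast
    then have "LL (Ov D - insert c N) \<le> Suc (LL (Ov D - N))"
      using LL_step(1)[of c "Ov D - insert c N"] insert.prems by simp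
    then show ?case using insert by simp
  qed
qed

lemma LL_bound_B:
  assumes "N \<subseteq> Ov D" "N \<noteq> {}"
  shows "LL N + 2 \<le> LL {} + card N"
proof -
  have "finite N" using assms(1) fin_Ov finite_subset by blast
  from this assms(2,1) show ?thesis
  proof (induction N rule: finite_ne_induct)
    case (singleton c)
    then show ?case using LL_first(2)[of c] by simp
  next
    case (insert c N)
    have "LL (insert c N) \<le> Suc (LL N)" using LL_step(2)[of c N] insert by simp
    then show ?case using insert by simp
  qed
qed

end

section \<open>Span\<close>

lemma lookup_Apow_mult: "Poly_Mapping.lookup (Apow k * p) j = Poly_Mapping.lookup p (j - k)"
proof -
  have "Sum_any (\<lambda>q. Poly_Mapping.lookup p q when j = l + q) = Poly_Mapping.lookup p (j - l)" for l
  proof -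
    have "j = l + q \<longleftrightarrow> q = j - l" for q by auto
    then show ?thesis by simp
  qed
  moreover have "Poly_Mapping.lookup (Apow k) l * x = (x when l = k)" for l x
    by (simp add: Apow_def lookup_single when_def)
  ultimately show ?thesis by (simp add: lookup_mult)
qed

text \<open>For \<open>s = 1\<close>, \<open>d\<close> is the maximal degree of \<open>p\<close> with coefficient \<open>a\<close>; for \<open>s = -1\<close>, \<open>-d\<close> is the minimal degree.\<close>

definition ext :: "int \<Rightarrow> laurent \<Rightarrow> int \<Rightarrow> int \<Rightarrow> bool" where
  "ext s p d a \<longleftrightarrow> (\<forall>k. s * k > d \<longrightarrow> Poly_Mapping.lookup p k = 0) \<and> Poly_Mapping.lookup p (s * d) = a"

lemma ext_delta:
  assumes s: "s = 1 \<or> s = - 1"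
  shows "ext s (delta ^ n) (2 * int n) ((- 1) ^ n)"
proof (induction n)
  case 0
  then show ?case using s by (auto simp: ext_def lookup_one when_def)
next
  case (Suc n)
  have l: "Poly_Mapping.lookup (delta ^ Suc n) k =
      - Poly_Mapping.lookup (delta ^ n) (k - 2) - Poly_Mapping.lookup (delta ^ n) (k + 2)" for k
  proof -
    have "delta * p = - (Apow 2 * p) - Apow (- 2) * p" for p by (simp add: left_diff_distrib)
    then show ?thesis unfolding power_Suc by (simp only: lookup_minus lookup_uminus lookup_Apow_mult) simp
  qed
  show ?case
    unfolding ext_def l using Suc s by (auto simp: ext_def)
qed

lemma ext_Apow:
  assumes "ext s p d a" "s = 1 \<or> s = - 1"
  shows "ext s (Apow k * p) (d + s * k) a"
  using assms by (auto simp: ext_def lookup_Apow_mult)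

context proper_alternating
begin

abbreviation "cc \<equiv> int (card (Ov D))"

lemma bracket_sum:
  "bracket D = (\<Sum>T \<in> Pow (Ov D). Apow (int (card T) - int (card (Ov D - T))) * delta ^ (LL T - 1))"
  unfolding bracket_marks ssum_def LL_def half_edges_def ..

lemma LL_pos: "LL T \<ge> 1"
proof -
  have "H \<noteq> {}" using marks_facts(5) ncomp_pos by (auto simp: half_edges_def)
  then show ?thesis unfolding LL_def using kc_pos[OF fin_H] by (simp add: Suc_leI)
qed

text \<open>Each switch away from the extreme state moves the exponent of A by 2 towards the middle,
  and each extra loop moves the degree back by 2. As the first switch loses a loop, all other states
  end strictly inside, and the extreme coefficient cannot cancel.\<close>

lemma ext_bracket:
  assumes s: "s = 1 \<or> s = - 1"
  defines "T0 \<equiv> (if s = 1 then Ov D else {})"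
  shows "ext s (bracket D) (cc + 2 * (int (LL T0) - 1)) ((- 1) ^ (LL T0 - 1))"
proof -
  let ?d = "cc + 2 * (int (LL T0) - 1)"
  let ?t = "\<lambda>T. Apow (int (card T) - int (card (Ov D - T))) * delta ^ (LL T - 1)"
  have T0: "T0 \<subseteq> Ov D" by (auto simp: T0_def)
  have t: "ext s (?t T) (2 * (int (LL T) - 1) + s * (int (card T) - int (card (Ov D - T)))) ((- 1) ^ (LL T - 1))" for T
    using ext_Apow[OF ext_delta[OF s, of "LL T - 1"] s] LL_pos[of T] by (simp add: of_nat_diff)
  have t0: "ext s (?t T0) ?d ((- 1) ^ (LL T0 - 1))"
    using t[of T0] s by (auto simp: T0_def add.commute)
  have zero: "Poly_Mapping.lookup (?t T) k = 0" if T: "T \<subseteq> Ov D" "T \<noteq> T0" and k: "s * k \<ge> ?d" for T k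
  proof -
    have finT: "finite T" using T(1) fin_Ov finite_subset by blast
    have cT: "card (Ov D - T) = card (Ov D) - card T" "card T \<le> card (Ov D)"
      using T(1) finT fin_Ov by (simp_all add: card_Diff_subset card_mono)
    have "2 * (int (LL T) - 1) + s * (int (card T) - int (card (Ov D - T))) < ?d"
    proof (cases "s = 1")
      case True
      have "LL (Ov D - (Ov D - T)) + 2 \<le> LL (Ov D) + card (Ov D - T)"
        using T True by (intro LL_bound_A) (auto simp: T0_def)
      moreover have "Ov D - (Ov D - T) = T" using T(1) by blast
      ultimately show ?thesis using True cT by (simp add: T0_def of_nat_diff)
    next
      case False
      then have s1: "s = - 1" using s by simp
      have "LL T + 2 \<le> LL {} + card T"
        using T s1 by (intro LL_bound_B) (auto simp: T0_def)
      then show ?thesis using s1 cT by (simp add: T0_def of_nat_diff)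
    qed
    then have "s * k > 2 * (int (LL T) - 1) + s * (int (card T) - int (card (Ov D - T)))" using k by simp
    then show ?thesis using t[of T] unfolding ext_def by blast
  qed
  have fP: "finite (Pow (Ov D))" using fin_Ov by simp
  have lk: "Poly_Mapping.lookup (bracket D) k = Poly_Mapping.lookup (?t T0) k" if k: "s * k \<ge> ?d" for k
  proof -
    have "Poly_Mapping.lookup (bracket D) k = (\<Sum>T\<in>Pow (Ov D). Poly_Mapping.lookup (?t T) k)"
      unfolding bracket_sum lookup_sum ..
    also have "\<dots> = Poly_Mapping.lookup (?t T0) k + (\<Sum>T\<in>Pow (Ov D) - {T0}. Poly_Mapping.lookup (?t T) k)"
      by (rule sum.remove[OF fP]) (use T0 in simp)
    also have "(\<Sum>T\<in>Pow (Ov D) - {T0}. Poly_Mapping.lookup (?t T) k) = 0"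
      by (rule sum.neutral) (use zero k in auto)
    finally show ?thesis by simp
  qed
  have "s * (s * ?d) = ?d" using s by auto
  then show ?thesis
    using t0 lk unfolding ext_def by (metis less_imp_le order_refl)
qed

lemma ext_f_poly:
  assumes "s = 1 \<or> s = - 1"
  shows "\<exists>a. a \<noteq> 0 \<and> ext s (f_poly D) (cc + 2 * (int (LL (if s = 1 then Ov D else {})) - 1) + s * (- 3 * writhe D)) a"
proof -
  let ?n = "nat \<bar>writhe D\<bar>"
  have m: "(- 1) ^ ?n * p = p \<or> (- 1) ^ ?n * p = - p" for p :: laurent
    by (cases "even ?n") simp_all
  let ?p = "Apow (- 3 * writhe D) * bracket D"
  obtain a where a: "a \<noteq> 0" "ext s ?p (cc + 2 * (int (LL (if s = 1 then Ov D else {})) - 1) + s * (- 3 * writhe D)) a"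
  proof -
    have "(- 1 :: int) ^ (LL (if s = 1 then Ov D else {}) - 1) \<noteq> 0" by simp
    then show ?thesis using ext_Apow[OF ext_bracket[OF assms] assms] that by blast
  qed
  have f: "f_poly D = (- 1) ^ ?n * ?p" by (simp add: f_poly_def mult.assoc)
  from m[of ?p] show ?thesis
  proof
    assume "(- 1) ^ ?n * ?p = ?p"
    then show ?thesis using a unfolding f by metis
  next
    assume *: "(- 1) ^ ?n * ?p = - ?p"
    show ?thesis unfolding f * using a by (intro exI[of _ "- a"]) (simp add: ext_def)
  qed
qed

text \<open>The writhe shifts both extreme degrees equally and drops out of the difference; the
  constant 4 comes from the two exponents \<open>LL T - 1\<close>, each counted twice.\<close>

lemma span_eq:
  "span_diagram D = 2 * cc + 2 * (int (LL (Ov D)) + int (LL {})) - 4"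
proof -
  obtain a where a: "a \<noteq> 0" "ext 1 (f_poly D) (cc + 2 * (int (LL (Ov D)) - 1) - 3 * writhe D) a"
    using ext_f_poly[of 1] by auto
  obtain b where b: "b \<noteq> 0" "ext (- 1) (f_poly D) (cc + 2 * (int (LL {}) - 1) + 3 * writhe D) b"
    using ext_f_poly[of "- 1"] by auto
  have "Max (Poly_Mapping.keys (f_poly D)) = cc + 2 * (int (LL (Ov D)) - 1) - 3 * writhe D"
  proof (rule Max_eqI)
    show "k \<le> cc + 2 * (int (LL (Ov D)) - 1) - 3 * writhe D" if "k \<in> Poly_Mapping.keys (f_poly D)" for k
      using a(2) that unfolding ext_def in_keys_iff by (metis mult_1 not_less)
  qed (use a in \<open>simp_all add: ext_def in_keys_iff\<close>)
  moreover have "Min (Poly_Mapping.keys (f_poly D)) = - (cc + 2 * (int (LL {}) - 1) + 3 * writhe D)"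
  proof (rule Min_eqI)
    show "- (cc + 2 * (int (LL {}) - 1) + 3 * writhe D) \<le> k" if "k \<in> Poly_Mapping.keys (f_poly D)" for k
    proof (rule ccontr)
      assume "\<not> ?thesis"
      then have "- 1 * k > cc + 2 * (int (LL {}) - 1) + 3 * writhe D" by simp
      then have "Poly_Mapping.lookup (f_poly D) k = 0" using b(2) unfolding ext_def by blast
      then show False using that by (simp add: in_keys_iff)
    qed
    show "- (cc + 2 * (int (LL {}) - 1) + 3 * writhe D) \<in> Poly_Mapping.keys (f_poly D)"
      using b unfolding ext_def in_keys_iff by (metis mult_minus1)
  qed simp
  ultimately show ?thesis by (simp add: span_diagram_def)
qed

lemma span_formula:
  "span_diagram D = 4 * (int (crossing_number D) - int (supporting_genus D) + int (card (connected_components D)) - 1)"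
  using span_eq genus_eq boundary_loops LL_loops crossing_number by simp

end

theorem theorem1p2:
  fixes L :: "vdiagram set" and D :: vdiagram
  assumes "L \<in> virtual_links"
    and "alternating_link L"
    and "D \<in> L"
    and "alternating D"
    and "proper D"
  shows "span_link L =
           4 * (int (crossing_number D) - int (supporting_genus D)
                + int (card (connected_components D)) - 1)
       \<and> (connected_diagram D \<longrightarrow>
            span_link L = 4 * (int (crossing_number D) - int (supporting_genus D)))"
proof -
  let ?E = "(moves \<union> moves\<inverse>)\<^sup>*"
  obtain D0 where D0: "is_vdiagram D0" "L = ?E `` {D0}"
    using assms(1) unfolding virtual_links_def by (blast elim: quotientE)
  have "(D0, D) \<in> ?E" using assms(3) D0(2) by simp
  \<comment> \<open>Every move relates diagrams only, so all members of the class are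
    diagrams.\<close>
  then have "is_vdiagram D" using D0(1) by (cases rule: rtranclE) (auto simp: moves_def)
  then interpret proper_alternating D by unfold_locales (use assms in simp_all)
  have f_poly_eq: "f_poly D' = f_poly D" if "D' \<in> L" for D'
    using f_poly_moves[of D0 D'] f_poly_moves[of D0 D] that assms(3) D0(2) by simp
  have "span_diagram D' = span_diagram D" if "D' \<in> L" for D'
    unfolding span_diagram_def f_poly_eq[OF that] ..
  \<comment> \<open>\<open>the_elem\<close> requires a singleton: the span is constant on
    \<open>L\<close>, and \<open>L\<close> contains \<open>D\<close>.\<close>
  then have "span_diagram ` L = (\<lambda>_. span_diagram D) ` L" by (rule image_cong[OF refl])
  also have "\<dots> = {span_diagram D}" using assms(3) by (rule image_constant)
  finally have "span_link L = span_diagram D" by (simp add: span_link_def)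
  then show ?thesis using span_formula by (simp add: connected_diagram_def)
qed

end
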